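(* Let $\nu$ be a Borel probability measure on $\mathbb{R}^2$. Then $\nu$ is bi-freely infinitely divisible if and only if there exist probability laws $\mu_n$ on $\mathbb{R}^2$ and unbounded positive integers $k_n$ such that the bi-free compound Poisson laws $\nu_{k_n,\mu_n}$ converge weakly to the measure $\nu$ on $\mathbb{R}^2$.
   Context: For a Borel probability measure $\mu$ on $\mathbb{R}^2$, its marginals are $\mu^{(j)}=\mu\circ\pi_j^{-1}$, $j=1,2$, where $\pi_1(s,t)=s$, $\pi_2(s,t)=t$, and its Cauchy transform is $G_\mu(z,w)=\int_{\mathbb{R}^2}\frac{1}{(z-s)(w-t)}\,d\mu(s,t)$ for $z,w\in\mathbb{C}\setminus\mathbb{R}$. For a probability measure $m$ on $\mathbb{R}$, $G_m(z)=\int_{\mathbb{R}}\frac{1}{z-x}\,dm(x)$, $z\notin\mathbb{R}$. For $\alpha,\beta>0$ the Stolz angle is $\Delta=\Delta_{\alpha,\beta}=\{x+iy\in\mathbb{C}: y<0,\ |x|<-\alpha y,\ y>-\beta\}$, $\overline{\Delta}=\{\bar z:z\in\Delta\}$ is its reflection, and the associated product domain is $\Omega=(\Delta\cup\overline\Delta)\times(\Delta\cup\overline\Delta)$. The one-dimensional $R$-transform $R_m$ of a probability measure $m$ on $\mathbb{R}$ is the holomorphic function on $\Delta\cup\overline\Delta$ (for a sufficiently small Stolz angle $\Delta$) with $1/z+R_m(z)\notin\mathbb{R}$, $G_m(1/z+R_m(z))=z$, and $zR_m(z)\to0$ as $z\to0$ in $\Delta\cup\overline\Delta$. The bi-free partial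 $R$-transform of a probability measure $\mu$ on $\mathbb{R}^2$ is $$R_\mu(z,w)=zR_{\mu^{(1)}}(z)+wR_{\mu^{(2)}}(w)+\left[1-\frac{1}{h_\mu(z,w)}\right],\quad h_\mu(z,w)=\frac{G_\mu\left(1/z+R_{\mu^{(1)}}(z),\,1/w+R_{\mu^{(2)}}(w)\right)}{zw},$$ which is defined and holomorphic on a product domain $\Omega$ (with $\Delta$ small enough) on which $R_{\mu^{(1)}},R_{\mu^{(2)}}$ are defined and $h_\mu$ has no zeros; $R_\mu$ also denotes its holomorphic extension to $(\mathbb{C}\setminus\mathbb{R})^2$ when this exists. A probability measure $\nu$ on $\mathbb{R}^2$ with $R$-transform $R_\nu$ on a product domain $\Omega$ is bi-freely infinitely divisible if for each integer $m\ge2$ there exists a probability law $\mu_m$ on $\mathbb{R}^2$ such that $R_\nu=mR_{\mu_m}$ in $\Omega$. For $\lambda>0$ and a probability measure $\mu$ on $\mathbb{R}^2$, the bi-free compound Poisson law $\nu_{\lambda,\mu}$ with rate $\lambda$ and jump distribution $\mu$ is the unique probability measure on $\mathbb{R}^2$ whose bi-free $R$-transform is $$R_{\nu_{\lambda,\mu}}(z,w)=-\lambda+\lambda\int_{\mathbb{R}^2}\frac{1}{(1-zs)(1-wt)}\,d\mu(s,t),\qquad z,w\notin\mathbb{R}$$ (for $\mu=\delta_{(0,0)}$ this gives $\nu_{\lambda,\mu}=\delta_{(0,0)}$). *)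

theory Defs
  imports "HOL-Probability.Probability"
begin

definition borel_prob :: "'a::topological_space measure \<Rightarrow> bool" where
  "borel_prob M \<longleftrightarrow> prob_space M \<and> sets M = sets borel"

definition marginal1 :: "(real \<times> real) measure \<Rightarrow> real measure" where
  "marginal1 \<mu> = distr \<mu> borel fst"

definition marginal2 :: "(real \<times> real) measure \<Rightarrow> real measure" where
  "marginal2 \<mu> = distr \<mu> borel snd"

definition cauchy_transform :: "real measure \<Rightarrow> complex \<Rightarrow> complex" where
  "cauchy_transform m z = (\<integral>x. 1 / (z - of_real x) \<partial>m)"

definition cauchy_transform2 :: "(real \<times> real) measure \<Rightarrow> complex \<Rightarrow> complex \<Rightarrow> complex" where
  "cauchy_transform2 \<mu> z w = (\<integral>(s, t). 1 / ((z - of_real s) * (w - of_real t)) \<partial>\<mu>)"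

text \<open>The library's \<open>weak_conv_m\<close> is stated through distribution functions on the line only.\<close>

definition weakly_converges ::
    "(nat \<Rightarrow> 'a::topological_space measure) \<Rightarrow> 'a measure \<Rightarrow> bool" where
  "weakly_converges M N \<longleftrightarrow>
     (\<forall>f :: 'a \<Rightarrow> real. continuous_on UNIV f \<longrightarrow> bounded (range f) \<longrightarrow>
        (\<lambda>n. \<integral>x. f x \<partial>(M n)) \<longlonglongrightarrow> (\<integral>x. f x \<partial>N))"

definition stolz_angle :: "real \<Rightarrow> real \<Rightarrow> complex set" where
  "stolz_angle \<alpha> \<beta> = {z. Im z < 0 \<and> \<bar>Re z\<bar> < - \<alpha> * Im z \<and> Im z > - \<beta>}"

definition double_stolz :: "real \<Rightarrow> real \<Rightarrow> complex set" where
  "double_stolz \<alpha> \<beta> = stolz_angle \<alpha> \<beta> \<union> cnj ` stolz_angle \<alpha> \<beta>"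

text \<open>
  R-transforms depend on the chosen Stolz angle, so they are rendered as predicates: \<open>D\<close> is a
  set \<open>double_stolz \<alpha> \<beta>\<close>, the product domain is \<open>D \<times> D\<close>, and only the values of \<open>R\<close> on \<open>D\<close>
  (respectively on \<open>D \<times> D\<close>) are constrained. On these sets the conditions determine \<open>R\<close>.
\<close>

definition free_R_transform_on ::
    "real measure \<Rightarrow> complex set \<Rightarrow> (complex \<Rightarrow> complex) \<Rightarrow> bool" where
  "free_R_transform_on m D R \<longleftrightarrow>
     R holomorphic_on D \<and>
     (\<forall>z\<in>D. 1 / z + R z \<notin> \<real> \<and> cauchy_transform m (1 / z + R z) = z) \<and>
     ((\<lambda>z. z * R z) \<longlongrightarrow> 0) (at 0 within D)"

definition bifree_h ::
    "(real \<times> real) measure \<Rightarrow> (complex \<Rightarrow> complex) \<Rightarrow> (complex \<Rightarrow> complex) \<Rightarrow>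
     complex \<Rightarrow> complex \<Rightarrow> complex" where
  "bifree_h \<mu> R1 R2 z w = cauchy_transform2 \<mu> (1 / z + R1 z) (1 / w + R2 w) / (z * w)"

definition bifree_R_transform_on ::
    "(real \<times> real) measure \<Rightarrow> complex set \<Rightarrow> (complex \<Rightarrow> complex \<Rightarrow> complex) \<Rightarrow> bool" where
  "bifree_R_transform_on \<mu> D R \<longleftrightarrow>
     (\<exists>R1 R2. free_R_transform_on (marginal1 \<mu>) D R1 \<and>
              free_R_transform_on (marginal2 \<mu>) D R2 \<and>
              (\<forall>z\<in>D. \<forall>w\<in>D. bifree_h \<mu> R1 R2 z w \<noteq> 0 \<and>
                 R z w = z * R1 z + w * R2 w + (1 - 1 / bifree_h \<mu> R1 R2 z w)))"

definition bifreely_infinitely_divisible :: "(real \<times> real) measure \<Rightarrow> bool" where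
  "bifreely_infinitely_divisible \<nu> \<longleftrightarrow>
     (\<exists>\<alpha>>0. \<exists>\<beta>>0. \<exists>R. bifree_R_transform_on \<nu> (double_stolz \<alpha> \<beta>) R \<and>
        (\<forall>m::nat. m \<ge> 2 \<longrightarrow>
           (\<exists>\<mu> Q. borel_prob \<mu> \<and> bifree_R_transform_on \<mu> (double_stolz \<alpha> \<beta>) Q \<and>
              (\<forall>z\<in>double_stolz \<alpha> \<beta>. \<forall>w\<in>double_stolz \<alpha> \<beta>. R z w = of_nat m * Q z w))))"

text \<open>Holomorphy on the open set \<open>A \<times> B\<close>: continuous and holomorphic in each variable separately.\<close>

definition holomorphic2_on ::
    "(complex \<Rightarrow> complex \<Rightarrow> complex) \<Rightarrow> complex set \<Rightarrow> complex set \<Rightarrow> bool" where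
  "holomorphic2_on F A B \<longleftrightarrow>
     continuous_on (A \<times> B) (\<lambda>(z, w). F z w) \<and>
     (\<forall>w\<in>B. (\<lambda>z. F z w) holomorphic_on A) \<and>
     (\<forall>z\<in>A. (\<lambda>w. F z w) holomorphic_on B)"

text \<open>\<open>F\<close> is the holomorphic extension of the bi-free R-transform of \<open>\<mu>\<close> to pairs of non-real
  numbers. It is unique, as every product domain meets all four components.\<close>

definition bifree_R_transform_ext ::
    "(real \<times> real) measure \<Rightarrow> (complex \<Rightarrow> complex \<Rightarrow> complex) \<Rightarrow> bool" where
  "bifree_R_transform_ext \<mu> F \<longleftrightarrow>
     holomorphic2_on F (- \<real>) (- \<real>) \<and>
     (\<exists>\<alpha>>0. \<exists>\<beta>>0. bifree_R_transform_on \<mu> (double_stolz \<alpha> \<beta>) F)"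

text \<open>\<open>\<nu>\<close> is the law with rate \<open>r\<close> and jump distribution \<open>\<mu>\<close>. It is rendered as a predicate; the
  R-transform determines \<open>\<nu>\<close>.\<close>

definition bifree_compound_poisson ::
    "real \<Rightarrow> (real \<times> real) measure \<Rightarrow> (real \<times> real) measure \<Rightarrow> bool" where
  "bifree_compound_poisson r \<mu> \<nu> \<longleftrightarrow>
     borel_prob \<nu> \<and>
     bifree_R_transform_ext \<nu>
       (\<lambda>z w. - of_real r +
          of_real r * (\<integral>(s, t). 1 / ((1 - z * of_real s) * (1 - w * of_real t)) \<partial>\<mu>))"

end

theory Submission
  imports Defs "HOL-Complex_Analysis.Complex_Analysis" "HOL-Real_Asymp.Real_Asymp"
begin

text \<open>
  In the variables \<open>F = 1 / z\<close>, \<open>W = 1 / w\<close> the law with rate \<open>r\<close> and jump distribution \<open>\<mu>\<close> should have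
  marginal Cauchy transforms inverse to \<open>H F = F + r \<integral>F s / (F - s) d\<mu>\<close> and joint Cauchy transform
  \<open>1 / (F W (1 - E))\<close> at \<open>(H F, H W)\<close>, where \<open>E = r \<integral>s t / ((F - s) (W - t)) d\<mu>\<close>. For bounded jumps \<open>H\<close> can be
  inverted on each half plane, and this function is the Cauchy transform of a law because its jump across
  the real plane is a nonnegative density. If \<open>H\<close> and \<open>E\<close> converge along a sequence of rates and jump
  distributions, then after truncation of the jumps the laws are tight, and a limit law has the limiting
  R-transform. If \<open>R = m R\<^sub>m\<close> for laws \<open>\<mu>\<^sub>m\<close>, then \<open>\<mu>\<^sub>m\<close> converges to the point mass at the
  origin, and this is applied to rate \<open>m\<close> and jump distribution \<open>\<mu>\<^sub>m\<close>. If \<open>\<nu>\<close> is the limit of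
  the laws with rates \<open>k\<^sub>n\<close>, then \<open>H\<close> and \<open>E\<close> converge, and the rates \<open>k\<^sub>n / m\<close> yield a law whose
  R-transform is the \<open>m\<close>-th part of the R-transform of \<open>\<nu>\<close>.
\<close>

section \<open>Cauchy transforms\<close>

text \<open>The obstacle is positivity: nothing in the formula for the R-transform of a compound
  Poisson law shows that a law with this transform exists. One quantity governs the argument, A(F) =
  r \<integral> |s / (F - s)|^2 d\<mu> (\<open>poisson_A\<close>). It satisfies Im (H F) = Im F (1 -
  A(F)), so A < 1 exactly where H keeps a nonreal point in its half plane. On that set H is
  injective, and |E| \<le> (A + B) / 2 < 1, with B the same quantity for the second coordinate,
  keeps 1 - E nonzero; A < 1 and B < 1 also enter the positivity estimate. The same inequalities
  yield Lipschitz bounds for H and E that depend neither on the rate nor on the jump distribution,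
  and these turn weak convergence of laws back into convergence of H and E. Bounded jumps help
  because H F - F is then bounded on each region |Im F| \<ge> \<epsilon>, which permits a fixed
  point argument. Truncation is harmless: for fixed F and W it moves H and E by at most a constant
  times the rate times the cut-off mass. Rates are arbitrary nonnegative reals, since the m-th part
  of a limit needs the rates k / m.\<close>

lemma nonreal_iff: "z \<notin> \<real> \<longleftrightarrow> Im z \<noteq> 0" "z \<in> - \<real> \<longleftrightarrow> Im z \<noteq> 0"
  by (auto simp: complex_is_Real_iff)

lemma open_nonreal: "open (- \<real> :: complex set)"
  using closed_complex_Reals by blast

lemma abs_Im_le_norm_sub_real: "\<bar>Im z\<bar> \<le> norm (z - complex_of_real x)"
  using abs_Im_le_cmod[of "z - of_real x"] by simp

lemma sub_real_nonzero: "Im z \<noteq> 0 \<Longrightarrow> z - complex_of_real x \<noteq> 0"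
  using abs_Im_le_norm_sub_real[of z x] by auto

lemma norm_resolvent_le:
  assumes "Im z \<noteq> 0"
  shows "norm (1 / (z - complex_of_real x)) \<le> 1 / \<bar>Im z\<bar>"
  using abs_Im_le_norm_sub_real[of z x] assms by (auto simp: norm_divide intro!: divide_left_mono mult_pos_pos)

lemma integrable_cauchy_kernel:
  assumes "finite_measure M" and [measurable]: "u \<in> borel_measurable M" "g \<in> borel_measurable M"
    and "\<And>x. norm (g x) \<le> B" "Im z \<noteq> 0"
  shows "integrable M (\<lambda>x. g x / (z - complex_of_real (u x)))"
proof (rule finite_measure.integrable_const_bound[OF assms(1)])
  show "AE x in M. norm (g x / (z - complex_of_real (u x))) \<le> B / \<bar>Im z\<bar>"
  proof (rule AE_I2)
    fix x
    have "norm (g x / (z - complex_of_real (u x))) = norm (g x) * norm (1 / (z - complex_of_real (u x)))"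
      by (simp add: norm_divide)
    also have "\<dots> \<le> B * (1 / \<bar>Im z\<bar>)"
      by (intro mult_mono assms norm_resolvent_le order_trans[OF norm_ge_zero assms(4)]) auto
    finally show "norm (g x / (z - complex_of_real (u x))) \<le> B / \<bar>Im z\<bar>" by simp
  qed
qed measurable

text \<open>Differentiation under the integral sign with an explicit remainder: the difference
  quotient differs from the candidate derivative by (y - z) \<integral> g / ((z - u)^2 (y - u)), and
  this integral is bounded while y stays within half the distance from z to the real axis. The
  numerator g is kept general so that the other variable of a two-variable transform can be absorbed
  into it.\<close>

lemma holomorphic_cauchy_kernel:
  assumes "finite_measure M" and [measurable]: "u \<in> borel_measurable M" "g \<in> borel_measurable M"
    and B: "\<And>x. norm (g x) \<le> B"
  shows "(\<lambda>z. \<integral>x. g x / (z - complex_of_real (u x)) \<partial>M) holomorphic_on - \<real>"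
proof -
  interpret finite_measure M by fact
  define C where "C z = (\<integral>x. g x / (z - complex_of_real (u x)) \<partial>M)" for z
  have B0: "B \<ge> 0" using norm_ge_zero order_trans B by blast
  have "(C has_field_derivative - (\<integral>x. g x / (z - complex_of_real (u x))^2 \<partial>M)) (at z within - \<real>)"
    if z: "z \<in> - \<real>" for z
  proof -
    define l where "l = - (\<integral>x. g x / (z - complex_of_real (u x))^2 \<partial>M)"
    have z0: "Im z \<noteq> 0" using z by (simp add: complex_is_Real_iff)
    define K where "K = measure M (space M) * (B * (1 / \<bar>Im z\<bar>^2 * (2 / \<bar>Im z\<bar>)))"
    have main: "norm ((C y - C z) / (y - z) - l) \<le> K * norm (y - z)"
      if y: "norm (y - z) \<le> \<bar>Im z\<bar> / 2" "y \<noteq> z" for y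
    proof -
      have y2: "\<bar>Im y\<bar> \<ge> \<bar>Im z\<bar> / 2"
        using abs_Im_le_cmod[of "y - z"] y by simp
      then have y0: "Im y \<noteq> 0" using z0 by auto
      have i2: "integrable M (\<lambda>x. g x / (z - complex_of_real (u x))^2)"
      proof -
        have "integrable M (\<lambda>x. (g x / (z - complex_of_real (u x))) / (z - complex_of_real (u x)))"
        proof (rule integrable_cauchy_kernel[OF assms(1), where B="B / \<bar>Im z\<bar>"])
          show "norm (g x / (z - complex_of_real (u x))) \<le> B / \<bar>Im z\<bar>" for x
            using mult_mono[OF B norm_resolvent_le[OF z0, of "u x"] B0] by (simp add: norm_divide)
        qed (use z0 in measurable)
        then show ?thesis by (simp add: power2_eq_square)
      qed
      have i1: "integrable M (\<lambda>x. g x / (y - complex_of_real (u x)))" "integrable M (\<lambda>x. g x / (z - complex_of_real (u x)))"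
        using integrable_cauchy_kernel[OF assms(1-4)] y0 z0 by blast+
      have eq: "C y - C z - l * (y - z) = (\<integral>x. (y - z)^2 * (g x / ((z - complex_of_real (u x))^2 * (y - complex_of_real (u x)))) \<partial>M)"
      proof -
        have "C y - C z - l * (y - z) = (\<integral>x. g x / (y - complex_of_real (u x)) - g x / (z - complex_of_real (u x))
             + (g x / (z - complex_of_real (u x))^2) * (y - z) \<partial>M)"
          unfolding C_def l_def using i1 i2
          by (subst Bochner_Integration.integral_add) (auto simp del: times_divide_eq_left)
        also have "\<dots> = (\<integral>x. (y - z)^2 * (g x / ((z - complex_of_real (u x))^2 * (y - complex_of_real (u x)))) \<partial>M)"
        proof (rule Bochner_Integration.integral_cong[OF refl])
          fix x
          have "y - complex_of_real (u x) \<noteq> 0" "z - complex_of_real (u x) \<noteq> 0"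
            using sub_real_nonzero y0 z0 by auto
          then show "g x / (y - complex_of_real (u x)) - g x / (z - complex_of_real (u x))
             + (g x / (z - complex_of_real (u x))^2) * (y - z) = (y - z)^2 * (g x / ((z - complex_of_real (u x))^2 * (y - complex_of_real (u x))))"
            by (simp add: divide_simps) (simp add: algebra_simps power2_eq_square)
        qed
        finally show ?thesis .
      qed
      have "norm (C y - C z - l * (y - z)) \<le> measure M (space M) * (norm (y - z)^2 * (B * (1 / \<bar>Im z\<bar>^2 * (2 / \<bar>Im z\<bar>))))"
        unfolding eq
      proof (rule order_trans[OF integral_norm_bound])
        have "(\<integral>x. norm ((y - z)^2 * (g x / ((z - complex_of_real (u x))^2 * (y - complex_of_real (u x))))) \<partial>M)
          \<le> (\<integral>x. norm (y - z)^2 * (B * (1 / \<bar>Im z\<bar>^2 * (2 / \<bar>Im z\<bar>))) \<partial>M)"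
        proof (rule Bochner_Integration.integral_mono')
          fix x
          have y3: "norm (1 / (y - complex_of_real (u x))) \<le> 2 / \<bar>Im z\<bar>"
            using y2 z0 by (intro order_trans[OF norm_resolvent_le[OF y0]]) (auto simp: field_simps)
          have "norm (1 / (z - complex_of_real (u x)))^2 * norm (1 / (y - complex_of_real (u x))) \<le> (1/\<bar>Im z\<bar>)^2 * (2 / \<bar>Im z\<bar>)"
            by (intro mult_mono power_mono norm_resolvent_le[OF z0] y3) auto
          then have "norm (g x) * (norm (1 / (z - complex_of_real (u x)))^2 * norm (1 / (y - complex_of_real (u x)))) \<le> B * ((1/\<bar>Im z\<bar>)^2 * (2 / \<bar>Im z\<bar>))"
            by (rule mult_mono[OF B _ B0]) auto
          then have "norm (y - z)^2 * (norm (g x) * (norm (1 / (z - complex_of_real (u x)))^2 * norm (1 / (y - complex_of_real (u x))))) \<le> norm (y - z)^2 * (B * ((1/\<bar>Im z\<bar>)^2 * (2 / \<bar>Im z\<bar>)))"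
            by (rule mult_left_mono) auto
          then show "norm ((y - z)^2 * (g x / ((z - complex_of_real (u x))^2 * (y - complex_of_real (u x))))) \<le> norm (y - z)^2 * (B * (1 / \<bar>Im z\<bar>^2 * (2 / \<bar>Im z\<bar>)))"
            by (simp only: norm_mult norm_divide norm_power power_divide norm_one power_one times_divide_eq_left times_divide_eq_right mult_1_left divide_divide_eq_left mult_ac)
        qed (use B0 in auto)
        also have "\<dots> = measure M (space M) * (norm (y - z)^2 * (B * (1 / \<bar>Im z\<bar>^2 * (2 / \<bar>Im z\<bar>))))"
          by simp
        finally show "(\<integral>x. norm ((y - z)^2 * (g x / ((z - complex_of_real (u x))^2 * (y - complex_of_real (u x))))) \<partial>M) \<le> \<dots>" .
      qed
      also have "\<dots> = (K * norm (y - z)) * norm (y - z)"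
        by (simp add: K_def power2_eq_square)
      finally have "norm (C y - C z - l * (y - z)) / norm (y - z) \<le> K * norm (y - z)"
        using y(2) by (simp add: divide_le_eq)
      moreover have "(C y - C z) / (y - z) - l = (C y - C z - l * (y - z)) / (y - z)"
        using y(2) by (simp add: field_simps)
      ultimately show ?thesis by (simp add: norm_divide)
    qed
    have "((\<lambda>y. (C y - C z) / (y - z) - l) \<longlongrightarrow> 0) (at z within - \<real>)"
    proof (rule Lim_null_comparison)
      show "\<forall>\<^sub>F y in at z within - \<real>. norm ((C y - C z) / (y - z) - l) \<le> K * norm (y - z)"
        unfolding eventually_at using main z0
        by (intro exI[of _ "\<bar>Im z\<bar> / 2"]) (auto simp: dist_norm)
      show "((\<lambda>y. K * norm (y - z)) \<longlongrightarrow> 0) (at z within - \<real>)"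
        by (auto intro!: tendsto_eq_intros)
    qed
    then show ?thesis
      unfolding has_field_derivative_iff l_def[symmetric] by (simp add: LIM_zero_iff)
  qed
  then show ?thesis
    unfolding holomorphic_on_def field_differentiable_def C_def[symmetric] by blast
qed

section \<open>Borel laws, marginals and exchange of coordinates\<close>

lemma borel_probD:
  assumes "borel_prob M"
  shows "prob_space M" "finite_measure M" "sets M = sets borel" "space M = UNIV" "measure M (space M) = 1"
  using assms prob_space.prob_space[of M] prob_space_imp_subprob_space prob_space.finite_measure sets_eq_imp_space_eq[of M borel]
  unfolding borel_prob_def by auto

lemma borel_prob_distr:
  assumes "borel_prob M" and f: "f \<in> borel_measurable borel"
  shows "borel_prob (distr M borel f)"
proof -
  have "f \<in> borel_measurable M"
    using f measurable_cong_sets[OF borel_probD(3)[OF assms(1)] refl] by blast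
  then show ?thesis
    using prob_space.prob_space_distr[OF borel_probD(1)[OF assms(1)]] by (auto simp: borel_prob_def)
qed

lemma borel_prob_marginal:
  assumes "borel_prob \<mu>"
  shows "borel_prob (marginal1 \<mu>)" "borel_prob (marginal2 \<mu>)"
  unfolding marginal1_def marginal2_def
  by (intro borel_prob_distr assms borel_measurable_continuous_onI continuous_intros)+

text \<open>Exchanging the coordinates exchanges the marginals, so that many statements are proved
  for the first coordinate alone and transferred to the second.\<close>

definition swap_law :: "(real \<times> real) measure \<Rightarrow> (real \<times> real) measure" where
  "swap_law \<mu> = distr \<mu> borel prod.swap"

lemma borel_measurable_swap: "(prod.swap :: real \<times> real \<Rightarrow> real \<times> real) \<in> borel_measurable borel"
  by (intro borel_measurable_continuous_onI continuous_on_swap)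

lemma borel_prob_swap: "borel_prob \<mu> \<Longrightarrow> borel_prob (swap_law \<mu>)"
  unfolding swap_law_def by (intro borel_prob_distr borel_measurable_swap)

lemma integral_swap_law:
  fixes f :: "real \<times> real \<Rightarrow> 'b::{banach, second_countable_topology}"
  assumes "borel_prob \<mu>" "f \<in> borel_measurable borel"
  shows "(\<integral>p. f p \<partial>swap_law \<mu>) = (\<integral>p. f (prod.swap p) \<partial>\<mu>)"
  unfolding swap_law_def
  by (rule integral_distr)
     (use assms borel_measurable_swap in \<open>auto simp: measurable_cong_sets[OF borel_probD(3)[OF assms(1)] refl]\<close>)

lemma marginal1_swap:
  assumes "borel_prob \<mu>"
  shows "marginal1 (swap_law \<mu>) = marginal2 \<mu>"
proof -
  have "fst \<in> borel_measurable (borel :: (real \<times> real) measure)"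
    by (intro borel_measurable_continuous_onI continuous_intros)
  then show ?thesis
    using assms borel_measurable_swap unfolding marginal1_def marginal2_def swap_law_def
    by (subst distr_distr)
       (auto simp: comp_def measurable_cong_sets[OF borel_probD(3)[OF assms] refl])
qed

lemma measurable_fst_real: "fst \<in> borel_measurable (borel :: (real \<times> real) measure)"
  and measurable_snd_real: "snd \<in> borel_measurable (borel :: (real \<times> real) measure)"
  by (intro borel_measurable_continuous_onI continuous_intros)+

lemma integral_marginal1:
  fixes f :: "real \<Rightarrow> 'b::{banach, second_countable_topology}"
  assumes "borel_prob \<mu>" "f \<in> borel_measurable borel"
  shows "(\<integral>x. f x \<partial>marginal1 \<mu>) = (\<integral>p. f (fst p) \<partial>\<mu>)"
  unfolding marginal1_def
  by (rule integral_distr)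
     (use assms measurable_fst_real in \<open>auto simp: measurable_cong_sets[OF borel_probD(3)[OF assms(1)] refl]\<close>)

lemma integral_marginal2:
  fixes f :: "real \<Rightarrow> 'b::{banach, second_countable_topology}"
  assumes "borel_prob \<mu>" "f \<in> borel_measurable borel"
  shows "(\<integral>x. f x \<partial>marginal2 \<mu>) = (\<integral>p. f (snd p) \<partial>\<mu>)"
  unfolding marginal2_def
  by (rule integral_distr)
     (use assms measurable_snd_real in \<open>auto simp: measurable_cong_sets[OF borel_probD(3)[OF assms(1)] refl]\<close>)

lemma cauchy_transform_marginal1:
  assumes "borel_prob \<mu>"
  shows "cauchy_transform (marginal1 \<mu>) z = (\<integral>p. 1 / (z - of_real (fst p)) \<partial>\<mu>)"
  unfolding cauchy_transform_def by (rule integral_marginal1[OF assms]) measurable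

lemma cauchy_transform_marginal2:
  assumes "borel_prob \<mu>"
  shows "cauchy_transform (marginal2 \<mu>) z = (\<integral>p. 1 / (z - of_real (snd p)) \<partial>\<mu>)"
  unfolding cauchy_transform_def by (rule integral_marginal2[OF assms]) measurable

text \<open>Each form has one resolvent as a bounded numerator over the other, the shape that the
  one-variable kernel lemmas expect.\<close>

lemma cauchy_transform2_eq:
  "cauchy_transform2 \<mu> z w = (\<integral>p. 1 / (w - of_real (snd p)) / (z - of_real (fst p)) \<partial>\<mu>)"
  "cauchy_transform2 \<mu> z w = (\<integral>p. 1 / (z - of_real (fst p)) / (w - of_real (snd p)) \<partial>\<mu>)"
  unfolding cauchy_transform2_def by (auto intro!: Bochner_Integration.integral_cong simp: mult.commute)

lemma cauchy_transform2_swap: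
  assumes "borel_prob \<mu>"
  shows "cauchy_transform2 (swap_law \<mu>) z w = cauchy_transform2 \<mu> w z"
proof -
  have [measurable]: "fst \<in> borel_measurable (borel :: (real \<times> real) measure)" "snd \<in> borel_measurable (borel :: (real \<times> real) measure)"
    by (rule measurable_fst_real measurable_snd_real)+
  have "(\<lambda>p. 1 / (w - complex_of_real (snd p)) / (z - complex_of_real (fst p))) \<in> borel_measurable borel"
    by measurable
  from integral_swap_law[OF assms this] show ?thesis
    unfolding cauchy_transform2_eq(1)[of "swap_law \<mu>"] cauchy_transform2_eq(2)[of \<mu>] by simp
qed

section \<open>Regularity and equicontinuity of Cauchy transforms\<close>

lemma measurable_borel_prob:
  assumes "borel_prob M"
  shows "f \<in> borel_measurable M \<longleftrightarrow> f \<in> borel_measurable borel"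
  by (simp add: measurable_cong_sets[OF borel_probD(3)[OF assms] refl])

lemma measurable_coordinates:
  assumes "borel_prob \<mu>"
  shows "(fst :: real \<times> real \<Rightarrow> real) \<in> borel_measurable \<mu>" "(snd :: real \<times> real \<Rightarrow> real) \<in> borel_measurable \<mu>"
  using measurable_fst_real measurable_snd_real by (simp_all add: measurable_borel_prob[OF assms])

lemma integrable_resolvent:
  assumes "borel_prob m" "Im z \<noteq> 0"
  shows "integrable m (\<lambda>x. 1 / (z - complex_of_real x))"
  using integrable_cauchy_kernel[OF borel_probD(2)[OF assms(1)], of "\<lambda>x. x" "\<lambda>_. 1" 1 z] assms
  by (simp add: measurable_borel_prob)

lemma integrable_resolvent2:
  assumes "borel_prob \<mu>" "Im z \<noteq> 0" "Im w \<noteq> 0"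
  shows "integrable \<mu> (\<lambda>p. 1 / (w - complex_of_real (snd p)) / (z - complex_of_real (fst p)))"
proof (rule integrable_cauchy_kernel[OF borel_probD(2)[OF assms(1)]])
  note [measurable] = measurable_coordinates[OF assms(1)]
  show "fst \<in> borel_measurable \<mu>" "(\<lambda>x. 1 / (w - complex_of_real (snd x))) \<in> borel_measurable \<mu>"
    by measurable
  show "norm (1 / (w - complex_of_real (snd x))) \<le> 1 / \<bar>Im w\<bar>" for x :: "real \<times> real"
    using norm_resolvent_le[OF assms(3)] .
qed (rule assms)

lemma integrable_resolvent_coordinates:
  assumes "borel_prob \<mu>" "Im z \<noteq> 0"
  shows "integrable \<mu> (\<lambda>p. 1 / (z - complex_of_real (fst p)))" "integrable \<mu> (\<lambda>p. 1 / (z - complex_of_real (snd p)))"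
  using integrable_cauchy_kernel[OF borel_probD(2)[OF assms(1)], of fst "\<lambda>_. 1" 1 z]
    integrable_cauchy_kernel[OF borel_probD(2)[OF assms(1)], of snd "\<lambda>_. 1" 1 z] assms
    measurable_coordinates[OF assms(1)]
  by auto

lemma cauchy_transform_holomorphic:
  assumes "borel_prob m"
  shows "cauchy_transform m holomorphic_on - \<real>"
  unfolding cauchy_transform_def
  using holomorphic_cauchy_kernel[OF borel_probD(2)[OF assms(1)], of "\<lambda>x. x" "\<lambda>_. 1" 1] assms
  by (simp add: measurable_borel_prob)

lemma cauchy_transform2_holomorphic1:
  assumes "borel_prob \<mu>" "Im w \<noteq> 0"
  shows "(\<lambda>z. cauchy_transform2 \<mu> z w) holomorphic_on - \<real>"
  unfolding cauchy_transform2_eq(1)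
proof (rule holomorphic_cauchy_kernel[OF borel_probD(2)[OF assms(1)]])
  note [measurable] = measurable_coordinates[OF assms(1)]
  show "fst \<in> borel_measurable \<mu>" "(\<lambda>x. 1 / (w - complex_of_real (snd x))) \<in> borel_measurable \<mu>"
    by measurable
qed (rule norm_resolvent_le[OF assms(2)])

lemma cauchy_transform2_holomorphic2:
  assumes "borel_prob \<mu>" "Im z \<noteq> 0"
  shows "(\<lambda>w. cauchy_transform2 \<mu> z w) holomorphic_on - \<real>"
  using cauchy_transform2_holomorphic1[OF borel_prob_swap[OF assms(1)] assms(2)]
  by (simp add: cauchy_transform2_swap[OF assms(1)])

lemma norm_integral_prob_le:
  fixes f :: "'a \<Rightarrow> 'b::{banach, second_countable_topology}"
  assumes "prob_space M" "\<And>x. norm (f x) \<le> B"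
  shows "norm (\<integral>x. f x \<partial>M) \<le> B"
proof (cases "integrable M f")
  case True
  interpret prob_space M by fact
  have "norm (\<integral>x. f x \<partial>M) \<le> (\<integral>x. norm (f x) \<partial>M)" by simp
  also have "\<dots> \<le> (\<integral>x. B \<partial>M)"
    by (rule integral_mono) (use True assms(2) in auto)
  finally show ?thesis by (simp add: prob_space)
next
  case False
  then show ?thesis using order_trans[OF norm_ge_zero assms(2)] by (simp add: not_integrable_integral_eq)
qed

lemma norm_resolvent2_le:
  assumes "Im z \<noteq> 0" "Im w \<noteq> 0"
  shows "norm (1 / (w - complex_of_real t) / (z - complex_of_real s)) \<le> 1 / (\<bar>Im z\<bar> * \<bar>Im w\<bar>)"
  using mult_mono[OF norm_resolvent_le[OF assms(2), of t] norm_resolvent_le[OF assms(1), of s]]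
  by (simp add: norm_divide norm_mult mult.commute)

lemma resolvent_diff:
  assumes "Im z \<noteq> 0" "Im z' \<noteq> 0"
  shows "1 / (z - complex_of_real x) - 1 / (z' - complex_of_real x)
    = (z' - z) * (1 / (z - complex_of_real x)) * (1 / (z' - complex_of_real x))"
  using sub_real_nonzero[OF assms(1), of x] sub_real_nonzero[OF assms(2), of x] by (simp add: field_simps)

lemma norm_resolvent_diff_le:
  assumes "Im z \<noteq> 0" "Im z' \<noteq> 0"
  shows "norm (1 / (z - complex_of_real x) - 1 / (z' - complex_of_real x)) \<le> norm (z - z') / (\<bar>Im z\<bar> * \<bar>Im z'\<bar>)"
proof -
  have "norm (1 / (z - complex_of_real x) - 1 / (z' - complex_of_real x))
    = norm (z' - z) * (norm (1 / (z - complex_of_real x)) * norm (1 / (z' - complex_of_real x)))"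
    unfolding resolvent_diff[OF assms] by (simp only: norm_mult mult.assoc)
  also have "\<dots> \<le> norm (z' - z) * ((1 / \<bar>Im z\<bar>) * (1 / \<bar>Im z'\<bar>))"
    by (intro mult_left_mono mult_mono norm_resolvent_le assms) auto
  finally show ?thesis by (simp add: norm_minus_commute)
qed

lemma cauchy_transform_lipschitz:
  assumes m: "borel_prob m" and "Im z \<noteq> 0" "Im z' \<noteq> 0"
  shows "norm (cauchy_transform m z - cauchy_transform m z') \<le> norm (z - z') / (\<bar>Im z\<bar> * \<bar>Im z'\<bar>)"
proof -
  have "cauchy_transform m z - cauchy_transform m z' = (\<integral>x. (1 / (z - complex_of_real x) - 1 / (z' - complex_of_real x)) \<partial>m)"
    unfolding cauchy_transform_def
    by (subst Bochner_Integration.integral_diff) (use integrable_resolvent[OF m] assms in auto)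
  then show ?thesis
    using norm_integral_prob_le[OF borel_probD(1)[OF m] norm_resolvent_diff_le[OF assms(2,3)]] by simp
qed

lemma cauchy_transform2_lipschitz1:
  assumes \<mu>: "borel_prob \<mu>" and z: "Im z \<noteq> 0" "Im z' \<noteq> 0" and w: "Im w \<noteq> 0"
  shows "norm (cauchy_transform2 \<mu> z w - cauchy_transform2 \<mu> z' w) \<le> norm (z - z') / (\<bar>Im z\<bar> * \<bar>Im z'\<bar> * \<bar>Im w\<bar>)"
proof -
  have "norm (1 / (w - complex_of_real t) / (z - complex_of_real s) - 1 / (w - complex_of_real t) / (z' - complex_of_real s))
      \<le> norm (z - z') / (\<bar>Im z\<bar> * \<bar>Im z'\<bar> * \<bar>Im w\<bar>)" for s t
  proof -
    have "norm (1 / (w - complex_of_real t) / (z - complex_of_real s) - 1 / (w - complex_of_real t) / (z' - complex_of_real s))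
      = norm (1 / (w - complex_of_real t)) * norm (1 / (z - complex_of_real s) - 1 / (z' - complex_of_real s))"
      by (simp add: norm_mult[symmetric] algebra_simps)
    also have "\<dots> \<le> (1 / \<bar>Im w\<bar>) * (norm (z - z') / (\<bar>Im z\<bar> * \<bar>Im z'\<bar>))"
      by (intro mult_mono norm_resolvent_le norm_resolvent_diff_le assms) auto
    finally show ?thesis by (simp add: mult_ac)
  qed
  note le = this
  have "cauchy_transform2 \<mu> z w - cauchy_transform2 \<mu> z' w = (\<integral>p. (1 / (w - complex_of_real (snd p)) / (z - complex_of_real (fst p)) - 1 / (w - complex_of_real (snd p)) / (z' - complex_of_real (fst p))) \<partial>\<mu>)"
    unfolding cauchy_transform2_eq(1)
    by (subst Bochner_Integration.integral_diff) (use integrable_resolvent2[OF \<mu>] assms in auto)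
  then show ?thesis
    using norm_integral_prob_le[OF borel_probD(1)[OF \<mu>] le] by simp
qed

lemma cauchy_transform2_lipschitz2:
  assumes \<mu>: "borel_prob \<mu>" and "Im z \<noteq> 0" "Im w \<noteq> 0" "Im w' \<noteq> 0"
  shows "norm (cauchy_transform2 \<mu> z w - cauchy_transform2 \<mu> z w') \<le> norm (w - w') / (\<bar>Im w\<bar> * \<bar>Im w'\<bar> * \<bar>Im z\<bar>)"
  using cauchy_transform2_lipschitz1[OF borel_prob_swap[OF \<mu>] assms(3,4,2)]
  by (simp add: cauchy_transform2_swap[OF \<mu>])

text \<open>The Lipschitz constants depend only on the distances to the real axis, never on the law.
  Hence evaluation points that move with n may be frozen at their limit along an arbitrary sequence
  of laws.\<close>

lemma cauchy_transform2_equicontinuous: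
  assumes \<mu>: "\<And>n. borel_prob (\<mu> n)" and lim: "z \<longlonglongrightarrow> z0" "w \<longlonglongrightarrow> w0" and "Im z0 \<noteq> 0" "Im w0 \<noteq> 0"
  shows "(\<lambda>n. cauchy_transform2 (\<mu> n) (z n) (w n) - cauchy_transform2 (\<mu> n) z0 w0) \<longlonglongrightarrow> 0"
proof (rule Lim_null_comparison)
  have ne: "\<forall>\<^sub>F n in sequentially. Im (z n) \<noteq> 0" "\<forall>\<^sub>F n in sequentially. Im (w n) \<noteq> 0"
    using tendsto_imp_eventually_ne[OF tendsto_Im[OF lim(1)] assms(4)]
      tendsto_imp_eventually_ne[OF tendsto_Im[OF lim(2)] assms(5)] by auto
  show "\<forall>\<^sub>F n in sequentially. norm (cauchy_transform2 (\<mu> n) (z n) (w n) - cauchy_transform2 (\<mu> n) z0 w0)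
     \<le> norm (z n - z0) / (\<bar>Im (z n)\<bar> * \<bar>Im z0\<bar> * \<bar>Im (w n)\<bar>) + norm (w n - w0) / (\<bar>Im (w n)\<bar> * \<bar>Im w0\<bar> * \<bar>Im z0\<bar>)"
    using ne
  proof eventually_elim
    case (elim n)
    then show ?case
      using cauchy_transform2_lipschitz1[OF \<mu>[of n] elim(1) assms(4) elim(2)]
        cauchy_transform2_lipschitz2[OF \<mu>[of n] assms(4) elim(2) assms(5)]
        norm_triangle_ineq[of "cauchy_transform2 (\<mu> n) (z n) (w n) - cauchy_transform2 (\<mu> n) z0 (w n)" "cauchy_transform2 (\<mu> n) z0 (w n) - cauchy_transform2 (\<mu> n) z0 w0"]
      by simp
  qed
  have "(\<lambda>n. norm (z n - z0) / (\<bar>Im (z n)\<bar> * \<bar>Im z0\<bar> * \<bar>Im (w n)\<bar>) + norm (w n - w0) / (\<bar>Im (w n)\<bar> * \<bar>Im w0\<bar> * \<bar>Im z0\<bar>))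
     \<longlonglongrightarrow> norm (z0 - z0) / (\<bar>Im z0\<bar> * \<bar>Im z0\<bar> * \<bar>Im w0\<bar>) + norm (w0 - w0) / (\<bar>Im w0\<bar> * \<bar>Im w0\<bar> * \<bar>Im z0\<bar>)"
    using assms(4,5) by (intro tendsto_intros lim) auto
  then show "(\<lambda>n. norm (z n - z0) / (\<bar>Im (z n)\<bar> * \<bar>Im z0\<bar> * \<bar>Im (w n)\<bar>) + norm (w n - w0) / (\<bar>Im (w n)\<bar> * \<bar>Im w0\<bar> * \<bar>Im z0\<bar>))
     \<longlonglongrightarrow> 0" by simp
qed

lemma cauchy_transform_equicontinuous:
  assumes m: "\<And>n. borel_prob (m n)" and lim: "z \<longlonglongrightarrow> z0" and "Im z0 \<noteq> 0"
  shows "(\<lambda>n. cauchy_transform (m n) (z n) - cauchy_transform (m n) z0) \<longlonglongrightarrow> 0"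
proof (rule Lim_null_comparison)
  have "\<forall>\<^sub>F n in sequentially. Im (z n) \<noteq> 0"
    using tendsto_imp_eventually_ne[OF tendsto_Im[OF lim] assms(3)] .
  then show "\<forall>\<^sub>F n in sequentially. norm (cauchy_transform (m n) (z n) - cauchy_transform (m n) z0)
     \<le> norm (z n - z0) / (\<bar>Im (z n)\<bar> * \<bar>Im z0\<bar>)"
    by eventually_elim (rule cauchy_transform_lipschitz[OF m _ assms(3)])
  have "(\<lambda>n. norm (z n - z0) / (\<bar>Im (z n)\<bar> * \<bar>Im z0\<bar>)) \<longlonglongrightarrow> norm (z0 - z0) / (\<bar>Im z0\<bar> * \<bar>Im z0\<bar>)"
    using assms(3) by (intro tendsto_intros lim) auto
  then show "(\<lambda>n. norm (z n - z0) / (\<bar>Im (z n)\<bar> * \<bar>Im z0\<bar>)) \<longlonglongrightarrow> 0" by simp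
qed

lemma cauchy_transform_cnj: "cauchy_transform m (cnj z) = cnj (cauchy_transform m z)"
  unfolding cauchy_transform_def by (simp flip: Bochner_Integration.integral_cnj)

lemma Im_resolvent: "Im (1 / (z - complex_of_real x)) = - Im z * norm (1 / (z - complex_of_real x))^2"
  by (simp add: Im_divide norm_divide power_divide cmod_power2)

lemma integral_positive:
  assumes "prob_space M" "integrable M f" "\<And>x. f x > (0::real)"
  shows "(\<integral>x. f x \<partial>M) > 0"
proof -
  interpret prob_space M by fact
  have "(\<integral>x. 0 \<partial>M) < (\<integral>x. f x \<partial>M)"
    by (rule integral_less_AE_space) (use assms(2,3) in \<open>auto simp: emeasure_space_1\<close>)
  then show ?thesis by simp
qed

text \<open>Pointwise, the resolvent has imaginary part - Im z |1 / (z - x)|^2, so the integrand of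
  Im z Im G is strictly negative. The reciprocal of G therefore maps each half plane into
  itself.\<close>

lemma Im_cauchy_transform:
  assumes m: "borel_prob m" and z: "Im z \<noteq> 0"
  shows "Im z * Im (cauchy_transform m z) < 0"
proof -
  have i: "integrable m (\<lambda>x. 1 / (z - complex_of_real x))" by (rule integrable_resolvent[OF assms])
  have "Im (cauchy_transform m z) = (\<integral>x. Im (1 / (z - complex_of_real x)) \<partial>m)"
    unfolding cauchy_transform_def using i by (rule integral_Im[symmetric])
  also have "Im z * \<dots> = - (\<integral>x. (Im z)^2 * norm (1 / (z - complex_of_real x))^2 \<partial>m)"
    unfolding Im_resolvent by (simp add: power2_eq_square mult.assoc flip: integral_minus integral_mult_right_zero)
  also have "\<dots> < 0"
  proof -
    have "integrable m (\<lambda>x. - Im z * Im (1 / (z - complex_of_real x)))"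
      using integrable_Im[OF i] by simp
    then have "integrable m (\<lambda>x. (Im z)^2 * norm (1 / (z - complex_of_real x))^2)"
      unfolding Im_resolvent by (simp add: power2_eq_square mult.assoc)
    then show ?thesis
      using integral_positive[OF borel_probD(1)[OF m], of "\<lambda>x. (Im z)^2 * norm (1 / (z - complex_of_real x))^2"] sub_real_nonzero[OF z] z
      by simp
  qed
  finally show ?thesis .
qed

text \<open>In the cone |Im w| \<ge> c |w| the factor w / (w - t) is bounded by 1 / c and tends to
  1, so dominated convergence removes the second variable. Through this limit marginal data are read
  off from joint data.\<close>

lemma cauchy_transform2_at_infinity:
  assumes \<mu>: "borel_prob \<mu>" and z: "Im z \<noteq> 0" and c: "c > 0"
    and w: "filterlim w at_infinity sequentially" "\<And>j. \<bar>Im (w j)\<bar> \<ge> c * norm (w j)" "\<And>j. w j \<noteq> 0"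
  shows "(\<lambda>j. w j * cauchy_transform2 \<mu> z (w j)) \<longlonglongrightarrow> cauchy_transform (marginal1 \<mu>) z"
proof -
  note [measurable] = measurable_coordinates[OF \<mu>]
  have w0: "Im (w j) \<noteq> 0" for j
    using w(2)[of j] w(3)[of j] c by (auto simp: mult_le_0_iff)
  have eq: "w j * cauchy_transform2 \<mu> z (w j) = (\<integral>p. w j / (w j - of_real (snd p)) / (z - of_real (fst p)) \<partial>\<mu>)" for j
    unfolding cauchy_transform2_eq(1) by (simp flip: integral_mult_right_zero)
  show ?thesis
    unfolding eq cauchy_transform_marginal1[OF \<mu>]
  proof (rule integral_dominated_convergence[where w="\<lambda>_. 1 / c * (1 / \<bar>Im z\<bar>)"])
    show "integrable \<mu> (\<lambda>_. 1 / c * (1 / \<bar>Im z\<bar>))"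
      using borel_probD(2)[OF \<mu>] by (simp add: finite_measure.integrable_const)
    show "AE p in \<mu>. norm (w j / (w j - complex_of_real (snd p)) / (z - complex_of_real (fst p))) \<le> 1 / c * (1 / \<bar>Im z\<bar>)" for j
    proof (rule AE_I2)
      fix p :: "real \<times> real"
      have "norm (w j) * norm (1 / (w j - complex_of_real (snd p))) \<le> norm (w j) * (1 / \<bar>Im (w j)\<bar>)"
        by (intro mult_left_mono norm_resolvent_le w0) auto
      also have "\<dots> \<le> 1 / c"
        using w(2)[of j] c w0[of j] by (simp add: field_simps)
      finally have "norm (w j) * norm (1 / (w j - complex_of_real (snd p))) * norm (1 / (z - complex_of_real (fst p))) \<le> 1 / c * (1 / \<bar>Im z\<bar>)"
        by (intro mult_mono norm_resolvent_le z) (use c in auto)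
      then show "norm (w j / (w j - complex_of_real (snd p)) / (z - complex_of_real (fst p))) \<le> 1 / c * (1 / \<bar>Im z\<bar>)"
        by (simp add: norm_divide norm_mult)
    qed
    show "AE p in \<mu>. (\<lambda>j. w j / (w j - complex_of_real (snd p)) / (z - complex_of_real (fst p))) \<longlonglongrightarrow> 1 / (z - complex_of_real (fst p))"
    proof (rule AE_I2)
      fix p :: "real \<times> real"
      have "(\<lambda>j. complex_of_real (snd p) / w j) \<longlonglongrightarrow> 0"
        by (rule tendsto_divide_0[OF tendsto_const w(1)])
      then have "(\<lambda>j. 1 / (1 - complex_of_real (snd p) / w j) / (z - complex_of_real (fst p))) \<longlonglongrightarrow> 1 / (1 - 0) / (z - complex_of_real (fst p))"
        by (intro tendsto_intros) (use sub_real_nonzero[OF z] in auto)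
      moreover have "1 / (1 - complex_of_real (snd p) / w j) = w j / (w j - complex_of_real (snd p))" for j
        using w(3)[of j] sub_real_nonzero[OF w0[of j], of "snd p"] by (simp add: field_simps)
      ultimately show "(\<lambda>j. w j / (w j - complex_of_real (snd p)) / (z - complex_of_real (fst p))) \<longlonglongrightarrow> 1 / (z - complex_of_real (fst p))"
        by simp
    qed
  qed measurable
qed

section \<open>Marginal subordination functions\<close>

text \<open>Since G(1 / z) / z = \<integral> 1 / (1 - z x) dm, this equals r \<integral> x / (1 - z
  x) dm, the R-transform of the free compound Poisson law with rate r and jump distribution
  m.\<close>

definition poisson_R :: "real \<Rightarrow> real measure \<Rightarrow> complex \<Rightarrow> complex" where
  "poisson_R r m z = of_real r * (cauchy_transform m (1 / z) / z - 1) / z"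

definition poisson_H :: "real \<Rightarrow> real measure \<Rightarrow> complex \<Rightarrow> complex" where
  "poisson_H r m F = F + of_real r * F * (F * cauchy_transform m F - 1)"

lemma poisson_H_inverse: "z \<noteq> 0 \<Longrightarrow> poisson_H r m (1 / z) = 1 / z + poisson_R r m z"
  by (simp add: poisson_H_def poisson_R_def)

lemma poisson_H_cnj: "poisson_H r m (cnj F) = cnj (poisson_H r m F)"
  by (simp add: poisson_H_def cauchy_transform_cnj)

lemma poisson_H_holomorphic:
  assumes "borel_prob m"
  shows "poisson_H r m holomorphic_on - \<real>"
  unfolding poisson_H_def by (intro holomorphic_intros cauchy_transform_holomorphic assms)

lemma integrable_bounded_prob:
  fixes f :: "'a::topological_space \<Rightarrow> 'b::{banach, second_countable_topology}"
  assumes "borel_prob M" "f \<in> borel_measurable borel" "\<And>x. norm (f x) \<le> B"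
  shows "integrable M f"
  by (rule finite_measure.integrable_const_bound[OF borel_probD(2)[OF assms(1)]])
     (use assms(3) in \<open>auto simp: measurable_borel_prob[OF assms(1)] assms(2)\<close>)

lemma norm_real_resolvent_le:
  assumes "Im F \<noteq> 0"
  shows "norm (complex_of_real x / (F - complex_of_real x)) \<le> 1 + norm F / \<bar>Im F\<bar>"
proof -
  have "complex_of_real x / (F - complex_of_real x) = F * (1 / (F - complex_of_real x)) - 1"
    using sub_real_nonzero[OF assms, of x] by (simp add: field_simps)
  moreover have "norm (F * (1 / (F - complex_of_real x))) \<le> norm F * (1 / \<bar>Im F\<bar>)"
    unfolding norm_mult by (intro mult_left_mono norm_resolvent_le assms) auto
  ultimately show ?thesis
    using norm_triangle_ineq4[of "F * (1 / (F - complex_of_real x))" 1] by simp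
qed

lemma has_bochner_integral_poisson_H:
  assumes m: "borel_prob m" and F: "Im F \<noteq> 0"
  shows "has_bochner_integral m (\<lambda>x. F * (F * (1 / (F - complex_of_real x)) - 1)) (F * (F * cauchy_transform m F - 1))"
proof -
  have 1: "has_bochner_integral m (\<lambda>x. 1 / (F - complex_of_real x)) (cauchy_transform m F)"
    unfolding cauchy_transform_def by (rule has_bochner_integral_integrable[OF integrable_resolvent[OF m F]])
  have 2: "has_bochner_integral m (\<lambda>x. 1 :: complex) 1"
    using borel_probD(2,5)[OF m] by (simp add: has_bochner_integral_iff finite_measure.integrable_const)
  show ?thesis
    by (rule has_bochner_integral_mult_right[OF has_bochner_integral_diff[OF has_bochner_integral_mult_right[OF 1] 2]])
qed

text \<open>The function F x / (F - x) has divided difference - (x / (F - x)) (x / (F' - x)). The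
  choice F' = \<open>cnj F\<close> will give the imaginary part of H, and general F' will give
  injectivity and Lipschitz continuity.\<close>

lemma poisson_H_diff:
  assumes m: "borel_prob m" and F: "Im F \<noteq> 0" "Im F' \<noteq> 0"
  shows "poisson_H r m F - poisson_H r m F' = (F - F') *
    (1 - of_real r * (\<integral>x. (of_real x / (F - of_real x)) * (of_real x / (F' - of_real x)) \<partial>m))"
proof -
  let ?f = "\<lambda>F x. F * (F * (1 / (F - complex_of_real x)) - 1)"
  have "F * (F * cauchy_transform m F - 1) - F' * (F' * cauchy_transform m F' - 1)
    = (\<integral>x. ?f F x - ?f F' x \<partial>m)"
    using has_bochner_integral_integral_eq[OF has_bochner_integral_diff[OF has_bochner_integral_poisson_H[OF m F(1)] has_bochner_integral_poisson_H[OF m F(2)]]] by simp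
  also have "\<dots> = (\<integral>x. - (F - F') * ((of_real x / (F - of_real x)) * (of_real x / (F' - of_real x))) \<partial>m)"
  proof (rule Bochner_Integration.integral_cong[OF refl])
    fix x
    have "?f F x = complex_of_real x * F / (F - complex_of_real x)" if "Im F \<noteq> 0" for F
      using sub_real_nonzero[OF that, of x] by (simp add: field_simps)
    then have "?f F x - ?f F' x = complex_of_real x * F / (F - complex_of_real x) - complex_of_real x * F' / (F' - complex_of_real x)"
      using F by simp
    also have "\<dots> = - (F - F') * ((of_real x / (F - of_real x)) * (of_real x / (F' - of_real x)))"
      using sub_real_nonzero[OF F(1), of x] sub_real_nonzero[OF F(2), of x]
      by (simp add: divide_simps) (simp add: algebra_simps)
    finally show "?f F x - ?f F' x = \<dots>" .
  qed
  also have "\<dots> = - (F - F') * (\<integral>x. (of_real x / (F - of_real x)) * (of_real x / (F' - of_real x)) \<partial>m)"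
    by (rule integral_mult_right_zero)
  finally have eq: "F * (F * cauchy_transform m F - 1) - F' * (F' * cauchy_transform m F' - 1) = \<dots>" .
  have "poisson_H r m F - poisson_H r m F' = (F - F') + of_real r * (F * (F * cauchy_transform m F - 1) - F' * (F' * cauchy_transform m F' - 1))"
    unfolding poisson_H_def by (simp add: algebra_simps)
  moreover have "(F - F') + R * (- (F - F') * I) = (F - F') * (1 - R * I)" for R I
    by (simp add: algebra_simps)
  ultimately show ?thesis unfolding eq by simp
qed

lemma integrable_real_resolvent_square:
  assumes m: "borel_prob m" and F: "Im F \<noteq> 0"
  shows "integrable m (\<lambda>x. (norm (complex_of_real x / (F - of_real x)))^2)"
proof (rule integrable_bounded_prob[OF m, where B="(1 + norm F / \<bar>Im F\<bar>)^2"])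
  show "norm ((norm (complex_of_real x / (F - of_real x)))^2) \<le> (1 + norm F / \<bar>Im F\<bar>)^2" for x
    using power_mono[OF norm_real_resolvent_le[OF F, of x], of 2] by simp
qed measurable

text \<open>The relative loss of imaginary part under \<open>poisson_H\<close>, as
  \<open>Im_poisson_H\<close> shows; it is below 1 exactly where a nonreal F stays in its half
  plane.\<close>

definition poisson_A :: "real \<Rightarrow> real measure \<Rightarrow> complex \<Rightarrow> real" where
  "poisson_A r m F = r * (\<integral>x. (norm (complex_of_real x / (F - of_real x)))^2 \<partial>m)"

lemma poisson_A_nonneg: "r \<ge> 0 \<Longrightarrow> poisson_A r m F \<ge> 0"
  unfolding poisson_A_def by (intro mult_nonneg_nonneg integral_nonneg_AE) auto

lemma Im_poisson_H:
  assumes m: "borel_prob m" and F: "Im F \<noteq> 0"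
  shows "Im (poisson_H r m F) = Im F * (1 - poisson_A r m F)"
proof -
  have "(of_real x / (F - of_real x)) * (of_real x / (cnj F - of_real x)) = complex_of_real ((norm (complex_of_real x / (F - of_real x)))^2)" for x
  proof -
    have "of_real x / (cnj F - of_real x) = cnj (complex_of_real x / (F - of_real x))" by simp
    then show ?thesis by (simp only: complex_norm_square)
  qed
  then have "poisson_H r m F - cnj (poisson_H r m F) = (F - cnj F) * (1 - of_real (poisson_A r m F))"
    using poisson_H_diff[OF m F, of "cnj F" r] F unfolding poisson_A_def
    by (simp only: poisson_H_cnj integral_complex_of_real of_real_mult complex_cnj) simp
  then have "Im (poisson_H r m F - cnj (poisson_H r m F)) = Im ((F - cnj F) * (1 - of_real (poisson_A r m F)))" by simp
  then show ?thesis by (simp add: algebra_simps)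
qed

text \<open>Both points have \<open>poisson_A\<close> below 1, and 2 a b \<le> a^2 + b^2 bounds the
  mixed integral in \<open>poisson_H_diff\<close>, times the rate, by the mean of the two values.
  The divided difference of H is then 1 minus a number of modulus below 1.\<close>

lemma poisson_H_inj:
  assumes m: "borel_prob m" and r: "r \<ge> 0"
    and F: "Im F * Im (poisson_H r m F) > 0" "Im F' * Im (poisson_H r m F') > 0"
    and eq: "poisson_H r m F = poisson_H r m F'"
  shows "F = F'"
proof (rule ccontr)
  assume ne: "F \<noteq> F'"
  have nr: "Im F \<noteq> 0" "Im F' \<noteq> 0" using F by auto
  have A1: "poisson_A r m G < 1" if "Im G * Im (poisson_H r m G) > 0" for G
  proof (rule ccontr)
    assume "\<not> poisson_A r m G < 1"
    then have "Im G * Im G * (1 - poisson_A r m G) \<le> 0" by (intro mult_nonneg_nonpos) auto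
    moreover have "Im G \<noteq> 0" using that by auto
    ultimately show False using that by (simp add: Im_poisson_H[OF m])
  qed
  let ?p = "\<lambda>F x. complex_of_real x / (F - of_real x)"
  have "norm (\<integral>x. ?p F x * ?p F' x \<partial>m) \<le> (\<integral>x. norm (?p F x * ?p F' x) \<partial>m)" by simp
  also have "\<dots> \<le> (\<integral>x. ((norm (?p F x))^2 + (norm (?p F' x))^2) / 2 \<partial>m)"
  proof (rule Bochner_Integration.integral_mono')
    show "integrable m (\<lambda>x. ((norm (?p F x))^2 + (norm (?p F' x))^2) / 2)"
      using integrable_real_resolvent_square[OF m nr(1)] integrable_real_resolvent_square[OF m nr(2)] by simp
    show "norm (?p F x * ?p F' x) \<le> ((norm (?p F x))^2 + (norm (?p F' x))^2) / 2" for x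
      using sum_squares_bound[of "norm (?p F x)" "norm (?p F' x)"] by (simp only: norm_mult) simp
  qed simp
  also have "\<dots> = ((\<integral>x. (norm (?p F x))^2 \<partial>m) + (\<integral>x. (norm (?p F' x))^2 \<partial>m)) / 2"
    using integrable_real_resolvent_square[OF m nr(1)] integrable_real_resolvent_square[OF m nr(2)] by simp
  finally have "r * norm (\<integral>x. ?p F x * ?p F' x \<partial>m) \<le> r * (((\<integral>x. (norm (?p F x))^2 \<partial>m) + (\<integral>x. (norm (?p F' x))^2 \<partial>m)) / 2)"
    using r by (rule mult_left_mono)
  also have "\<dots> = (poisson_A r m F + poisson_A r m F') / 2"
    unfolding poisson_A_def by (simp add: algebra_simps)
  also have "\<dots> < 1" using A1[OF F(1)] A1[OF F(2)] by simp
  finally have "norm (of_real r * (\<integral>x. ?p F x * ?p F' x \<partial>m)) < 1"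
    using r by (simp add: norm_mult)
  then have "1 - of_real r * (\<integral>x. ?p F x * ?p F' x \<partial>m) \<noteq> 0" by auto
  then show False
    using poisson_H_diff[OF m nr, of r] eq ne by simp
qed

text \<open>The integrand of (H F - F) / r is x (1 + x / (F - x)), so bounded jumps keep H at
  bounded distance from the identity on every region |Im F| \<ge> \<epsilon>.\<close>

lemma poisson_H_bound:
  assumes m: "borel_prob m" and r: "r \<ge> 0" and M: "M \<ge> 0" "AE x in m. \<bar>x\<bar> \<le> M" and F: "Im F \<noteq> 0"
  shows "norm (poisson_H r m F - F) \<le> r * M * (1 + M / \<bar>Im F\<bar>)"
proof -
  note hb = has_bochner_integral_poisson_H[OF m F]
  have "norm (F * (F * cauchy_transform m F - 1)) \<le> (\<integral>x. norm (F * (F * (1 / (F - complex_of_real x)) - 1)) \<partial>m)"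
    unfolding has_bochner_integral_integral_eq[OF hb, symmetric] by (rule integral_norm_bound)
  also have "\<dots> \<le> (\<integral>x. M * (1 + M / \<bar>Im F\<bar>) \<partial>m)"
  proof (rule integral_mono_AE)
    show "integrable m (\<lambda>x. norm (F * (F * (1 / (F - complex_of_real x)) - 1)))"
      using integrable.intros[OF hb] by (rule integrable_norm)
    show "integrable m (\<lambda>x. M * (1 + M / \<bar>Im F\<bar>))"
      using borel_probD(2)[OF m] by (simp add: finite_measure.integrable_const)
    show "AE x in m. norm (F * (F * (1 / (F - complex_of_real x)) - 1)) \<le> M * (1 + M / \<bar>Im F\<bar>)"
      using M(2)
    proof eventually_elim
      case (elim x)
      have "F * (F * (1 / (F - complex_of_real x)) - 1) = of_real x * (1 + of_real x * (1 / (F - of_real x)))"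
        using sub_real_nonzero[OF F, of x] by (simp add: field_simps)
      also have "norm \<dots> \<le> M * (1 + M * (1 / \<bar>Im F\<bar>))"
      proof -
        have "norm (complex_of_real x * (1 / (F - of_real x))) \<le> M * (1 / \<bar>Im F\<bar>)"
          unfolding norm_mult using elim M by (intro mult_mono norm_resolvent_le F) auto
        then have "norm (1 + complex_of_real x * (1 / (F - of_real x))) \<le> 1 + M * (1 / \<bar>Im F\<bar>)"
          using norm_triangle_ineq[of 1 "complex_of_real x * (1 / (F - of_real x))"] by simp
        then show ?thesis
          unfolding norm_mult[of "of_real x"] using elim M by (intro mult_mono) auto
      qed
      finally show ?case by simp
    qed
  qed
  also have "\<dots> = M * (1 + M / \<bar>Im F\<bar>)" using borel_probD(5)[OF m] by simp
  finally have "r * norm (F * (F * cauchy_transform m F - 1)) \<le> r * (M * (1 + M / \<bar>Im F\<bar>))"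
    using r by (rule mult_left_mono)
  moreover have "poisson_H r m F - F = of_real r * (F * (F * cauchy_transform m F - 1))"
    by (simp add: poisson_H_def)
  ultimately show ?thesis using r by (simp only: norm_mult) (simp add: mult.assoc)
qed

text \<open>A preimage of \<zeta> is a fixed point of F -> \<zeta> - (H F - F). The values of this
  map have imaginary part at least Im \<zeta>, because Im (H F) \<le> Im F in the upper half plane,
  and by \<open>poisson_H_bound\<close> they stay within a fixed distance of \<zeta>. Brouwer's
  theorem applies to the resulting compact convex set; the lower half plane follows by
  conjugation.\<close>

lemma poisson_H_surj:
  assumes m: "borel_prob m" and r: "r \<ge> 0" and M: "M \<ge> 0" "AE x in m. \<bar>x\<bar> \<le> M" and \<zeta>: "Im \<zeta> \<noteq> 0"
  shows "\<exists>F. Im F * Im \<zeta> > 0 \<and> poisson_H r m F = \<zeta>"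
proof -
  have upper: "\<exists>F. Im F > 0 \<and> poisson_H r m F = \<zeta>" if \<zeta>: "Im \<zeta> > 0" for \<zeta>
  proof -
    define K where "K = {F. Im F \<ge> Im \<zeta>} \<inter> cball \<zeta> (r * M * (1 + M / Im \<zeta>))"
    have K: "Im F > 0" if "F \<in> K" for F using that \<zeta> by (auto simp: K_def)
    have Knr: "K \<subseteq> - \<real>"
    proof
      fix F assume "F \<in> K"
      from K[OF this] show "F \<in> - \<real>" by (simp add: nonreal_iff)
    qed
    obtain F where "F \<in> K" "\<zeta> - (poisson_H r m F - F) = F"
    proof (rule brouwer[of K "\<lambda>F. \<zeta> - (poisson_H r m F - F)"])
      show "compact K" unfolding K_def
        by (intro closed_Int_compact compact_cball closed_halfspace_Im_ge)
      show "convex K" unfolding K_def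
        by (intro convex_Int convex_cball convex_halfspace_Im_ge)
      show "K \<noteq> {}" using \<zeta> r M by (auto simp: K_def intro!: exI[of _ \<zeta>])
      show "continuous_on K (\<lambda>F. \<zeta> - (poisson_H r m F - F))"
        by (intro continuous_intros continuous_on_subset[OF holomorphic_on_imp_continuous_on[OF poisson_H_holomorphic[OF m]] Knr])
      show "(\<lambda>F. \<zeta> - (poisson_H r m F - F)) \<in> K \<rightarrow> K"
      proof
        fix F assume F: "F \<in> K"
        then have F0: "Im F > 0" "Im F \<ge> Im \<zeta>" using K by (auto simp: K_def)
        have "norm (poisson_H r m F - F) \<le> r * M * (1 + M / \<bar>Im F\<bar>)"
          by (rule poisson_H_bound[OF m r M]) (use F0 in auto)
        also have "\<dots> \<le> r * M * (1 + M / Im \<zeta>)"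
          using F0 \<zeta> r M by (intro mult_left_mono add_left_mono divide_left_mono) auto
        finally have "norm (poisson_H r m F - F) \<le> r * M * (1 + M / Im \<zeta>)" .
        moreover have "Im (poisson_H r m F) \<le> Im F"
          using Im_poisson_H[OF m, of F r] F0 mult_left_mono[of "1 - poisson_A r m F" 1 "Im F"] poisson_A_nonneg[OF r, of m F] by simp
        ultimately show "\<zeta> - (poisson_H r m F - F) \<in> K"
          by (simp add: K_def dist_norm)
      qed
    qed
    then show ?thesis using K by (intro exI[of _ F]) (auto simp: algebra_simps)
  qed
  show ?thesis
  proof (cases "Im \<zeta> > 0")
    case True
    with upper[OF True] show ?thesis by (blast intro: mult_pos_pos)
  next
    case False
    with \<zeta> have n: "Im (cnj \<zeta>) > 0" by simp
    from upper[OF n] obtain F where "Im F > 0" "poisson_H r m F = cnj \<zeta>" by blast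
    then show ?thesis using n
      by (intro exI[of _ "cnj F"]) (auto simp: poisson_H_cnj mult_pos_neg)
  qed
qed

text \<open>Injectivity is known on the open set S where H preserves half planes, and
  \<open>poisson_H_surj\<close> finds a preimage in S for every nonreal point. So the holomorphic
  inverse on the image of S is defined at all nonreal points.\<close>

lemma poisson_H_inverse_exists:
  assumes m: "borel_prob m" and r: "r \<ge> 0" and M: "M \<ge> 0" "AE x in m. \<bar>x\<bar> \<le> M"
  obtains \<Phi> where "\<Phi> holomorphic_on - \<real>"
    "\<And>\<zeta>. Im \<zeta> \<noteq> 0 \<Longrightarrow> Im (\<Phi> \<zeta>) * Im \<zeta> > 0" "\<And>\<zeta>. Im \<zeta> \<noteq> 0 \<Longrightarrow> poisson_H r m (\<Phi> \<zeta>) = \<zeta>"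
    "\<And>F. Im F * Im (poisson_H r m F) > 0 \<Longrightarrow> \<Phi> (poisson_H r m F) = F"
proof -
  define S where "S = {F \<in> - \<real>. Im F * Im (poisson_H r m F) > 0}"
  have hol: "poisson_H r m holomorphic_on S"
    by (rule holomorphic_on_subset[OF poisson_H_holomorphic[OF m]]) (auto simp: S_def)
  have "open S"
  proof -
    have "S = (- \<real>) \<inter> (\<lambda>F. Im F * Im (poisson_H r m F)) -` {0<..}" by (auto simp: S_def)
    moreover have "open \<dots>"
      by (intro continuous_open_preimage open_nonreal open_greaterThan continuous_intros
          holomorphic_on_imp_continuous_on poisson_H_holomorphic m)
    ultimately show ?thesis by simp
  qed
  moreover have "inj_on (poisson_H r m) S"
    by (rule inj_onI) (auto simp: S_def intro: poisson_H_inj[OF m r])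
  ultimately obtain \<Phi> where \<Phi>: "\<Phi> holomorphic_on poisson_H r m ` S" "\<And>z. z \<in> S \<Longrightarrow> \<Phi> (poisson_H r m z) = z"
    using holomorphic_has_inverse[OF hol] by metis
  have S: "\<exists>F\<in>S. poisson_H r m F = \<zeta>" if "Im \<zeta> \<noteq> 0" for \<zeta>
    using poisson_H_surj[OF m r M that] by (force simp: S_def nonreal_iff)
  then have im: "- \<real> \<subseteq> poisson_H r m ` S" by (force simp: nonreal_iff)
  show ?thesis
  proof
    show "\<Phi> holomorphic_on - \<real>" using \<Phi>(1) im by (rule holomorphic_on_subset)
    show "Im (\<Phi> \<zeta>) * Im \<zeta> > 0" "poisson_H r m (\<Phi> \<zeta>) = \<zeta>" if "Im \<zeta> \<noteq> 0" for \<zeta>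
      using S[OF that] \<Phi>(2) by (auto simp: S_def)
    show "\<Phi> (poisson_H r m F) = F" if "Im F * Im (poisson_H r m F) > 0" for F
      by (rule \<Phi>(2)) (use that in \<open>auto simp: S_def nonreal_iff\<close>)
  qed
qed

text \<open>The term \<open>1 - 1 / h\<close> of the bi-free R-transform of a compound Poisson law, in the variables
  \<open>F = 1 / z\<close> and \<open>W = 1 / w\<close>.\<close>

definition joint_E :: "real \<Rightarrow> (real \<times> real) measure \<Rightarrow> complex \<Rightarrow> complex \<Rightarrow> complex" where
  "joint_E r \<mu> F W = of_real r *
     (\<integral>p. (of_real (fst p) / (F - of_real (fst p))) * (of_real (snd p) / (W - of_real (snd p))) \<partial>\<mu>)"

section \<open>Size and positivity of the joint term\<close>

lemma integrable_bounded_prob2: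
  fixes f :: "real \<times> real \<Rightarrow> 'b::{banach, second_countable_topology}"
  assumes "borel_prob \<mu>" "f \<in> borel_measurable \<mu>" "\<And>x. norm (f x) \<le> B"
  shows "integrable \<mu> f"
  by (rule finite_measure.integrable_const_bound[OF borel_probD(2)[OF assms(1)]])
     (rule AE_I2, rule assms(3), rule assms(2))

lemma poisson_A_marginal1:
  assumes "borel_prob \<mu>"
  shows "poisson_A r (marginal1 \<mu>) F = r * (\<integral>p. (norm (complex_of_real (fst p) / (F - of_real (fst p))))^2 \<partial>\<mu>)"
  unfolding poisson_A_def by (subst integral_marginal1[OF assms]) auto

lemma poisson_A_marginal2:
  assumes "borel_prob \<mu>"
  shows "poisson_A r (marginal2 \<mu>) F = r * (\<integral>p. (norm (complex_of_real (snd p) / (F - of_real (snd p))))^2 \<partial>\<mu>)"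
  unfolding poisson_A_def by (subst integral_marginal2[OF assms]) auto

lemma cnj_real_resolvent: "complex_of_real s / (cnj F - of_real s) = cnj (complex_of_real s / (F - of_real s))"
  by simp

lemma poisson_A_cnj: "poisson_A r m (cnj F) = poisson_A r m F"
  unfolding poisson_A_def cnj_real_resolvent complex_mod_cnj ..

text \<open>The product f g in the integrand is dominated by (|f|^2 + |g|^2) / 2, whose two
  integrals are the marginal quantities. Where both are below 1, the factor 1 - E cannot
  vanish.\<close>

lemma norm_joint_E_le:
  assumes \<mu>: "borel_prob \<mu>" and r: "r \<ge> 0" and F: "Im F \<noteq> 0" and W: "Im W \<noteq> 0"
  shows "norm (joint_E r \<mu> F W) \<le> (poisson_A r (marginal1 \<mu>) F + poisson_A r (marginal2 \<mu>) W) / 2"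
proof -
  note [measurable] = measurable_coordinates[OF \<mu>]
  let ?f = "\<lambda>p :: real \<times> real. complex_of_real (fst p) / (F - of_real (fst p))"
  let ?g = "\<lambda>p :: real \<times> real. complex_of_real (snd p) / (W - of_real (snd p))"
  have i1: "integrable \<mu> (\<lambda>p. (norm (?f p))^2)"
  proof (rule integrable_bounded_prob2[OF \<mu>])
    show "norm ((norm (?f p))^2) \<le> (1 + norm F / \<bar>Im F\<bar>)^2" for p
      using power_mono[OF norm_real_resolvent_le[OF F, of "fst p"], of 2] by simp
  qed measurable
  have i2: "integrable \<mu> (\<lambda>p. (norm (?g p))^2)"
  proof (rule integrable_bounded_prob2[OF \<mu>])
    show "norm ((norm (?g p))^2) \<le> (1 + norm W / \<bar>Im W\<bar>)^2" for p
      using power_mono[OF norm_real_resolvent_le[OF W, of "snd p"], of 2] by simp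
  qed measurable
  note i = i1 i2
  have "norm (\<integral>p. ?f p * ?g p \<partial>\<mu>) \<le> (\<integral>p. norm (?f p * ?g p) \<partial>\<mu>)" by (rule integral_norm_bound)
  also have "\<dots> \<le> (\<integral>p. ((norm (?f p))^2 + (norm (?g p))^2) / 2 \<partial>\<mu>)"
  proof (rule Bochner_Integration.integral_mono')
    show "norm (?f p * ?g p) \<le> ((norm (?f p))^2 + (norm (?g p))^2) / 2" for p
      using sum_squares_bound[of "norm (?f p)" "norm (?g p)"] by (simp only: norm_mult) simp
  qed (use i in simp_all)
  also have "\<dots> = ((\<integral>p. (norm (?f p))^2 \<partial>\<mu>) + (\<integral>p. (norm (?g p))^2 \<partial>\<mu>)) / 2"
    using i by simp
  finally have "r * norm (\<integral>p. ?f p * ?g p \<partial>\<mu>) \<le> r * (((\<integral>p. (norm (?f p))^2 \<partial>\<mu>) + (\<integral>p. (norm (?g p))^2 \<partial>\<mu>)) / 2)"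
    using r by (rule mult_left_mono)
  then show ?thesis
    unfolding joint_E_def norm_mult poisson_A_marginal1[OF \<mu>] poisson_A_marginal2[OF \<mu>]
    using r by (simp add: algebra_simps)
qed

text \<open>The inequality is \<open>r * \<integral>|C g + h / a - C f|\<^sup>2 \<ge> 0\<close> in disguise, where \<open>C\<close> is chosen such that
  \<open>Im (C / (W (1 - E)))\<close> is a positive multiple of the difference of the two real parts.\<close>

lemma joint_positivity:
  assumes \<mu>: "borel_prob \<mu>" and r: "r \<ge> 0" and F: "Im F > 0" and W: "Im W > 0"
    and A1: "poisson_A r (marginal1 \<mu>) F < 1" and B1: "poisson_A r (marginal2 \<mu>) W < 1"
  shows "Re (1 / (F * W * (1 - joint_E r \<mu> F W))) \<le> Re (1 / (cnj F * W * (1 - joint_E r \<mu> (cnj F) W)))"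
proof -
  note [measurable] = measurable_coordinates[OF \<mu>]
  define f :: "real \<times> real \<Rightarrow> complex" where "f p = of_real (fst p) / (F - of_real (fst p))" for p
  define g :: "real \<times> real \<Rightarrow> complex" where "g p = of_real (snd p) / (W - of_real (snd p))" for p
  \<comment> \<open>Here 1 + g = W / (W - t). The products h conj f, |h|^2 and g conj h are the ones
    through which the changes under conjugation of F and of W can be expressed.\<close>
  define h where "h p = f p * (1 + g p)" for p
  define Kf where "Kf = 1 + norm F / \<bar>Im F\<bar>"
  define Kg where "Kg = 1 + norm W / \<bar>Im W\<bar>"
  have [measurable]: "f \<in> borel_measurable \<mu>" "g \<in> borel_measurable \<mu>" "h \<in> borel_measurable \<mu>"
    unfolding f_def g_def h_def by measurable
  have [measurable]: "cnj \<in> borel_measurable borel"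
    by (intro borel_measurable_continuous_onI continuous_intros)
  have bf: "norm (f p) \<le> Kf" and bg: "norm (g p) \<le> Kg" for p
    unfolding f_def g_def Kf_def Kg_def by (rule norm_real_resolvent_le; use F W in simp)+
  have K: "Kf \<ge> 0" "Kg \<ge> 0" unfolding Kf_def Kg_def by auto
  have bh: "norm (h p) \<le> Kf * (1 + Kg)" for p
    unfolding h_def norm_mult using norm_triangle_ineq[of 1 "g p"] bg[of p]
    by (intro mult_mono bf K) auto
  have sF: "F - of_real x \<noteq> 0" "cnj F - of_real x \<noteq> 0" and sW: "W - of_real x \<noteq> 0" "cnj W - of_real x \<noteq> 0" for x
    using F W sub_real_nonzero[of F x] sub_real_nonzero[of "cnj F" x] sub_real_nonzero[of W x] sub_real_nonzero[of "cnj W" x] by auto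
  have int_mult: "integrable \<mu> (\<lambda>p. u p * v p)"
    if "u \<in> borel_measurable \<mu>" "v \<in> borel_measurable \<mu>" "\<And>p. norm (u p) \<le> Ku" "\<And>p. norm (v p) \<le> Kv"
    for u v :: "real \<times> real \<Rightarrow> complex" and Ku Kv
  proof (rule integrable_bounded_prob2[OF \<mu>])
    show "(\<lambda>p. u p * v p) \<in> borel_measurable \<mu>" using that by measurable
    show "norm (u p * v p) \<le> Ku * Kv" for p
      unfolding norm_mult by (intro mult_mono that order_trans[OF norm_ge_zero that(3)[of p]]) simp
  qed
  have int_sq: "integrable \<mu> (\<lambda>p. (norm (u p))^2)"
    if "u \<in> borel_measurable \<mu>" "\<And>p. norm (u p) \<le> Ku" for u :: "real \<times> real \<Rightarrow> complex" and Ku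
  proof (rule integrable_bounded_prob2[OF \<mu>])
    show "(\<lambda>p. (norm (u p))^2) \<in> borel_measurable \<mu>" using that by measurable
    show "norm ((norm (u p))^2) \<le> Ku^2" for p
      using power_mono[OF that(2)[of p], of 2] by simp
  qed
  define E where "E = joint_E r \<mu> F W"
  define P where "P = joint_E r \<mu> (cnj F) W"
  define A where "A = poisson_A r (marginal1 \<mu>) F"
  define B where "B = poisson_A r (marginal2 \<mu>) W"
  define T where "T = r * (\<integral>p. (norm (h p))^2 \<partial>\<mu>)"
  define q where "q = of_real r * (\<integral>p. h p * cnj (f p) \<partial>\<mu>)"
  define \<rho> where "\<rho> = of_real r * (\<integral>p. g p * cnj (h p) \<partial>\<mu>)"
  have E_eq: "E = of_real r * (\<integral>p. f p * g p \<partial>\<mu>)"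
    unfolding E_def joint_E_def f_def g_def ..
  have P_eq: "P = of_real r * (\<integral>p. cnj (f p) * g p \<partial>\<mu>)"
    unfolding P_def joint_E_def f_def g_def cnj_real_resolvent ..
  have A_eq: "A = r * (\<integral>p. (norm (f p))^2 \<partial>\<mu>)" and B_eq: "B = r * (\<integral>p. (norm (g p))^2 \<partial>\<mu>)"
    unfolding A_def B_def f_def g_def poisson_A_marginal1[OF \<mu>] poisson_A_marginal2[OF \<mu>] by rule+
  define a where "a = 1 - A"
  have a: "a > 0" using A1 unfolding a_def A_def by simp
  define Z where "Z = cnj F - F"
  have Z: "Z = - 2 * \<i> * of_real (Im F)" unfolding Z_def by (simp add: complex_eq_iff)
  have Z0: "Z \<noteq> 0" using F unfolding Z by simp
  have "norm E < 1"
    using norm_joint_E_le[OF \<mu> r, of F W] F W A1 B1 unfolding E_def by simp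
  then have e0: "1 - E \<noteq> 0" by auto
  have "norm P < 1"
    using norm_joint_E_le[OF \<mu> r, of "cnj F" W] F W A1 B1 unfolding P_def by (simp add: poisson_A_cnj)
  then have p0: "1 - P \<noteq> 0" by auto
  note hbi = has_bochner_integral_integrable
  have hE: "has_bochner_integral \<mu> (\<lambda>p. f p * g p) (\<integral>p. f p * g p \<partial>\<mu>)"
    by (rule hbi, rule int_mult[OF _ _ bf bg]) measurable
  have hP: "has_bochner_integral \<mu> (\<lambda>p. cnj (f p) * g p) (\<integral>p. cnj (f p) * g p \<partial>\<mu>)"
    by (rule hbi, rule int_mult[where Ku=Kf, OF _ _ _ bg]) (measurable, use bf in simp)
  have hq: "has_bochner_integral \<mu> (\<lambda>p. h p * cnj (f p)) (\<integral>p. h p * cnj (f p) \<partial>\<mu>)"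
    by (rule hbi, rule int_mult[where Kv=Kf, OF _ _ bh]) (measurable, use bf in simp)
  have h\<rho>: "has_bochner_integral \<mu> (\<lambda>p. g p * cnj (h p)) (\<integral>p. g p * cnj (h p) \<partial>\<mu>)"
    by (rule hbi, rule int_mult[where Kv="Kf * (1 + Kg)", OF _ _ bg]) (measurable, use bh in simp)
  have hA: "has_bochner_integral \<mu> (\<lambda>p. (norm (f p))^2) (\<integral>p. (norm (f p))^2 \<partial>\<mu>)"
    by (rule hbi, rule int_sq[OF _ bf]) measurable
  have hB: "has_bochner_integral \<mu> (\<lambda>p. (norm (g p))^2) (\<integral>p. (norm (g p))^2 \<partial>\<mu>)"
    by (rule hbi, rule int_sq[OF _ bg]) measurable
  have hT: "has_bochner_integral \<mu> (\<lambda>p. (norm (h p))^2) (\<integral>p. (norm (h p))^2 \<partial>\<mu>)"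
    by (rule hbi, rule int_sq[OF _ bh]) measurable
  note right = has_bochner_integral_mult_right and cc = has_bochner_integral_of_real
  have W_eq: "1 + g p = W / (W - of_real (snd p))" for p
    using sW(1)[of "snd p"] unfolding g_def by (simp add: field_simps)
  \<comment> \<open>The divided difference of F s / (F - s) between F and its conjugate produces
    |f|^2; then |f|^2 g = h conj f - |f|^2.\<close>
  have I1: "F * E - cnj F * P = Z * (q - of_real A)"
  proof -
    have "(\<integral>p. F * (f p * g p) - cnj F * (cnj (f p) * g p) \<partial>\<mu>)
        = (\<integral>p. Z * (h p * cnj (f p) - of_real ((norm (f p))^2)) \<partial>\<mu>)"
    proof (rule Bochner_Integration.integral_cong[OF refl])
      fix p :: "real \<times> real"
      have "F * f p - cnj F * cnj (f p) = Z * (f p * cnj (f p))"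
        using sF[of "fst p"] unfolding f_def Z_def by (simp add: divide_simps) (simp add: algebra_simps)
      moreover have "F * (f p * g p) - cnj F * (cnj (f p) * g p) = (F * f p - cnj F * cnj (f p)) * g p"
        by (simp add: algebra_simps)
      ultimately have "F * (f p * g p) - cnj F * (cnj (f p) * g p) = Z * (f p * cnj (f p)) * g p"
        by simp
      also have "\<dots> = Z * (h p * cnj (f p) - of_real ((norm (f p))^2))"
        unfolding h_def complex_norm_square by (simp add: algebra_simps)
      finally show "F * (f p * g p) - cnj F * (cnj (f p) * g p) = \<dots>" .
    qed
    then have "F * (\<integral>p. f p * g p \<partial>\<mu>) - cnj F * (\<integral>p. cnj (f p) * g p \<partial>\<mu>)
      = Z * ((\<integral>p. h p * cnj (f p) \<partial>\<mu>) - of_real (\<integral>p. (norm (f p))^2 \<partial>\<mu>))"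
      using has_bochner_integral_integral_eq[OF has_bochner_integral_diff[OF right[OF hE, of F] right[OF hP, of "cnj F"]]]
        has_bochner_integral_integral_eq[OF right[OF has_bochner_integral_diff[OF hq cc[OF hA]], of Z]]
      by argo
    then have "of_real r * (F * (\<integral>p. f p * g p \<partial>\<mu>) - cnj F * (\<integral>p. cnj (f p) * g p \<partial>\<mu>))
      = of_real r * (Z * ((\<integral>p. h p * cnj (f p) \<partial>\<mu>) - of_real (\<integral>p. (norm (f p))^2 \<partial>\<mu>)))" by simp
    then show ?thesis unfolding E_eq P_eq q_def A_eq by (simp add: algebra_simps)
  qed
  \<comment> \<open>W = (1 + g) (W - t) turns conj (1 + g) W into |1 + g|^2 (W - t), and the real
    number t does not contribute to the imaginary part.\<close>
  have I2: "Im W * T = Im (W * cnj q)"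
  proof -
    have "(\<integral>p. Im W * (norm (h p))^2 \<partial>\<mu>) = (\<integral>p. Im (W * cnj (h p * cnj (f p))) \<partial>\<mu>)"
    proof (rule Bochner_Integration.integral_cong[OF refl])
      fix p :: "real \<times> real"
      have "W * cnj (h p * cnj (f p)) = cnj (1 + g p) * W * (f p * cnj (f p))"
        unfolding h_def by (simp add: algebra_simps)
      also have "\<dots> = of_real ((norm (f p))^2) * (cnj (1 + g p) * W)"
        unfolding complex_norm_square by simp
      also have "cnj (1 + g p) * W = (1 + g p) * cnj (1 + g p) * (W - of_real (snd p))"
        unfolding W_eq using sW by simp
      also have "\<dots> = of_real ((norm (1 + g p))^2) * (W - of_real (snd p))"
        by (simp only: complex_norm_square)
      finally have "Im (W * cnj (h p * cnj (f p))) = (norm (f p))^2 * ((norm (1 + g p))^2 * Im W)"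
        by (simp add: mult.assoc)
      then show "Im W * (norm (h p))^2 = Im (W * cnj (h p * cnj (f p)))"
        unfolding h_def norm_mult by (simp add: power_mult_distrib)
    qed
    then have "Im W * (\<integral>p. (norm (h p))^2 \<partial>\<mu>) = Im (W * cnj (\<integral>p. h p * cnj (f p) \<partial>\<mu>))"
      using has_bochner_integral_integral_eq[OF right[OF hT, of "Im W"]]
       has_bochner_integral_integral_eq[OF has_bochner_integral_Im[OF right[OF has_bochner_integral_cnj[OF hq], of W]]] by argo
    then have "r * (Im W * (\<integral>p. (norm (h p))^2 \<partial>\<mu>)) = r * Im (W * cnj (\<integral>p. h p * cnj (f p) \<partial>\<mu>))" by simp
    then show ?thesis unfolding T_def q_def by (simp add: algebra_simps)
  qed
  \<comment> \<open>The analogue in the second variable: W (conj g - g) = (W - conj W) conj g (1 +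
    g).\<close>
  have I3: "W * (cnj P - E) = 2 * \<i> * of_real (Im W) * cnj \<rho>"
  proof -
    have "(\<integral>p. W * (cnj (cnj (f p) * g p) - f p * g p) \<partial>\<mu>) = (\<integral>p. (2 * \<i> * of_real (Im W)) * cnj (g p * cnj (h p)) \<partial>\<mu>)"
    proof (rule Bochner_Integration.integral_cong[OF refl])
      fix p :: "real \<times> real"
      have "W * (cnj (g p) - g p) = (W - cnj W) * cnj (g p) * (1 + g p)"
        unfolding W_eq using sW[of "snd p"] unfolding g_def by (simp add: divide_simps) (simp add: algebra_simps)
      moreover have "W - cnj W = 2 * \<i> * of_real (Im W)" by (simp add: complex_eq_iff)
      moreover have "W * (cnj (cnj (f p) * g p) - f p * g p) = (W * (cnj (g p) - g p)) * f p"
        by (simp add: algebra_simps)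
      ultimately show "W * (cnj (cnj (f p) * g p) - f p * g p) = (2 * \<i> * of_real (Im W)) * cnj (g p * cnj (h p))"
        unfolding h_def by (simp only: complex_cnj_mult complex_cnj_cnj mult_ac)
    qed
    then have "W * (cnj (\<integral>p. cnj (f p) * g p \<partial>\<mu>) - (\<integral>p. f p * g p \<partial>\<mu>)) = (2 * \<i> * of_real (Im W)) * cnj (\<integral>p. g p * cnj (h p) \<partial>\<mu>)"
      using has_bochner_integral_integral_eq[OF right[OF has_bochner_integral_diff[OF has_bochner_integral_cnj[OF hP] hE], of W]]
       has_bochner_integral_integral_eq[OF right[OF has_bochner_integral_cnj[OF h\<rho>], of "2 * \<i> * of_real (Im W)"]] by argo
    then have "of_real r * (W * (cnj (\<integral>p. cnj (f p) * g p \<partial>\<mu>) - (\<integral>p. f p * g p \<partial>\<mu>))) = of_real r * ((2 * \<i> * of_real (Im W)) * cnj (\<integral>p. g p * cnj (h p) \<partial>\<mu>))" by simp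
    then show ?thesis unfolding E_eq P_eq \<rho>_def by (simp add: algebra_simps)
  qed
  \<comment> \<open>The numerator is the one that appears when 1 / (F W (1 - E)) - 1 / (conj F W (1
    - P)) is put over a common denominator. By \<open>I1\<close> the normalisation gives (1 - P) C =
    1 + q / a.\<close>
  define C where "C = (cnj F * (1 - P) - F * (1 - E)) / ((1 - P) * of_real a * Z)"
  have C1: "(1 - P) * C = 1 + q / of_real a"
  proof -
    have "cnj F * (1 - P) - F * (1 - E) = Z + (F * E - cnj F * P)" unfolding Z_def by (simp add: algebra_simps)
    also have "\<dots> = Z * (of_real a + q)" unfolding I1 a_def by (simp add: algebra_simps)
    finally have "C = Z * (of_real a + q) / ((1 - P) * of_real a * Z)" unfolding C_def by simp
    then show ?thesis using p0 Z0 a by (simp add: add_divide_distrib distrib_left)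
  qed
  have ineq: "1 + T / a + 2 * Re (C * \<rho>) \<ge> 0"
  proof -
    let ?u = "\<lambda>p. (norm C)^2 * (norm (g p))^2 + (norm (h p))^2 / a^2 + (norm C)^2 * (norm (f p))^2
      + 2 / a * Re (C * (g p * cnj (h p))) - 2 * (norm C)^2 * Re (cnj (f p) * g p) - 2 / a * Re (cnj C * (h p * cnj (f p)))"
    have sq: "(norm (C * g p + h p / of_real a - C * f p))^2 = ?u p" for p
      unfolding cmod_power2 using a by (simp add: field_simps power2_eq_square)
    have hb: "has_bochner_integral \<mu> ?u
      ((norm C)^2 * (\<integral>p. (norm (g p))^2 \<partial>\<mu>) + (\<integral>p. (norm (h p))^2 \<partial>\<mu>) / a^2 + (norm C)^2 * (\<integral>p. (norm (f p))^2 \<partial>\<mu>)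
      + 2 / a * Re (C * (\<integral>p. g p * cnj (h p) \<partial>\<mu>)) - 2 * (norm C)^2 * Re (\<integral>p. cnj (f p) * g p \<partial>\<mu>) - 2 / a * Re (cnj C * (\<integral>p. h p * cnj (f p) \<partial>\<mu>)))"
      by (intro has_bochner_integral_add has_bochner_integral_diff right has_bochner_integral_divide_zero has_bochner_integral_Re hA hB hT hP hq h\<rho>)
    have "0 \<le> (\<integral>p. (norm (C * g p + h p / of_real a - C * f p))^2 \<partial>\<mu>)" by simp
    also have "\<dots> = ((norm C)^2 * (\<integral>p. (norm (g p))^2 \<partial>\<mu>) + (\<integral>p. (norm (h p))^2 \<partial>\<mu>) / a^2 + (norm C)^2 * (\<integral>p. (norm (f p))^2 \<partial>\<mu>)
      + 2 / a * Re (C * (\<integral>p. g p * cnj (h p) \<partial>\<mu>)) - 2 * (norm C)^2 * Re (\<integral>p. cnj (f p) * g p \<partial>\<mu>) - 2 / a * Re (cnj C * (\<integral>p. h p * cnj (f p) \<partial>\<mu>)))"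
      unfolding sq using has_bochner_integral_integral_eq[OF hb] .
    finally have "0 \<le> r * \<dots>" using r by simp
    also have "\<dots> = (norm C)^2 * B + T / a^2 + (norm C)^2 * A + 2 / a * Re (C * \<rho>) - 2 * (norm C)^2 * Re P - 2 / a * Re (cnj C * q)"
      unfolding B_eq T_def A_eq \<rho>_def P_eq q_def by (simp add: algebra_simps)
    finally have 1: "0 \<le> (norm C)^2 * B + T / a^2 + (norm C)^2 * A + 2 / a * Re (C * \<rho>) - 2 * (norm C)^2 * Re P - 2 / a * Re (cnj C * q)" .
    \<comment> \<open>Eliminating q through the relation for C cancels the terms with Re P, so that
      only |C|^2 and Re C survive beside T, B and \<rho>.\<close>
    have qa: "q = of_real a * ((1 - P) * C - 1)"
      using C1 a by (simp add: field_simps)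
    have "cnj C * q = of_real a * ((1 - P) * (C * cnj C) - cnj C)"
      unfolding qa by (simp add: algebra_simps)
    also have "\<dots> = of_real a * ((1 - P) * of_real ((norm C)^2) - cnj C)"
      by (simp only: complex_norm_square)
    finally have 2: "Re (cnj C * q) = a * ((norm C)^2 * (1 - Re P) - Re C)" by simp
    have "0 \<le> (norm C)^2 * B + T / a^2 + (norm C)^2 * (1 - a) + 2 / a * Re (C * \<rho>) - 2 * (norm C)^2 + 2 * Re C"
    proof -
      have "2 / a * Re (cnj C * q) = 2 * ((norm C)^2 * (1 - Re P) - Re C)" using 2 a by simp
      moreover have "A = 1 - a" unfolding a_def by simp
      ultimately show ?thesis using 1 by (simp only:) (simp add: algebra_simps)
    qed
    then have "0 \<le> a * ((norm C)^2 * B + T / a^2 + (norm C)^2 * (1 - a) + 2 / a * Re (C * \<rho>) - 2 * (norm C)^2 + 2 * Re C)"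
      using a by simp
    also have "\<dots> = T / a + 2 * Re (C * \<rho>) + 2 * a * Re C - a * (norm C)^2 * (1 - B) - a^2 * (norm C)^2"
      using a by (simp add: field_simps power2_eq_square)
    finally have 3: "0 \<le> \<dots>" .
    \<comment> \<open>The linear term in C is absorbed together with a^2 |C|^2 and leaves the
      constant 1. The remaining term a |C|^2 (1 - B) has the favourable sign because B < 1.\<close>
    have 4: "2 * a * Re C \<le> 1 + a^2 * (norm C)^2"
    proof -
      have "2 * a * Re C \<le> 2 * 1 * (a * norm C)"
        using complex_Re_le_cmod[of C] a by simp
      also have "\<dots> \<le> 1^2 + (a * norm C)^2" by (rule sum_squares_bound)
      finally show ?thesis by (simp add: power_mult_distrib)
    qed
    have "0 \<le> a * (norm C)^2 * (1 - B)"
      using a B1 unfolding B_def by simp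
    with 3 4 show ?thesis by linarith
  qed
  have pos: "Im (W * (1 - E) * cnj C) \<ge> 0"
  proof -
    have "W * (1 - E) * cnj C = W * cnj ((1 - P) * C) + W * (cnj P - E) * cnj C"
      by (simp add: algebra_simps)
    also have "\<dots> = W + W * cnj q / of_real a + 2 * \<i> * of_real (Im W) * cnj (C * \<rho>)"
      unfolding C1 I3 by (simp add: algebra_simps)
    finally have "Im (W * (1 - E) * cnj C) = Im W + Im (W * cnj q) / a + 2 * Im W * Re (C * \<rho>)"
      by (simp add: Im_divide_of_real)
    also have "\<dots> = Im W * (1 + T / a + 2 * Re (C * \<rho>))"
      unfolding I2[symmetric] by (simp add: algebra_simps)
    finally show ?thesis using ineq W by simp
  qed
  have "Im (C / Y) = - Im (Y * cnj C) / (norm Y)^2" for Y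
    by (simp add: Im_divide cmod_power2 algebra_simps)
  then have le: "Im (C / (W * (1 - E))) \<le> 0"
    using pos by (simp only: divide_nonpos_nonneg zero_le_power2 neg_le_0_iff_le)
  have F0: "F \<noteq> 0" "W \<noteq> 0" using F W by auto
  define X where "X = 1 / (F * W * (1 - E)) - 1 / (cnj F * W * (1 - P))"
  have "(G * e' - F * e) / (e' * b * Z) / (W * e) = F * G * (1 / (F * W * e) - 1 / (G * W * e')) / (b * Z)"
    if "F \<noteq> 0" "G \<noteq> 0" "W \<noteq> 0" "e \<noteq> 0" "e' \<noteq> 0" "b \<noteq> 0" "Z \<noteq> 0" for F G W e e' b Z :: complex
    using that by (simp add: field_simps)
  from this[of F "cnj F" W "1 - E" "1 - P" "of_real a" Z]
  have "C / (W * (1 - E)) = F * cnj F * X / (of_real a * Z)"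
    unfolding C_def X_def using F0 e0 p0 Z0 a by simp
  \<comment> \<open>Since Z = - 2 i Im F, the quotient is i times a positive multiple of X, and the
    sign of its imaginary part is the sign of Re X.\<close>
  also have "\<dots> = \<i> * (of_real ((norm F)^2 / (2 * a * Im F)) * X)"
    unfolding Z complex_norm_square[symmetric] using a F by (simp add: field_simps)
  finally have "Im (C / (W * (1 - E))) = (norm F)^2 / (2 * a * Im F) * Re X"
    by (simp only: Im_i_times times_complex.sel Re_complex_of_real Im_complex_of_real) simp
  with le have "(norm F)^2 / (2 * a * Im F) * Re X \<le> 0" by simp
  moreover have "(norm F)^2 / (2 * a * Im F) > 0" using F0 a F by simp
  ultimately have "Re X \<le> 0"
    by (meson mult_pos_pos not_le)
  then show ?thesis unfolding E_def P_def X_def by simp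
qed

section \<open>Stieltjes inversion in two variables\<close>

lemma integrable_inverse_one_plus_square: "integrable lborel (\<lambda>x::real. C / (1 + x^2))"
proof -
  have "integrable lborel (\<lambda>x::real. inverse (1 + x^2))"
    using integrable_inverse_1_plus_square by (simp add: set_integrable_def)
  then have "integrable lborel (\<lambda>x::real. C * inverse (1 + x^2))" by (rule integrable_mult_right)
  then show ?thesis by (simp add: divide_inverse)
qed

lemma integral_inverse_one_plus_square: "(\<integral>x. 1 / (1 + (x::real)^2) \<partial>lborel) = pi"
  using LBINT_inverse_1_plus_square
  by (simp add: interval_lebesgue_integral_def set_lebesgue_integral_def inverse_eq_divide)

text \<open>Closing the segment [-R, R] by the upper semicircle costs at most a multiple of R / (1 +
  R^2), which vanishes in the limit. The finite exceptional set K allows an integrand with a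
  removable singularity.\<close>

lemma integral_upper_half_plane_eq_0:
  fixes f :: "complex \<Rightarrow> complex"
  assumes cont: "continuous_on {z. Im z \<ge> 0} f" and K: "finite K"
    and diff: "\<And>z. Im z > 0 \<Longrightarrow> z \<notin> K \<Longrightarrow> f field_differentiable (at z)"
    and bound: "\<And>z. Im z \<ge> 0 \<Longrightarrow> norm (f z) \<le> C / (1 + (norm z)^2)"
  shows "integrable lborel (\<lambda>x. f (of_real x))" "(\<integral>x. f (of_real x) \<partial>lborel) = 0"
proof -
  have [measurable]: "(\<lambda>x. f (of_real x)) \<in> borel_measurable borel"
    by (intro borel_measurable_continuous_onI continuous_on_compose2[OF cont] continuous_intros) auto
  have C: "C \<ge> 0" using order_trans[OF norm_ge_zero bound[of 0]] by simp
  have b': "norm (f (of_real x)) \<le> C / (1 + x^2)" for x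
    using bound[of "of_real x"] by simp
  show i: "integrable lborel (\<lambda>x. f (of_real x))"
    by (rule Bochner_Integration.integrable_bound[OF integrable_inverse_one_plus_square[of C]])
       (use b' C in \<open>auto simp: order_trans[OF b' abs_ge_self]\<close>)
  define R :: "nat \<Rightarrow> real" where "R n = real n + 1" for n
  have R: "R n > 0" for n by (simp add: R_def)
  define I where "I n = (\<integral>x. indicator {- R n..R n} x *\<^sub>R f (of_real x) \<partial>lborel)" for n
  have Ib: "norm (I n) \<le> C * pi * (1 / R n)" for n
  proof -
    let ?l = "linepath (of_real (- R n)) (complex_of_real (R n))"
    let ?c = "part_circlepath 0 (R n) 0 pi"
    have pl: "path_image ?l \<subseteq> {z. Im z \<ge> 0}"
      by (auto simp: path_image_linepath closed_segment_def)
    have pc: "path_image ?c \<subseteq> {z. Im z \<ge> 0}"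
      using R[of n] by (auto simp: path_image_part_circlepath' image_def closed_segment_eq_real_ivl cis.simps intro!: mult_nonneg_nonneg sin_ge_zero)
    have h: "(f has_contour_integral 0) (?l +++ ?c)"
    proof (rule Cauchy_theorem_convex[OF cont _ K])
      show "convex {z. Im z \<ge> 0}" using convex_halfspace_Im_ge[of 0] by simp
      show "f field_differentiable at x" if "x \<in> interior {z. Im z \<ge> 0} - K" for x
        by (rule diff) (use that interior_halfspace_ge[of \<i> 0] in \<open>auto simp: inner_complex_def\<close>)
      show "valid_path (?l +++ ?c)"
        by (intro valid_path_join valid_path_linepath valid_path_part_circlepath) simp
      show "path_image (?l +++ ?c) \<subseteq> {z. Im z \<ge> 0}"
        by (rule subset_path_image_join[OF pl pc])
      show "pathfinish (?l +++ ?c) = pathstart (?l +++ ?c)" by simp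
    qed
    have il: "f contour_integrable_on ?l" and ic: "f contour_integrable_on ?c"
      using contour_integrable_continuous_linepath continuous_on_subset[OF cont pl[unfolded path_image_linepath]]
       contour_integrable_continuous_part_circlepath[OF continuous_on_subset[OF cont pc]] by blast+
    have "contour_integral ?l f + contour_integral ?c f = 0"
      using contour_integral_unique[OF h] contour_integral_join[OF il ic] by simp
    then have "norm (contour_integral ?l f) = norm (contour_integral ?c f)"
      by (metis add.inverse_unique norm_minus_cancel)
    also have "\<dots> \<le> C / (1 + (R n)^2) * R n * \<bar>pi - 0\<bar>"
    proof (rule contour_integral_bound_part_circlepath[OF ic])
      show "norm (f x) \<le> C / (1 + (R n)^2)" if x: "x \<in> path_image ?c" for x
      proof -
        have "norm x = R n" using in_path_image_part_circlepath[OF x] R[of n] by simp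
        then show ?thesis using bound[of x] pc x by auto
      qed
    qed (use C R[of n] in auto)
    also have "\<dots> = C * pi * (R n / (1 + (R n)^2))" by simp
    also have "\<dots> \<le> C * pi * (1 / R n)"
    proof (intro mult_left_mono)
      have "1 + (R n)^2 > 0" by (rule add_pos_nonneg) auto
      then show "R n / (1 + (R n)^2) \<le> 1 / R n"
        using R[of n] by (simp add: divide_simps power2_eq_square)
    qed (use C in auto)
    finally have "norm (contour_integral ?l f) \<le> C * pi * (1 / R n)" .
    moreover have "contour_integral ?l f = I n"
    proof -
      have "contour_integral ?l f = integral {- R n..R n} (\<lambda>x. f (of_real x))"
        using contour_integral_linepath_Reals_eq[of "of_real (- R n)" "complex_of_real (R n)" f] R[of n] by simp
      also have "\<dots> = (\<integral>x\<in>{- R n..R n}. f (of_real x) \<partial>lborel)"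
        by (rule set_borel_integral_eq_integral(2)[symmetric])
           (use i in \<open>auto simp: set_integrable_def intro!: integrable_mult_indicator\<close>)
      finally show ?thesis by (simp add: I_def set_lebesgue_integral_def)
    qed
    ultimately show ?thesis by simp
  qed
  have Rinf: "filterlim R at_top sequentially"
    unfolding R_def by real_asymp
  have "(\<lambda>n. C * pi * (1 / R n)) \<longlonglongrightarrow> 0"
    by (rule tendsto_mult_right_zero, rule tendsto_divide_0[OF tendsto_const])
       (rule filterlim_at_top_imp_at_infinity[OF Rinf])
  then have "I \<longlonglongrightarrow> 0"
    by (rule Lim_null_comparison[rotated]) (use Ib in auto)
  moreover have "I \<longlonglongrightarrow> (\<integral>x. f (of_real x) \<partial>lborel)"
    unfolding I_def
  proof (rule integral_dominated_convergence[where w="\<lambda>x. norm (f (of_real x))"])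
    show "integrable lborel (\<lambda>x. norm (f (of_real x)))" using i by simp
    show "AE x in lborel. (\<lambda>n. indicator {- R n..R n} x *\<^sub>R f (complex_of_real x)) \<longlonglongrightarrow> f (complex_of_real x)"
    proof (rule AE_I2)
      fix x :: real
      have "\<forall>\<^sub>F n in sequentially. R n \<ge> \<bar>x\<bar>"
        using Rinf unfolding filterlim_at_top by blast
      then have "\<forall>\<^sub>F n in sequentially. indicator {- R n..R n} x *\<^sub>R f (complex_of_real x) = f (complex_of_real x)"
        by eventually_elim (auto simp: indicator_def)
      then show "(\<lambda>n. indicator {- R n..R n} x *\<^sub>R f (complex_of_real x)) \<longlonglongrightarrow> f (complex_of_real x)"
        by (rule tendsto_eventually)
    qed
    show "AE x in lborel. norm (indicator {- R n..R n} x *\<^sub>R f (complex_of_real x)) \<le> norm (f (complex_of_real x))" for n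
      by (auto simp: indicator_def)
  qed measurable
  ultimately show "(\<integral>x. f (of_real x) \<partial>lborel) = 0"
    using LIMSEQ_unique by blast
qed


text \<open>A lower bound on the distance to the pole becomes decay in 1 + |z|, the form in which
  decay is tracked in the estimates below.\<close>

lemma one_plus_norm_le:
  assumes "norm (z - \<zeta>) \<ge> d" "d > 0"
  shows "1 / norm (z - \<zeta>) \<le> ((1 + norm \<zeta>) / d + 1) / (1 + norm z)"
proof -
  have "1 + norm z \<le> 1 + norm \<zeta> + norm (z - \<zeta>)"
    using norm_triangle_ineq[of \<zeta> "z - \<zeta>"] by simp
  also have "\<dots> \<le> (1 + norm \<zeta>) * (norm (z - \<zeta>) / d) + norm (z - \<zeta>)"
    using mult_left_mono[of 1 "norm (z - \<zeta>) / d" "1 + norm \<zeta>"] assms by (simp add: le_divide_eq)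
  also have "\<dots> = ((1 + norm \<zeta>) / d + 1) * norm (z - \<zeta>)"
    by (simp add: algebra_simps add_divide_distrib)
  finally show ?thesis
    using assms norm_ge_zero[of z] by (simp add: divide_le_eq le_divide_eq add_pos_nonneg mult.commute)
qed

lemma one_plus_norm_square: "(1::real) + (norm z)^2 \<le> (1 + norm z)^2"
  by (simp add: power2_eq_square algebra_simps)

text \<open>The pole lies in the lower half plane, so the integrand is holomorphic above, and the
  extra factor raises the decay 1 / |z| of g to the order 1 / |z|^2 that the contour argument
  needs.\<close>

lemma cauchy_integral_lower:
  fixes g :: "complex \<Rightarrow> complex"
  assumes cont: "continuous_on {z. Im z \<ge> 0} g"
    and diff: "\<And>z. Im z > 0 \<Longrightarrow> g field_differentiable (at z)"
    and bound: "\<And>z. Im z \<ge> 0 \<Longrightarrow> norm (g z) \<le> C / (1 + norm z)" and \<zeta>: "Im \<zeta> < 0"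
  shows "integrable lborel (\<lambda>x. g (of_real x) / (\<zeta> - of_real x))"
    "(\<integral>x. g (of_real x) / (\<zeta> - of_real x) \<partial>lborel) = 0"
proof -
  have C: "C \<ge> 0" using order_trans[OF norm_ge_zero bound[of 0]] by simp
  have ne: "\<zeta> - z \<noteq> 0" if "Im z \<ge> 0" for z using \<zeta> that by auto
  define K where "K = (1 + norm \<zeta>) / \<bar>Im \<zeta>\<bar> + 1"
  have K: "K \<ge> 0" unfolding K_def by auto
  have b: "norm (g z / (\<zeta> - z)) \<le> C * K / (1 + (norm z)^2)" if z: "Im z \<ge> 0" for z
  proof -
    have "\<bar>Im \<zeta>\<bar> \<le> norm (z - \<zeta>)"
      using abs_Im_le_cmod[of "z - \<zeta>"] \<zeta> z by simp
    from one_plus_norm_le[OF this] have "1 / norm (\<zeta> - z) \<le> K / (1 + norm z)"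
      using \<zeta> by (simp add: K_def norm_minus_commute)
    then have "norm (g z) * (1 / norm (\<zeta> - z)) \<le> C / (1 + norm z) * (K / (1 + norm z))"
      by (intro mult_mono bound z) (use C in \<open>auto intro!: divide_nonneg_nonneg add_nonneg_nonneg\<close>)
    also have "\<dots> = C * K / (1 + norm z)^2" by (simp add: power2_eq_square)
    also have "\<dots> \<le> C * K / (1 + (norm z)^2)"
      using C K by (intro divide_left_mono one_plus_norm_square mult_nonneg_nonneg mult_pos_pos add_pos_nonneg zero_less_power) auto
    finally show ?thesis by (simp add: norm_divide)
  qed
  have c: "continuous_on {z. Im z \<ge> 0} (\<lambda>z. g z / (\<zeta> - z))"
    by (intro continuous_intros cont) (use ne in auto)
  have d: "(\<lambda>z. g z / (\<zeta> - z)) field_differentiable (at z)" if "Im z > 0" for z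
    by (intro field_differentiable_divide field_differentiable_diff diff that
         field_differentiable_const field_differentiable_ident) (use ne[of z] that in simp)
  show "integrable lborel (\<lambda>x. g (of_real x) / (\<zeta> - of_real x))"
    "(\<integral>x. g (of_real x) / (\<zeta> - of_real x) \<partial>lborel) = 0"
    using integral_upper_half_plane_eq_0[OF c, of "{}" "C * K"] d b by auto
qed

text \<open>The pole at \<zeta> is split off with the kernel
  \<open>k z = (\<zeta> - cnj \<zeta>) / (z - cnj \<zeta>)\<close>, which is 1 at \<zeta>, decays at
  infinity and has its own pole in the lower half plane. The quotient of g - g(\<zeta>) k by \<zeta>
  - z has a removable singularity and integrates to 0. What remains on the real line is a multiple
  of the Poisson kernel of \<zeta>, whose integral is explicit.\<close>

lemma cauchy_integral_upper:
  fixes g :: "complex \<Rightarrow> complex"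
  assumes cont: "continuous_on {z. Im z \<ge> 0} g"
    and diff: "\<And>z. Im z > 0 \<Longrightarrow> g field_differentiable (at z)"
    and bound: "\<And>z. Im z \<ge> 0 \<Longrightarrow> norm (g z) \<le> C / (1 + norm z)" and \<zeta>: "Im \<zeta> > 0"
  shows "integrable lborel (\<lambda>x. g (of_real x) / (\<zeta> - of_real x))"
    "(\<integral>x. g (of_real x) / (\<zeta> - of_real x) \<partial>lborel) = - 2 * pi * \<i> * g \<zeta>"
proof -
  have C: "C \<ge> 0" using order_trans[OF norm_ge_zero bound[of 0]] by simp
  define \<eta> where "\<eta> = Im \<zeta>"
  have \<eta>: "\<eta> > 0" using \<zeta> by (simp add: \<eta>_def)
  define k where "k z = (\<zeta> - cnj \<zeta>) / (z - cnj \<zeta>)" for z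
  have nec: "z - cnj \<zeta> \<noteq> 0" if "Im z \<ge> 0" for z using \<zeta> that by (auto simp: complex_eq_iff)
  define N where "N z = g z - g \<zeta> * k z" for z
  have Ncont: "continuous_on {z. Im z \<ge> 0} N"
    unfolding N_def k_def by (intro continuous_intros cont) (use nec in auto)
  have Ndiff: "N field_differentiable (at z)" if "Im z > 0" for z
    unfolding N_def k_def
    by (intro field_differentiable_divide field_differentiable_diff field_differentiable_mult diff that
         field_differentiable_const field_differentiable_ident) (use nec[of z] that in simp)
  have N\<zeta>: "N \<zeta> = 0" using nec[of \<zeta>] \<zeta> by (simp add: N_def k_def)
  define d where "d = deriv N \<zeta>"
  have Nd: "((\<lambda>z. (N z - N \<zeta>) / (z - \<zeta>)) \<longlongrightarrow> d) (at \<zeta>)"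
    using field_differentiable_derivI[OF Ndiff[OF \<zeta>]] unfolding d_def has_field_derivative_iff .
  \<comment> \<open>The value - d is the limit at \<zeta>, since N vanishes there and N z / (\<zeta>
    - z) is the negative of the difference quotient.\<close>
  define f where "f z = (if z = \<zeta> then - d else N z / (\<zeta> - z))" for z
  have fcont: "continuous_on {z. Im z \<ge> 0} f"
  proof (rule continuous_on_eq_continuous_within[THEN iffD2], rule ballI)
    fix z assume z: "z \<in> {z. Im z \<ge> 0}"
    show "continuous (at z within {z. Im z \<ge> 0}) f"
    proof (cases "z = \<zeta>")
      case True
      have "((\<lambda>z. - ((N z - N \<zeta>) / (z - \<zeta>))) \<longlongrightarrow> - d) (at \<zeta>)"
        by (intro tendsto_minus Nd)
      then have "(f \<longlongrightarrow> - d) (at \<zeta>)"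
        by (rule Lim_transform_eventually)
           (auto simp: eventually_at f_def N\<zeta> minus_divide_right intro!: exI[of _ 1])
      then have "isCont f \<zeta>" by (simp add: isCont_def f_def)
      then show ?thesis using True continuous_at_imp_continuous_at_within by blast
    next
      case False
      have "continuous (at z within {z. Im z \<ge> 0}) (\<lambda>z. N z / (\<zeta> - z))"
        using Ncont z False by (intro continuous_intros) (auto simp: continuous_on_eq_continuous_within)
      then show ?thesis
        by (rule continuous_transform_within[where \<delta>="dist z \<zeta>"])
           (use False z in \<open>auto simp: f_def dist_commute\<close>)
    qed
  qed
  have fdiff: "f field_differentiable (at z)" if "Im z > 0" "z \<notin> {\<zeta>}" for z
  proof -
    have "(\<lambda>z. N z / (\<zeta> - z)) field_differentiable (at z)"
      by (intro field_differentiable_divide field_differentiable_diff Ndiff that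
         field_differentiable_const field_differentiable_ident) (use that in auto)
    then show ?thesis
      by (rule field_differentiable_transform_within[where d="dist z \<zeta>", rotated 3])
         (use that in \<open>auto simp: f_def dist_commute\<close>)
  qed
  define K where "K = (1 + norm (cnj \<zeta>)) / \<eta> + 1"
  have K: "K \<ge> 0" unfolding K_def using \<eta> by auto
  have kb: "norm (k z) \<le> 2 * \<eta> * K / (1 + norm z)" if z: "Im z \<ge> 0" for z
  proof -
    have "\<eta> \<le> norm (z - cnj \<zeta>)"
      using abs_Im_le_cmod[of "z - cnj \<zeta>"] \<zeta> z by (simp add: \<eta>_def)
    from one_plus_norm_le[OF this \<eta>] have "1 / norm (z - cnj \<zeta>) \<le> K / (1 + norm z)"
      by (simp add: K_def)
    then have "2 * \<eta> * (1 / norm (z - cnj \<zeta>)) \<le> 2 * \<eta> * (K / (1 + norm z))"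
      using \<eta> by (intro mult_left_mono) auto
    moreover have "\<zeta> - cnj \<zeta> = 2 * \<i> * of_real \<eta>" by (simp add: \<eta>_def complex_eq_iff)
    ultimately show ?thesis using \<eta> by (simp add: k_def norm_divide norm_mult)
  qed
  define D where "D = C + norm (g \<zeta>) * (2 * \<eta> * K)"
  have D: "D \<ge> 0" unfolding D_def using C K \<eta> by auto
  have Nb: "norm (N z) \<le> D / (1 + norm z)" if z: "Im z \<ge> 0" for z
  proof -
    have "norm (N z) \<le> norm (g z) + norm (g \<zeta>) * norm (k z)"
      unfolding N_def norm_mult[symmetric] by (rule norm_triangle_ineq4)
    also have "\<dots> \<le> C / (1 + norm z) + norm (g \<zeta>) * (2 * \<eta> * K / (1 + norm z))"
      by (intro add_mono mult_left_mono bound kb z) auto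
    finally show ?thesis by (simp add: D_def add_divide_distrib)
  qed
  define L where "L = (1 + norm \<zeta>) / \<eta> + 1"
  have L: "L \<ge> 0" unfolding L_def using \<eta> by auto
  \<comment> \<open>Close to \<zeta> the quotient is controlled by continuity alone; the disc of
    radius \<eta> = Im \<zeta> stays in the closed upper half plane.\<close>
  have "compact ((\<lambda>z. norm (f z) * (1 + (norm z)^2)) ` cball \<zeta> \<eta>)"
  proof (intro compact_continuous_image compact_cball continuous_intros continuous_on_subset[OF fcont] subsetI)
    fix z assume "z \<in> cball \<zeta> \<eta>"
    then have "\<bar>Im (\<zeta> - z)\<bar> \<le> \<eta>" using abs_Im_le_cmod[of "\<zeta> - z"] by (simp add: dist_norm)
    then show "z \<in> {z. Im z \<ge> 0}" by (simp add: \<eta>_def)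
  qed
  then obtain B where B: "\<And>z. z \<in> cball \<zeta> \<eta> \<Longrightarrow> norm (f z) * (1 + (norm z)^2) \<le> B"
    using compact_imp_bounded bounded_imp_bdd_above by (fastforce simp: bdd_above_def)
  have fb: "norm (f z) \<le> max B (D * L) / (1 + (norm z)^2)" if z: "Im z \<ge> 0" for z
  proof (cases "z \<in> cball \<zeta> \<eta>")
    case True
    have "norm (f z) \<le> B / (1 + (norm z)^2)"
      using B[OF True] by (simp add: le_divide_eq add_pos_nonneg)
    also have "\<dots> \<le> max B (D * L) / (1 + (norm z)^2)"
      by (intro divide_right_mono) auto
    finally show ?thesis .
  next
    case False
    then have n: "\<eta> \<le> norm (z - \<zeta>)" by (simp add: dist_norm norm_minus_commute)
    from one_plus_norm_le[OF this \<eta>] have "1 / norm (\<zeta> - z) \<le> L / (1 + norm z)"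
      by (simp add: L_def norm_minus_commute)
    then have "norm (N z) * (1 / norm (\<zeta> - z)) \<le> D / (1 + norm z) * (L / (1 + norm z))"
      by (intro mult_mono Nb z) (use D in \<open>auto intro!: divide_nonneg_nonneg add_nonneg_nonneg\<close>)
    also have "\<dots> = D * L / (1 + norm z)^2" by (simp add: power2_eq_square)
    also have "\<dots> \<le> D * L / (1 + (norm z)^2)"
      using D L by (intro divide_left_mono one_plus_norm_square mult_nonneg_nonneg mult_pos_pos add_pos_nonneg zero_less_power) auto
    also have "\<dots> \<le> max B (D * L) / (1 + (norm z)^2)"
      by (intro divide_right_mono) auto
    finally show ?thesis using n \<eta> by (auto simp: norm_divide f_def)
  qed
  have f: "integrable lborel (\<lambda>x. f (of_real x))" "(\<integral>x. f (of_real x) \<partial>lborel) = 0"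
    using integral_upper_half_plane_eq_0[OF fcont, of "{\<zeta>}", OF _ fdiff fb] by auto
  define u where "u x = 1 / (1 + ((x - Re \<zeta>) / \<eta>)^2)" for x
  have ui: "integrable lborel u" and uI: "(\<integral>x. u x \<partial>lborel) = \<eta> * pi"
  proof -
    have eq: "u x = 1 / (1 + ((- Re \<zeta> / \<eta>) + (1 / \<eta>) * x)^2)" for x
      by (simp add: u_def diff_divide_distrib)
    show "integrable lborel u"
      unfolding eq using lborel_integrable_real_affine_iff[of "1 / \<eta>" "\<lambda>x. 1 / (1 + x^2)" "- Re \<zeta> / \<eta>"] \<eta>
        integrable_inverse_one_plus_square[of 1] by simp
    have "(\<integral>x. 1 / (1 + x^2) \<partial>lborel) = \<bar>1 / \<eta>\<bar> *\<^sub>R (\<integral>x. u x \<partial>lborel)"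
      unfolding eq using lborel_integral_real_affine[of "1 / \<eta>" "\<lambda>x. 1 / (1 + x^2)" "- Re \<zeta> / \<eta>"] \<eta> by simp
    then show "(\<integral>x. u x \<partial>lborel) = \<eta> * pi"
      unfolding integral_inverse_one_plus_square using \<eta> by (simp add: field_simps)
  qed
  have eq: "g (of_real x) / (\<zeta> - of_real x) = f (of_real x) + g \<zeta> * (- 2 * \<i> / of_real \<eta>) * of_real (u x)" for x
  proof -
    have n1: "\<zeta> - of_real x \<noteq> 0" "of_real x - cnj \<zeta> \<noteq> 0" using \<zeta> nec[of "of_real x"] sub_real_nonzero[of \<zeta> x] by auto
    have "(\<zeta> - of_real x) * (of_real x - cnj \<zeta>) = - of_real ((x - Re \<zeta>)^2 + \<eta>^2)"
      by (simp add: complex_eq_iff \<eta>_def power2_eq_square algebra_simps)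
    also have "(x - Re \<zeta>)^2 + \<eta>^2 = \<eta>^2 / u x"
      using \<eta> unfolding u_def by (simp add: field_simps)
    finally have p: "(\<zeta> - of_real x) * (of_real x - cnj \<zeta>) = - of_real (\<eta>^2 / u x)" .
    have "\<zeta> - cnj \<zeta> = 2 * \<i> * of_real \<eta>" by (simp add: \<eta>_def complex_eq_iff)
    then have "k (of_real x) / (\<zeta> - of_real x) = 2 * \<i> * of_real \<eta> / ((\<zeta> - of_real x) * (of_real x - cnj \<zeta>))"
      by (simp add: k_def mult.commute)
    also have "\<dots> = (- 2 * \<i> / of_real \<eta>) * of_real (u x)"
      unfolding p using \<eta> by (simp add: field_simps power2_eq_square)
    finally have k: "k (of_real x) / (\<zeta> - of_real x) = (- 2 * \<i> / of_real \<eta>) * of_real (u x)" .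
    have "f (of_real x) = N (of_real x) / (\<zeta> - of_real x)" using n1 by (auto simp: f_def)
    also have "\<dots> = g (of_real x) / (\<zeta> - of_real x) - g \<zeta> * (k (of_real x) / (\<zeta> - of_real x))"
      by (simp add: N_def diff_divide_distrib)
    finally show ?thesis unfolding k by simp
  qed
  have i2: "integrable lborel (\<lambda>x. g \<zeta> * (- 2 * \<i> / of_real \<eta>) * of_real (u x))"
    using ui by (intro integrable_mult_right integrable_of_real)
  show "integrable lborel (\<lambda>x. g (of_real x) / (\<zeta> - of_real x))"
    unfolding eq by (intro Bochner_Integration.integrable_add f i2)
  show "(\<integral>x. g (of_real x) / (\<zeta> - of_real x) \<partial>lborel) = - 2 * pi * \<i> * g \<zeta>"
    unfolding eq Bochner_Integration.integral_add[OF f(1) i2] f(2) integral_mult_right_zero integral_complex_of_real uI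
    using \<eta> by (simp add: field_simps)
qed

definition shift :: "real \<Rightarrow> complex \<Rightarrow> complex" where
  "shift \<epsilon> z = z + of_real (sgn (Im z) * \<epsilon>) * \<i>"

lemma Im_shift: "Im (shift \<epsilon> z) = Im z + sgn (Im z) * \<epsilon>" and Re_shift: "Re (shift \<epsilon> z) = Re z"
  by (simp_all add: shift_def)

lemma abs_Im_shift: "\<epsilon> > 0 \<Longrightarrow> Im z \<noteq> 0 \<Longrightarrow> \<bar>Im (shift \<epsilon> z)\<bar> = \<bar>Im z\<bar> + \<epsilon>"
  by (auto simp: Im_shift sgn_if)

text \<open>The trace from below is carried to the upper half plane by the reflection z -> - z. For
  Im \<zeta> > 0 only the trace from above contributes, for Im \<zeta> < 0 only the one from below,
  and both cases give the value of g at \<zeta> shifted away from the axis.\<close>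

lemma cauchy_integral_jump:
  fixes g :: "complex \<Rightarrow> complex"
  assumes hol: "g holomorphic_on - \<real>" and \<epsilon>: "\<epsilon> > 0"
    and bound: "\<And>z. \<bar>Im z\<bar> \<ge> \<epsilon> \<Longrightarrow> norm (g z) \<le> C / (1 + norm z)" and \<zeta>: "Im \<zeta> \<noteq> 0"
  shows "integrable lborel (\<lambda>x. (g (of_real x + \<i> * of_real \<epsilon>) - g (of_real x - \<i> * of_real \<epsilon>)) / (\<zeta> - of_real x))"
    "(\<integral>x. (g (of_real x + \<i> * of_real \<epsilon>) - g (of_real x - \<i> * of_real \<epsilon>)) / (\<zeta> - of_real x) \<partial>lborel)
      = - 2 * pi * \<i> * g (shift \<epsilon> \<zeta>)"
proof -
  have gd: "g field_differentiable at z" if "Im z \<noteq> 0" for z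
    by (rule holomorphic_on_imp_differentiable_at[OF hol open_nonreal]) (use that in \<open>simp add: nonreal_iff\<close>)
  have C: "C \<ge> 0" using order_trans[OF norm_ge_zero bound[of "\<i> * of_real \<epsilon>"]] \<epsilon> by (simp add: zero_le_divide_iff norm_mult)
  define g1 where "g1 z = g (z + \<i> * of_real \<epsilon>)" for z
  define g2 where "g2 z = g (- z - \<i> * of_real \<epsilon>)" for z
  have d1: "g1 field_differentiable (at z)" if "Im z \<ge> 0" for z
    unfolding g1_def using \<epsilon> that
    by (intro field_differentiable_compose[of "\<lambda>z. z + \<i> * of_real \<epsilon>" z g, unfolded comp_def]
      field_differentiable_add field_differentiable_ident field_differentiable_const gd) auto
  have d2: "g2 field_differentiable (at z)" if "Im z \<ge> 0" for z
    unfolding g2_def using \<epsilon> that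
    by (intro field_differentiable_compose[of "\<lambda>z. - z - \<i> * of_real \<epsilon>" z g, unfolded comp_def]
      field_differentiable_diff field_differentiable_minus field_differentiable_ident field_differentiable_const gd) auto
  have c1: "continuous_on {z. Im z \<ge> 0} g1" and c2: "continuous_on {z. Im z \<ge> 0} g2"
    using d1 d2 by (auto intro!: continuous_at_imp_continuous_on field_differentiable_imp_continuous_at)
  have n: "C / (1 + norm w) \<le> C * (1 + \<epsilon>) / (1 + norm z)" if "norm z \<le> norm w + \<epsilon>" for z w :: complex
  proof -
    have "1 + norm z \<le> (1 + \<epsilon>) * (1 + norm w)"
      using that mult_nonneg_nonneg[OF less_imp_le[OF \<epsilon>] norm_ge_zero[of w]] by (simp add: algebra_simps)
    then have "C * (1 + norm z) \<le> C * ((1 + \<epsilon>) * (1 + norm w))" using C by (rule mult_left_mono)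
    then show ?thesis by (simp add: field_simps add_pos_nonneg)
  qed
  have b1: "norm (g1 z) \<le> C * (1 + \<epsilon>) / (1 + norm z)" if "Im z \<ge> 0" for z
    unfolding g1_def using \<epsilon> that norm_triangle_ineq4[of "z + \<i> * of_real \<epsilon>" "\<i> * of_real \<epsilon>"]
    by (intro order_trans[OF bound n]) (auto simp: norm_mult)
  have b2: "norm (g2 z) \<le> C * (1 + \<epsilon>) / (1 + norm z)" if "Im z \<ge> 0" for z
    unfolding g2_def using \<epsilon> that norm_triangle_ineq[of "- z - \<i> * of_real \<epsilon>" "\<i> * of_real \<epsilon>"]
    by (intro order_trans[OF bound n]) (auto simp: norm_mult)
  have refl: "integrable lborel (\<lambda>x. g (of_real x - \<i> * of_real \<epsilon>) / (\<zeta> - of_real x))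
      \<longleftrightarrow> integrable lborel (\<lambda>x. g2 (of_real x) / (- \<zeta> - of_real x))"
    "(\<integral>x. g (of_real x - \<i> * of_real \<epsilon>) / (\<zeta> - of_real x) \<partial>lborel) = - (\<integral>x. g2 (of_real x) / (- \<zeta> - of_real x) \<partial>lborel)"
  proof -
    define f where "f x = g (of_real x - \<i> * of_real \<epsilon>) / (\<zeta> - of_real x)" for x
    have eq: "f (0 + (-1) * x) = - (g2 (of_real x) / (- \<zeta> - of_real x))" for x
      unfolding f_def g2_def minus_divide_right by simp
    show "integrable lborel (\<lambda>x. g (of_real x - \<i> * of_real \<epsilon>) / (\<zeta> - of_real x))
      \<longleftrightarrow> integrable lborel (\<lambda>x. g2 (of_real x) / (- \<zeta> - of_real x))"
      unfolding f_def[symmetric] using lborel_integrable_real_affine_iff[of "-1" f 0] unfolding eq by simp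
    show "(\<integral>x. g (of_real x - \<i> * of_real \<epsilon>) / (\<zeta> - of_real x) \<partial>lborel) = - (\<integral>x. g2 (of_real x) / (- \<zeta> - of_real x) \<partial>lborel)"
      unfolding f_def[symmetric] using lborel_integral_real_affine[of "-1" f 0] unfolding eq by simp
  qed
  note u1 = cauchy_integral_upper[OF c1 d1[OF less_imp_le] b1] and l1 = cauchy_integral_lower[OF c1 d1[OF less_imp_le] b1]
  note u2 = cauchy_integral_upper[OF c2 d2[OF less_imp_le] b2] and l2 = cauchy_integral_lower[OF c2 d2[OF less_imp_le] b2]
  have i: "integrable lborel (\<lambda>x. g1 (of_real x) / (\<zeta> - of_real x))"
     "integrable lborel (\<lambda>x. g (of_real x - \<i> * of_real \<epsilon>) / (\<zeta> - of_real x))"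
    using u1(1)[of \<zeta>] l1(1)[of \<zeta>] u2(1)[of "- \<zeta>"] l2(1)[of "- \<zeta>"] \<zeta> unfolding refl by (cases "Im \<zeta> > 0"; simp)+
  have I: "(\<integral>x. g1 (of_real x) / (\<zeta> - of_real x) \<partial>lborel) - (\<integral>x. g (of_real x - \<i> * of_real \<epsilon>) / (\<zeta> - of_real x) \<partial>lborel)
    = - 2 * pi * \<i> * g (shift \<epsilon> \<zeta>)"
  proof (cases "Im \<zeta> > 0")
    case True
    then show ?thesis
      using u1(2)[of \<zeta>] l2(2)[of "- \<zeta>"] unfolding refl by (simp add: g1_def shift_def mult.commute)
  next
    case False
    then show ?thesis
      using l1(2)[of \<zeta>] u2(2)[of "- \<zeta>"] \<zeta> unfolding refl by (simp add: g2_def shift_def mult.commute)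
  qed
  show "integrable lborel (\<lambda>x. (g (of_real x + \<i> * of_real \<epsilon>) - g (of_real x - \<i> * of_real \<epsilon>)) / (\<zeta> - of_real x))"
    unfolding diff_divide_distrib using i unfolding g1_def by (rule Bochner_Integration.integrable_diff)
  show "(\<integral>x. (g (of_real x + \<i> * of_real \<epsilon>) - g (of_real x - \<i> * of_real \<epsilon>)) / (\<zeta> - of_real x) \<partial>lborel)
      = - 2 * pi * \<i> * g (shift \<epsilon> \<zeta>)"
    unfolding diff_divide_distrib I[symmetric] using i unfolding g1_def by (rule Bochner_Integration.integral_diff)
qed

section \<open>Laws from jumps across the real plane\<close>

lemma integrable_lborel_product:
  fixes f :: "real \<times> real \<Rightarrow> 'b::{banach, second_countable_topology}"
  assumes f: "f \<in> borel_measurable borel" and b: "\<And>x y. norm (f (x, y)) \<le> C / ((1 + x^2) * (1 + y^2))"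
  shows "integrable (lborel \<Otimes>\<^sub>M lborel) f"
proof -
  have C: "C \<ge> 0" using order_trans[OF norm_ge_zero b[of 0 0]] by simp
  have [measurable]: "f \<in> borel_measurable (lborel \<Otimes>\<^sub>M lborel)"
    using f by (simp add: lborel_prod)
  have i1: "integrable lborel (\<lambda>y::real. C / (1 + x^2) * (1 / (1 + y^2)))" for x :: real
    by (rule integrable_mult_right[OF integrable_inverse_one_plus_square])
  have b': "norm (f (x, y)) \<le> C / (1 + x^2) * (1 / (1 + y^2))" for x y
    using b[of x y] by simp
  have i2: "integrable lborel (\<lambda>y. f (x, y))" for x
    by (rule Bochner_Integration.integrable_bound[OF i1[of x]])
       (measurable, use order_trans[OF b' abs_ge_self] in simp)
  show ?thesis
  proof (rule lborel_pair.Fubini_integrable)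
    show "integrable lborel (\<lambda>x. \<integral>y. norm (f (x, y)) \<partial>lborel)"
    proof (rule Bochner_Integration.integrable_bound[OF integrable_inverse_one_plus_square[of "C * pi"]])
      show "AE x in lborel. norm (\<integral>y. norm (f (x, y)) \<partial>lborel) \<le> norm (C * pi / (1 + x^2))"
      proof (rule AE_I2)
        fix x :: real
        have "(\<integral>y. norm (f (x, y)) \<partial>lborel) \<le> (\<integral>y. C / (1 + x^2) * (1 / (1 + y^2)) \<partial>lborel)"
          by (intro integral_mono i1 integrable_norm i2 b')
        also have "\<dots> = C * pi / (1 + x^2)"
          unfolding integral_mult_right_zero integral_inverse_one_plus_square by simp
        finally show "norm (\<integral>y. norm (f (x, y)) \<partial>lborel) \<le> norm (C * pi / (1 + x^2))"
          by (simp add: abs_of_nonneg[OF integral_nonneg_AE] order_trans[OF _ abs_ge_self] del: abs_divide)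
      qed
    qed measurable
    show "AE x in lborel. integrable lborel (\<lambda>y. f (x, y))" using i2 by simp
  qed measurable
qed

lemma norm_resolvent_one_plus_le:
  assumes "Im \<zeta> \<noteq> 0"
  shows "norm (1 / (\<zeta> - complex_of_real x)) \<le> ((1 + norm \<zeta>) / \<bar>Im \<zeta>\<bar> + 1) / (1 + \<bar>x\<bar>)"
  using one_plus_norm_le[of "\<bar>Im \<zeta>\<bar>" "of_real x" \<zeta>] abs_Im_le_norm_sub_real[of \<zeta> x] assms
  by (simp add: norm_divide norm_minus_commute)

lemma divide_one_plus_le:
  fixes C a b :: real
  assumes "C \<ge> 0" "a \<ge> 0" "b \<ge> 0"
  shows "C / ((1 + a) * (1 + b)) \<le> C / (1 + b)"
proof (rule divide_left_mono)
  show "1 + b \<le> (1 + a) * (1 + b)" using mult_right_mono[of 1 "1 + a" "1 + b"] assms by simp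
  show "0 < (1 + a) * (1 + b) * (1 + b)" using assms by (intro mult_pos_pos) auto
qed (rule assms)

lemma divide_one_plus_mono:
  fixes C a b :: real
  assumes "C \<ge> 0" "0 \<le> a" "0 \<le> b" "a \<le> a'" "b \<le> b'"
  shows "C / ((1 + a') * (1 + b')) \<le> C / ((1 + a) * (1 + b))"
proof (rule divide_left_mono)
  show "(1 + a) * (1 + b) \<le> (1 + a') * (1 + b')" using assms by (intro mult_mono) auto
  show "0 < (1 + a') * (1 + b') * ((1 + a) * (1 + b))" using assms by (intro mult_pos_pos) auto
qed (rule assms)

lemma abs_le_norm_real_plus: "\<bar>x\<bar> \<le> norm (complex_of_real x + \<i> * of_real y)" "\<bar>x\<bar> \<le> norm (complex_of_real x - \<i> * of_real y)"
  using abs_Re_le_cmod[of "complex_of_real x + \<i> * of_real y"] abs_Re_le_cmod[of "complex_of_real x - \<i> * of_real y"] by auto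


text \<open>Assumption \<open>pos\<close> says that the jump of \<open>G\<close> across the real plane is a nonnegative density, and
  \<open>lim1\<close>, \<open>lim2\<close> normalise its total mass to 1.\<close>

locale bivariate_nevanlinna =
  fixes G :: "complex \<Rightarrow> complex \<Rightarrow> complex"
  assumes hol1: "\<And>w. Im w \<noteq> 0 \<Longrightarrow> (\<lambda>z. G z w) holomorphic_on - \<real>"
    and hol2: "\<And>z. Im z \<noteq> 0 \<Longrightarrow> G z holomorphic_on - \<real>"
    and cont: "continuous_on ((- \<real>) \<times> (- \<real>)) (\<lambda>(z, w). G z w)"
    and bound: "\<And>\<epsilon>. \<epsilon> > 0 \<Longrightarrow> \<exists>C\<ge>0. \<forall>z w. \<bar>Im z\<bar> \<ge> \<epsilon> \<longrightarrow> \<bar>Im w\<bar> \<ge> \<epsilon> \<longrightarrow> norm (G z w) \<le> C / ((1 + norm z) * (1 + norm w))"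
    and G_cnj: "\<And>z w. G (cnj z) (cnj w) = cnj (G z w)"
    and pos: "\<And>z w. Im z > 0 \<Longrightarrow> Im w > 0 \<Longrightarrow> Re (G z w) \<le> Re (G (cnj z) w)"
    and lim1: "((\<lambda>t. of_real (t^2) * G (\<i> * of_real t) (\<i> * of_real t)) \<longlongrightarrow> - 1) at_top"
    and lim2: "((\<lambda>t. of_real (t^2) * G (- (\<i>) * of_real t) (\<i> * of_real t)) \<longlongrightarrow> 1) at_top"
begin

definition jump :: "real \<Rightarrow> real \<times> real \<Rightarrow> complex" where
  "jump \<epsilon> p = (G (of_real (fst p) + \<i> * of_real \<epsilon>) (of_real (snd p) + \<i> * of_real \<epsilon>)
             - G (of_real (fst p) - \<i> * of_real \<epsilon>) (of_real (snd p) + \<i> * of_real \<epsilon>))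
            - (G (of_real (fst p) + \<i> * of_real \<epsilon>) (of_real (snd p) - \<i> * of_real \<epsilon>)
             - G (of_real (fst p) - \<i> * of_real \<epsilon>) (of_real (snd p) - \<i> * of_real \<epsilon>))"

definition dens :: "real \<Rightarrow> real \<times> real \<Rightarrow> real" where
  "dens \<epsilon> p = (Re (G (of_real (fst p) - \<i> * of_real \<epsilon>) (of_real (snd p) + \<i> * of_real \<epsilon>))
             - Re (G (of_real (fst p) + \<i> * of_real \<epsilon>) (of_real (snd p) + \<i> * of_real \<epsilon>))) / (2 * pi^2)"

text \<open>The symmetry \<open>G_cnj\<close> pairs the four corner values into twice two real
  parts. The normalisation - 4 pi^2 = (- 2 pi i)^2 is the product of the constants from the two
  Cauchy integrals.\<close>

lemma jump_eq_dens: "jump \<epsilon> p = - 4 * of_real (pi^2) * of_real (dens \<epsilon> p)"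
proof -
  let ?z = "complex_of_real (fst p) + \<i> * of_real \<epsilon>" and ?w = "complex_of_real (snd p) + \<i> * of_real \<epsilon>"
  have c: "complex_of_real x - \<i> * of_real \<epsilon> = cnj (complex_of_real x + \<i> * of_real \<epsilon>)" for x by simp
  have 1: "G ?z (cnj ?w) = cnj (G (cnj ?z) ?w)" using G_cnj[of "cnj ?z" ?w] by simp
  have "jump \<epsilon> p = (G ?z ?w + cnj (G ?z ?w)) - (G (cnj ?z) ?w + cnj (G (cnj ?z) ?w))"
    unfolding jump_def c 1 G_cnj by simp
  also have "\<dots> = - 4 * of_real (pi^2) * of_real (dens \<epsilon> p)"
    unfolding complex_add_cnj dens_def c by (simp add: field_simps)
  finally show ?thesis .
qed

lemma dens_nonneg: "\<epsilon> > 0 \<Longrightarrow> dens \<epsilon> p \<ge> 0"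
  using pos[of "of_real (fst p) + \<i> * of_real \<epsilon>" "of_real (snd p) + \<i> * of_real \<epsilon>"]
  by (simp add: dens_def)

lemma jump_continuous:
  assumes "\<epsilon> > 0"
  shows "continuous_on UNIV (jump \<epsilon>)"
proof -
  have "continuous_on UNIV (\<lambda>p. (\<lambda>(z, w). G z w) (f p, g p))"
    if "continuous_on UNIV f" "continuous_on UNIV g" "\<And>p. Im (f p) \<noteq> 0" "\<And>p. Im (g p) \<noteq> 0"
    for f g :: "real \<times> real \<Rightarrow> complex"
    by (rule continuous_on_compose2[OF cont])
       (use that in \<open>auto intro!: continuous_intros simp: complex_is_Real_iff\<close>)
  note * = this[unfolded case_prod_conv]
  show ?thesis
    unfolding jump_def using assms by (intro continuous_intros *) auto
qed

lemma jump_bound: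
  assumes "\<epsilon> > 0"
  obtains C where "C \<ge> 0" "\<And>x y. norm (jump \<epsilon> (x, y)) \<le> C / ((1 + \<bar>x\<bar>) * (1 + \<bar>y\<bar>))"
proof -
  obtain C where C: "C \<ge> 0" "\<And>z w. \<bar>Im z\<bar> \<ge> \<epsilon> \<Longrightarrow> \<bar>Im w\<bar> \<ge> \<epsilon> \<Longrightarrow> norm (G z w) \<le> C / ((1 + norm z) * (1 + norm w))"
    using bound[OF assms] by blast
  have b: "norm (G z w) \<le> C / ((1 + \<bar>x\<bar>) * (1 + \<bar>y\<bar>))"
    if "z = of_real x + \<i> * of_real \<epsilon> \<or> z = of_real x - \<i> * of_real \<epsilon>" "w = of_real y + \<i> * of_real \<epsilon> \<or> w = of_real y - \<i> * of_real \<epsilon>"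
    for z w x y
  proof -
    have "norm (G z w) \<le> C / ((1 + norm z) * (1 + norm w))" using that assms by (intro C) auto
    also have "\<dots> \<le> C / ((1 + \<bar>x\<bar>) * (1 + \<bar>y\<bar>))"
      using that abs_le_norm_real_plus[of x \<epsilon>] abs_le_norm_real_plus[of y \<epsilon>]
      by (intro divide_one_plus_mono C(1)) auto
    finally show ?thesis .
  qed
  show ?thesis
  proof
    show "norm (jump \<epsilon> (x, y)) \<le> 4 * C / ((1 + \<bar>x\<bar>) * (1 + \<bar>y\<bar>))" for x y
    proof -
      have "norm (jump \<epsilon> (x, y)) \<le> (C / ((1 + \<bar>x\<bar>) * (1 + \<bar>y\<bar>)) + C / ((1 + \<bar>x\<bar>) * (1 + \<bar>y\<bar>))) + (C / ((1 + \<bar>x\<bar>) * (1 + \<bar>y\<bar>)) + C / ((1 + \<bar>x\<bar>) * (1 + \<bar>y\<bar>)))"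
        unfolding jump_def by (intro order_trans[OF norm_triangle_ineq4] add_mono b) auto
      then show ?thesis by simp
    qed
  qed (use C in simp)
qed

text \<open>By Fubini the inner integral over x and the outer one over y are both instances of
  \<open>cauchy_integral_jump\<close>, each with the other variable held fixed. The decay of G in
  both variables gives absolute integrability.\<close>

lemma integral_jump:
  assumes \<epsilon>: "\<epsilon> > 0" and \<zeta>: "Im \<zeta> \<noteq> 0" and \<omega>: "Im \<omega> \<noteq> 0"
  shows "integrable lborel (\<lambda>p. jump \<epsilon> p / (\<omega> - of_real (snd p)) / (\<zeta> - of_real (fst p)))"
    "(\<integral>p. jump \<epsilon> p / (\<omega> - of_real (snd p)) / (\<zeta> - of_real (fst p)) \<partial>lborel)
      = - 4 * of_real (pi^2) * G (shift \<epsilon> \<zeta>) (shift \<epsilon> \<omega>)"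
proof -
  note [measurable] = measurable_fst_real measurable_snd_real borel_measurable_continuous_onI[OF jump_continuous[OF \<epsilon>]]
  let ?f = "\<lambda>p. jump \<epsilon> p / (\<omega> - of_real (snd p)) / (\<zeta> - of_real (fst p))"
  have fm: "?f \<in> borel_measurable borel" by measurable
  obtain C where C: "C \<ge> 0" "\<And>x y. norm (jump \<epsilon> (x, y)) \<le> C / ((1 + \<bar>x\<bar>) * (1 + \<bar>y\<bar>))"
    using jump_bound[OF \<epsilon>] by metis
  define K1 where "K1 = (1 + norm \<zeta>) / \<bar>Im \<zeta>\<bar> + 1"
  define K2 where "K2 = (1 + norm \<omega>) / \<bar>Im \<omega>\<bar> + 1"
  have K: "K1 \<ge> 0" "K2 \<ge> 0" unfolding K1_def K2_def by auto
  have i: "integrable (lborel \<Otimes>\<^sub>M lborel) ?f"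
  proof (rule integrable_lborel_product[OF fm])
    fix x y :: real
    have "norm (?f (x, y)) = norm (jump \<epsilon> (x, y)) * norm (1 / (\<omega> - of_real y)) * norm (1 / (\<zeta> - of_real x))"
      by (simp add: norm_divide norm_mult)
    also have "\<dots> \<le> C / ((1 + \<bar>x\<bar>) * (1 + \<bar>y\<bar>)) * (K2 / (1 + \<bar>y\<bar>)) * (K1 / (1 + \<bar>x\<bar>))"
      unfolding K1_def K2_def
      by (intro mult_mono C norm_resolvent_one_plus_le \<zeta> \<omega> mult_nonneg_nonneg divide_nonneg_nonneg add_nonneg_nonneg) auto
    also have "\<dots> = C * K1 * K2 / ((1 + \<bar>x\<bar>)^2 * (1 + \<bar>y\<bar>)^2)"
      by (simp add: power2_eq_square mult_ac)
    also have "\<dots> \<le> C * K1 * K2 / ((1 + x^2) * (1 + y^2))"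
    proof (rule divide_left_mono)
      show "(1 + x^2) * (1 + y^2) \<le> (1 + \<bar>x\<bar>)^2 * (1 + \<bar>y\<bar>)^2"
        using one_plus_norm_square[of x] one_plus_norm_square[of y] by (intro mult_mono) auto
      show "0 \<le> C * K1 * K2" using C K by simp
      show "0 < (1 + \<bar>x\<bar>)^2 * (1 + \<bar>y\<bar>)^2 * ((1 + x^2) * (1 + y^2))"
        by (intro mult_pos_pos zero_less_power add_pos_nonneg) auto
    qed
    finally show "norm (?f (x, y)) \<le> C * K1 * K2 / ((1 + x^2) * (1 + y^2))" .
  qed
  then show "integrable lborel ?f" by (simp add: lborel_prod)
  have fubini: "(\<integral>p. f p \<partial>(lborel \<Otimes>\<^sub>M lborel)) = (\<integral>y. \<integral>x. f (x, y) \<partial>lborel \<partial>lborel)"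
    if "integrable (lborel \<Otimes>\<^sub>M lborel) f" for f :: "real \<times> real \<Rightarrow> complex"
    using lborel_pair.integral_snd[of "\<lambda>x y. f (x, y)"] that by simp
  have "(\<integral>p. ?f p \<partial>lborel) = (\<integral>p. ?f p \<partial>(lborel \<Otimes>\<^sub>M lborel))" by (simp add: lborel_prod)
  also have "\<dots> = (\<integral>y. \<integral>x. ?f (x, y) \<partial>lborel \<partial>lborel)"
    using fubini[OF i] .
  also have "\<dots> = (\<integral>y. - 2 * pi * \<i> * ((G (shift \<epsilon> \<zeta>) (of_real y + \<i> * of_real \<epsilon>) - G (shift \<epsilon> \<zeta>) (of_real y - \<i> * of_real \<epsilon>)) / (\<omega> - of_real y)) \<partial>lborel)"
  proof (rule Bochner_Integration.integral_cong[OF refl])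
    fix y :: real
    obtain B where B: "B \<ge> 0" "\<And>z w. \<bar>Im z\<bar> \<ge> \<epsilon> \<Longrightarrow> \<bar>Im w\<bar> \<ge> \<epsilon> \<Longrightarrow> norm (G z w) \<le> B / ((1 + norm z) * (1 + norm w))"
      using bound[OF \<epsilon>] by blast
    let ?h = "\<lambda>z. G z (of_real y + \<i> * of_real \<epsilon>) - G z (of_real y - \<i> * of_real \<epsilon>)"
    have int: "(\<integral>x. (?h (of_real x + \<i> * of_real \<epsilon>) - ?h (of_real x - \<i> * of_real \<epsilon>)) / (\<zeta> - of_real x) \<partial>lborel) = - 2 * pi * \<i> * ?h (shift \<epsilon> \<zeta>)"
    proof (rule cauchy_integral_jump(2)[OF _ \<epsilon> _ \<zeta>])
      show "?h holomorphic_on - \<real>" using \<epsilon> by (intro holomorphic_intros hol1) auto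
      show "norm (?h z) \<le> 2 * B / (1 + norm z)" if "\<bar>Im z\<bar> \<ge> \<epsilon>" for z
      proof -
        have "norm (G z w) \<le> B / (1 + norm z)" if "\<bar>Im w\<bar> \<ge> \<epsilon>" for w
        proof -
          have "norm (G z w) \<le> B / ((1 + norm w) * (1 + norm z))"
            using B(2)[OF \<open>\<bar>Im z\<bar> \<ge> \<epsilon>\<close> that] by (simp only: mult.commute)
          also have "\<dots> \<le> B / (1 + norm z)"
            by (intro divide_one_plus_le B(1)) auto
          finally show ?thesis .
        qed
        then have "norm (?h z) \<le> B / (1 + norm z) + B / (1 + norm z)"
          using \<epsilon> by (intro order_trans[OF norm_triangle_ineq4] add_mono) auto
        then show ?thesis by simp
      qed
    qed
    have eq: "?f (x, y) = (1 / (\<omega> - of_real y)) * ((?h (of_real x + \<i> * of_real \<epsilon>) - ?h (of_real x - \<i> * of_real \<epsilon>)) / (\<zeta> - of_real x))" for x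
    proof -
      have "jump \<epsilon> (x, y) = ?h (of_real x + \<i> * of_real \<epsilon>) - ?h (of_real x - \<i> * of_real \<epsilon>)"
        by (simp add: jump_def)
      then show ?thesis by simp
    qed
    have "(\<integral>x. ?f (x, y) \<partial>lborel) = (1 / (\<omega> - of_real y)) * (\<integral>x. (?h (of_real x + \<i> * of_real \<epsilon>) - ?h (of_real x - \<i> * of_real \<epsilon>)) / (\<zeta> - of_real x) \<partial>lborel)"
      unfolding eq by (rule integral_mult_right_zero)
    also have "\<dots> = - 2 * pi * \<i> * (?h (shift \<epsilon> \<zeta>) / (\<omega> - of_real y))"
      unfolding int by (simp only: times_divide_eq_left times_divide_eq_right mult_1_left)
    finally show "(\<integral>x. ?f (x, y) \<partial>lborel) = - 2 * pi * \<i> * (?h (shift \<epsilon> \<zeta>) / (\<omega> - of_real y))" .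
  qed
  also have "\<dots> = - 2 * pi * \<i> * (- 2 * pi * \<i> * G (shift \<epsilon> \<zeta>) (shift \<epsilon> \<omega>))"
  proof -
    obtain B where B: "B \<ge> 0" "\<And>z w. \<bar>Im z\<bar> \<ge> \<epsilon> \<Longrightarrow> \<bar>Im w\<bar> \<ge> \<epsilon> \<Longrightarrow> norm (G z w) \<le> B / ((1 + norm z) * (1 + norm w))"
      using bound[OF \<epsilon>] by blast
    have s: "\<bar>Im (shift \<epsilon> \<zeta>)\<bar> \<ge> \<epsilon>" using abs_Im_shift[OF \<epsilon> \<zeta>] by simp
    have "(\<integral>y. (G (shift \<epsilon> \<zeta>) (of_real y + \<i> * of_real \<epsilon>) - G (shift \<epsilon> \<zeta>) (of_real y - \<i> * of_real \<epsilon>)) / (\<omega> - of_real y) \<partial>lborel)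
       = - 2 * pi * \<i> * G (shift \<epsilon> \<zeta>) (shift \<epsilon> \<omega>)"
    proof (rule cauchy_integral_jump(2)[OF hol2 \<epsilon> _ \<omega>])
      show "Im (shift \<epsilon> \<zeta>) \<noteq> 0" using s \<epsilon> by auto
      show "norm (G (shift \<epsilon> \<zeta>) w) \<le> B / (1 + norm w)" if "\<bar>Im w\<bar> \<ge> \<epsilon>" for w
      proof -
        have "norm (G (shift \<epsilon> \<zeta>) w) \<le> B / ((1 + norm (shift \<epsilon> \<zeta>)) * (1 + norm w))" by (rule B(2)[OF s that])
        also have "\<dots> \<le> B / (1 + norm w)"
          by (intro divide_one_plus_le B(1)) auto
        finally show ?thesis .
      qed
    qed
    then show ?thesis unfolding integral_mult_right_zero by (rule arg_cong)
  qed
  also have "\<dots> = - 4 * of_real (pi^2) * G (shift \<epsilon> \<zeta>) (shift \<epsilon> \<omega>)"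
  proof -
    have "- 2 * a * j * (- 2 * a * j * g) = - 4 * a^2 * g" if "j * j = -1" for a g j :: complex
      using that by algebra
    from this[OF i_squared, of "of_real pi"] show ?thesis
      by (simp only: of_real_mult of_real_minus of_real_numeral of_real_power)
  qed
  finally show "(\<integral>p. ?f p \<partial>lborel) = \<dots>" .
qed

end

context bivariate_nevanlinna
begin

lemma integral_dens:
  assumes \<epsilon>: "\<epsilon> > 0" and \<zeta>: "Im \<zeta> \<noteq> 0" and \<omega>: "Im \<omega> \<noteq> 0"
  shows "has_bochner_integral lborel (\<lambda>p. of_real (dens \<epsilon> p) * (1 / (\<omega> - of_real (snd p)) / (\<zeta> - of_real (fst p))))
    (G (shift \<epsilon> \<zeta>) (shift \<epsilon> \<omega>))"
proof -
  have "has_bochner_integral lborel (\<lambda>p. jump \<epsilon> p / (\<omega> - of_real (snd p)) / (\<zeta> - of_real (fst p)))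
    (- 4 * of_real (pi^2) * G (shift \<epsilon> \<zeta>) (shift \<epsilon> \<omega>))"
    using integral_jump[OF assms] by (simp add: has_bochner_integral_iff)
  from has_bochner_integral_mult_right[OF this, of "- 1 / (4 * of_real (pi^2))"]
  show ?thesis by (simp add: jump_eq_dens)
qed

lemma dens_measurable: "\<epsilon> > 0 \<Longrightarrow> dens \<epsilon> \<in> borel_measurable borel"
proof -
  assume "\<epsilon> > 0"
  note [measurable] = borel_measurable_continuous_onI[OF jump_continuous[OF this]]
  have "dens \<epsilon> = (\<lambda>p. Re (jump \<epsilon> p) / (- 4 * pi^2))"
    by (simp add: jump_eq_dens)
  then show ?thesis by simp
qed

text \<open>With N = n + 1 the cut-off N^2 / (x^2 + N^2) is a combination of the resolvents at i N
  and - i N, so integrals of \<open>dens\<close> against products of it are computable from G, and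
  it increases to 1.\<close>

definition weight :: "nat \<Rightarrow> real \<Rightarrow> real" where
  "weight n x = (real n + 1)^2 / (x^2 + (real n + 1)^2)"

lemma weight_eq: "complex_of_real (weight n x) = \<i> * of_real (real n + 1) / 2 *
   (1 / (\<i> * of_real (real n + 1) - of_real x) - 1 / (- \<i> * of_real (real n + 1) - of_real x))"
proof -
  define N where "N = real n + 1"
  have N: "N > 0" by (simp add: N_def)
  then have ne: "\<i> * of_real N - complex_of_real x \<noteq> 0" "- \<i> * of_real N - complex_of_real x \<noteq> 0" "x^2 + N^2 \<noteq> 0"
    by (auto simp: complex_eq_iff add_nonneg_eq_0_iff)
  have "(\<i> * of_real N - complex_of_real x) * (- \<i> * of_real N - complex_of_real x) = of_real (x^2 + N^2)"
    by (simp add: complex_eq_iff power2_eq_square)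
  moreover have "1 / (\<i> * of_real N - complex_of_real x) - 1 / (- \<i> * of_real N - complex_of_real x)
     = (- 2 * \<i> * of_real N) / ((\<i> * of_real N - complex_of_real x) * (- \<i> * of_real N - complex_of_real x))"
    using ne by (simp add: field_simps)
  moreover have "j * m / 2 * ((- 2 * j * m) / S) = - (j * j) * (m^2 / S)" for j m S :: complex
    by (simp add: power2_eq_square)
  ultimately show ?thesis
    unfolding weight_def N_def[symmetric]
    by (simp only: i_squared minus_minus mult_1_left of_real_divide of_real_power)
qed

lemma weight_bounds: "0 \<le> weight n x" "weight n x \<le> 1"
proof -
  have "x^2 + (real n + 1)^2 > 0" by (intro add_nonneg_pos) auto
  then show "0 \<le> weight n x" "weight n x \<le> 1" by (simp_all add: weight_def divide_le_eq_1)
qed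

lemma weight_mono: "n \<le> m \<Longrightarrow> weight n x \<le> weight m x"
proof -
  assume "n \<le> m"
  then have "(real n + 1)^2 \<le> (real m + 1)^2" by (intro power_mono) auto
  then have "(real n + 1)^2 * x^2 \<le> (real m + 1)^2 * x^2" by (intro mult_right_mono) auto
  moreover have "x^2 + (real k + 1)^2 > 0" for k by (intro add_nonneg_pos) auto
  ultimately show ?thesis by (simp add: weight_def divide_simps algebra_simps)
qed

lemma weight_tendsto: "(\<lambda>n. weight n x) \<longlonglongrightarrow> 1"
  unfolding weight_def by real_asymp

lemma borel_measurable_weight [measurable]: "weight n \<in> borel_measurable borel"
  unfolding weight_def by measurable

lemma integral_weight_dens:
  fixes n :: nat
  assumes \<epsilon>: "\<epsilon> > 0"
  defines "t \<equiv> real n + 1 + \<epsilon>"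
  shows "has_bochner_integral lborel (\<lambda>p. weight n (fst p) * weight n (snd p) * dens \<epsilon> p)
    ((real n + 1)^2 / 2 * (Re (G (- (\<i>) * of_real t) (\<i> * of_real t)) - Re (G (\<i> * of_real t) (\<i> * of_real t))))"
proof -
  define N where "N = real n + 1"
  have N: "N > 0" by (simp add: N_def)
  let ?k = "\<lambda>\<zeta> \<omega> p. complex_of_real (dens \<epsilon> p) * (1 / (\<omega> - of_real (snd p)) / (\<zeta> - of_real (fst p)))"
  let ?z = "\<i> * of_real N" let ?w = "- (\<i>) * of_real N"
  let ?a = "\<i> * complex_of_real t" let ?b = "- (\<i>) * complex_of_real t"
  have s: "shift \<epsilon> ?z = ?a" "shift \<epsilon> ?w = ?b"
    using N by (simp_all add: shift_def t_def N_def algebra_simps)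
  have h: "has_bochner_integral lborel (?k \<zeta> \<omega>) (G (shift \<epsilon> \<zeta>) (shift \<epsilon> \<omega>))" if "\<zeta> \<in> {?z, ?w}" "\<omega> \<in> {?z, ?w}" for \<zeta> \<omega>
    using that N by (intro integral_dens \<epsilon>) auto
  have "has_bochner_integral lborel (\<lambda>p. - of_real (N^2 / 4) * ((?k ?z ?z p - ?k ?w ?z p) - (?k ?z ?w p - ?k ?w ?w p)))
     (- of_real (N^2 / 4) * ((G ?a ?a - G ?b ?a) - (G ?a ?b - G ?b ?b)))"
    using h[of ?z ?z] h[of ?w ?z] h[of ?z ?w] h[of ?w ?w] unfolding s
    by (intro has_bochner_integral_mult_right has_bochner_integral_diff) auto
  moreover have "- of_real (N^2 / 4) * ((?k ?z ?z p - ?k ?w ?z p) - (?k ?z ?w p - ?k ?w ?w p))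
     = complex_of_real (weight n (fst p) * weight n (snd p) * dens \<epsilon> p)" for p
    unfolding of_real_mult weight_eq N_def[symmetric]
    by (simp add: algebra_simps power2_eq_square)
  moreover have "- of_real (N^2 / 4) * ((G ?a ?a - G ?b ?a) - (G ?a ?b - G ?b ?b)) = of_real (N^2 / 2 * (Re (G ?b ?a) - Re (G ?a ?a)))"
  proof -
    have "G ?b ?b = cnj (G ?a ?a)" "G ?a ?b = cnj (G ?b ?a)"
      using G_cnj[of ?a ?a] G_cnj[of ?b ?a] by simp_all
    then have "(G ?a ?a - G ?b ?a) - (G ?a ?b - G ?b ?b) = of_real (2 * Re (G ?a ?a) - 2 * Re (G ?b ?a))"
      by (simp add: complex_eq_iff)
    then have "- of_real (N^2 / 4) * ((G ?a ?a - G ?b ?a) - (G ?a ?b - G ?b ?b)) = complex_of_real (- (N^2 / 4) * (2 * Re (G ?a ?a) - 2 * Re (G ?b ?a)))"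
      by (simp only: of_real_mult of_real_minus)
    also have "- (N^2 / 4) * (2 * Re (G ?a ?a) - 2 * Re (G ?b ?a)) = N^2 / 2 * (Re (G ?b ?a) - Re (G ?a ?a))"
      by (simp add: field_simps)
    finally show ?thesis .
  qed
  ultimately have "has_bochner_integral lborel (\<lambda>p. complex_of_real (weight n (fst p) * weight n (snd p) * dens \<epsilon> p))
    (of_real (N^2 / 2 * (Re (G ?b ?a) - Re (G ?a ?a))))" by (simp only:)
  from has_bochner_integral_Re[OF this] show ?thesis unfolding N_def by simp
qed

text \<open>The constant 1 is only a limit of combinations of resolvents, so the total mass is
  obtained by monotone convergence along \<open>weight\<close>, for which nonnegativity of
  \<open>dens\<close> is essential. The limits -1 and 1 from \<open>lim1\<close> and
  \<open>lim2\<close> give the mass (1 - (-1)) / 2 = 1.\<close>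

lemma has_bochner_integral_dens:
  assumes \<epsilon>: "\<epsilon> > 0"
  shows "has_bochner_integral lborel (dens \<epsilon>) 1"
proof -
  let ?f = "\<lambda>n p. weight n (fst p) * weight n (snd p) * dens \<epsilon> p"
  have f: "integrable lborel (?f n)" for n
    using integral_weight_dens[OF \<epsilon>] by (simp add: has_bochner_integral_iff)
  have mono: "AE p in lborel. mono (\<lambda>n. ?f n p)"
    using dens_nonneg[OF \<epsilon>] weight_bounds weight_mono
    by (auto simp: mono_def intro!: mult_right_mono mult_mono)
  have lim: "AE p in lborel. (\<lambda>n. ?f n p) \<longlonglongrightarrow> dens \<epsilon> p"
  proof (rule AE_I2)
    fix p
    have "(\<lambda>n. ?f n p) \<longlonglongrightarrow> 1 * 1 * dens \<epsilon> p" by (intro tendsto_intros weight_tendsto)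
    then show "(\<lambda>n. ?f n p) \<longlonglongrightarrow> dens \<epsilon> p" by simp
  qed
  have t: "filterlim (\<lambda>n. real n + 1 + \<epsilon>) at_top sequentially"
    by real_asymp
  have r: "(\<lambda>n. (real n + 1)^2 / (real n + 1 + \<epsilon>)^2) \<longlonglongrightarrow> 1"
    by real_asymp
  have a: "(\<lambda>n. Re (of_real ((real n + 1 + \<epsilon>)^2) * G (\<i> * of_real (real n + 1 + \<epsilon>)) (\<i> * of_real (real n + 1 + \<epsilon>)))) \<longlonglongrightarrow> Re (- 1)"
    by (rule tendsto_Re, rule filterlim_compose[OF lim1 t])
  have b: "(\<lambda>n. Re (of_real ((real n + 1 + \<epsilon>)^2) * G (- (\<i>) * of_real (real n + 1 + \<epsilon>)) (\<i> * of_real (real n + 1 + \<epsilon>)))) \<longlonglongrightarrow> Re 1"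
    by (rule tendsto_Re, rule filterlim_compose[OF lim2 t])
  have "(\<lambda>n. (real n + 1)^2 / (real n + 1 + \<epsilon>)^2 / 2 * (Re (of_real ((real n + 1 + \<epsilon>)^2) * G (- (\<i>) * of_real (real n + 1 + \<epsilon>)) (\<i> * of_real (real n + 1 + \<epsilon>)))
      - Re (of_real ((real n + 1 + \<epsilon>)^2) * G (\<i> * of_real (real n + 1 + \<epsilon>)) (\<i> * of_real (real n + 1 + \<epsilon>))))) \<longlonglongrightarrow> 1 / 2 * (Re 1 - Re (- 1))"
    by (intro tendsto_mult tendsto_divide tendsto_diff r a b tendsto_const) auto
  moreover have "(real n + 1)^2 / (real n + 1 + \<epsilon>)^2 / 2 * (Re (of_real ((real n + 1 + \<epsilon>)^2) * G (- (\<i>) * of_real (real n + 1 + \<epsilon>)) (\<i> * of_real (real n + 1 + \<epsilon>)))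
      - Re (of_real ((real n + 1 + \<epsilon>)^2) * G (\<i> * of_real (real n + 1 + \<epsilon>)) (\<i> * of_real (real n + 1 + \<epsilon>)))) = (\<integral>p. ?f n p \<partial>lborel)" for n
  proof -
    have alg: "c / d / 2 * (Re (of_real d * X) - Re (of_real d * Y)) = c / 2 * (Re X - Re Y)" if "d \<noteq> 0" for c d :: real and X Y
      using that by (simp add: field_simps)
    have "real n + 1 + \<epsilon> > 0" using \<epsilon> by (intro add_nonneg_pos) auto
    then have "(real n + 1 + \<epsilon>)^2 \<noteq> 0" by simp
    from alg[OF this] show ?thesis
      by (rule trans) (rule has_bochner_integral_integral_eq[OF integral_weight_dens[OF \<epsilon>, of n], symmetric])
  qed
  ultimately have lim_int: "(\<lambda>n. \<integral>p. ?f n p \<partial>lborel) \<longlonglongrightarrow> 1" by simp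
  show ?thesis
    by (rule has_bochner_integral_monotone_convergence[OF f mono lim lim_int])
       (use dens_measurable[OF \<epsilon>] in simp)
qed

text \<open>A regularisation at height \<epsilon>: its Cauchy transform is G at points pushed off
  the real axis by \<epsilon>, so a law with transform G itself is sought as a limit for \<epsilon>
  -> 0.\<close>

definition smooth_law :: "real \<Rightarrow> (real \<times> real) measure" where
  "smooth_law \<epsilon> = density lborel (\<lambda>p. ennreal (dens \<epsilon> p))"

lemma borel_prob_smooth_law:
  assumes \<epsilon>: "\<epsilon> > 0"
  shows "borel_prob (smooth_law \<epsilon>)"
proof -
  note [measurable] = dens_measurable[OF \<epsilon>]
  have "emeasure (smooth_law \<epsilon>) (space (smooth_law \<epsilon>)) = (\<integral>\<^sup>+p. ennreal (dens \<epsilon> p) \<partial>lborel)"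
    unfolding smooth_law_def by (subst emeasure_density) (auto intro!: nn_integral_cong)
  also have "\<dots> = 1"
    using nn_integral_eq_integral[of lborel "dens \<epsilon>"] has_bochner_integral_dens[OF \<epsilon>] dens_nonneg[OF \<epsilon>]
    by (simp add: has_bochner_integral_iff)
  finally show ?thesis
    unfolding borel_prob_def smooth_law_def by (auto intro: prob_spaceI)
qed

lemma cauchy_transform2_smooth_law:
  assumes "\<epsilon> > 0" "Im \<zeta> \<noteq> 0" "Im \<omega> \<noteq> 0"
  shows "cauchy_transform2 (smooth_law \<epsilon>) \<zeta> \<omega> = G (shift \<epsilon> \<zeta>) (shift \<epsilon> \<omega>)"
proof -
  note [measurable] = dens_measurable[OF assms(1)] measurable_fst_real measurable_snd_real
  have "cauchy_transform2 (smooth_law \<epsilon>) \<zeta> \<omega>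
    = (\<integral>p. dens \<epsilon> p *\<^sub>R (1 / (\<omega> - of_real (snd p)) / (\<zeta> - of_real (fst p))) \<partial>lborel)"
    unfolding cauchy_transform2_eq(1) smooth_law_def
    by (rule integral_density) (use dens_nonneg[OF assms(1)] in auto)
  then show ?thesis
    using integral_dens[OF assms] by (simp add: has_bochner_integral_iff scaleR_conv_of_real)
qed

end

section \<open>Weak compactness in the plane\<close>

text \<open>The library has Helly's selection theorem on the line only. \<open>plane_code\<close> is a Borel section of
  the plane-filling curve \<open>plane_curve\<close> and has linear growth, so that tightness and weak limits can be
  transported between the line and the plane.\<close>

definition tri :: "real \<Rightarrow> real" where
  "tri t = arccos (cos (pi * t)) / pi"

lemma tri_add_even: "tri (t + 2 * of_int k) = tri t"
proof -
  have "cos (pi * (t + 2 * of_int k)) = cos (pi * t + of_int k * (2 * pi))"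
    by (simp add: algebra_simps)
  also have "\<dots> = cos (pi * t)"
    using cos.plus_of_int[of "pi * t" k] by (simp add: algebra_simps)
  finally show ?thesis by (simp add: tri_def)
qed

lemma tri_unit: "0 \<le> t \<Longrightarrow> t \<le> 1 \<Longrightarrow> tri t = t"
  by (simp add: tri_def arccos_cos mult_le_cancel_left1)

lemma continuous_tri: "continuous_on UNIV tri"
  unfolding tri_def by (intro continuous_intros) auto

text \<open>A continuous readout of the leading ternary digit on [0, 1]: it is 0 on [0, 1/3] and 1
  on [2/3, 1], and it inherits the period 2 of \<open>tri\<close>.\<close>

definition sel :: "real \<Rightarrow> real" where
  "sel t = max 0 (min 1 (3 * tri t - 1))"

lemma sel_bounds: "0 \<le> sel t" "sel t \<le> 1"
  by (auto simp: sel_def)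

lemma continuous_sel: "continuous_on UNIV sel"
  unfolding sel_def by (intro continuous_intros continuous_on_compose2[OF continuous_tri]) auto

definition cantor :: "(nat \<Rightarrow> real) \<Rightarrow> real" where
  "cantor d = (\<Sum>n. 2 * d n / 3 ^ Suc n)"

lemma summable_cantor:
  assumes "\<And>n. d n \<in> {0, 1::real}"
  shows "summable (\<lambda>n. 2 * d n / 3 ^ Suc n)"
proof (rule summable_comparison_test[OF exI[of _ 0]], intro allI impI)
  show "norm (2 * d n / 3 ^ Suc n) \<le> (1/3)^n" for n
    using assms[of n] by (auto simp: power_divide divide_simps)
qed (simp add: summable_geometric)

lemma cantor_Suc:
  assumes "\<And>n. d n \<in> {0, 1::real}"
  shows "cantor d = 2 * d 0 / 3 + cantor (\<lambda>n. d (Suc n)) / 3"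
proof -
  have "cantor d = 2 * d 0 / 3 + (\<Sum>n. 2 * d (Suc n) / 3 ^ Suc (Suc n))"
    unfolding cantor_def using suminf_split_head[OF summable_cantor[of d, OF assms]] by (simp del: power_Suc)
  also have "(\<Sum>n. 2 * d (Suc n) / 3 ^ Suc (Suc n)) = (\<Sum>n. 2 * d (Suc n) / 3 ^ Suc n / 3)"
    by (intro suminf_cong) simp
  also have "\<dots> = cantor (\<lambda>n. d (Suc n)) / 3"
    unfolding cantor_def by (rule suminf_divide, rule summable_cantor, rule assms)
  finally show ?thesis .
qed

lemma cantor_bounds:
  assumes "\<And>n. d n \<in> {0, 1::real}"
  shows "0 \<le> cantor d" "cantor d \<le> 1"
proof -
  have d: "0 \<le> d n" "d n \<le> 1" for n using assms[of n] by auto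
  show "0 \<le> cantor d"
    unfolding cantor_def by (rule suminf_nonneg[OF summable_cantor[of d, OF assms]]) (use d in simp)
  have g: "(\<lambda>n. 2 / 3 * (1/3)^n) sums (2 / 3 * (1 / (1 - 1/3 :: real)))"
    by (intro sums_mult geometric_sums) simp
  have "cantor d \<le> (\<Sum>n. 2 / 3 * (1/3)^n)"
    unfolding cantor_def using d g
    by (intro suminf_le summable_cantor[of d, OF assms]) (auto simp: power_divide sums_iff intro!: divide_right_mono)
  then show "cantor d \<le> 1" using g by (simp add: sums_iff)
qed

text \<open>Multiplication by 3 shifts the ternary digits and releases an integer that is 0 or 2.
  Being even, it is invisible to a function of period 2, so after n steps the n-th digit has become
  the leading one.\<close>

lemma sel_cantor:
  assumes "\<And>n. d n \<in> {0, 1::real}"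
  shows "sel (3 ^ n * (cantor d + 2 * of_int k)) = d n"
  using assms
proof (induction n arbitrary: d k)
  case 0
  define c where "c = cantor (\<lambda>n. d (Suc n))"
  have c: "0 \<le> c" "c \<le> 1" unfolding c_def using cantor_bounds[of "\<lambda>n. d (Suc n)"] 0 by auto
  have "tri (cantor d + 2 * of_int k) = 2 * d 0 / 3 + c / 3"
    unfolding tri_add_even cantor_Suc[of d, OF 0] c_def[symmetric] using c 0[of 0] by (intro tri_unit) auto
  moreover have "d 0 = 0 \<or> d 0 = 1" using 0[of 0] by blast
  ultimately show ?case using c by (elim disjE) (simp_all add: sel_def)
next
  case (Suc n)
  have "d 0 = 0 \<or> d 0 = 1" using Suc.prems[of 0] by blast
  then obtain j :: int where j: "d 0 = of_int j"
    by (elim disjE) (auto intro: that[of 0] that[of 1])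
  have eq: "3 ^ Suc n * (cantor d + 2 * of_int k) = 3 ^ n * (cantor (\<lambda>n. d (Suc n)) + 2 * of_int (j + 3 * k))"
    unfolding cantor_Suc[of d, OF Suc.prems] j by (simp add: algebra_simps)
  show ?case unfolding eq by (rule Suc.IH) (rule Suc.prems)
qed

definition digit :: "real \<Rightarrow> nat \<Rightarrow> real" where
  "digit u n = of_int (\<lfloor>2 ^ Suc n * u\<rfloor> - 2 * \<lfloor>2 ^ n * u\<rfloor>)"

lemma digit_01: "digit u n \<in> {0, 1}"
proof -
  let ?x = "2 ^ n * u"
  have "\<lfloor>2 * ?x\<rfloor> - 2 * \<lfloor>?x\<rfloor> = 0 \<or> \<lfloor>2 * ?x\<rfloor> - 2 * \<lfloor>?x\<rfloor> = 1" by linarith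
  then show ?thesis by (auto simp: digit_def mult.assoc)
qed

text \<open>The partial sums telescope to \<lfloor>2^n u\<rfloor> / 2^n, which lies within 2^(-n) of
  u.\<close>

lemma sums_digit:
  assumes "0 \<le> u" "u < 1"
  shows "(\<lambda>n. digit u n / 2 ^ Suc n) sums u"
proof -
  have part: "(\<Sum>i<n. digit u i / 2 ^ Suc i) = of_int \<lfloor>2 ^ n * u\<rfloor> / 2 ^ n" for n
  proof (induction n)
    case 0
    have "\<lfloor>u\<rfloor> = 0" using assms by linarith
    then show ?case by simp
  next
    case (Suc n)
    then show ?case by (simp add: digit_def field_simps)
  qed
  have "(\<lambda>n. of_int \<lfloor>2 ^ n * u\<rfloor> / 2 ^ n) \<longlonglongrightarrow> u"
  proof (rule real_tendsto_sandwich[where f="\<lambda>n. u - (1/2)^n" and h="\<lambda>_. u"])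
    show "\<forall>\<^sub>F n in sequentially. u - (1/2)^n \<le> of_int \<lfloor>2 ^ n * u\<rfloor> / 2 ^ n"
    proof (rule always_eventually, rule allI)
      fix n
      have "2 ^ n * u - 1 \<le> of_int \<lfloor>2 ^ n * u\<rfloor>" by linarith
      then have "(2 ^ n * u - 1) / 2 ^ n \<le> of_int \<lfloor>2 ^ n * u\<rfloor> / 2 ^ n" by (rule divide_right_mono) simp
      then show "u - (1/2)^n \<le> of_int \<lfloor>2 ^ n * u\<rfloor> / 2 ^ n" by (simp add: diff_divide_distrib power_divide)
    qed
    show "\<forall>\<^sub>F n in sequentially. of_int \<lfloor>2 ^ n * u\<rfloor> / 2 ^ n \<le> u"
      by (rule always_eventually) (simp add: divide_le_eq mult.commute)
    have "(\<lambda>n. u - (1/2)^n) \<longlonglongrightarrow> u - 0" by (intro tendsto_intros) auto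
    then show "(\<lambda>n. u - (1/2)^n) \<longlonglongrightarrow> u" by simp
  qed auto
  then show ?thesis unfolding sums_def part .
qed

text \<open>The coordinates of Schoenberg's space-filling curve: on Cantor points j = 0 reads the
  even and j = 1 the odd ternary digits and reassembles them as binary digits.\<close>

definition schoenberg :: "nat \<Rightarrow> real \<Rightarrow> real" where
  "schoenberg j t = (\<Sum>n. sel (3 ^ (2 * n + j) * t) / 2 ^ Suc n)"

lemma continuous_schoenberg: "continuous_on UNIV (schoenberg j)"
  unfolding schoenberg_def
proof (rule uniform_limit_theorem)
  show "\<forall>\<^sub>F n in sequentially. continuous_on UNIV (\<lambda>t. \<Sum>n<n. sel (3 ^ (2 * n + j) * t) / 2 ^ Suc n)"
    by (intro always_eventually allI continuous_intros continuous_on_compose2[OF continuous_sel]) auto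
  show "uniform_limit UNIV (\<lambda>n t. \<Sum>n<n. sel (3 ^ (2 * n + j) * t) / 2 ^ Suc n)
    (\<lambda>t. \<Sum>n. sel (3 ^ (2 * n + j) * t) / 2 ^ Suc n) sequentially"
  proof (rule Weierstrass_m_test)
    show "norm (sel (3 ^ (2 * n + j) * t) / 2 ^ Suc n) \<le> (1 / 2) ^ Suc n" for n t
      using sel_bounds by (simp add: power_divide divide_right_mono)
    show "summable (\<lambda>n. (1 / 2 :: real) ^ Suc n)"
      by (simp add: summable_geometric)
  qed
qed auto

lemma schoenberg_cantor:
  assumes "0 \<le> u" "u < 1" "\<And>n. d (2 * n + j) = digit u n" "\<And>n. d n \<in> {0, 1::real}"
  shows "schoenberg j (cantor d + 2 * of_int k) = u"
  unfolding schoenberg_def sel_cantor[of d, OF assms(4)] assms(3)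
  using sums_digit[OF assms(1,2)] by (simp add: sums_iff)

text \<open>At t = c + 2 k with c in [0, 1] the factor (t - \<open>tri\<close> t) / 2 is the integer
  k, so the unit square filled by the Schoenberg curve is stretched to [-k, k]^2. Growing k makes
  one continuous curve cover the plane.\<close>

definition plane_curve :: "real \<Rightarrow> real \<times> real" where
  "plane_curve t = ((t - tri t) / 2 * (2 * schoenberg 0 t - 1), (t - tri t) / 2 * (2 * schoenberg 1 t - 1))"

lemma continuous_plane_curve: "continuous_on UNIV plane_curve"
  unfolding plane_curve_def
  by (intro continuous_intros continuous_tri continuous_schoenberg) auto

text \<open>The added 1 makes the level strictly larger than both absolute coordinates, which puts
  the rescaled coordinates strictly below 1, where \<open>sums_digit\<close> applies, and keeps the
  level positive at the origin.\<close>

definition level :: "real \<times> real \<Rightarrow> int" where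
  "level p = \<lfloor>max \<bar>fst p\<bar> \<bar>snd p\<bar>\<rfloor> + 1"

definition plane_code :: "real \<times> real \<Rightarrow> real" where
  "plane_code p = cantor (\<lambda>n. if even n then digit ((fst p / of_int (level p) + 1) / 2) (n div 2)
       else digit ((snd p / of_int (level p) + 1) / 2) (n div 2)) + 2 * of_int (level p)"

lemma level_bounds:
  "max \<bar>fst p\<bar> \<bar>snd p\<bar> < of_int (level p)" "of_int (level p) \<le> max \<bar>fst p\<bar> \<bar>snd p\<bar> + 1" "0 < level p"
proof -
  show "max \<bar>fst p\<bar> \<bar>snd p\<bar> < of_int (level p)" "of_int (level p) \<le> max \<bar>fst p\<bar> \<bar>snd p\<bar> + 1"
    unfolding level_def by linarith+
  have "0 \<le> \<lfloor>max \<bar>fst p\<bar> \<bar>snd p\<bar>\<rfloor>" by (simp add: le_max_iff_disj)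
  then show "0 < level p" by (simp add: level_def)
qed

lemma plane_code_digits: "(if even n then digit a (n div 2) else digit b (n div 2)) \<in> {0, 1}"
  using digit_01 by auto

text \<open>The even digits of the Cantor point store the first rescaled coordinate and the odd
  digits the second, while the integer part 2 k stores the scale. Since \<open>tri\<close> returns
  exactly the Cantor point, all three pieces are recovered.\<close>

lemma plane_curve_code: "plane_curve (plane_code p) = p"
proof -
  define k where "k = level p"
  define u where "u = (fst p / of_int k + 1) / 2"
  define v where "v = (snd p / of_int k + 1) / 2"
  define d where "d n = (if even n then digit u (n div 2) else digit v (n div 2))" for n
  have d: "d n \<in> {0, 1}" for n unfolding d_def by (rule plane_code_digits)
  have t: "plane_code p = cantor d + 2 * of_int k"
    unfolding plane_code_def d_def u_def v_def k_def by simp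
  have k: "max \<bar>fst p\<bar> \<bar>snd p\<bar> < of_int k" "0 < k" unfolding k_def using level_bounds by auto
  then have uv: "0 \<le> u" "u < 1" "0 \<le> v" "v < 1"
    unfolding u_def v_def by (auto simp: field_simps abs_less_iff)
  have tri: "tri (plane_code p) = cantor d"
    unfolding t tri_add_even by (intro tri_unit cantor_bounds d)
  have sch: "schoenberg 0 (plane_code p) = u" "schoenberg 1 (plane_code p) = v"
    unfolding t by (rule schoenberg_cantor[OF uv(1,2) _ d], simp add: d_def) 
      (rule schoenberg_cantor[OF uv(3,4) _ d], simp add: d_def)
  have "plane_curve (plane_code p) = (of_int k * (2 * u - 1), of_int k * (2 * v - 1))"
    unfolding plane_curve_def tri sch by (simp add: t)
  then show ?thesis using k by (simp add: u_def v_def prod_eq_iff field_simps)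
qed

lemma abs_plane_code_le: "\<bar>plane_code p\<bar> \<le> 2 * max \<bar>fst p\<bar> \<bar>snd p\<bar> + 3"
proof -
  have *: "\<bar>c + 2 * of_int (level p)\<bar> \<le> 2 * max \<bar>fst p\<bar> \<bar>snd p\<bar> + 3" if "0 \<le> c" "c \<le> 1" for c :: real
  proof -
    have "0 < real_of_int (level p)" using level_bounds(3)[of p] by simp
    then show ?thesis using that level_bounds(2)[of p] by (simp add: abs_le_iff)
  qed
  then show ?thesis
    unfolding plane_code_def by (intro * cantor_bounds plane_code_digits)
qed

lemma borel_measurable_plane_code: "plane_code \<in> borel_measurable borel"
proof -
  note [measurable] = measurable_fst_real measurable_snd_real
  have [measurable]: "(\<lambda>p. of_int (level p) :: real) \<in> borel_measurable borel"
    unfolding level_def by measurable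
  have "(\<lambda>p. digit (f p) n) \<in> borel_measurable borel" if [measurable]: "f \<in> borel_measurable borel" for f :: "real \<times> real \<Rightarrow> real" and n
    unfolding digit_def of_int_diff of_int_mult by measurable
  note [measurable] = this
  show ?thesis
    unfolding plane_code_def cantor_def
    by (intro borel_measurable_add borel_measurable_suminf borel_measurable_times borel_measurable_const borel_measurable_divide measurable_If) measurable
qed

lemma real_distribution_interval:
  assumes "real_distribution M" "\<epsilon> > 0"
  shows "\<exists>K::nat. measure M {- real K<..real K} > 1 - \<epsilon>"
proof -
  interpret real_distribution M by fact
  have "(\<lambda>i. measure M {- real i<..real i}) \<longlonglongrightarrow> measure M (\<Union>i. {- real i<..real i})"
    by (rule finite_Lim_measure_incseq) (auto simp: incseq_def)
  also have "(\<Union>i. {- real i<..real i}) = UNIV"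
  proof (rule set_eqI, simp only: UNIV_I simp_thms)
    fix x :: real
    obtain i :: nat where "\<bar>x\<bar> < real i" using reals_Archimedean2 by blast
    then show "x \<in> (\<Union>i. {- real i<..real i})" by (intro UN_I[of i]) (auto simp: abs_less_iff)
  qed
  also have "measure M UNIV = 1" using prob_space by simp
  finally have "\<forall>\<^sub>F i in sequentially. measure M {- real i<..real i} > 1 - \<epsilon>"
    by (rule order_tendstoD) (use assms in simp)
  then show ?thesis by (auto simp: eventually_sequentially)
qed

text \<open>The laws are pushed to the line by \<open>plane_code\<close>, compactness of tight laws
  is applied there, and the limit is pushed back by \<open>plane_curve\<close>. A test function
  composed with \<open>plane_curve\<close> stays continuous and bounded, and composing further with
  \<open>plane_code\<close> returns the original one, so measurability of \<open>plane_code\<close>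
  is enough.\<close>

lemma borel_prob_weak_compactness:
  fixes N :: "nat \<Rightarrow> (real \<times> real) measure"
  assumes N: "\<And>n. borel_prob (N n)"
    and tight: "\<And>\<delta>. \<delta> > 0 \<Longrightarrow> \<exists>Y. \<forall>\<^sub>F n in sequentially. measure (N n) {p. Y \<le> max \<bar>fst p\<bar> \<bar>snd p\<bar>} \<le> \<delta>"
  shows "\<exists>r L. strict_mono (r :: nat \<Rightarrow> nat) \<and> borel_prob L \<and> weakly_converges (N \<circ> r) L"
proof -
  note code = borel_measurable_plane_code
  have codeN: "plane_code \<in> borel_measurable (N n)" for n
    using code by (simp add: measurable_borel_prob[OF N])
  define q where "q n = distr (N n) borel plane_code" for n
  have q: "real_distribution (q n)" for n
  proof -
    have "prob_space (q n)" unfolding q_def by (rule prob_space.prob_space_distr[OF borel_probD(1)[OF N] codeN])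
    then show ?thesis by (simp add: real_distribution_def real_distribution_axioms_def q_def)
  qed
  have "tight q"
    unfolding tight_def
  proof (intro conjI allI impI q)
    fix \<epsilon> :: real assume \<epsilon>: "\<epsilon> > 0"
    obtain Y n0 where Y: "\<And>n. n \<ge> n0 \<Longrightarrow> measure (N n) {p. Y \<le> max \<bar>fst p\<bar> \<bar>snd p\<bar>} \<le> \<epsilon> / 2"
      using tight[of "\<epsilon> / 2"] \<epsilon> by (auto simp: eventually_sequentially)
    obtain K where K: "\<And>n. measure (q n) {- real (K n)<..real (K n)} > 1 - \<epsilon>"
      using real_distribution_interval[OF q \<epsilon>] by metis
    \<comment> \<open>Where both coordinates are below Y in modulus, the code is bounded by 2 |Y| +
      3. The sum covers the finitely many initial laws, because tightness quantifies over all
      n.\<close>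
    define B where "B = 2 * \<bar>Y\<bar> + 4 + (\<Sum>n<n0. real (K n))"
    have "(\<Sum>n<n0. real (K n)) \<ge> 0" by (intro sum_nonneg) auto
    then have B: "B > 0" unfolding B_def by linarith
    have "measure (q n) {- B<..B} > 1 - \<epsilon>" for n
    proof (cases "n < n0")
      case True
      have "real (K n) \<le> (\<Sum>n<n0. real (K n))" by (rule member_le_sum) (use True in auto)
      then have "{- real (K n)<..real (K n)} \<subseteq> {- B<..B}" unfolding B_def by auto
      moreover have "finite_measure (q n)" "sets (q n) = sets borel"
        using q by (auto simp: real_distribution_def real_distribution_axioms_def prob_space.finite_measure q_def)
      ultimately have "measure (q n) {- real (K n)<..real (K n)} \<le> measure (q n) {- B<..B}"
        by (intro finite_measure.finite_measure_mono) auto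
      with K[of n] show ?thesis by simp
    next
      case False
      interpret N: prob_space "N n" by (rule borel_probD(1)[OF N])
      have m: "{p :: real \<times> real. Y \<le> max \<bar>fst p\<bar> \<bar>snd p\<bar>} \<in> sets (N n)"
        unfolding borel_probD(3)[OF N]
        by (intro borel_closed closed_Collect_le continuous_intros)
      have mp: "plane_code -` {- B<..B} \<inter> space (N n) \<in> sets (N n)"
        by (rule measurable_sets[OF codeN]) simp
      have sub: "space (N n) - {p. Y \<le> max \<bar>fst p\<bar> \<bar>snd p\<bar>} \<subseteq> plane_code -` {- B<..B} \<inter> space (N n)"
      proof -
        have "- B < plane_code p \<and> plane_code p \<le> B" if "\<not> Y \<le> max \<bar>fst p\<bar> \<bar>snd p\<bar>" for p
        proof -
          have "(\<Sum>n<n0. real (K n)) \<ge> 0" by (intro sum_nonneg) auto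
          then have "\<bar>plane_code p\<bar> < B" using that abs_plane_code_le[of p] unfolding B_def by linarith
          then show ?thesis by (simp add: abs_less_iff)
        qed
        then show ?thesis by auto
      qed
      have "1 - \<epsilon> < 1 - measure (N n) {p. Y \<le> max \<bar>fst p\<bar> \<bar>snd p\<bar>}"
        using Y[of n] False \<epsilon> by simp
      also have "\<dots> = measure (N n) (space (N n) - {p. Y \<le> max \<bar>fst p\<bar> \<bar>snd p\<bar>})"
        by (rule N.prob_compl[OF m, symmetric])
      also have "\<dots> \<le> measure (N n) (plane_code -` {- B<..B} \<inter> space (N n))"
        using sub mp by (rule N.finite_measure_mono)
      also have "\<dots> = measure (q n) {- B<..B}"
        unfolding q_def by (rule measure_distr[OF codeN, symmetric]) simp
      finally show ?thesis .
    qed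
    then show "\<exists>a b. a < b \<and> (\<forall>n. measure (q n) {a<..b} > 1 - \<epsilon>)"
      using B by (intro exI[of _ "- B"] exI[of _ B]) auto
  qed
  from tight_imp_convergent_subsubsequence[OF this strict_mono_id]
  obtain r M where r: "strict_mono r" and M: "real_distribution M" and w: "weak_conv_m (q \<circ> id \<circ> r) M"
    by blast
  have pc: "plane_curve \<in> borel_measurable borel"
    by (rule borel_measurable_continuous_onI[OF continuous_plane_curve])
  have Mb: "borel_prob M"
    using M by (auto simp: borel_prob_def real_distribution_def real_distribution_axioms_def)
  define L where "L = distr M borel plane_curve"
  have L: "borel_prob L" unfolding L_def by (rule borel_prob_distr[OF Mb pc])
  have "weakly_converges (N \<circ> r) L"
    unfolding weakly_converges_def
  proof (intro allI impI)
    fix f :: "real \<times> real \<Rightarrow> real"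
    assume f: "continuous_on UNIV f" and bf: "bounded (range f)"
    obtain B where B: "\<And>x. norm (f x) \<le> B" using bf by (auto simp: bounded_iff)
    have fm: "f \<in> borel_measurable borel" by (rule borel_measurable_continuous_onI[OF f])
    have fc: "continuous_on UNIV (\<lambda>t. f (plane_curve t))"
      by (rule continuous_on_compose2[OF f continuous_plane_curve]) auto
    have "(\<lambda>n. \<integral>t. f (plane_curve t) \<partial>((q \<circ> id \<circ> r) n)) \<longlonglongrightarrow> (\<integral>t. f (plane_curve t) \<partial>M)"
    proof (rule weak_conv_imp_integral_bdd_continuous_conv[OF _ M w])
      show "isCont (\<lambda>t. f (plane_curve t)) x" for x
        using fc by (simp add: continuous_on_eq_continuous_at)
      show "norm (f (plane_curve x)) \<le> B" for x by (rule B)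
    qed (use q in simp)
    moreover have "(\<integral>t. f (plane_curve t) \<partial>((q \<circ> id \<circ> r) n)) = (\<integral>p. f p \<partial>((N \<circ> r) n))" for n
    proof -
      have "(\<lambda>t. f (plane_curve t)) \<in> borel_measurable borel" using pc fm by measurable
      then show ?thesis
        unfolding q_def comp_def id_def by (subst integral_distr[OF codeN]) (simp_all add: plane_curve_code)
    qed
    moreover have "(\<integral>t. f (plane_curve t) \<partial>M) = (\<integral>p. f p \<partial>L)"
      unfolding L_def by (rule integral_distr[symmetric]) (use pc fm in \<open>auto simp: measurable_borel_prob[OF Mb]\<close>)
    ultimately show "(\<lambda>n. \<integral>x. f x \<partial>((N \<circ> r) n)) \<longlonglongrightarrow> (\<integral>x. f x \<partial>L)" by simp
  qed
  then show ?thesis using r L by blast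
qed

section \<open>Continuity of transforms and marginals under weak convergence\<close>

lemma weakly_converges_complex:
  fixes f :: "'a::topological_space \<Rightarrow> complex"
  assumes w: "weakly_converges N L" and N: "\<And>n. borel_prob (N n)" "borel_prob L"
    and f: "continuous_on UNIV f" "\<And>x. norm (f x) \<le> B"
  shows "(\<lambda>n. \<integral>x. f x \<partial>(N n)) \<longlonglongrightarrow> (\<integral>x. f x \<partial>L)"
proof -
  have fm: "f \<in> borel_measurable borel" by (rule borel_measurable_continuous_onI[OF f(1)])
  have i: "integrable M f" if "borel_prob M" for M
    by (rule integrable_bounded_prob[OF that fm f(2)])
  have "bounded (range (\<lambda>x. Re (f x)))" "bounded (range (\<lambda>x. Im (f x)))"
    using order_trans[OF abs_Re_le_cmod f(2)] order_trans[OF abs_Im_le_cmod f(2)]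
    unfolding bounded_iff by (auto intro!: exI[of _ B])
  then have "(\<lambda>n. \<integral>x. Re (f x) \<partial>(N n)) \<longlonglongrightarrow> (\<integral>x. Re (f x) \<partial>L)" "(\<lambda>n. \<integral>x. Im (f x) \<partial>(N n)) \<longlonglongrightarrow> (\<integral>x. Im (f x) \<partial>L)"
    using w f(1) unfolding weakly_converges_def by (auto intro: continuous_intros)
  then show ?thesis
    unfolding tendsto_complex_iff using integral_Re[OF i[OF N(1)]] integral_Im[OF i[OF N(1)]] integral_Re[OF i[OF N(2)]] integral_Im[OF i[OF N(2)]]
    by simp
qed

lemma weakly_converges_cauchy_transform2:
  assumes w: "weakly_converges N L" and N: "\<And>n. borel_prob (N n)" "borel_prob L"
    and z: "Im z \<noteq> 0" "Im w \<noteq> 0"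
  shows "(\<lambda>n. cauchy_transform2 (N n) z w) \<longlonglongrightarrow> cauchy_transform2 L z w"
  unfolding cauchy_transform2_eq(1)
proof (rule weakly_converges_complex[OF w N])
  show "continuous_on UNIV (\<lambda>x. 1 / (w - complex_of_real (snd x)) / (z - complex_of_real (fst x)))"
    by (intro continuous_intros) (use sub_real_nonzero z in auto)
  show "norm (1 / (w - complex_of_real (snd x)) / (z - complex_of_real (fst x))) \<le> 1 / (\<bar>Im z\<bar> * \<bar>Im w\<bar>)" for x
    by (rule norm_resolvent2_le[OF z])
qed

lemma weakly_converges_marginal1:
  assumes w: "weakly_converges N L" and N: "\<And>n. borel_prob (N n)" "borel_prob L"
  shows "weakly_converges (\<lambda>n. marginal1 (N n)) (marginal1 L)"
  unfolding weakly_converges_def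
proof (intro allI impI)
  fix f :: "real \<Rightarrow> real" assume f: "continuous_on UNIV f" "bounded (range f)"
  have fm: "f \<in> borel_measurable borel" by (rule borel_measurable_continuous_onI[OF f(1)])
  have "continuous_on UNIV (\<lambda>p :: real \<times> real. f (fst p))"
    by (rule continuous_on_compose2[OF f(1)]) (auto intro: continuous_intros)
  moreover have "bounded (range (\<lambda>p :: real \<times> real. f (fst p)))"
    by (rule bounded_subset[OF f(2)]) auto
  ultimately show "(\<lambda>n. \<integral>x. f x \<partial>marginal1 (N n)) \<longlonglongrightarrow> (\<integral>x. f x \<partial>marginal1 L)"
    using w unfolding integral_marginal1[OF N(1) fm] integral_marginal1[OF N(2) fm] weakly_converges_def by blast
qed

lemma weakly_converges_swap:
  assumes w: "weakly_converges N L" and N: "\<And>n. borel_prob (N n)" "borel_prob L"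
  shows "weakly_converges (\<lambda>n. swap_law (N n)) (swap_law L)"
  unfolding weakly_converges_def
proof (intro allI impI)
  fix f :: "real \<times> real \<Rightarrow> real" assume f: "continuous_on UNIV f" "bounded (range f)"
  have fm: "f \<in> borel_measurable borel" by (rule borel_measurable_continuous_onI[OF f(1)])
  have "continuous_on UNIV (\<lambda>p. f (prod.swap p))"
    by (rule continuous_on_compose2[OF f(1) continuous_on_swap]) auto
  moreover have "bounded (range (\<lambda>p. f (prod.swap p)))"
    by (rule bounded_subset[OF f(2)]) auto
  ultimately show "(\<lambda>n. \<integral>x. f x \<partial>swap_law (N n)) \<longlonglongrightarrow> (\<integral>x. f x \<partial>swap_law L)"
    using w unfolding integral_swap_law[OF N(1) fm] integral_swap_law[OF N(2) fm] weakly_converges_def by blast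
qed

lemma weakly_converges_cauchy_transform:
  assumes w: "weakly_converges N L" and N: "\<And>n. borel_prob (N n)" "borel_prob L"
    and z: "Im z \<noteq> 0"
  shows "(\<lambda>n. cauchy_transform (N n) z) \<longlonglongrightarrow> cauchy_transform L z"
  unfolding cauchy_transform_def
proof (rule weakly_converges_complex[OF w N])
  show "continuous_on UNIV (\<lambda>x. 1 / (z - complex_of_real x))"
    by (intro continuous_intros) (use sub_real_nonzero z in auto)
qed (rule norm_resolvent_le[OF z])

section \<open>Tails and uniqueness\<close>

text \<open>At \<zeta> = i y the real part of 1 - \<zeta> / (\<zeta> - t) is t^2 / (t^2 + y^2),
  which is at least 1/2 once |t| \<ge> y. Replacing i y by a nearby \<zeta> costs 2 \<epsilon>
  uniformly in t, and the integral of the expression is 1 - \<zeta> G(\<zeta>), of modulus at most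
  \<epsilon> by the prescribed value of G. Together this gives 2 (\<epsilon> + 2 \<epsilon>) = 6
  \<epsilon>.\<close>

lemma tail_bound_of_cauchy_transform:
  assumes m: "borel_prob m" and y: "y > 0" and \<epsilon>: "\<epsilon> \<le> 1/2"
    and \<zeta>: "norm (\<zeta> - \<i> * of_real y) \<le> \<epsilon> * y" and G: "cauchy_transform m \<zeta> = 1 / (\<i> * of_real y)"
  shows "measure m {x. y \<le> \<bar>x\<bar>} \<le> 6 * \<epsilon>"
proof -
  interpret prob_space m by (rule borel_probD(1)[OF m])
  have im: "Im \<zeta> \<ge> y / 2"
  proof -
    have "\<bar>Im \<zeta> - y\<bar> \<le> \<epsilon> * y" using abs_Im_le_cmod[of "\<zeta> - \<i> * of_real y"] \<zeta> by simp
    moreover have "\<epsilon> * y \<le> 1/2 * y" using \<epsilon> y by (intro mult_right_mono) auto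
    ultimately show ?thesis by linarith
  qed
  then have im0: "Im \<zeta> \<noteq> 0" using y by auto
  have \<epsilon>0: "\<epsilon> \<ge> 0"
    using order_trans[OF norm_ge_zero \<zeta>] y by (simp add: zero_le_mult_iff)
  have point: "indicator {x. y \<le> \<bar>x\<bar>} t / 2 \<le> Re (1 - \<zeta> * (1 / (\<zeta> - of_real t))) + 2 * \<epsilon>" for t :: real
  proof -
    let ?w = "\<i> * complex_of_real y"
    have n1: "\<zeta> - of_real t \<noteq> 0" "?w - of_real t \<noteq> 0"
      using sub_real_nonzero[OF im0] sub_real_nonzero[of ?w] y by auto
    have "t^2 + y^2 > 0" using y by (intro add_nonneg_pos) auto
    then have "indicator {x. y \<le> \<bar>x\<bar>} t / 2 \<le> t^2 / (t^2 + y^2)"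
      using power_mono[of y "\<bar>t\<bar>" 2] y by (auto simp: indicator_def divide_simps)
    also have "\<dots> = Re (1 - ?w * (1 / (?w - of_real t)))"
      using \<open>t^2 + y^2 > 0\<close> y by (simp add: Re_divide divide_simps power2_eq_square)
    also have "1 - ?w * (1 / (?w - of_real t)) = (1 - \<zeta> * (1 / (\<zeta> - of_real t)))
       + of_real t * (?w - \<zeta>) / ((\<zeta> - of_real t) * (?w - of_real t))"
      using n1 by (simp add: divide_simps) (simp add: algebra_simps)
    also have "Re \<dots> \<le> Re (1 - \<zeta> * (1 / (\<zeta> - of_real t))) + norm (of_real t * (?w - \<zeta>) / ((\<zeta> - of_real t) * (?w - of_real t)))"
      using complex_Re_le_cmod by simp
    also have "norm (of_real t * (?w - \<zeta>) / ((\<zeta> - of_real t) * (?w - of_real t))) \<le> 2 * \<epsilon>"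
    proof -
      have "\<bar>t\<bar> \<le> norm (?w - of_real t)"
        using abs_Re_le_cmod[of "?w - of_real t"] by simp
      then have 1: "\<bar>t\<bar> / norm (?w - of_real t) \<le> 1" by (simp add: divide_le_eq_1)
      have "y / 2 \<le> norm (\<zeta> - of_real t)"
        using abs_Im_le_norm_sub_real[of \<zeta> t] im by linarith
      then have "norm (?w - \<zeta>) / norm (\<zeta> - of_real t) \<le> (\<epsilon> * y) / (y / 2)"
        using \<zeta> y by (intro frac_le) (auto simp: norm_minus_commute order_trans[OF norm_ge_zero \<zeta>])
      also have "\<dots> = 2 * \<epsilon>" using y by simp
      finally have "norm (?w - \<zeta>) / norm (\<zeta> - of_real t) * (\<bar>t\<bar> / norm (?w - of_real t)) \<le> 2 * \<epsilon> * 1"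
        using 1 \<epsilon>0 by (intro mult_mono) auto
      then show ?thesis by (simp add: norm_mult norm_divide mult.commute)
    qed
    finally show ?thesis by simp
  qed
  have sm: "{x. y \<le> \<bar>x\<bar>} \<in> sets m"
    unfolding borel_probD(3)[OF m] by (intro borel_closed closed_Collect_le continuous_intros)
  have i: "integrable m (\<lambda>t. 1 / (\<zeta> - complex_of_real t))"
    by (rule integrable_resolvent[OF m im0])
  have hb: "has_bochner_integral m (\<lambda>t. Re (1 - \<zeta> * (1 / (\<zeta> - of_real t))) + 2 * \<epsilon>) (Re (1 - \<zeta> * cauchy_transform m \<zeta>) + 2 * \<epsilon>)"
  proof -
    have 1: "has_bochner_integral m (\<lambda>x. c) c" for c :: "'b::{banach, second_countable_topology}"
      by (simp add: has_bochner_integral_iff prob_space)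
    have "has_bochner_integral m (\<lambda>x. 1 / (\<zeta> - complex_of_real x)) (cauchy_transform m \<zeta>)"
      unfolding cauchy_transform_def by (rule has_bochner_integral_integrable[OF i])
    then show ?thesis
      by (intro has_bochner_integral_add has_bochner_integral_Re has_bochner_integral_diff has_bochner_integral_mult_right 1)
  qed
  have "measure m {x. y \<le> \<bar>x\<bar>} / 2 = (\<integral>t. indicator {x. y \<le> \<bar>x\<bar>} t / 2 \<partial>m)"
    using sm by simp
  also have "\<dots> \<le> (\<integral>t. Re (1 - \<zeta> * (1 / (\<zeta> - of_real t))) + 2 * \<epsilon> \<partial>m)"
  proof (rule integral_mono)
    show "integrable m (\<lambda>t. indicator {x. y \<le> \<bar>x\<bar>} t / 2 :: real)"
      using sm by (intro integrable_divide_zero integrable_real_indicator) (auto simp: emeasure_eq_measure)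
    show "integrable m (\<lambda>t. Re (1 - \<zeta> * (1 / (\<zeta> - of_real t))) + 2 * \<epsilon>)"
      using integrable.intros[OF hb] .
  qed (rule point)
  also have "\<dots> = Re (1 - \<zeta> * cauchy_transform m \<zeta>) + 2 * \<epsilon>"
    using has_bochner_integral_integral_eq[OF hb] .
  also have "\<dots> \<le> \<epsilon> + 2 * \<epsilon>"
  proof -
    have "1 - \<zeta> * cauchy_transform m \<zeta> = - (\<zeta> - \<i> * of_real y) / (\<i> * of_real y)"
      unfolding G using y by (simp add: field_simps)
    then have "norm (1 - \<zeta> * cauchy_transform m \<zeta>) = norm (\<zeta> - \<i> * of_real y) / y"
      using y by (simp only: norm_divide norm_minus_cancel norm_mult norm_ii norm_of_real mult_1_left abs_of_pos)
    also have "\<dots> \<le> \<epsilon>" using \<zeta> y by (simp add: divide_le_eq)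
    finally show ?thesis using complex_Re_le_cmod[of "1 - \<zeta> * cauchy_transform m \<zeta>"] by linarith
  qed
  finally show ?thesis by simp
qed

lemma measure_max_marginals_le:
  assumes N: "borel_prob N"
  shows "measure N {p. Y \<le> max \<bar>fst p\<bar> \<bar>snd p\<bar>}
    \<le> measure (marginal1 N) {x. Y \<le> \<bar>x\<bar>} + measure (marginal2 N) {x. Y \<le> \<bar>x\<bar>}"
proof -
  interpret prob_space N by (rule borel_probD(1)[OF N])
  have b: "{x :: real. Y \<le> \<bar>x\<bar>} \<in> sets borel"
    by (intro borel_closed closed_Collect_le continuous_intros)
  have s: "{p :: real \<times> real. Y \<le> \<bar>fst p\<bar>} \<in> sets N" "{p :: real \<times> real. Y \<le> \<bar>snd p\<bar>} \<in> sets N"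
    unfolding borel_probD(3)[OF N] by (intro borel_closed closed_Collect_le continuous_intros)+
  have "{p. Y \<le> max \<bar>fst p\<bar> \<bar>snd p\<bar>} = {p. Y \<le> \<bar>fst p\<bar>} \<union> {p :: real \<times> real. Y \<le> \<bar>snd p\<bar>}"
    by (auto simp: le_max_iff_disj)
  then have "measure N {p. Y \<le> max \<bar>fst p\<bar> \<bar>snd p\<bar>} \<le> measure N {p. Y \<le> \<bar>fst p\<bar>} + measure N {p. Y \<le> \<bar>snd p\<bar>}"
    using measure_Un_le[OF s] by simp
  also have "measure N {p. Y \<le> \<bar>fst p\<bar>} = measure (marginal1 N) {x. Y \<le> \<bar>x\<bar>}"
    unfolding marginal1_def using borel_probD(4)[OF N]
    by (subst measure_distr[OF measurable_coordinates(1)[OF N] b]) (simp add: vimage_def)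
  also have "measure N {p. Y \<le> \<bar>snd p\<bar>} = measure (marginal2 N) {x. Y \<le> \<bar>x\<bar>}"
    unfolding marginal2_def using borel_probD(4)[OF N]
    by (subst measure_distr[OF measurable_coordinates(2)[OF N] b]) (simp add: vimage_def)
  finally show ?thesis .
qed

section \<open>Uniqueness through smoothing by Cauchy densities\<close>

definition cauchy_density :: "real \<times> real \<Rightarrow> real" where
  "cauchy_density q = 1 / (pi^2 * ((1 + (fst q)^2) * (1 + (snd q)^2)))"

lemma continuous_cauchy_density: "continuous_on UNIV cauchy_density"
proof -
  have "(1 + x^2 :: real) \<noteq> 0" for x
    using add_pos_nonneg[of 1 "x^2"] by simp
  then show ?thesis unfolding cauchy_density_def by (intro continuous_intros) auto
qed

lemma cauchy_density_nonneg: "cauchy_density q \<ge> 0"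
  by (simp add: cauchy_density_def)

lemma has_bochner_integral_cauchy_density: "has_bochner_integral lborel cauchy_density 1"
proof -
  have i: "integrable (lborel \<Otimes>\<^sub>M lborel) cauchy_density"
  proof (rule integrable_lborel_product)
    show "norm (cauchy_density (x, y)) \<le> (1 / pi^2) / ((1 + x^2) * (1 + y^2))" for x y
      using cauchy_density_nonneg[of "(x, y)"] by (simp add: cauchy_density_def)
  qed (rule borel_measurable_continuous_onI[OF continuous_cauchy_density])
  have "(\<integral>q. cauchy_density q \<partial>(lborel \<Otimes>\<^sub>M lborel)) = (\<integral>y. \<integral>x. cauchy_density (x, y) \<partial>lborel \<partial>lborel)"
    using lborel_pair.integral_snd[of "\<lambda>x y. cauchy_density (x, y)"] i by simp
  also have "\<dots> = (\<integral>y. \<integral>x. (1 / pi^2 * (1 / (1 + y^2))) * (1 / (1 + x^2)) \<partial>lborel \<partial>lborel)"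
    by (simp add: cauchy_density_def mult_ac)
  also have "\<dots> = (\<integral>y. (1 / pi) * (1 / (1 + y^2)) \<partial>lborel)"
  proof (rule Bochner_Integration.integral_cong[OF refl])
    show "(\<integral>x. (1 / pi^2 * (1 / (1 + y^2))) * (1 / (1 + x^2)) \<partial>lborel) = (1 / pi) * (1 / (1 + y^2))" for y :: real
      unfolding integral_mult_right_zero integral_inverse_one_plus_square by (simp add: power2_eq_square)
  qed
  also have "\<dots> = 1"
    unfolding integral_mult_right_zero integral_inverse_one_plus_square by simp
  finally show ?thesis using i by (simp add: has_bochner_integral_iff lborel_prod)
qed

lemma lborel_integral_affine2:
  fixes F :: "real \<times> real \<Rightarrow> real"
  assumes [measurable]: "F \<in> borel_measurable borel" and c: "c > 0"
  shows "integrable lborel (\<lambda>x. F (p + c *\<^sub>R x)) \<longleftrightarrow> integrable lborel F"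
    "(\<integral>u. F u \<partial>lborel) = c^2 * (\<integral>x. F (p + c *\<^sub>R x) \<partial>lborel)"
proof -
  have [measurable]: "(\<lambda>x. p + c *\<^sub>R x) \<in> borel_measurable borel"
    by (intro borel_measurable_continuous_onI continuous_intros)
  have a: "lborel = density (distr lborel borel (\<lambda>x. p + c *\<^sub>R x)) (\<lambda>_. ennreal (c^2))"
    using lborel_affine[of c p] c by (simp add: power2_eq_square)
  have "integrable lborel F \<longleftrightarrow> integrable (distr lborel borel (\<lambda>x. p + c *\<^sub>R x)) (\<lambda>x. c^2 * F x)"
    by (subst a, subst integrable_density) (auto simp: real_scaleR_def)
  also have "\<dots> \<longleftrightarrow> integrable (distr lborel borel (\<lambda>x. p + c *\<^sub>R x)) F"
    using c by simp
  also have "\<dots> \<longleftrightarrow> integrable lborel (\<lambda>x. F (p + c *\<^sub>R x))"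
    by (rule integrable_distr_eq) auto
  finally show "integrable lborel (\<lambda>x. F (p + c *\<^sub>R x)) \<longleftrightarrow> integrable lborel F" by simp
  have "(\<integral>u. F u \<partial>lborel) = (\<integral>x. c^2 * F x \<partial>distr lborel borel (\<lambda>x. p + c *\<^sub>R x))"
    by (subst a, subst integral_density) (auto simp: real_scaleR_def)
  also have "\<dots> = c^2 * (\<integral>x. F (p + c *\<^sub>R x) \<partial>lborel)"
    by (subst integral_distr) auto
  finally show "(\<integral>u. F u \<partial>lborel) = c^2 * (\<integral>x. F (p + c *\<^sub>R x) \<partial>lborel)" .
qed


text \<open>In each variable \<epsilon> / (d^2 + \<epsilon>^2) is, up to the factor - 2 i, the jump
  of the resolvent between the heights \<epsilon> and - \<epsilon>. The planar kernel is thus a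
  combination of four products of resolvents.\<close>

lemma cauchy_density_eq_resolvents:
  assumes \<epsilon>: "\<epsilon> > 0"
  shows "complex_of_real (cauchy_density ((1 / \<epsilon>) *\<^sub>R (u - p)) / \<epsilon>^2) = - (1 / (4 * of_real (pi^2))) *
    ((1 / (of_real (fst u) + \<i> * of_real \<epsilon> - of_real (fst p)) - 1 / (of_real (fst u) - \<i> * of_real \<epsilon> - of_real (fst p)))
   * (1 / (of_real (snd u) + \<i> * of_real \<epsilon> - of_real (snd p)) - 1 / (of_real (snd u) - \<i> * of_real \<epsilon> - of_real (snd p))))"
proof -
  have r: "1 / (of_real x + j * of_real \<epsilon> - of_real s) - 1 / (of_real x - j * of_real \<epsilon> - of_real s)
    = - 2 * j * of_real (\<epsilon> / ((x - s)^2 + \<epsilon>^2))" if j: "j = \<i>" for x s and j :: complex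
  proof -
    have p: "(x - s)^2 + \<epsilon>^2 > 0" using \<epsilon> by (intro add_nonneg_pos) auto
    have ne: "of_real x + j * of_real \<epsilon> - complex_of_real s \<noteq> 0" "of_real x - j * of_real \<epsilon> - complex_of_real s \<noteq> 0"
      using \<epsilon> j by (auto simp: complex_eq_iff)
    have "(of_real x + j * of_real \<epsilon> - complex_of_real s) * (of_real x - j * of_real \<epsilon> - complex_of_real s) = of_real ((x - s)^2 + \<epsilon>^2)"
      using j by (simp add: complex_eq_iff power2_eq_square algebra_simps)
    moreover have "1 / (of_real x + j * of_real \<epsilon> - complex_of_real s) - 1 / (of_real x - j * of_real \<epsilon> - complex_of_real s)
      = - 2 * j * of_real \<epsilon> / ((of_real x + j * of_real \<epsilon> - complex_of_real s) * (of_real x - j * of_real \<epsilon> - complex_of_real s))"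
      using ne by (simp add: divide_simps)
    ultimately show ?thesis by simp
  qed
  have alg: "- (1 / (4 * P)) * ((- 2 * j * A) * (- 2 * j * B)) = A * B / P" if "j * j = -1" for j A B P :: complex
  proof -
    have h: "(- 2 * j * A) * (- 2 * j * B) = - 4 * (A * B)" using that by algebra
    show ?thesis unfolding h by simp
  qed
  have "cauchy_density ((1 / \<epsilon>) *\<^sub>R (u - p)) / \<epsilon>^2
    = (\<epsilon> / ((fst u - fst p)^2 + \<epsilon>^2)) * (\<epsilon> / ((snd u - snd p)^2 + \<epsilon>^2)) / pi^2"
  proof -
    have "1 / (1 + ((1 / \<epsilon>) * d)^2) = \<epsilon>^2 / (d^2 + \<epsilon>^2)" for d
    proof -
      have "1 + ((1 / \<epsilon>) * d)^2 = (d^2 + \<epsilon>^2) / \<epsilon>^2"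
        using \<epsilon> by (simp add: power_divide add_divide_distrib)
      then show ?thesis by simp
    qed
    note d = this
    have "1 / (P * (X * Y)) = (1 / X) * (1 / Y) / P" for P X Y :: real by simp
    then have "cauchy_density ((1 / \<epsilon>) *\<^sub>R (u - p)) = (\<epsilon>^2 / ((fst u - fst p)^2 + \<epsilon>^2)) * (\<epsilon>^2 / ((snd u - snd p)^2 + \<epsilon>^2)) / pi^2"
      unfolding cauchy_density_def fst_scaleR snd_scaleR fst_diff snd_diff real_scaleR_def by (simp only: d)
    then show ?thesis using \<epsilon> by (simp add: power2_eq_square)
  qed
  then show ?thesis
    unfolding r[OF refl] alg[OF i_squared] by simp
qed

lemma integral_cauchy_density_shift:
  assumes \<mu>: "borel_prob \<mu>" and \<epsilon>: "\<epsilon> > 0"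
  shows "complex_of_real (\<integral>p. cauchy_density ((1 / \<epsilon>) *\<^sub>R (u - p)) / \<epsilon>^2 \<partial>\<mu>) = - (1 / (4 * of_real (pi^2))) *
    ((cauchy_transform2 \<mu> (of_real (fst u) + \<i> * of_real \<epsilon>) (of_real (snd u) + \<i> * of_real \<epsilon>)
      - cauchy_transform2 \<mu> (of_real (fst u) - \<i> * of_real \<epsilon>) (of_real (snd u) + \<i> * of_real \<epsilon>))
    - (cauchy_transform2 \<mu> (of_real (fst u) + \<i> * of_real \<epsilon>) (of_real (snd u) - \<i> * of_real \<epsilon>)
      - cauchy_transform2 \<mu> (of_real (fst u) - \<i> * of_real \<epsilon>) (of_real (snd u) - \<i> * of_real \<epsilon>)))"
proof -
  let ?z = "complex_of_real (fst u) + \<i> * of_real \<epsilon>" and ?w = "complex_of_real (snd u) + \<i> * of_real \<epsilon>"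
  let ?z' = "complex_of_real (fst u) - \<i> * of_real \<epsilon>" and ?w' = "complex_of_real (snd u) - \<i> * of_real \<epsilon>"
  let ?k = "\<lambda>z w p. 1 / (w - complex_of_real (snd p)) / (z - complex_of_real (fst p))"
  have h: "has_bochner_integral \<mu> (?k z w) (cauchy_transform2 \<mu> z w)" if "Im z \<noteq> 0" "Im w \<noteq> 0" for z w
    unfolding cauchy_transform2_eq(1)
    by (rule has_bochner_integral_integrable[OF integrable_resolvent2[OF \<mu> that]])
  have "has_bochner_integral \<mu> (\<lambda>p. - (1 / (4 * of_real (pi^2))) * ((?k ?z ?w p - ?k ?z' ?w p) - (?k ?z ?w' p - ?k ?z' ?w' p)))
    (- (1 / (4 * of_real (pi^2))) *
    ((cauchy_transform2 \<mu> ?z ?w - cauchy_transform2 \<mu> ?z' ?w) - (cauchy_transform2 \<mu> ?z ?w' - cauchy_transform2 \<mu> ?z' ?w')))"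
    using \<epsilon> by (intro has_bochner_integral_mult_right has_bochner_integral_diff h) auto
  moreover have "- (1 / (4 * of_real (pi^2))) * ((?k ?z ?w p - ?k ?z' ?w p) - (?k ?z ?w' p - ?k ?z' ?w' p))
    = complex_of_real (cauchy_density ((1 / \<epsilon>) *\<^sub>R (u - p)) / \<epsilon>^2)" for p
  proof -
    have "(1 / b / a - 1 / b / a') - (1 / b' / a - 1 / b' / a') = (1 / a - 1 / a') * (1 / b - 1 / b')" for a b a' b' :: complex
      by (simp add: algebra_simps)
    then show ?thesis unfolding cauchy_density_eq_resolvents[OF \<epsilon>] by (simp only:)
  qed
  ultimately show ?thesis
    by (simp only: has_bochner_integral_iff integral_complex_of_real)
qed

text \<open>The convolution of a law with the scaled Cauchy density depends on its transform alone,
  by \<open>integral_cauchy_density_shift\<close>. Fubini moves the smoothing onto the test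
  function, which converges pointwise and boundedly back to f as \<epsilon> tends to 0.\<close>

lemma cauchy_transform2_determines:
  fixes f :: "real \<times> real \<Rightarrow> real"
  assumes \<mu>: "borel_prob \<mu>" "borel_prob \<nu>"
    and eq: "\<And>z w. Im z \<noteq> 0 \<Longrightarrow> Im w \<noteq> 0 \<Longrightarrow> cauchy_transform2 \<mu> z w = cauchy_transform2 \<nu> z w"
    and f: "continuous_on UNIV f" and bf: "\<And>x. norm (f x) \<le> B"
  shows "(\<integral>x. f x \<partial>\<mu>) = (\<integral>x. f x \<partial>\<nu>)"
proof -
  have fm [measurable]: "f \<in> borel_measurable borel" by (rule borel_measurable_continuous_onI[OF f])
  note [measurable] = borel_measurable_continuous_onI[OF continuous_cauchy_density]
  have B: "B \<ge> 0" using order_trans[OF norm_ge_zero bf] .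
  have kd: "integrable lborel cauchy_density" "(\<integral>q. cauchy_density q \<partial>lborel) = 1"
    using has_bochner_integral_cauchy_density by (auto simp: has_bochner_integral_iff)
  define K where "K \<epsilon> u p = cauchy_density ((1 / \<epsilon>) *\<^sub>R (u - p)) / \<epsilon>^2" for \<epsilon> :: real and u p
  define g where "g \<epsilon> p = (\<integral>u. f u * K \<epsilon> u p \<partial>lborel)" for \<epsilon> p
  have K0: "K \<epsilon> u p \<ge> 0" for \<epsilon> u p unfolding K_def using cauchy_density_nonneg by simp
  have Km: "(\<lambda>u. K \<epsilon> u p) \<in> borel_measurable borel" if "\<epsilon> > 0" for \<epsilon> p
    unfolding K_def using that by (intro borel_measurable_continuous_onI continuous_intros continuous_on_compose2[OF continuous_cauchy_density]) auto
  have Km2: "(\<lambda>x. f (snd x) * K \<epsilon> (snd x) (fst x)) \<in> borel_measurable borel" if "\<epsilon> > 0" for \<epsilon>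
    unfolding K_def using that
    by (intro borel_measurable_continuous_onI continuous_intros continuous_on_compose2[OF continuous_cauchy_density] continuous_on_compose2[OF f]) auto
  have Ki: "integrable lborel (\<lambda>u. K \<epsilon> u p)" "(\<integral>u. K \<epsilon> u p \<partial>lborel) = 1" if \<epsilon>: "\<epsilon> > 0" for \<epsilon> p
  proof -
    have e: "K \<epsilon> (p + \<epsilon> *\<^sub>R q) p = cauchy_density q / \<epsilon>^2" for q
      using \<epsilon> by (simp add: K_def)
    show "integrable lborel (\<lambda>u. K \<epsilon> u p)"
      using lborel_integral_affine2(1)[OF Km[OF \<epsilon>, of p] \<epsilon>, of p] kd unfolding e by simp
    show "(\<integral>u. K \<epsilon> u p \<partial>lborel) = 1"
      using lborel_integral_affine2(2)[OF Km[OF \<epsilon>, of p] \<epsilon>, of p] kd \<epsilon> unfolding e by simp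
  qed
  \<comment> \<open>The substitution u = p + \<epsilon> q moves \<epsilon> from the kernel into the
    argument of f, so that dominated convergence has a fixed majorant.\<close>
  have g_eq: "g \<epsilon> p = (\<integral>q. f (p + \<epsilon> *\<^sub>R q) * cauchy_density q \<partial>lborel)" if \<epsilon>: "\<epsilon> > 0" for \<epsilon> p
  proof -
    have "(\<lambda>u. f u * K \<epsilon> u p) \<in> borel_measurable borel" using Km[OF \<epsilon>] fm by measurable
    from lborel_integral_affine2(2)[OF this \<epsilon>, of p]
    have "g \<epsilon> p = \<epsilon>^2 * (\<integral>q. f (p + \<epsilon> *\<^sub>R q) * K \<epsilon> (p + \<epsilon> *\<^sub>R q) p \<partial>lborel)"
      unfolding g_def .
    also have "\<dots> = \<epsilon>^2 * (\<integral>q. (f (p + \<epsilon> *\<^sub>R q) * cauchy_density q) / \<epsilon>^2 \<partial>lborel)"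
      using \<epsilon> by (simp add: K_def)
    also have "\<dots> = (\<integral>q. f (p + \<epsilon> *\<^sub>R q) * cauchy_density q \<partial>lborel)"
      using \<epsilon> by simp
    finally show ?thesis .
  qed
  have fK: "norm (f u * K \<epsilon> u p) \<le> B * K \<epsilon> u p" for \<epsilon> u p
    using mult_right_mono[OF bf K0] K0 by (simp add: abs_mult)
  have fKi: "integrable lborel (\<lambda>u. f u * K \<epsilon> u p)" if "\<epsilon> > 0" for \<epsilon> p
    by (rule Bochner_Integration.integrable_bound[OF integrable_mult_right[OF Ki(1)[OF that, of p], of B]])
       (use Km[OF that] fm fK B K0 in \<open>auto intro!: borel_measurable_times\<close>)
  have gb: "norm (g \<epsilon> p) \<le> B" if "\<epsilon> > 0" for \<epsilon> p
  proof -
    have "norm (g \<epsilon> p) \<le> (\<integral>u. norm (f u * K \<epsilon> u p) \<partial>lborel)" unfolding g_def by (rule integral_norm_bound)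
    also have "\<dots> \<le> (\<integral>u. B * K \<epsilon> u p \<partial>lborel)"
      by (intro integral_mono integrable_norm fKi that integrable_mult_right Ki fK)
    finally show ?thesis using Ki(2)[OF that] by simp
  qed
  have swap: "(\<integral>p. g \<epsilon> p \<partial>M) = (\<integral>u. f u * (\<integral>p. K \<epsilon> u p \<partial>M) \<partial>lborel)" and gm: "g \<epsilon> \<in> borel_measurable M"
    if \<epsilon>: "\<epsilon> > 0" and M: "borel_prob M" for \<epsilon> and M :: "(real \<times> real) measure"
  proof -
    interpret M: prob_space M by (rule borel_probD(1)[OF M])
    interpret P: pair_sigma_finite M lborel ..
    have "sets (M \<Otimes>\<^sub>M (lborel :: (real \<times> real) measure)) = sets (borel \<Otimes>\<^sub>M borel)"
      by (rule sets_pair_measure_cong[OF borel_probD(3)[OF M] sets_lborel])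
    then have sets: "sets (M \<Otimes>\<^sub>M (lborel :: (real \<times> real) measure)) = sets borel"
      by (simp only: borel_prod)
    have m: "(\<lambda>(p, u). f u * K \<epsilon> u p) \<in> borel_measurable (M \<Otimes>\<^sub>M lborel)"
      using Km2[OF \<epsilon>] by (simp add: measurable_cong_sets[OF sets refl] case_prod_beta')
    show gm: "g \<epsilon> \<in> borel_measurable M"
      unfolding g_def using lborel.borel_measurable_lebesgue_integral[OF m] .
    have "integrable (M \<Otimes>\<^sub>M lborel) (\<lambda>(p, u). f u * K \<epsilon> u p)"
    proof (rule P.Fubini_integrable[OF m])
      have m': "(\<lambda>(p, u). norm (f u * K \<epsilon> u p)) \<in> borel_measurable (M \<Otimes>\<^sub>M lborel)"
        using m by (simp add: case_prod_beta')
      show "integrable M (\<lambda>p. \<integral>u. norm (case (p, u) of (p, u) \<Rightarrow> f u * K \<epsilon> u p) \<partial>lborel)"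
      proof (rule M.integrable_const_bound)
        show "(\<lambda>p. \<integral>u. norm (case (p, u) of (p, u) \<Rightarrow> f u * K \<epsilon> u p) \<partial>lborel) \<in> borel_measurable M"
          using lborel.borel_measurable_lebesgue_integral[OF m'] by simp
        have "(\<integral>u. norm (f u * K \<epsilon> u p) \<partial>lborel) \<le> B" for p
        proof -
          have "(\<integral>u. norm (f u * K \<epsilon> u p) \<partial>lborel) \<le> (\<integral>u. B * K \<epsilon> u p \<partial>lborel)"
            by (intro integral_mono integrable_norm fKi \<epsilon> integrable_mult_right Ki fK)
          then show ?thesis using Ki(2)[OF \<epsilon>] by simp
        qed
        then show "AE p in M. norm (\<integral>u. norm (case (p, u) of (p, u) \<Rightarrow> f u * K \<epsilon> u p) \<partial>lborel) \<le> B"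
          by (auto simp: abs_of_nonneg[OF integral_nonneg_AE])
      qed
      show "AE p in M. integrable lborel (\<lambda>u. case (p, u) of (p, u) \<Rightarrow> f u * K \<epsilon> u p)"
        using fKi[OF \<epsilon>] by simp
    qed
    from P.Fubini_integral[OF this] show "(\<integral>p. g \<epsilon> p \<partial>M) = (\<integral>u. f u * (\<integral>p. K \<epsilon> u p \<partial>M) \<partial>lborel)"
      unfolding g_def by simp
  qed
  have Keq: "(\<integral>p. K \<epsilon> u p \<partial>\<mu>) = (\<integral>p. K \<epsilon> u p \<partial>\<nu>)" if \<epsilon>: "\<epsilon> > 0" for \<epsilon> u
  proof -
    have "complex_of_real (\<integral>p. K \<epsilon> u p \<partial>\<mu>) = complex_of_real (\<integral>p. K \<epsilon> u p \<partial>\<nu>)"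
      unfolding K_def integral_cauchy_density_shift[OF \<mu>(1) \<epsilon>] integral_cauchy_density_shift[OF \<mu>(2) \<epsilon>]
      using \<epsilon> by (simp add: eq)
    then show ?thesis by simp
  qed
  define e where "e n = 1 / (real n + 1)" for n
  have e: "e n > 0" for n by (simp add: e_def add_nonneg_pos)
  have glim: "(\<lambda>n. g (e n) p) \<longlonglongrightarrow> f p" for p
  proof -
    have "(\<lambda>n. \<integral>q. f (p + e n *\<^sub>R q) * cauchy_density q \<partial>lborel) \<longlonglongrightarrow> (\<integral>q. f p * cauchy_density q \<partial>lborel)"
    proof (rule integral_dominated_convergence[where w="\<lambda>q. B * cauchy_density q"])
      show "integrable lborel (\<lambda>q. B * cauchy_density q)" using kd by simp
      show "AE q in lborel. (\<lambda>n. f (p + e n *\<^sub>R q) * cauchy_density q) \<longlonglongrightarrow> f p * cauchy_density q"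
      proof (rule AE_I2)
        fix q :: "real \<times> real"
        have "e \<longlonglongrightarrow> 0" unfolding e_def by real_asymp
        then have "(\<lambda>n. p + e n *\<^sub>R q) \<longlonglongrightarrow> p + 0 *\<^sub>R q" by (intro tendsto_intros)
        then have "(\<lambda>n. f (p + e n *\<^sub>R q)) \<longlonglongrightarrow> f p"
          using f by (intro continuous_on_tendsto_compose[OF f]) auto
        then show "(\<lambda>n. f (p + e n *\<^sub>R q) * cauchy_density q) \<longlonglongrightarrow> f p * cauchy_density q"
          by (intro tendsto_intros)
      qed
      show "AE q in lborel. norm (f (p + e n *\<^sub>R q) * cauchy_density q) \<le> B * cauchy_density q" for n
        using mult_right_mono[OF bf cauchy_density_nonneg] cauchy_density_nonneg by (simp add: abs_mult)
      have "(\<lambda>q. f (p + e n *\<^sub>R q) * cauchy_density q) \<in> borel_measurable borel" for n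
        by (intro borel_measurable_continuous_onI continuous_intros continuous_on_compose2[OF f] continuous_cauchy_density) auto
      then show "(\<lambda>q. f (p + e n *\<^sub>R q) * cauchy_density q) \<in> borel_measurable lborel" for n
        by simp
    qed measurable
    then show ?thesis using kd(2) by (simp add: g_eq[OF e])
  qed
  have lim: "(\<lambda>n. \<integral>p. g (e n) p \<partial>M) \<longlonglongrightarrow> (\<integral>p. f p \<partial>M)" if M: "borel_prob M" for M
  proof (rule integral_dominated_convergence[where w="\<lambda>_. B"])
    show "integrable M (\<lambda>_. B)" using borel_probD(2)[OF M] by (simp add: finite_measure.integrable_const)
    show "f \<in> borel_measurable M" using fm by (simp add: measurable_borel_prob[OF M])
  qed (use glim gb e gm[OF e M] in auto)
  have "(\<integral>p. g (e n) p \<partial>\<mu>) = (\<integral>p. g (e n) p \<partial>\<nu>)" for n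
    unfolding swap[OF e \<mu>(1)] swap[OF e \<mu>(2)] Keq[OF e] ..
  then have "(\<lambda>n. \<integral>p. g (e n) p \<partial>\<mu>) \<longlonglongrightarrow> (\<integral>p. f p \<partial>\<nu>)" using lim[OF \<mu>(2)] by simp
  then show ?thesis using lim[OF \<mu>(1)] LIMSEQ_unique by blast
qed

section \<open>Compound Poisson laws with bounded jumps\<close>

lemma AE_marginal1:
  assumes "borel_prob \<mu>" "AE p in \<mu>. \<bar>fst p\<bar> \<le> M"
  shows "AE x in marginal1 \<mu>. \<bar>x\<bar> \<le> M"
  unfolding marginal1_def using assms
  by (subst AE_distr_iff[OF measurable_coordinates(1)]) (auto intro!: borel_closed closed_Collect_le continuous_intros)

lemma AE_marginal2:
  assumes "borel_prob \<mu>" "AE p in \<mu>. \<bar>snd p\<bar> \<le> M"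
  shows "AE x in marginal2 \<mu>. \<bar>x\<bar> \<le> M"
  unfolding marginal2_def using assms
  by (subst AE_distr_iff[OF measurable_coordinates(2)]) (auto intro!: borel_closed closed_Collect_le continuous_intros)

lemma marginal2_swap: "borel_prob \<mu> \<Longrightarrow> marginal2 (swap_law \<mu>) = marginal1 \<mu>"
  unfolding marginal1_def marginal2_def swap_law_def
  using measurable_snd_real borel_measurable_swap
  by (subst distr_distr) (auto simp: comp_def measurable_borel_prob)

lemma borel_measurable_real_resolvent:
  "(\<lambda>p :: real \<times> real. complex_of_real (fst p) / (F - of_real (fst p))) \<in> borel_measurable borel"
  "(\<lambda>p :: real \<times> real. complex_of_real (snd p) / (W - of_real (snd p))) \<in> borel_measurable borel"
proof -
  note [measurable] = measurable_fst_real measurable_snd_real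
  show "(\<lambda>p :: real \<times> real. complex_of_real (fst p) / (F - of_real (fst p))) \<in> borel_measurable borel"
    "(\<lambda>p :: real \<times> real. complex_of_real (snd p) / (W - of_real (snd p))) \<in> borel_measurable borel"
    by measurable
qed

lemma joint_E_swap:
  assumes "borel_prob \<mu>"
  shows "joint_E r (swap_law \<mu>) W F = joint_E r \<mu> F W"
  unfolding joint_E_def
  by (subst integral_swap_law[OF assms], intro borel_measurable_times borel_measurable_real_resolvent)
     (simp add: mult.commute)

text \<open>With s / (F - s) = F / (F - s) - 1 in both variables the product multiplies out into
  resolvents. Holomorphy and continuity of E are inherited from the Cauchy transforms through this
  formula.\<close>

lemma joint_E_eq:
  assumes \<mu>: "borel_prob \<mu>" and F: "Im F \<noteq> 0" and W: "Im W \<noteq> 0"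
  shows "joint_E r \<mu> F W = of_real r * (F * W * cauchy_transform2 \<mu> F W
    - F * cauchy_transform (marginal1 \<mu>) F - W * cauchy_transform (marginal2 \<mu>) W + 1)"
proof -
  let ?a = "\<lambda>p :: real \<times> real. 1 / (F - complex_of_real (fst p))"
  let ?b = "\<lambda>p :: real \<times> real. 1 / (W - complex_of_real (snd p))"
  have 1: "has_bochner_integral \<mu> (\<lambda>p. 1 / (W - complex_of_real (snd p)) / (F - complex_of_real (fst p))) (cauchy_transform2 \<mu> F W)"
    unfolding cauchy_transform2_eq(1) by (rule has_bochner_integral_integrable[OF integrable_resolvent2[OF \<mu> F W]])
  have 2: "has_bochner_integral \<mu> ?a (cauchy_transform (marginal1 \<mu>) F)"
    unfolding cauchy_transform_marginal1[OF \<mu>]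
    by (rule has_bochner_integral_integrable[OF integrable_resolvent_coordinates(1)[OF \<mu> F]])
  have 3: "has_bochner_integral \<mu> ?b (cauchy_transform (marginal2 \<mu>) W)"
    unfolding cauchy_transform_marginal2[OF \<mu>]
    by (rule has_bochner_integral_integrable[OF integrable_resolvent_coordinates(2)[OF \<mu> W]])
  have 4: "has_bochner_integral \<mu> (\<lambda>_. 1 :: complex) 1"
    using borel_probD(2,5)[OF \<mu>] by (simp add: has_bochner_integral_iff finite_measure.integrable_const)
  have h: "has_bochner_integral \<mu> (\<lambda>p. F * W * (1 / (W - complex_of_real (snd p)) / (F - complex_of_real (fst p))) - F * ?a p - W * ?b p + 1)
    (F * W * cauchy_transform2 \<mu> F W - F * cauchy_transform (marginal1 \<mu>) F - W * cauchy_transform (marginal2 \<mu>) W + 1)"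
    by (intro has_bochner_integral_add has_bochner_integral_diff has_bochner_integral_mult_right 1 2 3 4)
  have "F * W * (1 / (W - complex_of_real (snd p)) / (F - complex_of_real (fst p))) - F * ?a p - W * ?b p + 1
    = (of_real (fst p) / (F - of_real (fst p))) * (of_real (snd p) / (W - of_real (snd p)))" for p
    using sub_real_nonzero[OF F, of "fst p"] sub_real_nonzero[OF W, of "snd p"]
    by (simp add: divide_simps) (simp add: algebra_simps)
  with has_bochner_integral_integral_eq[OF h] show ?thesis unfolding joint_E_def by simp
qed

lemma cauchy_transform2_continuous:
  assumes \<mu>: "borel_prob \<mu>"
  shows "continuous_on ((- \<real>) \<times> (- \<real>)) (\<lambda>p. cauchy_transform2 \<mu> (fst p) (snd p))"
proof (rule continuous_on_sequentiallyI)
  fix u :: "nat \<Rightarrow> complex \<times> complex" and a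
  assume u: "\<forall>n. u n \<in> (- \<real>) \<times> (- \<real>)" and a: "a \<in> (- \<real>) \<times> (- \<real>)" and lim: "u \<longlonglongrightarrow> a"
  have a0: "Im (fst a) \<noteq> 0" "Im (snd a) \<noteq> 0" using a by (auto simp: complex_is_Real_iff)
  have "(\<lambda>n. cauchy_transform2 \<mu> (fst (u n)) (snd (u n)) - cauchy_transform2 \<mu> (fst a) (snd a)) \<longlonglongrightarrow> 0"
    by (rule cauchy_transform2_equicontinuous[OF \<mu> tendsto_fst[OF lim] tendsto_snd[OF lim] a0])
  then show "(\<lambda>n. cauchy_transform2 \<mu> (fst (u n)) (snd (u n))) \<longlonglongrightarrow> cauchy_transform2 \<mu> (fst a) (snd a)"
    by (simp add: LIM_zero_iff)
qed

lemma joint_E_holomorphic1: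
  assumes \<mu>: "borel_prob \<mu>" and W: "Im W \<noteq> 0"
  shows "(\<lambda>F. joint_E r \<mu> F W) holomorphic_on - \<real>"
proof -
  have "(\<lambda>F. of_real r * (F * W * cauchy_transform2 \<mu> F W
    - F * cauchy_transform (marginal1 \<mu>) F - W * cauchy_transform (marginal2 \<mu>) W + 1)) holomorphic_on - \<real>"
    by (intro holomorphic_intros cauchy_transform2_holomorphic1 cauchy_transform_holomorphic \<mu> W borel_prob_marginal)
  then show ?thesis
    by (rule holomorphic_transform) (use joint_E_eq[OF \<mu> _ W] in \<open>simp add: nonreal_iff\<close>)
qed

lemma joint_E_holomorphic2:
  assumes \<mu>: "borel_prob \<mu>" and F: "Im F \<noteq> 0"
  shows "joint_E r \<mu> F holomorphic_on - \<real>"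
  using joint_E_holomorphic1[OF borel_prob_swap[OF \<mu>] F, of r] by (simp add: joint_E_swap[OF \<mu>])

lemma joint_E_continuous:
  assumes \<mu>: "borel_prob \<mu>"
  shows "continuous_on ((- \<real>) \<times> (- \<real>)) (\<lambda>p. joint_E r \<mu> (fst p) (snd p))"
proof -
  have c: "continuous_on ((- \<real>) \<times> (- \<real>)) (\<lambda>p. cauchy_transform m (fst p))"
    "continuous_on ((- \<real>) \<times> (- \<real>)) (\<lambda>p. cauchy_transform m (snd p))" if "borel_prob m" for m
    by (rule continuous_on_compose2[OF holomorphic_on_imp_continuous_on[OF cauchy_transform_holomorphic[OF that]]];
        auto intro: continuous_intros)+
  have "continuous_on ((- \<real>) \<times> (- \<real>)) (\<lambda>p. of_real r * (fst p * snd p * cauchy_transform2 \<mu> (fst p) (snd p)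
    - fst p * cauchy_transform (marginal1 \<mu>) (fst p) - snd p * cauchy_transform (marginal2 \<mu>) (snd p) + 1))"
    by (intro continuous_intros cauchy_transform2_continuous[OF \<mu>] c borel_prob_marginal[OF \<mu>])
  then show ?thesis
    by (rule continuous_on_cong[THEN iffD1, rotated -1]) (use joint_E_eq[OF \<mu>] in \<open>auto simp: complex_is_Real_iff\<close>)
qed

lemma joint_E_cnj: "joint_E r \<mu> (cnj F) (cnj W) = cnj (joint_E r \<mu> F W)"
  unfolding joint_E_def by (simp flip: Bochner_Integration.integral_cnj)

text \<open>In contrast to \<open>norm_joint_E_le\<close>, the second factor is estimated through
  the bound on the jumps. The result decays as W moves away from the real axis with F fixed, which
  is what isolates the first marginal.\<close>

lemma norm_joint_E_le_Im:
  assumes \<mu>: "borel_prob \<mu>" and r: "r \<ge> 0" and M: "AE p in \<mu>. \<bar>snd p\<bar> \<le> M" and F: "Im F \<noteq> 0" and W: "Im W \<noteq> 0"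
  shows "norm (joint_E r \<mu> F W) \<le> r * (1 + norm F / \<bar>Im F\<bar>) * M / \<bar>Im W\<bar>"
proof -
  let ?f = "\<lambda>p :: real \<times> real. (of_real (fst p) / (F - of_real (fst p))) * (of_real (snd p) / (W - of_real (snd p)))"
  have "norm (\<integral>p. ?f p \<partial>\<mu>) \<le> (\<integral>p. norm (?f p) \<partial>\<mu>)" by (rule integral_norm_bound)
  also have "\<dots> \<le> (\<integral>p. (1 + norm F / \<bar>Im F\<bar>) * (M * (1 / \<bar>Im W\<bar>)) \<partial>\<mu>)"
  proof (rule integral_mono_AE)
    show "integrable \<mu> (\<lambda>p. norm (?f p))"
    proof (rule integrable_norm, rule integrable_bounded_prob[OF \<mu>])
      show "norm (?f p) \<le> (1 + norm F / \<bar>Im F\<bar>) * (1 + norm W / \<bar>Im W\<bar>)" for p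
        unfolding norm_mult by (intro mult_mono norm_real_resolvent_le F W) auto
    qed (intro borel_measurable_times borel_measurable_real_resolvent)
    show "integrable \<mu> (\<lambda>p. (1 + norm F / \<bar>Im F\<bar>) * (M * (1 / \<bar>Im W\<bar>)))"
      using borel_probD(2)[OF \<mu>] by (simp add: finite_measure.integrable_const)
    show "AE p in \<mu>. norm (?f p) \<le> (1 + norm F / \<bar>Im F\<bar>) * (M * (1 / \<bar>Im W\<bar>))"
      using M
    proof eventually_elim
      case (elim p)
      have "norm (complex_of_real (snd p) * (1 / (W - of_real (snd p)))) \<le> M * (1 / \<bar>Im W\<bar>)"
        unfolding norm_mult using elim by (intro mult_mono norm_resolvent_le W) auto
      then show ?case
        unfolding norm_mult by (intro mult_mono norm_real_resolvent_le F) (auto simp: norm_mult norm_divide)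
    qed
  qed
  also have "\<dots> = (1 + norm F / \<bar>Im F\<bar>) * (M * (1 / \<bar>Im W\<bar>))" using borel_probD(5)[OF \<mu>] by simp
  finally have "r * norm (\<integral>p. ?f p \<partial>\<mu>) \<le> r * ((1 + norm F / \<bar>Im F\<bar>) * (M * (1 / \<bar>Im W\<bar>)))"
    using r by (rule mult_left_mono)
  then show ?thesis unfolding joint_E_def norm_mult using r by (simp add: mult.assoc)
qed

section \<open>Subordination functions for bounded jumps\<close>

locale bounded_jumps =
  fixes r M :: real and \<mu> :: "(real \<times> real) measure"
  assumes \<mu>: "borel_prob \<mu>" and r: "r \<ge> 0" and M: "M \<ge> 0"
    and M1: "AE p in \<mu>. \<bar>fst p\<bar> \<le> M" and M2: "AE p in \<mu>. \<bar>snd p\<bar> \<le> M"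
begin

abbreviation "m1 \<equiv> marginal1 \<mu>"
abbreviation "m2 \<equiv> marginal2 \<mu>"

lemma m12: "borel_prob m1" "borel_prob m2"
  using borel_prob_marginal[OF \<mu>] .

lemma inverse1: "\<exists>\<Phi>. \<Phi> holomorphic_on - \<real> \<and> (\<forall>\<zeta>. Im \<zeta> \<noteq> 0 \<longrightarrow> Im (\<Phi> \<zeta>) * Im \<zeta> > 0 \<and> poisson_H r m1 (\<Phi> \<zeta>) = \<zeta>)
     \<and> (\<forall>F. Im F * Im (poisson_H r m1 F) > 0 \<longrightarrow> \<Phi> (poisson_H r m1 F) = F)"
  using poisson_H_inverse_exists[OF m12(1) r M AE_marginal1[OF \<mu> M1]] by metis

lemma inverse2: "\<exists>\<Phi>. \<Phi> holomorphic_on - \<real> \<and> (\<forall>\<zeta>. Im \<zeta> \<noteq> 0 \<longrightarrow> Im (\<Phi> \<zeta>) * Im \<zeta> > 0 \<and> poisson_H r m2 (\<Phi> \<zeta>) = \<zeta>)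
     \<and> (\<forall>F. Im F * Im (poisson_H r m2 F) > 0 \<longrightarrow> \<Phi> (poisson_H r m2 F) = F)"
  using poisson_H_inverse_exists[OF m12(2) r M AE_marginal2[OF \<mu> M2]] by metis

end

lemma bounded_jumps_swap: "bounded_jumps r M \<mu> \<Longrightarrow> bounded_jumps r M (swap_law \<mu>)"
  unfolding bounded_jumps_def swap_law_def using borel_prob_swap[unfolded swap_law_def] borel_measurable_swap
  by (subst (1 2) AE_distr_iff) (auto simp: measurable_borel_prob intro!: borel_closed closed_Collect_le continuous_intros)


text \<open>The functions \<Phi>1 and \<Phi>2 will be the reciprocal Cauchy transforms of the
  marginals of the law under construction. They are parameters of the locale so that exchanging the
  coordinates yields an instance of the same locale.\<close>

locale bounded_jumps_inverse = bounded_jumps +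
  fixes \<Phi>1 \<Phi>2 :: "complex \<Rightarrow> complex"
  assumes hol: "\<Phi>1 holomorphic_on - \<real>" "\<Phi>2 holomorphic_on - \<real>"
    and sgn1: "\<And>\<zeta>. Im \<zeta> \<noteq> 0 \<Longrightarrow> Im (\<Phi>1 \<zeta>) * Im \<zeta> > 0" and sgn2: "\<And>\<zeta>. Im \<zeta> \<noteq> 0 \<Longrightarrow> Im (\<Phi>2 \<zeta>) * Im \<zeta> > 0"
    and H1: "\<And>\<zeta>. Im \<zeta> \<noteq> 0 \<Longrightarrow> poisson_H r (marginal1 \<mu>) (\<Phi>1 \<zeta>) = \<zeta>"
    and H2: "\<And>\<zeta>. Im \<zeta> \<noteq> 0 \<Longrightarrow> poisson_H r (marginal2 \<mu>) (\<Phi>2 \<zeta>) = \<zeta>"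
    and inv1: "\<And>F. Im F * Im (poisson_H r (marginal1 \<mu>) F) > 0 \<Longrightarrow> \<Phi>1 (poisson_H r (marginal1 \<mu>) F) = F"
    and inv2: "\<And>F. Im F * Im (poisson_H r (marginal2 \<mu>) F) > 0 \<Longrightarrow> \<Phi>2 (poisson_H r (marginal2 \<mu>) F) = F"
begin

lemma swap: "bounded_jumps_inverse r M (swap_law \<mu>) \<Phi>2 \<Phi>1"
  using bounded_jumps_swap[OF bounded_jumps_axioms] hol sgn1 sgn2 H1 H2 inv1 inv2
  by (simp add: bounded_jumps_inverse_def bounded_jumps_inverse_axioms_def marginal1_swap[OF \<mu>] marginal2_swap[OF \<mu>])

lemma Im_nonzero: "Im \<zeta> \<noteq> 0 \<Longrightarrow> Im (\<Phi>1 \<zeta>) \<noteq> 0"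
  using sgn1[of \<zeta>] by auto

lemma \<Phi>1_cnj:
  assumes "Im \<zeta> \<noteq> 0"
  shows "\<Phi>1 (cnj \<zeta>) = cnj (\<Phi>1 \<zeta>)"
proof -
  have "poisson_H r m1 (cnj (\<Phi>1 \<zeta>)) = cnj \<zeta>" by (simp add: poisson_H_cnj H1[OF assms])
  then show ?thesis using inv1[of "cnj (\<Phi>1 \<zeta>)"] sgn1[OF assms] by simp
qed

lemma A_eq:
  assumes "Im \<zeta> \<noteq> 0"
  shows "Im \<zeta> = Im (\<Phi>1 \<zeta>) * (1 - poisson_A r m1 (\<Phi>1 \<zeta>))"
  using Im_poisson_H[OF m12(1) Im_nonzero[OF assms], of r] by (simp add: H1[OF assms])

lemma A_less_1:
  assumes "Im \<zeta> \<noteq> 0"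
  shows "poisson_A r m1 (\<Phi>1 \<zeta>) < 1"
proof -
  have "Im (\<Phi>1 \<zeta>) * Im (\<Phi>1 \<zeta>) * (1 - poisson_A r m1 (\<Phi>1 \<zeta>)) > 0"
    using sgn1[OF assms] A_eq[OF assms] by (simp add: mult.assoc)
  then show ?thesis by (auto simp: zero_less_mult_iff)
qed

text \<open>H multiplies imaginary parts by the factor 1 - \<open>poisson_A\<close>, which lies in
  (0, 1] at the values of \<Phi>1, so the inverse can only enlarge them.\<close>

lemma abs_Im_le:
  assumes "Im \<zeta> \<noteq> 0"
  shows "\<bar>Im \<zeta>\<bar> \<le> \<bar>Im (\<Phi>1 \<zeta>)\<bar>"
proof -
  have "\<bar>Im \<zeta>\<bar> = \<bar>Im (\<Phi>1 \<zeta>)\<bar> * (1 - poisson_A r m1 (\<Phi>1 \<zeta>))"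
    using A_eq[OF assms] A_less_1[OF assms] by (metis abs_mult abs_of_pos diff_gt_0_iff_gt)
  also have "\<dots> \<le> \<bar>Im (\<Phi>1 \<zeta>)\<bar> * 1"
    using poisson_A_nonneg[OF r] by (intro mult_left_mono) auto
  finally show ?thesis by simp
qed

text \<open>Evaluated at \<Phi>1 \<zeta>, the displacement bound for H becomes one for its inverse;
  by \<open>abs_Im_le\<close> the point \<Phi>1 \<zeta> is at least as far from the axis as
  \<zeta>.\<close>

lemma \<Phi>1_bound:
  assumes "\<bar>Im \<zeta>\<bar> \<ge> \<epsilon>" "\<epsilon> > 0"
  shows "norm (\<Phi>1 \<zeta> - \<zeta>) \<le> r * M * (1 + M / \<epsilon>)"
proof -
  have \<zeta>: "Im \<zeta> \<noteq> 0" using assms by auto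
  have "norm (\<Phi>1 \<zeta> - \<zeta>) \<le> r * M * (1 + M / \<bar>Im (\<Phi>1 \<zeta>)\<bar>)"
    using poisson_H_bound[OF m12(1) r M AE_marginal1[OF \<mu> M1] Im_nonzero[OF \<zeta>]] by (simp add: H1[OF \<zeta>] norm_minus_commute)
  also have "\<dots> \<le> r * M * (1 + M / \<epsilon>)"
    using assms abs_Im_le[OF \<zeta>] r M by (intro mult_left_mono add_left_mono divide_left_mono) auto
  finally show ?thesis .
qed

lemma \<Phi>1_lower:
  assumes "\<epsilon> > 0"
  obtains K where "K \<ge> 0" "\<And>\<zeta>. \<bar>Im \<zeta>\<bar> \<ge> \<epsilon> \<Longrightarrow> 1 / norm (\<Phi>1 \<zeta>) \<le> K / (1 + norm \<zeta>)"
proof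
  define C where "C = r * M * (1 + M / \<epsilon>)"
  have C: "C \<ge> 0" unfolding C_def using r M assms by simp
  show "0 \<le> (1 + C) / \<epsilon> + 1" using C assms by simp
  fix \<zeta> assume \<zeta>: "\<bar>Im \<zeta>\<bar> \<ge> \<epsilon>"
  then have \<zeta>0: "Im \<zeta> \<noteq> 0" using assms by auto
  have n: "norm (\<Phi>1 \<zeta>) \<ge> \<epsilon>"
    using abs_Im_le[OF \<zeta>0] \<zeta> abs_Im_le_cmod[of "\<Phi>1 \<zeta>"] by linarith
  have "1 + norm \<zeta> \<le> (1 + C) + norm (\<Phi>1 \<zeta>)"
    using norm_triangle_ineq4[of "\<Phi>1 \<zeta>" "\<Phi>1 \<zeta> - \<zeta>"] \<Phi>1_bound[OF \<zeta> assms] unfolding C_def by simp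
  also have "\<dots> \<le> (1 + C) * (norm (\<Phi>1 \<zeta>) / \<epsilon>) + norm (\<Phi>1 \<zeta>)"
    using mult_left_mono[of 1 "norm (\<Phi>1 \<zeta>) / \<epsilon>" "1 + C"] n assms C by (simp add: le_divide_eq)
  also have "\<dots> = ((1 + C) / \<epsilon> + 1) * norm (\<Phi>1 \<zeta>)"
    by (simp add: algebra_simps add_divide_distrib)
  finally have "1 + norm \<zeta> \<le> ((1 + C) / \<epsilon> + 1) * norm (\<Phi>1 \<zeta>)" .
  moreover have "norm (\<Phi>1 \<zeta>) > 0" "1 + norm \<zeta> > 0" using n assms by (auto intro: add_pos_nonneg)
  ultimately show "1 / norm (\<Phi>1 \<zeta>) \<le> ((1 + C) / \<epsilon> + 1) / (1 + norm \<zeta>)"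
    by (simp add: divide_le_eq le_divide_eq mult.commute)
qed

text \<open>By \<open>A_eq\<close>, \<open>poisson_A\<close> at \<Phi>1 \<zeta> is 1 - |Im \<zeta>|
  / |Im (\<Phi>1 \<zeta>)|, and the two imaginary parts differ by at most C = r M (1 + M /
  \<epsilon>). The first form gives decay at infinity, the second a gap below 1 that is uniform on
  |Im \<zeta>| \<ge> \<epsilon>.\<close>

lemma A_bound:
  assumes "\<bar>Im \<zeta>\<bar> \<ge> \<epsilon>" "\<epsilon> > 0"
  shows "poisson_A r m1 (\<Phi>1 \<zeta>) \<le> r * M * (1 + M / \<epsilon>) / \<bar>Im \<zeta>\<bar>"
    "poisson_A r m1 (\<Phi>1 \<zeta>) \<le> 1 - \<epsilon> / (\<epsilon> + r * M * (1 + M / \<epsilon>))"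
proof -
  define C where "C = r * M * (1 + M / \<epsilon>)"
  have C: "C \<ge> 0" unfolding C_def using r M assms by simp
  have \<zeta>: "Im \<zeta> \<noteq> 0" using assms by auto
  define x where "x = \<bar>Im \<zeta>\<bar>"
  define y where "y = \<bar>Im (\<Phi>1 \<zeta>)\<bar>"
  have x: "x \<ge> \<epsilon>" using assms by (simp add: x_def)
  have xy: "x \<le> y" unfolding x_def y_def by (rule abs_Im_le[OF \<zeta>])
  have yC: "y \<le> x + C"
    using \<Phi>1_bound[OF assms] abs_Im_le_cmod[of "\<Phi>1 \<zeta> - \<zeta>"] unfolding C_def x_def y_def by simp
  have A: "poisson_A r m1 (\<Phi>1 \<zeta>) = 1 - x / y"
  proof -
    have "x = y * (1 - poisson_A r m1 (\<Phi>1 \<zeta>))"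
      unfolding x_def y_def using A_eq[OF \<zeta>] A_less_1[OF \<zeta>] by (metis abs_mult abs_of_pos diff_gt_0_iff_gt)
    moreover have "y > 0" using x xy assms by simp
    ultimately show ?thesis by (simp add: field_simps)
  qed
  have xC: "x / y \<ge> x / (x + C)"
    using x xy yC assms by (intro divide_left_mono mult_pos_pos) auto
  have "1 - x / (x + C) = C / (x + C)" using x C assms by (simp add: field_simps)
  also have "\<dots> \<le> C / x" using x C assms by (intro divide_left_mono mult_pos_pos) auto
  finally show "poisson_A r m1 (\<Phi>1 \<zeta>) \<le> r * M * (1 + M / \<epsilon>) / \<bar>Im \<zeta>\<bar>"
    using xC unfolding A C_def[symmetric] x_def[symmetric] by simp
  have "\<epsilon> / (\<epsilon> + C) \<le> x / (x + C)"
  proof -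
    have "\<epsilon> * (x + C) \<le> x * (\<epsilon> + C)" using mult_right_mono[OF x C] by (simp add: algebra_simps)
    then show ?thesis using x C assms by (simp add: divide_simps)
  qed
  then show "poisson_A r m1 (\<Phi>1 \<zeta>) \<le> 1 - \<epsilon> / (\<epsilon> + r * M * (1 + M / \<epsilon>))"
    using xC unfolding A C_def[symmetric] by simp
qed

end

section \<open>The candidate joint Cauchy transform\<close>

context bounded_jumps_inverse
begin

text \<open>The value 0 at real arguments makes the conjugation symmetry demanded by
  \<open>bivariate_nevanlinna\<close> hold for all arguments.\<close>

definition poisson_G :: "complex \<Rightarrow> complex \<Rightarrow> complex" where
  "poisson_G z w = (if Im z = 0 \<or> Im w = 0 then 0 else 1 / (\<Phi>1 z * \<Phi>2 w * (1 - joint_E r \<mu> (\<Phi>1 z) (\<Phi>2 w))))"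

lemma Im_nonzero2: "Im \<zeta> \<noteq> 0 \<Longrightarrow> Im (\<Phi>2 \<zeta>) \<noteq> 0"
  using sgn2[of \<zeta>] by auto

lemma \<Phi>_nonzero: "Im \<zeta> \<noteq> 0 \<Longrightarrow> \<Phi>1 \<zeta> \<noteq> 0" "Im \<zeta> \<noteq> 0 \<Longrightarrow> \<Phi>2 \<zeta> \<noteq> 0"
  using Im_nonzero[of \<zeta>] Im_nonzero2[of \<zeta>] by auto

lemma E_le:
  assumes "Im z \<noteq> 0" "Im w \<noteq> 0"
  shows "norm (joint_E r \<mu> (\<Phi>1 z) (\<Phi>2 w)) \<le> (poisson_A r m1 (\<Phi>1 z) + poisson_A r m2 (\<Phi>2 w)) / 2"
  by (rule norm_joint_E_le[OF \<mu> r Im_nonzero[OF assms(1)] Im_nonzero2[OF assms(2)]])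

lemma one_minus_E_nonzero:
  assumes "Im z \<noteq> 0" "Im w \<noteq> 0"
  shows "1 - joint_E r \<mu> (\<Phi>1 z) (\<Phi>2 w) \<noteq> 0"
proof -
  interpret S: bounded_jumps_inverse r M "swap_law \<mu>" \<Phi>2 \<Phi>1 by (rule swap)
  have "norm (joint_E r \<mu> (\<Phi>1 z) (\<Phi>2 w)) < 1"
    using E_le[OF assms] A_less_1[OF assms(1)] S.A_less_1[OF assms(2)] by (simp add: marginal1_swap[OF \<mu>])
  then show ?thesis by auto
qed

text \<open>Decay in both variables comes from \<Phi>1 and \<Phi>2 staying comparable with the
  identity. The remaining factor is at most 1 / \<kappa>, where \<kappa> is the uniform gap of
  \<open>A_bound\<close>, passed on to E by \<open>E_le\<close>.\<close>

lemma poisson_G_bound: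
  assumes \<epsilon>: "\<epsilon> > 0"
  shows "\<exists>C\<ge>0. \<forall>z w. \<bar>Im z\<bar> \<ge> \<epsilon> \<longrightarrow> \<bar>Im w\<bar> \<ge> \<epsilon> \<longrightarrow> norm (poisson_G z w) \<le> C / ((1 + norm z) * (1 + norm w))"
proof -
  interpret S: bounded_jumps_inverse r M "swap_law \<mu>" \<Phi>2 \<Phi>1 by (rule swap)
  obtain K1 where K1: "K1 \<ge> 0" "\<And>\<zeta>. \<bar>Im \<zeta>\<bar> \<ge> \<epsilon> \<Longrightarrow> 1 / norm (\<Phi>1 \<zeta>) \<le> K1 / (1 + norm \<zeta>)"
    using \<Phi>1_lower[OF \<epsilon>] by metis
  obtain K2 where K2: "K2 \<ge> 0" "\<And>\<zeta>. \<bar>Im \<zeta>\<bar> \<ge> \<epsilon> \<Longrightarrow> 1 / norm (\<Phi>2 \<zeta>) \<le> K2 / (1 + norm \<zeta>)"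
    using S.\<Phi>1_lower[OF \<epsilon>] by metis
  define \<kappa> where "\<kappa> = \<epsilon> / (\<epsilon> + r * M * (1 + M / \<epsilon>))"
  have \<kappa>: "\<kappa> > 0" unfolding \<kappa>_def using \<epsilon> r M by (intro divide_pos_pos add_pos_nonneg mult_nonneg_nonneg) auto
  have "norm (poisson_G z w) \<le> K1 * K2 / \<kappa> / ((1 + norm z) * (1 + norm w))" if zw: "\<bar>Im z\<bar> \<ge> \<epsilon>" "\<bar>Im w\<bar> \<ge> \<epsilon>" for z w
  proof -
    have zw0: "Im z \<noteq> 0" "Im w \<noteq> 0" using zw \<epsilon> by auto
    have "norm (joint_E r \<mu> (\<Phi>1 z) (\<Phi>2 w)) \<le> 1 - \<kappa>"
      proof -
      have "a \<le> b" if "a \<le> (x + y) / 2" "x \<le> b" "y \<le> b" for a b x y :: real using that by simp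
      from this[OF E_le[OF zw0] A_bound(2)[OF zw(1) \<epsilon>] S.A_bound(2)[OF zw(2) \<epsilon>, unfolded marginal1_swap[OF \<mu>]]]
      show ?thesis unfolding \<kappa>_def .
    qed
    then have "\<kappa> \<le> norm (1 - joint_E r \<mu> (\<Phi>1 z) (\<Phi>2 w))"
      using norm_triangle_ineq2[of 1 "joint_E r \<mu> (\<Phi>1 z) (\<Phi>2 w)"] by simp
    then have "1 / norm (1 - joint_E r \<mu> (\<Phi>1 z) (\<Phi>2 w)) \<le> 1 / \<kappa>"
      using \<kappa> by (intro divide_left_mono mult_pos_pos) auto
    then have "(1 / norm (\<Phi>1 z)) * (1 / norm (\<Phi>2 w)) * (1 / norm (1 - joint_E r \<mu> (\<Phi>1 z) (\<Phi>2 w)))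
      \<le> (K1 / (1 + norm z)) * (K2 / (1 + norm w)) * (1 / \<kappa>)"
      using K1 K2 zw by (intro mult_mono mult_nonneg_nonneg) auto
    then show ?thesis using zw0 by (simp add: poisson_G_def norm_divide norm_mult mult_ac)
  qed
  then show ?thesis using K1 K2 \<kappa> by (intro exI[of _ "K1 * K2 / \<kappa>"]) auto
qed

lemma poisson_G_holomorphic1:
  assumes w: "Im w \<noteq> 0"
  shows "(\<lambda>z. poisson_G z w) holomorphic_on - \<real>"
proof -
  have E: "(\<lambda>z. joint_E r \<mu> (\<Phi>1 z) (\<Phi>2 w)) holomorphic_on - \<real>"
  proof -
    have "\<Phi>1 ` (- \<real>) \<subseteq> - \<real>" using Im_nonzero by (auto simp: complex_is_Real_iff)
    from holomorphic_on_compose_gen[OF hol(1) joint_E_holomorphic1[OF \<mu> Im_nonzero2[OF w], of r] this]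
    show ?thesis by (simp add: comp_def)
  qed
  have "(\<lambda>z. 1 / (\<Phi>1 z * \<Phi>2 w * (1 - joint_E r \<mu> (\<Phi>1 z) (\<Phi>2 w)))) holomorphic_on - \<real>"
    by (intro holomorphic_intros hol E) (use \<Phi>_nonzero one_minus_E_nonzero w in \<open>auto simp: complex_is_Real_iff\<close>)
  then show ?thesis
    by (rule holomorphic_transform) (use w in \<open>auto simp: poisson_G_def complex_is_Real_iff\<close>)
qed

lemma poisson_G_swap: "bounded_jumps_inverse.poisson_G r (swap_law \<mu>) \<Phi>2 \<Phi>1 w z = poisson_G z w"
proof -
  interpret S: bounded_jumps_inverse r M "swap_law \<mu>" \<Phi>2 \<Phi>1 by (rule swap)
  show ?thesis by (simp add: poisson_G_def S.poisson_G_def joint_E_swap[OF \<mu>] mult.commute)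
qed

lemma poisson_G_holomorphic2:
  assumes z: "Im z \<noteq> 0"
  shows "poisson_G z holomorphic_on - \<real>"
proof -
  interpret S: bounded_jumps_inverse r M "swap_law \<mu>" \<Phi>2 \<Phi>1 by (rule swap)
  show ?thesis using S.poisson_G_holomorphic1[OF z] unfolding poisson_G_swap .
qed

lemma poisson_G_continuous: "continuous_on ((- \<real>) \<times> (- \<real>)) (\<lambda>(z, w). poisson_G z w)"
proof -
  have c1: "continuous_on ((- \<real>) \<times> (- \<real>)) (\<lambda>p. \<Phi>1 (fst p))" and c2: "continuous_on ((- \<real>) \<times> (- \<real>)) (\<lambda>p. \<Phi>2 (snd p))"
    by (rule continuous_on_compose2[OF holomorphic_on_imp_continuous_on[OF hol(1)]]
        continuous_on_compose2[OF holomorphic_on_imp_continuous_on[OF hol(2)]];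
        auto intro: continuous_intros)+
  have "continuous_on ((- \<real>) \<times> (- \<real>)) (\<lambda>p. joint_E r \<mu> (fst (\<Phi>1 (fst p), \<Phi>2 (snd p))) (snd (\<Phi>1 (fst p), \<Phi>2 (snd p))))"
    by (rule continuous_on_compose2[OF joint_E_continuous[OF \<mu>, of r] continuous_on_Pair[OF c1 c2]])
       (use Im_nonzero Im_nonzero2 in \<open>auto simp: complex_is_Real_iff\<close>)
  then have c3: "continuous_on ((- \<real>) \<times> (- \<real>)) (\<lambda>p. joint_E r \<mu> (\<Phi>1 (fst p)) (\<Phi>2 (snd p)))" by simp
  have "continuous_on ((- \<real>) \<times> (- \<real>)) (\<lambda>p. 1 / (\<Phi>1 (fst p) * \<Phi>2 (snd p) * (1 - joint_E r \<mu> (\<Phi>1 (fst p)) (\<Phi>2 (snd p)))))"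
    by (intro continuous_intros c1 c2 c3) (use \<Phi>_nonzero one_minus_E_nonzero in \<open>auto simp: complex_is_Real_iff\<close>)
  then show ?thesis
    by (rule continuous_on_cong[THEN iffD1, rotated -1]) (auto simp: poisson_G_def complex_is_Real_iff)
qed

lemma \<Phi>_asymp:
  assumes t: "\<bar>t\<bar> \<ge> 1"
  shows "norm (\<Phi>1 (\<i> * of_real t) / (\<i> * of_real t) - 1) \<le> r * M * (1 + M) / \<bar>t\<bar>"
proof -
  have "norm (\<Phi>1 (\<i> * of_real t) - \<i> * of_real t) \<le> r * M * (1 + M / 1)"
    by (rule \<Phi>1_bound) (use t in auto)
  moreover have "\<Phi>1 (\<i> * of_real t) / (\<i> * of_real t) - 1 = (\<Phi>1 (\<i> * of_real t) - \<i> * of_real t) / (\<i> * of_real t)"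
    using t by (simp add: diff_divide_distrib)
  ultimately show ?thesis using t by (simp add: norm_divide norm_mult divide_right_mono)
qed

lemma \<Phi>_asymp_lim:
  assumes "s = 1 \<or> s = -1"
  shows "((\<lambda>t. \<Phi>1 (\<i> * of_real (s * t)) / (\<i> * of_real (s * t))) \<longlongrightarrow> 1) at_top"
proof -
  have "((\<lambda>t. \<Phi>1 (\<i> * of_real (s * t)) / (\<i> * of_real (s * t)) - 1) \<longlongrightarrow> 0) at_top"
  proof (rule Lim_null_comparison)
    show "\<forall>\<^sub>F t in at_top. norm (\<Phi>1 (\<i> * of_real (s * t)) / (\<i> * of_real (s * t)) - 1) \<le> r * M * (1 + M) / t"
      using eventually_ge_at_top[of 1]
    proof eventually_elim
      case (elim t)
      then have "\<bar>s * t\<bar> = t" using assms by auto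
      then show ?case using \<Phi>_asymp[of "s * t"] elim by simp
    qed
    show "((\<lambda>t. r * M * (1 + M) / t) \<longlongrightarrow> 0) at_top" by real_asymp
  qed
  then show ?thesis by (simp add: LIM_zero_iff)
qed

lemma E_asymp_lim:
  assumes "s = 1 \<or> s = -1"
  shows "((\<lambda>t. joint_E r \<mu> (\<Phi>1 (\<i> * of_real (s * t))) (\<Phi>2 (\<i> * of_real t))) \<longlongrightarrow> 0) at_top"
proof (rule Lim_null_comparison)
  interpret S: bounded_jumps_inverse r M "swap_law \<mu>" \<Phi>2 \<Phi>1 by (rule swap)
  show "\<forall>\<^sub>F t in at_top. norm (joint_E r \<mu> (\<Phi>1 (\<i> * of_real (s * t))) (\<Phi>2 (\<i> * of_real t))) \<le> r * M * (1 + M) / t"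
    using eventually_ge_at_top[of 1]
  proof eventually_elim
    case (elim t)
    have st: "\<bar>s * t\<bar> = t" using assms elim by auto
    then have st0: "s * t \<noteq> 0" using elim by auto
    have "norm (joint_E r \<mu> (\<Phi>1 (\<i> * of_real (s * t))) (\<Phi>2 (\<i> * of_real t))) \<le>
       (poisson_A r m1 (\<Phi>1 (\<i> * of_real (s * t))) + poisson_A r m2 (\<Phi>2 (\<i> * of_real t))) / 2"
      by (rule E_le) (use elim st0 in auto)
    also have "\<dots> \<le> (r * M * (1 + M / 1) / t + r * M * (1 + M / 1) / t) / 2"
      using A_bound(1)[of 1 "\<i> * of_real (s * t)"] S.A_bound(1)[of 1 "\<i> * of_real t"] elim st
      unfolding marginal1_swap[OF \<mu>] by (intro divide_right_mono add_mono) auto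
    also have "\<dots> = r * M * (1 + M) / t" by simp
    finally show ?case .
  qed
  show "((\<lambda>t. r * M * (1 + M) / t) \<longlongrightarrow> 0) at_top" by real_asymp
qed

text \<open>On the imaginary axis \<Phi>1 and \<Phi>2 are asymptotic to the identity and E tends to
  0, so the candidate behaves like 1 / ((i s t) (i t)) = - s / t^2.\<close>

lemma poisson_G_lim:
  assumes s: "s = 1 \<or> s = -1"
  shows "((\<lambda>t. of_real (t^2) * poisson_G (\<i> * of_real (s * t)) (\<i> * of_real t)) \<longlongrightarrow> - of_real s) at_top"
proof -
  interpret S: bounded_jumps_inverse r M "swap_law \<mu>" \<Phi>2 \<Phi>1 by (rule swap)
  have l2: "((\<lambda>t. \<Phi>2 (\<i> * of_real t) / (\<i> * of_real t)) \<longlongrightarrow> 1) at_top"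
    using S.\<Phi>_asymp_lim[of 1] by simp
  have "((\<lambda>t. - of_real s / ((\<Phi>1 (\<i> * of_real (s * t)) / (\<i> * of_real (s * t))) * (\<Phi>2 (\<i> * of_real t) / (\<i> * of_real t))
      * (1 - joint_E r \<mu> (\<Phi>1 (\<i> * of_real (s * t))) (\<Phi>2 (\<i> * of_real t))))) \<longlongrightarrow> - of_real s / (1 * 1 * (1 - 0))) at_top"
    by (intro tendsto_intros \<Phi>_asymp_lim l2 E_asymp_lim s) auto
  then have "((\<lambda>t. - of_real s / ((\<Phi>1 (\<i> * of_real (s * t)) / (\<i> * of_real (s * t))) * (\<Phi>2 (\<i> * of_real t) / (\<i> * of_real t))
      * (1 - joint_E r \<mu> (\<Phi>1 (\<i> * of_real (s * t))) (\<Phi>2 (\<i> * of_real t))))) \<longlongrightarrow> - of_real s) at_top" by simp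
  then show ?thesis
  proof (rule Lim_transform_eventually)
    show "\<forall>\<^sub>F t in at_top. - of_real s / ((\<Phi>1 (\<i> * of_real (s * t)) / (\<i> * of_real (s * t))) * (\<Phi>2 (\<i> * of_real t) / (\<i> * of_real t))
      * (1 - joint_E r \<mu> (\<Phi>1 (\<i> * of_real (s * t))) (\<Phi>2 (\<i> * of_real t))))
      = of_real (t^2) * poisson_G (\<i> * of_real (s * t)) (\<i> * of_real t)"
      using eventually_gt_at_top[of 0]
    proof eventually_elim
      case (elim t)
      have "s \<noteq> 0" using s by auto
      have alg: "- c / ((A / (j * (c * T))) * (B / (j * T)) * D) = T^2 * (1 / (A * B * D))"
        if "j * j = -1" "c * c = 1" "T \<noteq> 0" "A \<noteq> 0" "B \<noteq> 0" "D \<noteq> 0" for A B D T c j :: complex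
      proof -
        have "j \<noteq> 0" "c \<noteq> 0" using that by auto
        then have "- c / ((A / (j * (c * T))) * (B / (j * T)) * D) = - ((j * j) * (c * c) * T^2) / (A * B * D)"
          using that by (simp add: field_simps power2_eq_square)
        then show ?thesis using that by simp
      qed
      have n: "Im (\<i> * of_real (s * t)) \<noteq> 0" "Im (\<i> * complex_of_real t) \<noteq> 0" using elim \<open>s \<noteq> 0\<close> by auto
      have cc: "of_real s * of_real s = (1 :: complex)" using s by auto
      have G: "poisson_G (\<i> * of_real (s * t)) (\<i> * of_real t) = 1 / (\<Phi>1 (\<i> * of_real (s * t)) * \<Phi>2 (\<i> * of_real t) *
          (1 - joint_E r \<mu> (\<Phi>1 (\<i> * of_real (s * t))) (\<Phi>2 (\<i> * of_real t))))"
        using n by (simp add: poisson_G_def)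
      show ?case
        unfolding G of_real_power
        using alg[OF i_squared cc, of "of_real t"] elim \<Phi>_nonzero(1)[OF n(1)] \<Phi>_nonzero(2)[OF n(2)] one_minus_E_nonzero[OF n]
        by (simp only: of_real_mult) simp
    qed
  qed
qed

sublocale bivariate_nevanlinna poisson_G
proof
  interpret S: bounded_jumps_inverse r M "swap_law \<mu>" \<Phi>2 \<Phi>1 by (rule swap)
  show "poisson_G (cnj z) (cnj w) = cnj (poisson_G z w)" for z w
    by (simp add: poisson_G_def \<Phi>1_cnj S.\<Phi>1_cnj joint_E_cnj)
  \<comment> \<open>The positivity inequality is available because \<Phi>1 z and \<Phi>2 w lie in
    the upper half plane and both have \<open>poisson_A\<close> below 1.\<close>
  show "Re (poisson_G z w) \<le> Re (poisson_G (cnj z) w)" if "Im z > 0" "Im w > 0" for z w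
  proof -
    have n: "Im z \<noteq> 0" "Im w \<noteq> 0" using that by auto
    have "Im (\<Phi>1 z) > 0" "Im (\<Phi>2 w) > 0" using sgn1[OF n(1)] sgn2[OF n(2)] that by (auto simp: zero_less_mult_iff)
    then show ?thesis
      using joint_positivity[OF \<mu> r, of "\<Phi>1 z" "\<Phi>2 w"] A_less_1[OF n(1)] S.A_less_1[OF n(2)] n
      by (simp add: poisson_G_def \<Phi>1_cnj marginal1_swap[OF \<mu>])
  qed
  show "((\<lambda>t. of_real (t^2) * poisson_G (\<i> * of_real t) (\<i> * of_real t)) \<longlongrightarrow> - 1) at_top"
    using poisson_G_lim[of 1] by simp
  show "((\<lambda>t. of_real (t^2) * poisson_G (- (\<i>) * of_real t) (\<i> * of_real t)) \<longlongrightarrow> 1) at_top"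
    using poisson_G_lim[of "-1"] by simp
qed (rule poisson_G_holomorphic1 poisson_G_holomorphic2 poisson_G_continuous poisson_G_bound; assumption)+

end

text \<open>The equations are imposed at the points that H keeps in their half plane, because these
  are the values of the subordination functions. The product form of the joint equation also encodes
  that no factor vanishes.\<close>

definition poisson_law :: "real \<Rightarrow> (real \<times> real) measure \<Rightarrow> (real \<times> real) measure \<Rightarrow> bool" where
  "poisson_law r \<mu> N \<longleftrightarrow> borel_prob N \<and>
    (\<forall>F. Im F * Im (poisson_H r (marginal1 \<mu>) F) > 0 \<longrightarrow> cauchy_transform (marginal1 N) (poisson_H r (marginal1 \<mu>) F) = 1 / F) \<and>
    (\<forall>W. Im W * Im (poisson_H r (marginal2 \<mu>) W) > 0 \<longrightarrow> cauchy_transform (marginal2 N) (poisson_H r (marginal2 \<mu>) W) = 1 / W) \<and>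
    (\<forall>F W. Im F * Im (poisson_H r (marginal1 \<mu>) F) > 0 \<longrightarrow> Im W * Im (poisson_H r (marginal2 \<mu>) W) > 0 \<longrightarrow>
      cauchy_transform2 N (poisson_H r (marginal1 \<mu>) F) (poisson_H r (marginal2 \<mu>) W) * (F * W * (1 - joint_E r \<mu> F W)) = 1)"

context bounded_jumps_inverse
begin

text \<open>Multiplying the joint transform by w = i (j + 1) and letting j grow isolates the
  marginal, since \<Phi>2 is asymptotic to the identity and E decays by
  \<open>norm_joint_E_le_Im\<close>. A shift \<epsilon> > 0 serves the smoothed laws and \<epsilon>
  = 0 their limit.\<close>

lemma marginal_of_poisson_G:
  assumes N: "borel_prob N" and \<epsilon>: "\<epsilon> \<ge> 0" and z: "Im z \<noteq> 0"
    and G: "\<And>z w. Im z \<noteq> 0 \<Longrightarrow> Im w \<noteq> 0 \<Longrightarrow> cauchy_transform2 N z w = poisson_G (shift \<epsilon> z) (shift \<epsilon> w)"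
  shows "cauchy_transform (marginal1 N) z = 1 / \<Phi>1 (shift \<epsilon> z)"
proof -
  interpret S: bounded_jumps_inverse r M "swap_law \<mu>" \<Phi>2 \<Phi>1 by (rule swap)
  define z' where "z' = shift \<epsilon> z"
  have z': "Im z' \<noteq> 0" using z \<epsilon> by (auto simp: z'_def Im_shift sgn_if)
  define t where "t j = real j + 1 + \<epsilon>" for j :: nat
  have t: "t j \<ge> 1" for j using \<epsilon> by (simp add: t_def)
  have tinf: "filterlim t at_top sequentially" unfolding t_def by real_asymp
  define w where "w j = \<i> * complex_of_real (real j + 1)" for j :: nat
  define W where "W j = \<Phi>2 (\<i> * complex_of_real (t j))" for j
  have sw: "shift \<epsilon> (w j) = \<i> * complex_of_real (t j)" for j
    by (simp add: w_def t_def shift_def algebra_simps)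
  have lim1: "(\<lambda>j. w j * cauchy_transform2 N z (w j)) \<longlonglongrightarrow> cauchy_transform (marginal1 N) z"
  proof (rule cauchy_transform2_at_infinity[OF N z, of 1])
    show "filterlim w at_infinity sequentially"
      unfolding filterlim_at_infinity_conv_norm_at_top w_def norm_mult norm_ii norm_of_real by real_asymp
    have "norm (w j) = real j + 1" for j
      unfolding w_def norm_mult norm_ii norm_of_real by simp
    then show "1 * norm (w j) \<le> \<bar>Im (w j)\<bar>" "w j \<noteq> 0" for j
      by (simp_all add: w_def complex_eq_iff)
  qed simp
  have l2: "(\<lambda>j. W j / (\<i> * of_real (t j))) \<longlonglongrightarrow> 1"
    using filterlim_compose[OF S.\<Phi>_asymp_lim[of 1] tinf] by (simp add: W_def)
  have E: "(\<lambda>j. joint_E r \<mu> (\<Phi>1 z') (W j)) \<longlonglongrightarrow> 0"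
  proof (rule Lim_null_comparison)
    let ?K = "r * (1 + norm (\<Phi>1 z') / \<bar>Im (\<Phi>1 z')\<bar>) * M"
    show "\<forall>\<^sub>F j in sequentially. norm (joint_E r \<mu> (\<Phi>1 z') (W j)) \<le> ?K / t j"
    proof (rule always_eventually, rule allI)
      fix j
      have n: "Im (\<i> * complex_of_real (t j)) \<noteq> 0" using t[of j] by simp
      have "norm (joint_E r \<mu> (\<Phi>1 z') (W j)) \<le> ?K / \<bar>Im (W j)\<bar>"
        unfolding W_def by (rule norm_joint_E_le_Im[OF \<mu> r M2 Im_nonzero[OF z'] Im_nonzero2[OF n]])
      also have "\<dots> \<le> ?K / t j"
        using S.abs_Im_le[OF n] t[of j] r M unfolding W_def
        by (intro divide_left_mono mult_nonneg_nonneg mult_pos_pos) auto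
      finally show "norm (joint_E r \<mu> (\<Phi>1 z') (W j)) \<le> ?K / t j" .
    qed
    show "(\<lambda>j. ?K / t j) \<longlonglongrightarrow> 0"
      by (rule real_tendsto_divide_at_top[OF tendsto_const tinf])
  qed
  have q: "(\<lambda>j. complex_of_real ((real j + 1) / t j)) \<longlonglongrightarrow> of_real 1"
    unfolding t_def by (intro tendsto_of_real) real_asymp
  have "(\<lambda>j. of_real ((real j + 1) / t j) * (1 / (\<Phi>1 z' * (W j / (\<i> * of_real (t j))) * (1 - joint_E r \<mu> (\<Phi>1 z') (W j)))))
      \<longlonglongrightarrow> of_real 1 * (1 / (\<Phi>1 z' * 1 * (1 - 0)))"
    by (intro tendsto_intros q l2 E) (use \<Phi>_nonzero[OF z'] in auto)
  moreover have eq: "of_real ((real j + 1) / t j) * (1 / (\<Phi>1 z' * (W j / (\<i> * of_real (t j))) * (1 - joint_E r \<mu> (\<Phi>1 z') (W j))))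
      = w j * cauchy_transform2 N z (w j)" for j
  proof -
    have n: "Im (w j) \<noteq> 0" "Im (\<i> * complex_of_real (t j)) \<noteq> 0" using t[of j] by (auto simp: w_def)
    have a: "cauchy_transform2 N z (w j) = 1 / (\<Phi>1 z' * W j * (1 - joint_E r \<mu> (\<Phi>1 z') (W j)))"
      unfolding G[OF z n(1)] sw z'_def[symmetric] W_def using z' n by (simp add: poisson_G_def)
    have b: "c / T * (1 / (A * (B / (k * T)) * D)) = k * c * (1 / (A * B * D))" if "T \<noteq> 0" for A B D T c k :: complex
      using that by simp
    have "complex_of_real (t j) \<noteq> 0" using t[of j] by simp
    then show ?thesis unfolding a unfolding of_real_divide w_def by (rule b)
  qed
  ultimately have "(\<lambda>j. w j * cauchy_transform2 N z (w j)) \<longlonglongrightarrow> of_real 1 * (1 / (\<Phi>1 z' * 1 * (1 - 0)))"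
    by (simp only: eq)
  from LIMSEQ_unique[OF lim1 this] show ?thesis unfolding z'_def by simp
qed

text \<open>The point \<zeta> = H(i y) - i \<epsilon> is chosen so that its shift is H(i y), where
  \<Phi>1 takes the value i y. It lies within C + 1 of i y, where C bounds the displacement of H and
  1 bounds \<epsilon>, so y \<ge> (C + 1) / \<delta> makes the tail bound applicable uniformly in
  \<epsilon>.\<close>

lemma smooth_law_tail:
  assumes \<epsilon>: "0 < \<epsilon>" "\<epsilon> \<le> 1" and \<delta>: "0 < \<delta>" "\<delta> \<le> 1/2" and y: "y \<ge> (r * M * (1 + M) + 1) / \<delta>"
    and N: "borel_prob N" and G: "\<And>z w. Im z \<noteq> 0 \<Longrightarrow> Im w \<noteq> 0 \<Longrightarrow> cauchy_transform2 N z w = poisson_G (shift \<epsilon> z) (shift \<epsilon> w)"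
  shows "measure (marginal1 N) {x. y \<le> \<bar>x\<bar>} \<le> 6 * \<delta>"
proof -
  define C where "C = r * M * (1 + M)"
  have C: "C \<ge> 0" unfolding C_def using r M by simp
  have yC: "C + 1 \<le> \<delta> * y" using y \<delta> unfolding C_def[symmetric] by (simp add: divide_le_eq mult.commute)
  have y1: "y \<ge> 1" "y \<ge> 2 * (C + 1)"
  proof -
    have "y > 0" using yC C \<delta> by (metis add_nonneg_pos order_less_le_trans zero_less_mult_pos zero_less_one)
    then have "\<delta> * y \<le> 1/2 * y" using \<delta> by (intro mult_right_mono) auto
    then have "C + 1 \<le> 1/2 * y" using yC by (rule order_trans[rotated])
    then show "y \<ge> 1" "y \<ge> 2 * (C + 1)" using C by simp_all
  qed
  define h where "h = poisson_H r m1 (\<i> * of_real y)"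
  have "norm (h - \<i> * of_real y) \<le> r * M * (1 + M / \<bar>Im (\<i> * complex_of_real y)\<bar>)"
    unfolding h_def by (rule poisson_H_bound[OF m12(1) r M AE_marginal1[OF \<mu> M1]]) (use y1 in simp)
  also have "\<dots> \<le> C"
    unfolding C_def using y1 r M by (intro mult_left_mono add_left_mono) (auto simp: divide_le_eq mult_le_cancel_left1)
  finally have h: "norm (h - \<i> * of_real y) \<le> C" .
  then have imh: "Im h \<ge> y - C"
    using abs_Im_le_cmod[of "h - \<i> * of_real y"] by simp
  define \<zeta> where "\<zeta> = h - \<i> * of_real \<epsilon>"
  have im\<zeta>: "Im \<zeta> > 0" using imh y1 \<epsilon> C by (simp add: \<zeta>_def)
  have s: "shift \<epsilon> \<zeta> = h" using im\<zeta> by (simp add: shift_def) (simp add: \<zeta>_def)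
  have "Im (\<i> * complex_of_real y) * Im (poisson_H r m1 (\<i> * complex_of_real y)) > 0"
    using imh y1 C unfolding h_def[symmetric] by simp
  then have "\<Phi>1 h = \<i> * of_real y" unfolding h_def by (rule inv1)
  then have "cauchy_transform (marginal1 N) \<zeta> = 1 / (\<i> * of_real y)"
    using marginal_of_poisson_G[OF N less_imp_le[OF \<epsilon>(1)] _ G, of \<zeta>] im\<zeta> by (simp add: s)
  moreover have "norm (\<zeta> - \<i> * of_real y) \<le> \<delta> * y"
  proof -
    have "norm (\<zeta> - \<i> * of_real y) \<le> norm (h - \<i> * of_real y) + norm (\<i> * complex_of_real \<epsilon>)"
      unfolding \<zeta>_def using norm_triangle_ineq4[of "h - \<i> * of_real y" "\<i> * complex_of_real \<epsilon>"] by (simp add: algebra_simps)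
    also have "\<dots> \<le> C + 1" using h \<epsilon> by (simp add: norm_mult)
    finally show ?thesis using yC by simp
  qed
  ultimately show ?thesis
    using tail_bound_of_cauchy_transform[OF borel_prob_marginal(1)[OF N], of y \<delta> \<zeta>] y1 \<delta> by simp
qed

text \<open>The tails are uniform in the smoothing height, so the smoothed laws have a weak limit
  along a subsequence. Continuity of the candidate removes the shift, so the limit has the candidate
  as its Cauchy transform; the functional equations are this identity evaluated at values of
  H.\<close>

lemma poisson_law_exists_aux: "\<exists>N. poisson_law r \<mu> N"
proof -
  interpret S: bounded_jumps_inverse r M "swap_law \<mu>" \<Phi>2 \<Phi>1 by (rule swap)
  define e where "e n = 1 / (real n + 1)" for n
  have e: "0 < e n" "e n \<le> 1" for n by (auto simp: e_def divide_le_eq_1 add_nonneg_pos)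
  define N where "N n = smooth_law (e n)" for n
  have N: "borel_prob (N n)" for n unfolding N_def by (rule borel_prob_smooth_law[OF e(1)])
  have G: "cauchy_transform2 (N n) z w = poisson_G (shift (e n) z) (shift (e n) w)" if "Im z \<noteq> 0" "Im w \<noteq> 0" for n z w
    unfolding N_def by (rule cauchy_transform2_smooth_law[OF e(1) that])
  have GS: "cauchy_transform2 (swap_law (N n)) z w = S.poisson_G (shift (e n) z) (shift (e n) w)" if "Im z \<noteq> 0" "Im w \<noteq> 0" for n z w
    unfolding cauchy_transform2_swap[OF N] G[OF that(2,1)] poisson_G_swap ..
  have "\<exists>Y. \<forall>\<^sub>F n in sequentially. measure (N n) {p. Y \<le> max \<bar>fst p\<bar> \<bar>snd p\<bar>} \<le> \<delta>" if \<delta>: "\<delta> > 0" for \<delta>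
  proof -
    \<comment> \<open>Each marginal contributes at most 6 d to the tail, hence the 12; the cap 1/2
      is a condition of the tail bound.\<close>
    define d where "d = min (\<delta> / 12) (1/2)"
    have d: "0 < d" "d \<le> 1/2" "12 * d \<le> \<delta>" using \<delta> by (auto simp: d_def)
    define Y where "Y = (r * M * (1 + M) + 1) / d"
    have "measure (N n) {p. Y \<le> max \<bar>fst p\<bar> \<bar>snd p\<bar>} \<le> \<delta>" for n
    proof -
      have "measure (marginal1 (N n)) {x. Y \<le> \<bar>x\<bar>} \<le> 6 * d"
        by (rule smooth_law_tail[OF e d(1,2) _ N G]) (auto simp: Y_def)
      moreover have "measure (marginal2 (N n)) {x. Y \<le> \<bar>x\<bar>} \<le> 6 * d"
        using S.smooth_law_tail[OF e d(1,2) _ borel_prob_swap[OF N] GS] by (simp add: Y_def marginal1_swap[OF N])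
      ultimately show ?thesis using measure_max_marginals_le[OF N, of n Y] d(3) by linarith
    qed
    then show ?thesis by (intro exI[of _ Y] always_eventually allI)
  qed
  from borel_prob_weak_compactness[OF N this] obtain q L where q: "strict_mono (q :: nat \<Rightarrow> nat)"
    and L: "borel_prob L" and w: "weakly_converges (N \<circ> q) L" by blast
  have GL: "cauchy_transform2 L z w = poisson_G z w" if zw: "Im z \<noteq> 0" "Im w \<noteq> 0" for z w
  proof -
    have "e \<longlonglongrightarrow> 0" unfolding e_def by real_asymp
    then have e0: "(\<lambda>n. e (q n)) \<longlonglongrightarrow> 0" using q LIMSEQ_subseq_LIMSEQ[of e 0 q] by (simp add: comp_def)
    have sh: "(\<lambda>n. shift (e (q n)) z) \<longlonglongrightarrow> z" for z
    proof -
      have "(\<lambda>n. z + of_real (sgn (Im z) * e (q n)) * \<i>) \<longlonglongrightarrow> z + of_real (sgn (Im z) * 0) * \<i>"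
        by (intro tendsto_intros e0)
      then show ?thesis by (simp add: shift_def)
    qed
    have "(\<lambda>n. (\<lambda>(z, w). poisson_G z w) (shift (e (q n)) z, shift (e (q n)) w)) \<longlonglongrightarrow> (\<lambda>(z, w). poisson_G z w) (z, w)"
    proof (rule continuous_on_tendsto_compose[OF poisson_G_continuous tendsto_Pair[OF sh sh]])
      show "(z, w) \<in> (- \<real>) \<times> (- \<real>)" using zw by (simp add: complex_is_Real_iff)
      have "Im (shift (e (q n)) z) \<noteq> 0" if "Im z \<noteq> 0" for n z
        using abs_Im_shift[OF e(1)[of "q n"] that] e(1)[of "q n"] by auto
      then show "\<forall>\<^sub>F n in sequentially. (shift (e (q n)) z, shift (e (q n)) w) \<in> (- \<real>) \<times> (- \<real>)"
        using zw by (simp add: complex_is_Real_iff)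
    qed
    then have "(\<lambda>n. cauchy_transform2 ((N \<circ> q) n) z w) \<longlonglongrightarrow> poisson_G z w"
      using G[OF zw] by simp
    moreover have "(\<lambda>n. cauchy_transform2 ((N \<circ> q) n) z w) \<longlonglongrightarrow> cauchy_transform2 L z w"
      by (rule weakly_converges_cauchy_transform2[OF w _ L zw]) (simp add: N)
    ultimately show ?thesis using LIMSEQ_unique by blast
  qed
  have s0: "shift 0 z = z" for z by (simp add: shift_def)
  have m1L: "cauchy_transform (marginal1 L) z = 1 / \<Phi>1 z" if "Im z \<noteq> 0" for z
    using marginal_of_poisson_G[OF L order_refl that] GL by (simp add: s0)
  have m2L: "cauchy_transform (marginal2 L) z = 1 / \<Phi>2 z" if "Im z \<noteq> 0" for z
    using S.marginal_of_poisson_G[OF borel_prob_swap[OF L] order_refl that]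
    by (simp add: s0 marginal1_swap[OF L] cauchy_transform2_swap[OF L] GL poisson_G_swap)
  have "cauchy_transform2 L (poisson_H r m1 F) (poisson_H r m2 W) * (F * W * (1 - joint_E r \<mu> F W)) = 1"
    if "Im F * Im (poisson_H r m1 F) > 0" "Im W * Im (poisson_H r m2 W) > 0" for F W
  proof -
    have n: "Im (poisson_H r m1 F) \<noteq> 0" "Im (poisson_H r m2 W) \<noteq> 0" using that by auto
    have FW: "F \<noteq> 0" "W \<noteq> 0" using that by auto
    show ?thesis
      using one_minus_E_nonzero[OF n] n FW unfolding GL[OF n] by (simp add: poisson_G_def inv1[OF that(1)] inv2[OF that(2)])
  qed
  moreover have "cauchy_transform (marginal1 L) (poisson_H r m1 F) = 1 / F" if "Im F * Im (poisson_H r m1 F) > 0" for F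
  proof -
    have n: "Im (poisson_H r m1 F) \<noteq> 0" using that by auto
    show ?thesis unfolding m1L[OF n] inv1[OF that] ..
  qed
  moreover have "cauchy_transform (marginal2 L) (poisson_H r m2 F) = 1 / F" if "Im F * Im (poisson_H r m2 F) > 0" for F
  proof -
    have n: "Im (poisson_H r m2 F) \<noteq> 0" using that by auto
    show ?thesis unfolding m2L[OF n] inv2[OF that] ..
  qed
  ultimately show ?thesis using L unfolding poisson_law_def by blast
qed

end

theorem (in bounded_jumps) poisson_law_exists: "\<exists>N. poisson_law r \<mu> N"
proof -
  obtain \<Phi>1 where 1: "\<Phi>1 holomorphic_on - \<real> \<and> (\<forall>\<zeta>. Im \<zeta> \<noteq> 0 \<longrightarrow> Im (\<Phi>1 \<zeta>) * Im \<zeta> > 0 \<and> poisson_H r m1 (\<Phi>1 \<zeta>) = \<zeta>)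
     \<and> (\<forall>F. Im F * Im (poisson_H r m1 F) > 0 \<longrightarrow> \<Phi>1 (poisson_H r m1 F) = F)"
    using inverse1 by (rule exE)
  obtain \<Phi>2 where 2: "\<Phi>2 holomorphic_on - \<real> \<and> (\<forall>\<zeta>. Im \<zeta> \<noteq> 0 \<longrightarrow> Im (\<Phi>2 \<zeta>) * Im \<zeta> > 0 \<and> poisson_H r m2 (\<Phi>2 \<zeta>) = \<zeta>)
     \<and> (\<forall>F. Im F * Im (poisson_H r m2 F) > 0 \<longrightarrow> \<Phi>2 (poisson_H r m2 F) = F)"
    using inverse2 by (rule exE)
  have "bounded_jumps_inverse r M \<mu> \<Phi>1 \<Phi>2"
    unfolding bounded_jumps_inverse_def bounded_jumps_inverse_axioms_def
    using bounded_jumps_axioms 1 2 by (intro conjI allI impI; blast)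
  then show ?thesis by (rule bounded_jumps_inverse.poisson_law_exists_aux)
qed

section \<open>R-transforms on Stolz angles\<close>

lemma stolz_iff: "z \<in> stolz_angle \<alpha> \<beta> \<longleftrightarrow> Im z < 0 \<and> \<bar>Re z\<bar> < - \<alpha> * Im z \<and> Im z > - \<beta>"
  by (simp add: stolz_angle_def)

lemma double_stolz_iff:
  "z \<in> double_stolz \<alpha> \<beta> \<longleftrightarrow> Im z \<noteq> 0 \<and> \<bar>Re z\<bar> < \<alpha> * \<bar>Im z\<bar> \<and> \<bar>Im z\<bar> < \<beta>"
proof -
  have "z \<in> cnj ` stolz_angle \<alpha> \<beta> \<longleftrightarrow> cnj z \<in> stolz_angle \<alpha> \<beta>"
  proof
    assume "cnj z \<in> stolz_angle \<alpha> \<beta>"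
    from imageI[OF this, of cnj] show "z \<in> cnj ` stolz_angle \<alpha> \<beta>" by simp
  qed auto
  then show ?thesis
    by (cases "Im z < 0") (auto simp: double_stolz_def stolz_iff)
qed

lemma double_stolz_eq:
  "double_stolz \<alpha> \<beta> = {z. Im z \<noteq> 0} \<inter> {z. \<bar>Re z\<bar> < \<alpha> * \<bar>Im z\<bar>} \<inter> {z. \<bar>Im z\<bar> < \<beta>}"
  by (auto simp: double_stolz_iff)

lemma open_double_stolz: "open (double_stolz \<alpha> \<beta>)"
  unfolding double_stolz_eq
  by (intro open_Int open_Collect_less open_Collect_neq continuous_intros)

lemma double_stolz_mono: "\<alpha>' \<le> \<alpha> \<Longrightarrow> \<beta>' \<le> \<beta> \<Longrightarrow> double_stolz \<alpha>' \<beta>' \<subseteq> double_stolz \<alpha> \<beta>"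
proof
  fix z assume a: "\<alpha>' \<le> \<alpha>" "\<beta>' \<le> \<beta>" and z: "z \<in> double_stolz \<alpha>' \<beta>'"
  have "\<alpha>' * \<bar>Im z\<bar> \<le> \<alpha> * \<bar>Im z\<bar>" using a by (intro mult_right_mono) auto
  with z have "\<bar>Re z\<bar> < \<alpha> * \<bar>Im z\<bar>" unfolding double_stolz_iff by linarith
  then show "z \<in> double_stolz \<alpha> \<beta>" using a z by (simp add: double_stolz_iff)
qed

lemma double_stolz_nonreal: "z \<in> double_stolz \<alpha> \<beta> \<Longrightarrow> Im z \<noteq> 0"
  by (simp add: double_stolz_iff)

lemma double_stolz_subset_nonreal: "double_stolz \<alpha> \<beta> \<subseteq> - \<real>"
  by (auto simp: double_stolz_iff complex_is_Real_iff)

lemma norm_double_stolz_le: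
  assumes "z \<in> double_stolz \<alpha> \<beta>"
  shows "norm z \<le> (\<alpha> + 1) * \<bar>Im z\<bar>"
  using cmod_le[of z] assms by (auto simp: double_stolz_iff algebra_simps)

lemma Im_inverse: "Im (1 / z) = - Im z / (norm z)^2"
  by (simp add: Im_divide cmod_power2)

lemma Im_inverse_nonzero: "Im z \<noteq> 0 \<Longrightarrow> Im (1 / z) \<noteq> 0"
  by (auto simp: Im_inverse)

lemma abs_Im_inverse:
  assumes "z \<in> double_stolz \<alpha> \<beta>" "\<alpha> \<ge> 0"
  shows "\<bar>Im (1 / z)\<bar> * (\<alpha> + 1) \<ge> norm (1 / z)"
proof -
  have z: "norm z > 0" using double_stolz_nonreal[OF assms(1)] by auto
  have "norm (1 / z) = norm z / (norm z)^2" using z by (simp add: norm_divide power2_eq_square)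
  also have "\<dots> \<le> (\<alpha> + 1) * \<bar>Im z\<bar> / (norm z)^2"
    by (intro divide_right_mono norm_double_stolz_le[OF assms(1)]) auto
  finally show ?thesis by (simp add: Im_inverse mult.commute)
qed

text \<open>The sequence \<open>- \<i> \<beta> / (j + 2)\<close> approaches the vertex of the Stolz angle along its axis.\<close>

definition axis_seq :: "real \<Rightarrow> nat \<Rightarrow> complex" where
  "axis_seq \<beta> j = - \<i> * of_real (\<beta> / (real j + 2))"

lemma axis_seq_in: "\<alpha> > 0 \<Longrightarrow> \<beta> > 0 \<Longrightarrow> axis_seq \<beta> j \<in> double_stolz \<alpha> \<beta>"
  by (auto simp: axis_seq_def double_stolz_iff divide_less_eq)

lemma axis_seq_nonzero: "\<beta> > 0 \<Longrightarrow> axis_seq \<beta> j \<noteq> 0"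
proof -
  assume "\<beta> > 0"
  then have "\<beta> / (real j + 2) \<noteq> 0" by (simp add: add_nonneg_eq_0_iff)
  then show "axis_seq \<beta> j \<noteq> 0" by (simp add: axis_seq_def del: of_real_divide)
qed

lemma axis_seq_lim: "axis_seq \<beta> \<longlonglongrightarrow> 0"
proof -
  have "(\<lambda>j. complex_of_real (\<beta> / (real j + 2))) \<longlonglongrightarrow> of_real 0"
    by (intro tendsto_of_real) real_asymp
  from tendsto_mult_left[OF this, of "- \<i>"]
  show ?thesis unfolding axis_seq_def[abs_def] by (simp del: of_real_divide)
qed

lemma axis_seq_tendsto:
  assumes "((\<lambda>z. f z) \<longlongrightarrow> l) (at 0 within double_stolz \<alpha> \<beta>)" "\<alpha> > 0" "\<beta> > 0"
  shows "(\<lambda>j. f (axis_seq \<beta> j)) \<longlonglongrightarrow> l"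
proof (rule filterlim_compose[OF assms(1)])
  show "filterlim (axis_seq \<beta>) (at 0 within double_stolz \<alpha> \<beta>) sequentially"
    unfolding filterlim_at using axis_seq_lim axis_seq_in[OF assms(2,3)] axis_seq_nonzero[OF assms(3)] by auto
qed

section \<open>Marginal R-transforms as limits of the joint one\<close>

lemma free_R_transform_on_subset:
  assumes "free_R_transform_on m D R" "D' \<subseteq> D"
  shows "free_R_transform_on m D' R"
proof -
  have "R holomorphic_on D'" "((\<lambda>z. z * R z) \<longlongrightarrow> 0) (at 0 within D')"
    using assms holomorphic_on_subset tendsto_within_subset unfolding free_R_transform_on_def by blast+
  then show ?thesis using assms unfolding free_R_transform_on_def by blast
qed

text \<open>Along the axis 1 / w + R2 w = (1 + e) / w with e = w R2 w tending to 0. The point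
  therefore escapes to infinity inside a fixed cone, where
  \<open>cauchy_transform2_at_infinity\<close> applies.\<close>

lemma cauchy_transform2_shifted_at_infinity:
  assumes \<mu>: "borel_prob \<mu>" and z: "Im z \<noteq> 0" and ab: "\<alpha> > 0" "\<beta> > 0"
    and R2: "((\<lambda>w. w * R2 w) \<longlongrightarrow> 0) (at 0 within double_stolz \<alpha> \<beta>)"
  shows "(\<lambda>j. cauchy_transform2 \<mu> z (1 / axis_seq \<beta> j + R2 (axis_seq \<beta> j)) / axis_seq \<beta> j)
    \<longlonglongrightarrow> cauchy_transform (marginal1 \<mu>) z"
proof -
  define w where "w = axis_seq \<beta>"
  define e where "e j = w j * R2 (w j)" for j
  define \<omega> where "\<omega> j = 1 / w j + R2 (w j)" for j
  have e: "e \<longlonglongrightarrow> 0" unfolding e_def w_def by (rule axis_seq_tendsto[OF R2 ab])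
  have w0: "w j \<noteq> 0" for j unfolding w_def by (rule axis_seq_nonzero[OF ab(2)])
  have we: "w j * \<omega> j = 1 + e j" for j using w0[of j] by (simp add: \<omega>_def e_def distrib_left)
  then have \<omega>: "\<omega> j = (1 + e j) / w j" for j using w0[of j] by (simp add: field_simps)
  obtain J where J: "\<And>j. j \<ge> J \<Longrightarrow> norm (e j) \<le> 1/2"
    using tendstoD[OF e, of "1/2"] by (auto simp: eventually_sequentially dist_norm intro: less_imp_le)
  \<comment> \<open>For |e| \<le> 1/2 the imaginary part is at least b / 2 and the norm at most 3 b
    / 2, where b = 1 / |w|; this gives the cone constant 1/3. The offset J skips the indices before
    e is that small.\<close>
  have lim: "(\<lambda>j. \<omega> (j + J) * cauchy_transform2 \<mu> z (\<omega> (j + J))) \<longlonglongrightarrow> cauchy_transform (marginal1 \<mu>) z"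
  proof (rule cauchy_transform2_at_infinity[OF \<mu> z, of "1/3"])
    have n: "norm (w j) = \<beta> / (real j + 2)" for j
      unfolding w_def axis_seq_def using ab by (simp add: norm_mult del: of_real_divide)
    have lower: "norm (1 + e (j + J)) \<ge> 1/2" for j
      using J[of "j + J"] norm_triangle_ineq4[of "1 + e (j + J)" "e (j + J)"] by simp
    show "\<omega> (j + J) \<noteq> 0" for j
      using lower[of j] w0 by (auto simp: \<omega>)
    show "filterlim (\<lambda>j. \<omega> (j + J)) at_infinity sequentially"
      unfolding filterlim_at_infinity_conv_norm_at_top
    proof (rule filterlim_at_top_mono)
      show "filterlim (\<lambda>j. (real j + real J + 2) / (2 * \<beta>)) at_top sequentially"
        using ab(2) by real_asymp
      have "(real j + real J + 2) / (2 * \<beta>) \<le> norm (\<omega> (j + J))" for j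
      proof -
        have "norm (\<omega> (j + J)) = norm (1 + e (j + J)) * ((real j + real J + 2) / \<beta>)"
          unfolding \<omega> norm_divide n by (simp add: field_simps)
        also have "\<dots> \<ge> 1/2 * ((real j + real J + 2) / \<beta>)"
          using lower[of j] ab by (intro mult_right_mono) auto
        finally show ?thesis by simp
      qed
      then show "\<forall>\<^sub>F j in sequentially. (real j + real J + 2) / (2 * \<beta>) \<le> norm (\<omega> (j + J))" by simp
    qed
    show "1/3 * norm (\<omega> (j + J)) \<le> \<bar>Im (\<omega> (j + J))\<bar>" for j
    proof -
      define b where "b = (real (j + J) + 2) / \<beta>"
      have b: "b > 0" unfolding b_def using ab by (intro divide_pos_pos add_nonneg_pos) auto
      have "w (j + J) = - \<i> * of_real (1 / b)"
        unfolding w_def axis_seq_def b_def by simp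
      then have o: "\<omega> (j + J) = \<i> * (1 + e (j + J)) * of_real b"
      proof -
        have "x / (- k * of_real (1 / b)) = k * x * of_real b" if k: "k * k = -1" for x k :: complex
        proof -
          have "k \<noteq> 0" using k by auto
          then have "x / (- k * of_real (1 / b)) = - (x * of_real b) / k" using b by simp
          also have "\<dots> = (k * k) * (x * of_real b) / k" unfolding k by simp
          also have "\<dots> = k * x * of_real b" using \<open>k \<noteq> 0\<close> by simp
          finally show ?thesis .
        qed
        from this[OF i_squared] show ?thesis
          unfolding \<omega> \<open>w (j + J) = - \<i> * of_real (1 / b)\<close> .
      qed
      have "Im (\<omega> (j + J)) = Re (1 + e (j + J)) * b" unfolding o by simp
      moreover have "Re (1 + e (j + J)) \<ge> 1/2"
        using J[of "j + J"] abs_Re_le_cmod[of "e (j + J)"] by simp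
      ultimately have 1: "\<bar>Im (\<omega> (j + J))\<bar> \<ge> 1/2 * b"
        using b mult_right_mono[of "1/2" "Re (1 + e (j + J))" b] by simp
      have "norm (\<omega> (j + J)) = norm (1 + e (j + J)) * b" unfolding o using b by (simp add: norm_mult)
      also have "\<dots> \<le> 3/2 * b"
        using J[of "j + J"] norm_triangle_ineq[of 1 "e (j + J)"] b by (intro mult_right_mono) auto
      finally show ?thesis using 1 by simp
    qed
  qed simp
  have "(\<lambda>j. \<omega> j * cauchy_transform2 \<mu> z (\<omega> j)) \<longlonglongrightarrow> cauchy_transform (marginal1 \<mu>) z"
    using lim by (rule LIMSEQ_offset)
  then have "(\<lambda>j. \<omega> j * cauchy_transform2 \<mu> z (\<omega> j) / (1 + e j)) \<longlonglongrightarrow> cauchy_transform (marginal1 \<mu>) z / (1 + 0)"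
    by (intro tendsto_intros e) auto
  moreover have "\<forall>\<^sub>F j in sequentially. \<omega> j * cauchy_transform2 \<mu> z (\<omega> j) / (1 + e j) = cauchy_transform2 \<mu> z (\<omega> j) / w j"
    using eventually_ge_at_top[of J]
  proof eventually_elim
    case (elim j)
    have "norm (1 + e j) \<ge> 1/2"
      using J[OF elim] norm_triangle_ineq4[of "1 + e j" "e j"] by simp
    then have "1 + e j \<noteq> 0" by auto
    then have "x / y * G / x = G / y" if "x = 1 + e j" for x y G using that by simp
    then show ?case unfolding \<omega>[of j] by blast
  qed
  ultimately show ?thesis
    unfolding \<omega>_def w_def by (auto elim: Lim_transform_eventually)
qed

text \<open>As w tends to 0 along the axis, G(\<zeta>, 1 / w + R2 w) / w tends to the marginal
  transform at \<zeta> = 1 / z + R1 z, which is z. So h tends to 1, the bracket 1 - 1 / h disappears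
  and only z R1 z is left. The bi-free R-transform thus determines the marginal ones.\<close>

lemma bifree_R_axis_limit:
  assumes \<mu>: "borel_prob \<mu>" and ab: "\<alpha> > 0" "\<beta> > 0" and z: "z \<in> double_stolz \<alpha> \<beta>"
    and R1: "free_R_transform_on (marginal1 \<mu>) (double_stolz \<alpha> \<beta>) R1"
    and R2: "free_R_transform_on (marginal2 \<mu>) (double_stolz \<alpha> \<beta>) R2"
  shows "(\<lambda>j. z * R1 z + axis_seq \<beta> j * R2 (axis_seq \<beta> j) + (1 - 1 / bifree_h \<mu> R1 R2 z (axis_seq \<beta> j))) \<longlonglongrightarrow> z * R1 z"
proof -
  have z0: "z \<noteq> 0" using double_stolz_nonreal[OF z] by auto
  have R2': "((\<lambda>w. w * R2 w) \<longlongrightarrow> 0) (at 0 within double_stolz \<alpha> \<beta>)" using R2 by (simp add: free_R_transform_on_def)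
  have \<zeta>: "Im (1 / z + R1 z) \<noteq> 0" and G: "cauchy_transform (marginal1 \<mu>) (1 / z + R1 z) = z"
    using R1 z by (auto simp: free_R_transform_on_def complex_is_Real_iff)
  have "(\<lambda>j. cauchy_transform2 \<mu> (1 / z + R1 z) (1 / axis_seq \<beta> j + R2 (axis_seq \<beta> j)) / axis_seq \<beta> j) \<longlonglongrightarrow> z"
    using cauchy_transform2_shifted_at_infinity[OF \<mu> \<zeta> ab R2'] unfolding G .
  from tendsto_divide[OF this tendsto_const[of z]] z0
  have h: "(\<lambda>j. bifree_h \<mu> R1 R2 z (axis_seq \<beta> j)) \<longlonglongrightarrow> 1"
    by (simp add: bifree_h_def mult.commute)
  have "(\<lambda>j. z * R1 z + axis_seq \<beta> j * R2 (axis_seq \<beta> j) + (1 - 1 / bifree_h \<mu> R1 R2 z (axis_seq \<beta> j))) \<longlonglongrightarrow> z * R1 z + 0 + (1 - 1 / 1)"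
    by (intro tendsto_intros h axis_seq_tendsto[OF R2' ab]) auto
  then show ?thesis by simp
qed

section \<open>R-transforms of compound Poisson laws\<close>

definition joint_R :: "real \<Rightarrow> (real \<times> real) measure \<Rightarrow> complex \<Rightarrow> complex \<Rightarrow> complex" where
  "joint_R r \<mu> z w = of_real r * (cauchy_transform2 \<mu> (1 / z) (1 / w) / (z * w) - 1)"

lemma joint_R_eq_integral:
  assumes z: "Im z \<noteq> 0" and w: "Im w \<noteq> 0"
  shows "- of_real r + of_real r * (\<integral>(s, t). 1 / ((1 - z * of_real s) * (1 - w * of_real t)) \<partial>\<mu>) = joint_R r \<mu> z w"
proof -
  have zw: "z \<noteq> 0" "w \<noteq> 0" using z w by auto
  have "1 / ((1 - z * of_real s) * (1 - w * of_real t)) = (1 / (z * w)) * (1 / ((1 / z - of_real s) * (1 / w - of_real t)))" for s t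
  proof -
    have "1 - z * of_real s = z * (1 / z - of_real s)" "1 - w * of_real t = w * (1 / w - of_real t)"
      using zw by (simp_all add: right_diff_distrib)
    then show ?thesis by simp
  qed
  then have "(\<integral>(s, t). 1 / ((1 - z * of_real s) * (1 - w * of_real t)) \<partial>\<mu>) = (1 / (z * w)) * cauchy_transform2 \<mu> (1 / z) (1 / w)"
    unfolding cauchy_transform2_def case_prod_beta by (simp only: integral_mult_right_zero)
  then show ?thesis by (simp add: joint_R_def right_diff_distrib)
qed

lemma joint_R_eq:
  assumes \<mu>: "borel_prob \<mu>" and z: "Im z \<noteq> 0" and w: "Im w \<noteq> 0"
  shows "joint_R r \<mu> z w = z * poisson_R r (marginal1 \<mu>) z + w * poisson_R r (marginal2 \<mu>) w + joint_E r \<mu> (1 / z) (1 / w)"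
proof -
  have zw: "z \<noteq> 0" "w \<noteq> 0" using z w by auto
  have R: "x * poisson_R r m x = of_real r * (cauchy_transform m (1 / x) / x - 1)" if "x \<noteq> 0" for x m
    using that by (simp add: poisson_R_def)
  show ?thesis
    unfolding joint_R_def R[OF zw(1)] R[OF zw(2)] joint_E_eq[OF \<mu> Im_inverse_nonzero[OF z] Im_inverse_nonzero[OF w]]
    using zw by (simp add: algebra_simps)
qed

lemma inverse_image_nonreal: "(\<lambda>z. 1 / z) ` (- \<real>) \<subseteq> (- \<real> :: complex set)"
  unfolding image_subset_iff nonreal_iff(2) using Im_inverse_nonzero by (simp add: nonreal_iff)

lemma inverse_holomorphic_nonreal: "(\<lambda>z. 1 / z) holomorphic_on - \<real>"
  by (intro holomorphic_intros) auto

lemma joint_R_holomorphic1: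
  assumes \<mu>: "borel_prob \<mu>" and w: "Im w \<noteq> 0"
  shows "(\<lambda>z. joint_R r \<mu> z w) holomorphic_on - \<real>"
proof -
  from holomorphic_on_compose_gen[OF inverse_holomorphic_nonreal cauchy_transform2_holomorphic1[OF \<mu> Im_inverse_nonzero[OF w]] inverse_image_nonreal]
  have "(\<lambda>z. cauchy_transform2 \<mu> (1 / z) (1 / w)) holomorphic_on - \<real>" by (simp add: comp_def)
  then show ?thesis unfolding joint_R_def by (intro holomorphic_intros) (use w in auto)
qed

lemma joint_R_swap: "borel_prob \<mu> \<Longrightarrow> joint_R r (swap_law \<mu>) w z = joint_R r \<mu> z w"
  by (simp add: joint_R_def cauchy_transform2_swap mult.commute)

lemma joint_R_holomorphic2:
  assumes \<mu>: "borel_prob \<mu>" and z: "Im z \<noteq> 0"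
  shows "joint_R r \<mu> z holomorphic_on - \<real>"
  using joint_R_holomorphic1[OF borel_prob_swap[OF \<mu>] z, of r] by (simp add: joint_R_swap[OF \<mu>])

lemma joint_R_continuous:
  assumes \<mu>: "borel_prob \<mu>"
  shows "continuous_on ((- \<real>) \<times> (- \<real>)) (\<lambda>p. joint_R r \<mu> (fst p) (snd p))"
proof -
  have "continuous_on ((- \<real>) \<times> (- \<real>)) (\<lambda>p. cauchy_transform2 \<mu> (fst (1 / fst p, 1 / snd p)) (snd (1 / fst p, 1 / snd p)))"
    by (rule continuous_on_compose2[OF cauchy_transform2_continuous[OF \<mu>]])
       (use Im_inverse_nonzero in \<open>auto simp: complex_is_Real_iff intro!: continuous_intros\<close>)
  then show ?thesis
    unfolding joint_R_def by (intro continuous_intros) (auto simp: complex_is_Real_iff)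
qed

lemma poisson_R_holomorphic:
  assumes m: "borel_prob m"
  shows "poisson_R r m holomorphic_on - \<real>"
proof -
  from holomorphic_on_compose_gen[OF inverse_holomorphic_nonreal cauchy_transform_holomorphic[OF m] inverse_image_nonreal]
  have "(\<lambda>z. cauchy_transform m (1 / z)) holomorphic_on - \<real>" by (simp add: comp_def)
  then show ?thesis unfolding poisson_R_def by (intro holomorphic_intros) auto
qed

lemma holomorphic2_joint_R:
  assumes \<mu>: "borel_prob \<mu>"
  shows "holomorphic2_on (\<lambda>z w. - of_real r + of_real r * (\<integral>(s, t). 1 / ((1 - z * of_real s) * (1 - w * of_real t)) \<partial>\<mu>)) (- \<real>) (- \<real>)"
  unfolding holomorphic2_on_def
proof (intro conjI ballI)
  have "continuous_on ((- \<real>) \<times> (- \<real>)) (\<lambda>(z :: complex, w :: complex). - of_real r + of_real r * (\<integral>(s, t). 1 / ((1 - z * of_real s) * (1 - w * of_real t)) \<partial>\<mu>))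
    = continuous_on ((- \<real>) \<times> (- \<real>)) (\<lambda>p. joint_R r \<mu> (fst p) (snd p))"
  proof (rule continuous_on_cong[OF refl])
    fix p :: "complex \<times> complex" assume "p \<in> (- \<real>) \<times> (- \<real>)"
    then have "Im (fst p) \<noteq> 0" "Im (snd p) \<noteq> 0" by (auto simp: complex_is_Real_iff)
    from joint_R_eq_integral[OF this, of r \<mu>]
    show "(case p of (z, w) \<Rightarrow> - of_real r + of_real r * (\<integral>(s, t). 1 / ((1 - z * of_real s) * (1 - w * of_real t)) \<partial>\<mu>)) = joint_R r \<mu> (fst p) (snd p)"
      unfolding case_prod_beta .
  qed
  then show "continuous_on ((- \<real>) \<times> (- \<real>)) (\<lambda>(z :: complex, w :: complex). - of_real r + of_real r * (\<integral>(s, t). 1 / ((1 - z * of_real s) * (1 - w * of_real t)) \<partial>\<mu>))"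
    using joint_R_continuous[OF \<mu>, of r] by (simp only:)
next
  fix w :: complex assume w: "w \<in> - \<real>"
  show "(\<lambda>z. - of_real r + of_real r * (\<integral>(s, t). 1 / ((1 - z * of_real s) * (1 - w * of_real t)) \<partial>\<mu>)) holomorphic_on - \<real>"
    by (rule holomorphic_transform[OF joint_R_holomorphic1[OF \<mu>, of w]]; (rule joint_R_eq_integral[symmetric])?)
       (use w in \<open>auto simp: complex_is_Real_iff\<close>)
next
  fix z :: complex assume z: "z \<in> - \<real>"
  show "(\<lambda>w. - of_real r + of_real r * (\<integral>(s, t). 1 / ((1 - z * of_real s) * (1 - w * of_real t)) \<partial>\<mu>)) holomorphic_on - \<real>"
    by (rule holomorphic_transform[OF joint_R_holomorphic2[OF \<mu>, of z]]; (rule joint_R_eq_integral[symmetric])?)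
       (use z in \<open>auto simp: complex_is_Real_iff\<close>)
qed

lemma bifree_R_cong:
  assumes "bifree_R_transform_on \<mu> D R" "\<And>z w. z \<in> D \<Longrightarrow> w \<in> D \<Longrightarrow> R z w = R' z w"
  shows "bifree_R_transform_on \<mu> D R'"
  using assms unfolding bifree_R_transform_on_def by (metis (no_types, lifting))

text \<open>For jumps bounded by M, \<open>poisson_A\<close> is at most r M^2 / (Im F)^2, and |Im F|
  \<ge> r M^2 + 1 makes this less than 1. Hence 1 / z falls in the range of the functional equations
  for all z in a small Stolz angle.\<close>

lemma poisson_H_sign_bounded:
  assumes m: "borel_prob m" and r: "r \<ge> 0" and M: "AE x in m. \<bar>x\<bar> \<le> M" and F: "\<bar>Im F\<bar> \<ge> r * M^2 + 1"
  shows "Im F * Im (poisson_H r m F) > 0"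
proof -
  have F1: "\<bar>Im F\<bar> \<ge> 1" using F r by (smt (verit) mult_nonneg_nonneg zero_le_power2)
  then have F0: "Im F \<noteq> 0" by auto
  have "(\<integral>x. (norm (complex_of_real x / (F - of_real x)))^2 \<partial>m) \<le> (\<integral>x. M^2 / (Im F)^2 \<partial>m)"
  proof (rule integral_mono_AE[OF integrable_real_resolvent_square[OF m F0]])
    show "integrable m (\<lambda>x. M^2 / (Im F)^2)" using borel_probD(2)[OF m] by (simp add: finite_measure.integrable_const)
    show "AE x in m. (norm (complex_of_real x / (F - of_real x)))^2 \<le> M^2 / (Im F)^2"
      using M
    proof eventually_elim
      case (elim x)
      have "norm (complex_of_real x * (1 / (F - of_real x))) \<le> M * (1 / \<bar>Im F\<bar>)"
        unfolding norm_mult using elim by (intro mult_mono norm_resolvent_le F0) auto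
      then have "(norm (complex_of_real x / (F - of_real x)))^2 \<le> (M / \<bar>Im F\<bar>)^2"
        by (intro power_mono) (auto simp: norm_divide norm_mult)
      then show ?case by (simp add: power_divide)
    qed
  qed
  also have "\<dots> = M^2 / (Im F)^2" using borel_probD(5)[OF m] by simp
  finally have "poisson_A r m F \<le> r * (M^2 / (Im F)^2)"
    unfolding poisson_A_def using r by (rule mult_left_mono)
  also have "\<dots> < 1"
  proof -
    have "r * M^2 < \<bar>Im F\<bar>" using F by simp
    also have "\<dots> \<le> \<bar>Im F\<bar>^2" using F1 by (rule self_le_power) simp
    finally show ?thesis using F0 by (simp add: divide_less_eq)
  qed
  finally have "poisson_A r m F < 1" .
  moreover have "Im F * Im (poisson_H r m F) = (Im F)^2 * (1 - poisson_A r m F)"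
    by (simp add: Im_poisson_H[OF m F0] power2_eq_square)
  ultimately show ?thesis using F0 by simp
qed

text \<open>Condition \<open>D\<close> places every 1 / z in the region of
  \<open>poisson_H_sign_bounded\<close>, so the equation for n can be read at F = 1 / z. The limit z
  R z -> 0 holds because \<open>poisson_H_bound\<close> keeps R itself bounded on the
  domain.\<close>

lemma free_R_transform_poisson:
  assumes m: "borel_prob m" and r: "r \<ge> 0" and M: "M \<ge> 0" "AE x in m. \<bar>x\<bar> \<le> M"
    and D: "\<And>z. z \<in> double_stolz \<alpha> \<beta> \<Longrightarrow> \<bar>Im (1 / z)\<bar> \<ge> r * M^2 + 1"
    and N: "\<And>F. Im F * Im (poisson_H r m F) > 0 \<Longrightarrow> cauchy_transform n (poisson_H r m F) = 1 / F"
  shows "free_R_transform_on n (double_stolz \<alpha> \<beta>) (poisson_R r m)"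
  unfolding free_R_transform_on_def
proof (intro conjI ballI)
  show "poisson_R r m holomorphic_on double_stolz \<alpha> \<beta>"
    by (rule holomorphic_on_subset[OF poisson_R_holomorphic[OF m] double_stolz_subset_nonreal])
  fix z assume z: "z \<in> double_stolz \<alpha> \<beta>"
  have z0: "z \<noteq> 0" using double_stolz_nonreal[OF z] by auto
  note s = poisson_H_sign_bounded[OF m r M(2) D[OF z]]
  show "1 / z + poisson_R r m z \<notin> \<real>"
    using s unfolding poisson_H_inverse[OF z0, symmetric] by (auto simp: complex_is_Real_iff)
  show "cauchy_transform n (1 / z + poisson_R r m z) = z"
    using N[OF s] unfolding poisson_H_inverse[OF z0, symmetric] by simp
next
  show "((\<lambda>z. z * poisson_R r m z) \<longlongrightarrow> 0) (at 0 within double_stolz \<alpha> \<beta>)"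
  proof (rule Lim_null_comparison)
    show "\<forall>\<^sub>F z in at 0 within double_stolz \<alpha> \<beta>. norm (z * poisson_R r m z) \<le> norm z * (r * M * (1 + M))"
      unfolding eventually_at_filter
    proof (rule always_eventually, intro allI impI)
      fix z assume z: "z \<in> double_stolz \<alpha> \<beta>"
      have z0: "z \<noteq> 0" using double_stolz_nonreal[OF z] by auto
      have i: "\<bar>Im (1 / z)\<bar> \<ge> 1" using D[OF z] r by (smt (verit) mult_nonneg_nonneg zero_le_power2)
      then have "Im (1 / z) \<noteq> 0" by auto
      then have "norm (poisson_H r m (1 / z) - 1 / z) \<le> r * M * (1 + M / \<bar>Im (1 / z)\<bar>)" by (rule poisson_H_bound[OF m r M])
      also have "\<dots> \<le> r * M * (1 + M / 1)"
        using i r M by (intro mult_left_mono add_left_mono divide_left_mono) auto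
      finally have "norm (poisson_R r m z) \<le> r * M * (1 + M)"
        unfolding poisson_H_inverse[OF z0] by simp
      then show "norm (z * poisson_R r m z) \<le> norm z * (r * M * (1 + M))"
        unfolding norm_mult by (intro mult_left_mono) auto
    qed
    show "((\<lambda>z. norm z * (r * M * (1 + M))) \<longlongrightarrow> 0) (at 0 within double_stolz \<alpha> \<beta>)"
      by (auto intro!: tendsto_eq_intros)
  qed
qed

lemma bifree_compound_poisson_of_poisson_law:
  assumes b: "bounded_jumps r M \<mu>" and N: "poisson_law r \<mu> N"
  shows "bifree_compound_poisson r \<mu> N"
proof -
  interpret bounded_jumps r M \<mu> by (rule b)
  \<comment> \<open>With aperture 1, |z| \<le> 2 |Im z|, so |Im (1 / z)| = |Im z| / |z|^2 \<ge> 1 /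
    (4 |Im z|), which exceeds r M^2 + 1 for |Im z| < \<beta>.\<close>
  define \<beta> where "\<beta> = 1 / (4 * (r * M^2 + 1))"
  have p: "r * M^2 + 1 > 0" using r by (intro add_nonneg_pos) auto
  have \<beta>: "\<beta> > 0" unfolding \<beta>_def using p by simp
  have D: "\<bar>Im (1 / z)\<bar> \<ge> r * M^2 + 1" if z: "z \<in> double_stolz 1 \<beta>" for z
  proof -
    have n: "norm z \<le> 2 * \<bar>Im z\<bar>" using norm_double_stolz_le[OF z] by simp
    have i: "0 < \<bar>Im z\<bar>" "\<bar>Im z\<bar> < \<beta>" using z by (auto simp: double_stolz_iff)
    have "(norm z)^2 \<le> (2 * \<bar>Im z\<bar>)^2" using n by (intro power_mono) auto
    then have "(norm z)^2 \<le> 4 * \<bar>Im z\<bar> * \<bar>Im z\<bar>" by (simp add: power2_eq_square)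
    also have "\<dots> \<le> 4 * \<beta> * \<bar>Im z\<bar>" using i by (intro mult_right_mono) auto
    finally have "(norm z)^2 * (r * M^2 + 1) \<le> 4 * \<beta> * \<bar>Im z\<bar> * (r * M^2 + 1)" using p by (intro mult_right_mono) auto
    also have "\<dots> = \<bar>Im z\<bar>" unfolding \<beta>_def using p by (simp add: field_simps)
    finally have "(norm z)^2 * (r * M^2 + 1) \<le> \<bar>Im z\<bar>" .
    moreover have "norm z > 0" using i by auto
    ultimately show ?thesis by (simp add: Im_inverse le_divide_eq mult.commute)
  qed
  have N': "borel_prob N" using N by (simp add: poisson_law_def)
  have f1: "free_R_transform_on (marginal1 N) (double_stolz 1 \<beta>) (poisson_R r m1)"
    by (rule free_R_transform_poisson[OF m12(1) r M AE_marginal1[OF \<mu> M1] D]) (use N in \<open>auto simp: poisson_law_def\<close>)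
  have f2: "free_R_transform_on (marginal2 N) (double_stolz 1 \<beta>) (poisson_R r m2)"
    by (rule free_R_transform_poisson[OF m12(2) r M AE_marginal2[OF \<mu> M2] D]) (use N in \<open>auto simp: poisson_law_def\<close>)
  have "bifree_R_transform_on N (double_stolz 1 \<beta>) (joint_R r \<mu>)"
    unfolding bifree_R_transform_on_def
  proof (intro exI conjI ballI)
    show "free_R_transform_on (marginal1 N) (double_stolz 1 \<beta>) (poisson_R r m1)" by (rule f1)
    show "free_R_transform_on (marginal2 N) (double_stolz 1 \<beta>) (poisson_R r m2)" by (rule f2)
    fix z w assume zw: "z \<in> double_stolz 1 \<beta>" "w \<in> double_stolz 1 \<beta>"
    have i: "Im z \<noteq> 0" "Im w \<noteq> 0" using zw double_stolz_nonreal by auto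
    have n: "z \<noteq> 0" "w \<noteq> 0" using i by auto
    let ?h = "bifree_h N (poisson_R r m1) (poisson_R r m2) z w"
    have "cauchy_transform2 N (poisson_H r m1 (1 / z)) (poisson_H r m2 (1 / w)) * (1 / z * (1 / w) * (1 - joint_E r \<mu> (1 / z) (1 / w))) = 1"
      using N poisson_H_sign_bounded[OF m12(1) r AE_marginal1[OF \<mu> M1] D[OF zw(1)]]
        poisson_H_sign_bounded[OF m12(2) r AE_marginal2[OF \<mu> M2] D[OF zw(2)]] unfolding poisson_law_def by blast
    then have h: "?h * (1 - joint_E r \<mu> (1 / z) (1 / w)) = 1"
      unfolding bifree_h_def poisson_H_inverse[OF n(1)] poisson_H_inverse[OF n(2)] by simp
    then show h0: "?h \<noteq> 0" by auto
    have "1 / ?h = 1 - joint_E r \<mu> (1 / z) (1 / w)" using h h0 by (simp add: divide_eq_eq mult.commute)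
    then show "joint_R r \<mu> z w = z * poisson_R r m1 z + w * poisson_R r m2 w + (1 - 1 / ?h)"
      by (simp add: joint_R_eq[OF \<mu> i])
  qed
  then have "bifree_R_transform_on N (double_stolz 1 \<beta>)
      (\<lambda>z w. - of_real r + of_real r * (\<integral>(s, t). 1 / ((1 - z * of_real s) * (1 - w * of_real t)) \<partial>\<mu>))"
    by (rule bifree_R_cong) (intro joint_R_eq_integral[symmetric] double_stolz_nonreal)
  then show ?thesis
    unfolding bifree_compound_poisson_def bifree_R_transform_ext_def
    using N' holomorphic2_joint_R[OF \<mu>] \<beta> zero_less_one by blast
qed

section \<open>Analytic continuation from Stolz angles to both half planes\<close>

lemma identity_half_planes:
  assumes f: "f holomorphic_on - \<real>" and g: "g holomorphic_on - \<real>" and U: "open U" "U \<subseteq> - \<real>"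
    and ne: "\<exists>z\<in>U. Im z > 0" "\<exists>z\<in>U. Im z < 0" and eq: "\<And>z. z \<in> U \<Longrightarrow> f z = g z" and z: "Im z \<noteq> 0"
  shows "f z = g z"
proof (cases "Im z > 0")
  case True
  show ?thesis
  proof (rule analytic_continuation_open[of "U \<inter> {z. Im z > 0}" "{z. Im z > 0}" f g])
    show "open (U \<inter> {z. Im z > 0})" "open {z. Im z > 0}"
      using U by (auto intro!: open_Int open_halfspace_Im_gt)
    show "connected {z. Im z > 0}" by (rule convex_connected[OF convex_halfspace_Im_gt])
    show "f holomorphic_on {z. Im z > 0}" "g holomorphic_on {z. Im z > 0}"
      by (rule holomorphic_on_subset[OF f] holomorphic_on_subset[OF g]; auto simp: complex_is_Real_iff)+
  qed (use ne eq True in auto)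
next
  case False
  show ?thesis
  proof (rule analytic_continuation_open[of "U \<inter> {z. Im z < 0}" "{z. Im z < 0}" f g])
    show "open (U \<inter> {z. Im z < 0})" "open {z. Im z < 0}"
      using U by (auto intro!: open_Int open_halfspace_Im_lt)
    show "connected {z. Im z < 0}" by (rule convex_connected[OF convex_halfspace_Im_lt])
    show "f holomorphic_on {z. Im z < 0}" "g holomorphic_on {z. Im z < 0}"
      by (rule holomorphic_on_subset[OF f] holomorphic_on_subset[OF g]; auto simp: complex_is_Real_iff)+
  qed (use ne eq False z in auto)
qed

lemma cauchy_transform_nonzero:
  assumes "borel_prob m" "Im \<zeta> \<noteq> 0"
  shows "Im (cauchy_transform m \<zeta>) \<noteq> 0" "cauchy_transform m \<zeta> \<noteq> 0"
    "Im (1 / cauchy_transform m \<zeta>) * Im \<zeta> > 0"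
proof -
  have neg: "Im \<zeta> * Im (cauchy_transform m \<zeta>) < 0" by (rule Im_cauchy_transform[OF assms])
  then show 1: "Im (cauchy_transform m \<zeta>) \<noteq> 0" by auto
  then show 2: "cauchy_transform m \<zeta> \<noteq> 0" by auto
  have "Im (1 / cauchy_transform m \<zeta>) * Im \<zeta> = - (Im \<zeta> * Im (cauchy_transform m \<zeta>)) / (norm (cauchy_transform m \<zeta>))^2"
    by (simp add: Im_inverse mult.commute)
  also have "\<dots> > 0" using neg 2 by (intro divide_pos_pos) auto
  finally show "Im (1 / cauchy_transform m \<zeta>) * Im \<zeta> > 0" .
qed

text \<open>The transform G reverses half planes and takes the value z at 1 / z + R z, so this point
  and z lie in opposite half planes.\<close>

lemma free_R_transform_sign:
  assumes m: "borel_prob m" and R: "free_R_transform_on m D R" and z: "z \<in> D"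
  shows "Im (1 / z + R z) * Im z < 0" "Im (1 / z + R z) * Im (1 / z) > 0" "Im (1 / z + R z) \<noteq> 0"
proof -
  have n: "Im (1 / z + R z) \<noteq> 0" and G: "cauchy_transform m (1 / z + R z) = z"
    using R z by (auto simp: free_R_transform_on_def complex_is_Real_iff)
  show "Im (1 / z + R z) \<noteq> 0" by (rule n)
  show "Im (1 / z + R z) * Im z < 0" using Im_cauchy_transform[OF m n] by (simp add: G)
  show "Im (1 / z + R z) * Im (1 / z) > 0" using cauchy_transform_nonzero(3)[OF m n] by (simp add: G mult.commute)
qed

text \<open>The map z -> 1 / z + R z has the left inverse G, so it is injective, and an injective
  holomorphic map is open. An axis point and its conjugate reach both half planes, as
  \<open>identity_half_planes\<close> demands.\<close>

lemma free_R_transform_image: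
  assumes m: "borel_prob m" and R: "free_R_transform_on m (double_stolz \<alpha> \<beta>) R" and ab: "\<alpha> > 0" "\<beta> > 0"
  defines "U \<equiv> (\<lambda>z. 1 / z + R z) ` double_stolz \<alpha> \<beta>"
  shows "open U" "U \<subseteq> - \<real>" "\<exists>z\<in>U. Im z > 0" "\<exists>z\<in>U. Im z < 0"
proof -
  let ?D = "double_stolz \<alpha> \<beta>" and ?\<zeta> = "\<lambda>z. 1 / z + R z"
  have G: "cauchy_transform m (?\<zeta> z) = z" if "z \<in> ?D" for z
    using R that by (auto simp: free_R_transform_on_def)
  have "?\<zeta> holomorphic_on ?D"
    using R by (intro holomorphic_intros) (auto simp: free_R_transform_on_def dest: double_stolz_nonreal)
  moreover have "inj_on ?\<zeta> ?D" by (rule inj_onI) (metis G)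
  ultimately show "open U" unfolding U_def by (intro open_mapping_thm3[OF _ open_double_stolz])
  show "U \<subseteq> - \<real>" unfolding U_def using R by (auto simp: free_R_transform_on_def)
  let ?a = "axis_seq \<beta> 0"
  have a: "?a \<in> ?D" "cnj ?a \<in> ?D" using axis_seq_in[OF ab, of 0] by (auto simp: double_stolz_iff)
  have "Im ?a < 0" using ab by (simp add: axis_seq_def)
  then have "Im (?\<zeta> ?a) > 0" "Im (?\<zeta> (cnj ?a)) < 0"
    using free_R_transform_sign(1)[OF m R a(1)] free_R_transform_sign(1)[OF m R a(2)]
    unfolding complex_cnj mult_less_0_iff by auto
  then show "\<exists>z\<in>U. Im z > 0" "\<exists>z\<in>U. Im z < 0"
    unfolding U_def using a by blast+
qed

lemma free_R_transform_cong:
  assumes R: "free_R_transform_on m D R" and eq: "\<And>z. z \<in> D \<Longrightarrow> R z = R' z"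
  shows "free_R_transform_on m D R'"
proof -
  have "R' holomorphic_on D" using R eq holomorphic_transform unfolding free_R_transform_on_def by blast
  moreover have "((\<lambda>z. z * R' z) \<longlongrightarrow> 0) (at 0 within D)"
  proof (rule Lim_transform_eventually)
    show "((\<lambda>z. z * R z) \<longlongrightarrow> 0) (at 0 within D)" using R by (simp add: free_R_transform_on_def)
    show "\<forall>\<^sub>F z in at 0 within D. z * R z = z * R' z"
      unfolding eventually_at_filter using eq by (intro always_eventually) auto
  qed
  ultimately show ?thesis using R eq by (simp add: free_R_transform_on_def)
qed

lemma bifree_h_swap: "borel_prob \<mu> \<Longrightarrow> bifree_h (swap_law \<mu>) R2 R1 w z = bifree_h \<mu> R1 R2 z w"
  by (simp add: bifree_h_def cauchy_transform2_swap mult.commute)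

lemma bifree_R_limits:
  assumes \<mu>: "borel_prob \<mu>" and ab: "\<alpha> > 0" "\<beta> > 0"
    and R1: "free_R_transform_on (marginal1 \<mu>) (double_stolz \<alpha> \<beta>) R1"
    and R2: "free_R_transform_on (marginal2 \<mu>) (double_stolz \<alpha> \<beta>) R2"
    and R: "\<And>z w. z \<in> double_stolz \<alpha> \<beta> \<Longrightarrow> w \<in> double_stolz \<alpha> \<beta> \<Longrightarrow> R z w = z * R1 z + w * R2 w + (1 - 1 / bifree_h \<mu> R1 R2 z w)"
    and z: "z \<in> double_stolz \<alpha> \<beta>"
  shows "(\<lambda>j. R z (axis_seq \<beta> j)) \<longlonglongrightarrow> z * R1 z" "(\<lambda>j. R (axis_seq \<beta> j) z) \<longlonglongrightarrow> z * R2 z"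
proof -
  show "(\<lambda>j. R z (axis_seq \<beta> j)) \<longlonglongrightarrow> z * R1 z"
    using bifree_R_axis_limit[OF \<mu> ab z R1 R2] by (simp add: R[OF z axis_seq_in[OF ab]])
  have "(\<lambda>j. z * R2 z + axis_seq \<beta> j * R1 (axis_seq \<beta> j) + (1 - 1 / bifree_h (swap_law \<mu>) R2 R1 z (axis_seq \<beta> j))) \<longlonglongrightarrow> z * R2 z"
    using bifree_R_axis_limit[OF borel_prob_swap[OF \<mu>] ab z] R1 R2
    unfolding marginal1_swap[OF \<mu>] marginal2_swap[OF \<mu>] by blast
  then show "(\<lambda>j. R (axis_seq \<beta> j) z) \<longlonglongrightarrow> z * R2 z"
    unfolding bifree_h_swap[OF \<mu>] R[OF axis_seq_in[OF ab] z] by (simp only: add.commute)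
qed

lemma joint_R_limit:
  assumes \<mu>: "borel_prob \<mu>" and ab: "\<alpha> > 0" "\<beta> > 0" and z: "Im z \<noteq> 0"
  shows "(\<lambda>j. joint_R r \<mu> z (axis_seq \<beta> j)) \<longlonglongrightarrow> z * poisson_R r (marginal1 \<mu>) z"
proof -
  have z0: "z \<noteq> 0" using z by auto
  have "(\<lambda>j. cauchy_transform2 \<mu> (1 / z) (1 / axis_seq \<beta> j + 0) / axis_seq \<beta> j) \<longlonglongrightarrow> cauchy_transform (marginal1 \<mu>) (1 / z)"
    by (rule cauchy_transform2_shifted_at_infinity[where ?R2.0="\<lambda>_. 0", OF _ Im_inverse_nonzero[OF z]]) (use \<mu> ab in simp_all)
  then have "(\<lambda>j. of_real r * (cauchy_transform2 \<mu> (1 / z) (1 / axis_seq \<beta> j + 0) / axis_seq \<beta> j / z - 1))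
      \<longlonglongrightarrow> of_real r * (cauchy_transform (marginal1 \<mu>) (1 / z) / z - 1)"
    by (intro tendsto_intros z0)
  then show ?thesis using z0 by (simp add: joint_R_def poisson_R_def mult.commute)
qed

text \<open>The definition prescribes the joint R-transform and leaves the marginal ones
  existentially quantified. Comparing limits along the axis on both sides identifies them with
  \<open>poisson_R\<close>, and then the bracket 1 - 1 / h must be E.\<close>

lemma bifree_compound_poissonD:
  assumes \<mu>: "borel_prob \<mu>" and cp: "bifree_compound_poisson r \<mu> N"
  obtains \<alpha> \<beta> where "\<alpha> > 0" "\<beta> > 0"
    "free_R_transform_on (marginal1 N) (double_stolz \<alpha> \<beta>) (poisson_R r (marginal1 \<mu>))"
    "free_R_transform_on (marginal2 N) (double_stolz \<alpha> \<beta>) (poisson_R r (marginal2 \<mu>))"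
    "\<And>z w. z \<in> double_stolz \<alpha> \<beta> \<Longrightarrow> w \<in> double_stolz \<alpha> \<beta> \<Longrightarrow>
       bifree_h N (poisson_R r (marginal1 \<mu>)) (poisson_R r (marginal2 \<mu>)) z w * (1 - joint_E r \<mu> (1 / z) (1 / w)) = 1"
proof -
  let ?F = "\<lambda>z w. - of_real r + of_real r * (\<integral>(s, t). 1 / ((1 - z * of_real s) * (1 - w * of_real t)) \<partial>\<mu>)"
  have N: "borel_prob N" using cp by (simp add: bifree_compound_poisson_def)
  obtain \<alpha> \<beta> R1 R2 where ab: "\<alpha> > 0" "\<beta> > 0"
    and R1: "free_R_transform_on (marginal1 N) (double_stolz \<alpha> \<beta>) R1"
    and R2: "free_R_transform_on (marginal2 N) (double_stolz \<alpha> \<beta>) R2"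
    and F: "\<And>z w. z \<in> double_stolz \<alpha> \<beta> \<Longrightarrow> w \<in> double_stolz \<alpha> \<beta> \<Longrightarrow> bifree_h N R1 R2 z w \<noteq> 0 \<and> ?F z w = z * R1 z + w * R2 w + (1 - 1 / bifree_h N R1 R2 z w)"
    using cp unfolding bifree_compound_poisson_def bifree_R_transform_ext_def bifree_R_transform_on_def by blast
  have R: "joint_R r \<mu> z w = z * R1 z + w * R2 w + (1 - 1 / bifree_h N R1 R2 z w)"
    if "z \<in> double_stolz \<alpha> \<beta>" "w \<in> double_stolz \<alpha> \<beta>" for z w
    using F[OF that] joint_R_eq_integral[OF double_stolz_nonreal[OF that(1)] double_stolz_nonreal[OF that(2)], of r \<mu>] by simp
  have e1: "R1 z = poisson_R r (marginal1 \<mu>) z" if z: "z \<in> double_stolz \<alpha> \<beta>" for z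
  proof -
    have "z * R1 z = z * poisson_R r (marginal1 \<mu>) z"
      by (rule LIMSEQ_unique[OF bifree_R_limits(1)[OF N ab R1 R2 R z] joint_R_limit[OF \<mu> ab double_stolz_nonreal[OF z]]])
    then show ?thesis using double_stolz_nonreal[OF z] by auto
  qed
  have e2: "R2 z = poisson_R r (marginal2 \<mu>) z" if z: "z \<in> double_stolz \<alpha> \<beta>" for z
  proof -
    have "(\<lambda>j. joint_R r \<mu> (axis_seq \<beta> j) z) \<longlonglongrightarrow> z * poisson_R r (marginal2 \<mu>) z"
      using joint_R_limit[OF borel_prob_swap[OF \<mu>] ab double_stolz_nonreal[OF z], of r]
      by (simp add: joint_R_swap[OF \<mu>] marginal1_swap[OF \<mu>])
    from LIMSEQ_unique[OF bifree_R_limits(2)[OF N ab R1 R2 R z] this]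
    have "z * R2 z = z * poisson_R r (marginal2 \<mu>) z" .
    then show ?thesis using double_stolz_nonreal[OF z] by auto
  qed
  show ?thesis
  proof (rule that[OF ab free_R_transform_cong[OF R1 e1] free_R_transform_cong[OF R2 e2]])
    fix z w assume zw: "z \<in> double_stolz \<alpha> \<beta>" "w \<in> double_stolz \<alpha> \<beta>"
    have h: "bifree_h N (poisson_R r (marginal1 \<mu>)) (poisson_R r (marginal2 \<mu>)) z w = bifree_h N R1 R2 z w"
      by (simp add: bifree_h_def e1[OF zw(1)] e2[OF zw(2)])
    have "joint_E r \<mu> (1 / z) (1 / w) = 1 - 1 / bifree_h N R1 R2 z w"
      using R[OF zw] joint_R_eq[OF \<mu> double_stolz_nonreal[OF zw(1)] double_stolz_nonreal[OF zw(2)], of r]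
      by (simp add: e1[OF zw(1)] e2[OF zw(2)])
    then show "bifree_h N (poisson_R r (marginal1 \<mu>)) (poisson_R r (marginal2 \<mu>)) z w * (1 - joint_E r \<mu> (1 / z) (1 / w)) = 1"
      unfolding h using F[OF zw] by simp
  qed
qed

lemma inverse_cauchy_transform_holomorphic:
  assumes "borel_prob m"
  shows "(\<lambda>\<zeta>. 1 / cauchy_transform m \<zeta>) holomorphic_on - \<real>" "(\<lambda>\<zeta>. 1 / cauchy_transform m \<zeta>) ` (- \<real>) \<subseteq> - \<real>"
proof -
  show "(\<lambda>\<zeta>. 1 / cauchy_transform m \<zeta>) holomorphic_on - \<real>"
    by (intro holomorphic_intros cauchy_transform_holomorphic assms)
       (use cauchy_transform_nonzero(2)[OF assms] in \<open>auto simp: complex_is_Real_iff\<close>)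
  show "(\<lambda>\<zeta>. 1 / cauchy_transform m \<zeta>) ` (- \<real>) \<subseteq> - \<real>"
    using Im_inverse_nonzero[OF cauchy_transform_nonzero(1)[OF assms]]
    by (simp add: image_subset_iff complex_is_Real_iff del: one_divide_eq_0_iff)
qed

text \<open>On the image of the Stolz angle this is the equation that defines the R-transform. The
  reciprocal of G maps nonreal points to nonreal points, where H is holomorphic, so the identity
  propagates to both half planes.\<close>

lemma poisson_H_inverse_cauchy_transform:
  assumes m: "borel_prob m" and n: "borel_prob n" and ab: "\<alpha> > 0" "\<beta> > 0"
    and R: "free_R_transform_on n (double_stolz \<alpha> \<beta>) (poisson_R r m)" and \<zeta>: "Im \<zeta> \<noteq> 0"
  shows "poisson_H r m (1 / cauchy_transform n \<zeta>) = \<zeta>"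
proof (rule identity_half_planes[where g="\<lambda>\<zeta>. \<zeta>", OF _ _ free_R_transform_image[OF n R ab] _ \<zeta>])
  show "(\<lambda>\<zeta>. poisson_H r m (1 / cauchy_transform n \<zeta>)) holomorphic_on - \<real>"
    using holomorphic_on_compose_gen[OF inverse_cauchy_transform_holomorphic(1)[OF n] poisson_H_holomorphic[OF m, of r] inverse_cauchy_transform_holomorphic(2)[OF n]]
    by (simp add: comp_def)
  fix \<xi> assume "\<xi> \<in> (\<lambda>z. 1 / z + poisson_R r m z) ` double_stolz \<alpha> \<beta>"
  then obtain z where z: "z \<in> double_stolz \<alpha> \<beta>" "\<xi> = 1 / z + poisson_R r m z" by blast
  have "z \<noteq> 0" using double_stolz_nonreal[OF z(1)] by auto
  then show "poisson_H r m (1 / cauchy_transform n \<xi>) = \<xi>"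
    using R z by (simp add: free_R_transform_on_def poisson_H_inverse)
qed simp

text \<open>For the joint equation the continuation is done one variable at a time, starting from
  the product of the two image sets. The result no longer refers to a Stolz angle, whose size could
  shrink along a sequence of laws.\<close>

lemma bifree_compound_poisson_global:
  assumes \<mu>: "borel_prob \<mu>" and cp: "bifree_compound_poisson r \<mu> N"
  shows "\<And>\<zeta>. Im \<zeta> \<noteq> 0 \<Longrightarrow> poisson_H r (marginal1 \<mu>) (1 / cauchy_transform (marginal1 N) \<zeta>) = \<zeta>"
    "\<And>\<zeta>. Im \<zeta> \<noteq> 0 \<Longrightarrow> poisson_H r (marginal2 \<mu>) (1 / cauchy_transform (marginal2 N) \<zeta>) = \<zeta>"
    "\<And>\<zeta> \<omega>. Im \<zeta> \<noteq> 0 \<Longrightarrow> Im \<omega> \<noteq> 0 \<Longrightarrow>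
      cauchy_transform2 N \<zeta> \<omega> * (1 / cauchy_transform (marginal1 N) \<zeta> * (1 / cauchy_transform (marginal2 N) \<omega>)
       * (1 - joint_E r \<mu> (1 / cauchy_transform (marginal1 N) \<zeta>) (1 / cauchy_transform (marginal2 N) \<omega>))) = 1"
proof -
  have N: "borel_prob N" using cp by (simp add: bifree_compound_poisson_def)
  note m = borel_prob_marginal[OF \<mu>] and n = borel_prob_marginal[OF N]
  obtain \<alpha> \<beta> where ab: "\<alpha> > 0" "\<beta> > 0"
    and R1: "free_R_transform_on (marginal1 N) (double_stolz \<alpha> \<beta>) (poisson_R r (marginal1 \<mu>))"
    and R2: "free_R_transform_on (marginal2 N) (double_stolz \<alpha> \<beta>) (poisson_R r (marginal2 \<mu>))"
    and h: "\<And>z w. z \<in> double_stolz \<alpha> \<beta> \<Longrightarrow> w \<in> double_stolz \<alpha> \<beta> \<Longrightarrow>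
       bifree_h N (poisson_R r (marginal1 \<mu>)) (poisson_R r (marginal2 \<mu>)) z w * (1 - joint_E r \<mu> (1 / z) (1 / w)) = 1"
    using bifree_compound_poissonD[OF \<mu> cp] by metis
  show "poisson_H r (marginal1 \<mu>) (1 / cauchy_transform (marginal1 N) \<zeta>) = \<zeta>" if "Im \<zeta> \<noteq> 0" for \<zeta>
    by (rule poisson_H_inverse_cauchy_transform[OF m(1) n(1) ab R1 that])
  show "poisson_H r (marginal2 \<mu>) (1 / cauchy_transform (marginal2 N) \<zeta>) = \<zeta>" if "Im \<zeta> \<noteq> 0" for \<zeta>
    by (rule poisson_H_inverse_cauchy_transform[OF m(2) n(2) ab R2 that])
  define K1 where "K1 \<zeta> = 1 / cauchy_transform (marginal1 N) \<zeta>" for \<zeta>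
  define K2 where "K2 \<zeta> = 1 / cauchy_transform (marginal2 N) \<zeta>" for \<zeta>
  have K1: "K1 holomorphic_on - \<real>" "K1 ` (- \<real>) \<subseteq> - \<real>" and K2: "K2 holomorphic_on - \<real>" "K2 ` (- \<real>) \<subseteq> - \<real>"
    unfolding K1_def K2_def using inverse_cauchy_transform_holomorphic[OF n(1)] inverse_cauchy_transform_holomorphic[OF n(2)] by auto
  have Kn: "Im (K1 \<zeta>) \<noteq> 0" "Im (K2 \<zeta>) \<noteq> 0" if "Im \<zeta> \<noteq> 0" for \<zeta>
    using K1(2) K2(2) that by (auto simp: image_subset_iff complex_is_Real_iff)
  define U1 where "U1 = (\<lambda>z. 1 / z + poisson_R r (marginal1 \<mu>) z) ` double_stolz \<alpha> \<beta>"
  define U2 where "U2 = (\<lambda>z. 1 / z + poisson_R r (marginal2 \<mu>) z) ` double_stolz \<alpha> \<beta>"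
  note U1 = free_R_transform_image[OF n(1) R1 ab, folded U1_def]
  note U2 = free_R_transform_image[OF n(2) R2 ab, folded U2_def]
  let ?P = "\<lambda>\<zeta> \<omega>. cauchy_transform2 N \<zeta> \<omega> * (K1 \<zeta> * K2 \<omega> * (1 - joint_E r \<mu> (K1 \<zeta>) (K2 \<omega>)))"
  have E1: "(\<lambda>\<zeta>. joint_E r \<mu> (K1 \<zeta>) (K2 \<omega>)) holomorphic_on - \<real>" if "Im \<omega> \<noteq> 0" for \<omega>
    using holomorphic_on_compose_gen[OF K1(1) joint_E_holomorphic1[OF \<mu> Kn(2)[OF that], of r] K1(2)] by (simp add: comp_def)
  have E2: "(\<lambda>\<omega>. joint_E r \<mu> (K1 \<zeta>) (K2 \<omega>)) holomorphic_on - \<real>" if "Im \<zeta> \<noteq> 0" for \<zeta>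
    using holomorphic_on_compose_gen[OF K2(1) joint_E_holomorphic2[OF \<mu> Kn(1)[OF that], of r] K2(2)] by (simp add: comp_def)
  have base: "?P \<zeta> \<omega> = 1" if \<zeta>: "\<zeta> \<in> U1" and \<omega>: "\<omega> \<in> U2" for \<zeta> \<omega>
  proof -
    obtain z w where z: "z \<in> double_stolz \<alpha> \<beta>" "\<zeta> = 1 / z + poisson_R r (marginal1 \<mu>) z"
      and w: "w \<in> double_stolz \<alpha> \<beta>" "\<omega> = 1 / w + poisson_R r (marginal2 \<mu>) w"
      using \<zeta> \<omega> unfolding U1_def U2_def by blast
    have "K1 \<zeta> = 1 / z" "K2 \<omega> = 1 / w"
      using R1 R2 z w by (auto simp: K1_def K2_def free_R_transform_on_def)
    then show ?thesis using h[OF z(1) w(1)] by (simp add: bifree_h_def z(2)[symmetric] w(2)[symmetric])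
  qed
  have step: "?P \<zeta> \<omega> = 1" if \<omega>: "\<omega> \<in> U2" and \<zeta>: "Im \<zeta> \<noteq> 0" for \<zeta> \<omega>
  proof (rule identity_half_planes[where g="\<lambda>_. 1", OF _ _ U1 _ \<zeta>])
    have w: "Im \<omega> \<noteq> 0" using \<omega> U2(2) by (auto simp: complex_is_Real_iff)
    show "(\<lambda>\<zeta>. ?P \<zeta> \<omega>) holomorphic_on - \<real>"
      by (intro holomorphic_intros cauchy_transform2_holomorphic1[OF N w] K1(1) E1[OF w])
  qed (use base[OF _ \<omega>] in auto)
  show "cauchy_transform2 N \<zeta> \<omega> * (1 / cauchy_transform (marginal1 N) \<zeta> * (1 / cauchy_transform (marginal2 N) \<omega>)
       * (1 - joint_E r \<mu> (1 / cauchy_transform (marginal1 N) \<zeta>) (1 / cauchy_transform (marginal2 N) \<omega>))) = 1"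
    if \<zeta>: "Im \<zeta> \<noteq> 0" and \<omega>: "Im \<omega> \<noteq> 0" for \<zeta> \<omega>
    unfolding K1_def[symmetric] K2_def[symmetric]
  proof (rule identity_half_planes[where f="\<lambda>\<omega>. ?P \<zeta> \<omega>" and g="\<lambda>_. 1", OF _ _ U2 _ \<omega>])
    show "(\<lambda>\<omega>. ?P \<zeta> \<omega>) holomorphic_on - \<real>"
      by (intro holomorphic_intros cauchy_transform2_holomorphic2[OF N \<zeta>] K2(1) E2[OF \<zeta>])
  qed (use step[OF _ \<zeta>] in auto)
qed

section \<open>Limits of compound Poisson laws\<close>

text \<open>A solution of 1 / G(\<zeta>) = F is a fixed point of \<zeta> -> F + \<zeta> - 1 /
  G(\<zeta>). Far out in the sector \<zeta> G(\<zeta>) is close to 1, so the map preserves the disc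
  of radius \<epsilon> |F| about F, and Brouwer's theorem applies.\<close>

lemma cauchy_transform_surj_sector:
  assumes m: "borel_prob m" and \<epsilon>: "0 < \<epsilon>" "\<epsilon> \<le> 1/8"
  shows "\<exists>Y>0. \<forall>F. Y \<le> norm F \<longrightarrow> norm F \<le> 2 * \<bar>Im F\<bar> \<longrightarrow>
    (\<exists>\<zeta>. norm (\<zeta> - F) \<le> \<epsilon> * norm F \<and> Im \<zeta> \<noteq> 0 \<and> cauchy_transform m \<zeta> = 1 / F)"
proof -
  \<comment> \<open>This truncated first moment tends to 0 for every law by dominated convergence.
    On the disc the integrand \<zeta> / (\<zeta> - x) - 1 is bounded by four times min 1 (|x| /
    |F|), hence the threshold \<epsilon> / 8.\<close>
  define \<tau> where "\<tau> y = (\<integral>x. min 1 (\<bar>x\<bar> / y) \<partial>m)" for y :: real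
  have meas: "(\<lambda>x. min 1 (\<bar>x\<bar> / y)) \<in> borel_measurable borel" for y :: real by measurable
  have "(\<tau> \<longlongrightarrow> (\<integral>x. 0 \<partial>m)) at_top"
    unfolding \<tau>_def
  proof (rule integral_dominated_convergence_at_top[where w="\<lambda>_. 1"])
    show "integrable m (\<lambda>_. 1 :: real)" using borel_probD(2)[OF m] by (simp add: finite_measure.integrable_const)
    show "\<forall>\<^sub>F y in at_top. AE x in m. norm (min 1 (\<bar>x\<bar> / y)) \<le> 1"
      using eventually_gt_at_top[of "0 :: real"] by eventually_elim auto
    show "AE x in m. ((\<lambda>y. min 1 (\<bar>x\<bar> / y)) \<longlongrightarrow> 0) at_top"
    proof (rule AE_I2)
      fix x :: real
      have "((\<lambda>y. \<bar>x\<bar> / y) \<longlongrightarrow> 0) at_top" by real_asymp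
      from tendsto_min[OF tendsto_const this, of 1] show "((\<lambda>y. min 1 (\<bar>x\<bar> / y)) \<longlongrightarrow> 0) at_top" by simp
    qed
  qed (auto simp: measurable_borel_prob[OF m] meas)
  then have "\<forall>\<^sub>F y in at_top. \<tau> y < \<epsilon> / 8" using \<epsilon> by (intro order_tendstoD) auto
  then obtain Y0 where Y0: "\<And>y. y \<ge> Y0 \<Longrightarrow> \<tau> y < \<epsilon> / 8" by (auto simp: eventually_at_top_linorder)
  have "\<exists>\<zeta>. norm (\<zeta> - F) \<le> \<epsilon> * norm F \<and> Im \<zeta> \<noteq> 0 \<and> cauchy_transform m \<zeta> = 1 / F"
    if F: "max Y0 1 \<le> norm F" "norm F \<le> 2 * \<bar>Im F\<bar>" for F
  proof -
    define B where "B = cball F (\<epsilon> * norm F)"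
    have F0: "norm F > 0" using F by linarith
    have eF: "\<epsilon> * norm F \<le> 1/8 * norm F" using \<epsilon> by (intro mult_right_mono) auto
    have im: "\<bar>Im \<zeta>\<bar> \<ge> 3/8 * norm F" "norm \<zeta> \<le> 9/8 * norm F" if "\<zeta> \<in> B" for \<zeta>
    proof -
      have d: "norm (F - \<zeta>) \<le> 1/8 * norm F" using that eF by (simp add: B_def dist_norm)
      show "\<bar>Im \<zeta>\<bar> \<ge> 3/8 * norm F" using d F abs_Im_le_cmod[of "F - \<zeta>"] by simp
      show "norm \<zeta> \<le> 9/8 * norm F" using d norm_triangle_ineq2[of \<zeta> F] by (simp add: norm_minus_commute)
    qed
    have im0: "Im \<zeta> \<noteq> 0" if "\<zeta> \<in> B" for \<zeta> using im(1)[OF that] F0 by auto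
    have G: "norm (\<zeta> * cauchy_transform m \<zeta> - 1) \<le> \<epsilon> / 2" if \<zeta>: "\<zeta> \<in> B" for \<zeta>
    proof -
      have i: "integrable m (\<lambda>x. \<zeta> * (1 / (\<zeta> - complex_of_real x)))" "integrable m (\<lambda>x. 1 :: complex)"
        using integrable_mult_right[OF integrable_resolvent[OF m im0[OF \<zeta>]], of \<zeta>] borel_probD(2)[OF m]
        by (auto simp: finite_measure.integrable_const)
      have "(\<integral>x. \<zeta> * (1 / (\<zeta> - complex_of_real x)) - 1 \<partial>m) = \<zeta> * cauchy_transform m \<zeta> - 1"
        unfolding Bochner_Integration.integral_diff[OF i] cauchy_transform_def integral_mult_right_zero
        using borel_probD(5)[OF m] by simp
      moreover have "norm (\<integral>x. \<zeta> * (1 / (\<zeta> - complex_of_real x)) - 1 \<partial>m) \<le> (\<integral>x. 4 * min 1 (\<bar>x\<bar> / norm F) \<partial>m)"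
      proof (rule Bochner_Integration.integral_norm_bound_integral)
        show "integrable m (\<lambda>x. \<zeta> * (1 / (\<zeta> - complex_of_real x)) - 1)" using i by (rule Bochner_Integration.integrable_diff)
        show "integrable m (\<lambda>x. 4 * min 1 (\<bar>x\<bar> / norm F))"
          by (intro integrable_mult_right integrable_bounded_prob[OF m meas, of _ 1]) auto
        fix x
        have e: "\<zeta> * (1 / (\<zeta> - complex_of_real x)) - 1 = of_real x / (\<zeta> - complex_of_real x)"
          using sub_real_nonzero[OF im0[OF \<zeta>], of x] by (simp add: field_simps)
        have "norm (complex_of_real x / (\<zeta> - complex_of_real x)) \<le> 1 + norm \<zeta> / \<bar>Im \<zeta>\<bar>"
          by (rule norm_real_resolvent_le[OF im0[OF \<zeta>]])
        also have "norm \<zeta> / \<bar>Im \<zeta>\<bar> \<le> 3"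
          using im[OF \<zeta>] im0[OF \<zeta>] by (simp add: divide_le_eq)
        finally have 1: "norm (complex_of_real x / (\<zeta> - complex_of_real x)) \<le> 4" by simp
        have "norm (complex_of_real x * (1 / (\<zeta> - complex_of_real x))) \<le> \<bar>x\<bar> * (1 / \<bar>Im \<zeta>\<bar>)"
          unfolding norm_mult by (intro mult_mono norm_resolvent_le im0 \<zeta>) auto
        also have "\<dots> \<le> \<bar>x\<bar> * (1 / (norm F / 4))"
          using im[OF \<zeta>] F0 by (intro mult_left_mono divide_left_mono) (auto intro!: mult_pos_pos)
        finally have "norm (complex_of_real x / (\<zeta> - complex_of_real x)) \<le> 4 * (\<bar>x\<bar> / norm F)" by (simp add: mult.commute)
        with 1 show "norm (\<zeta> * (1 / (\<zeta> - complex_of_real x)) - 1) \<le> 4 * min 1 (\<bar>x\<bar> / norm F)"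
          unfolding e by (simp add: min_def)
      qed
      moreover have "(\<integral>x. 4 * min 1 (\<bar>x\<bar> / norm F) \<partial>m) = 4 * \<tau> (norm F)" by (simp add: \<tau>_def)
      moreover have "\<tau> (norm F) < \<epsilon> / 8" using F by (intro Y0) simp
      ultimately show ?thesis by simp
    qed
    have sub: "B \<subseteq> - \<real>" using im0 by (auto simp: complex_is_Real_iff)
    have G0: "cauchy_transform m \<zeta> \<noteq> 0" if "\<zeta> \<in> B" for \<zeta> using cauchy_transform_nonzero(2)[OF m im0[OF that]] .
    obtain \<zeta> where \<zeta>: "\<zeta> \<in> cball F (\<epsilon> * norm F)" "F + (\<zeta> - 1 / cauchy_transform m \<zeta>) = \<zeta>"
    proof (rule brouwer_ball)
      show "0 < \<epsilon> * norm F" using \<epsilon> F0 by simp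
      show "continuous_on (cball F (\<epsilon> * norm F)) (\<lambda>\<zeta>. F + (\<zeta> - 1 / cauchy_transform m \<zeta>))"
        using sub G0 unfolding B_def
        by (intro continuous_intros holomorphic_on_imp_continuous_on[OF holomorphic_on_subset[OF cauchy_transform_holomorphic[OF m]]]) auto
      show "(\<lambda>\<zeta>. F + (\<zeta> - 1 / cauchy_transform m \<zeta>)) \<in> cball F (\<epsilon> * norm F) \<rightarrow> cball F (\<epsilon> * norm F)"
      proof (rule Pi_I)
        fix \<zeta> assume "\<zeta> \<in> cball F (\<epsilon> * norm F)"
        then have \<zeta>: "\<zeta> \<in> B" by (simp add: B_def)
        define x where "x = \<zeta> * cauchy_transform m \<zeta>"
        have x: "norm (x - 1) \<le> \<epsilon> / 2" unfolding x_def by (rule G[OF \<zeta>])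
        have x1: "norm x \<ge> 15/16" using x \<epsilon> norm_triangle_ineq2[of 1 "1 - x"] by (simp add: norm_minus_commute)
        then have "x \<noteq> 0" by auto
        then have "\<zeta> - 1 / cauchy_transform m \<zeta> = \<zeta> * (x - 1) / x" using G0[OF \<zeta>] by (simp add: x_def field_simps)
        then have "norm (\<zeta> - 1 / cauchy_transform m \<zeta>) = norm \<zeta> * norm (x - 1) / norm x" by (simp add: norm_mult norm_divide)
        also have "\<dots> \<le> (9/8 * norm F) * (\<epsilon> / 2) / (15/16)"
          using im(2)[OF \<zeta>] x x1 \<epsilon> F0 by (intro frac_le mult_mono) auto
        also have "\<dots> \<le> \<epsilon> * norm F" using \<epsilon> F0 by simp
        finally show "F + (\<zeta> - 1 / cauchy_transform m \<zeta>) \<in> cball F (\<epsilon> * norm F)" by (simp add: dist_norm norm_minus_commute)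
      qed
    qed
    then have "F = 1 / cauchy_transform m \<zeta>" by simp
    moreover have "norm (\<zeta> - F) \<le> \<epsilon> * norm F" using \<zeta>(1) by (simp add: dist_norm norm_minus_commute)
    ultimately show ?thesis using im0[of \<zeta>] \<zeta>(1) by (auto simp: B_def)
  qed
  then show ?thesis by (intro exI[of _ "max Y0 1"]) auto
qed

section \<open>Estimates uniform in the rate and the jump distribution\<close>

lemma poisson_A_less_1:
  assumes m: "borel_prob m" and F: "Im F * Im (poisson_H r m F) > 0"
  shows "poisson_A r m F < 1"
proof -
  have "Im F \<noteq> 0" using F by auto
  from Im_poisson_H[OF m this, of r] have "(Im F)^2 * (1 - poisson_A r m F) > 0"
    using F by (simp add: power2_eq_square mult.assoc)
  then show ?thesis by (simp add: zero_less_mult_iff)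
qed

text \<open>A change of the evaluation point is expressed as a multiplicative error whose size does
  not depend on x. This keeps x / (F - x) as a factor, so the Lipschitz estimates involve the law
  through \<open>poisson_A\<close> at F alone.\<close>

lemma real_resolvent_change:
  assumes "Im F \<noteq> 0" "Im F' \<noteq> 0"
  shows "\<exists>q. norm q \<le> norm (F - F') / \<bar>Im F'\<bar> \<and>
    complex_of_real x / (F' - of_real x) = complex_of_real x / (F - of_real x) * (1 + q)"
proof (intro exI conjI)
  let ?q = "(F - F') * (1 / (F' - of_real x))"
  show "norm ?q \<le> norm (F - F') / \<bar>Im F'\<bar>"
    using mult_left_mono[OF norm_resolvent_le[OF assms(2), of x], of "norm (F - F')"] by (simp add: norm_mult norm_divide)
  have "x / b = x / a * (1 + (a - b) * (1 / b))" if "a \<noteq> 0" "b \<noteq> 0" for a b x :: complex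
    using that by (simp add: field_simps)
  from this[OF sub_real_nonzero[OF assms(1)] sub_real_nonzero[OF assms(2)], of "of_real x" x x]
  show "complex_of_real x / (F' - of_real x) = complex_of_real x / (F - of_real x) * (1 + ?q)" by simp
qed

text \<open>The mixed integral of \<open>poisson_H_diff\<close>, times the rate, is at most (1 + c)
  \<open>poisson_A\<close> at F with c = |F - F'| / |Im F'|, and \<open>poisson_A\<close> is below 1
  by the sign hypothesis. That hypothesis concerns F alone, so F' can be a limit point.\<close>

lemma poisson_H_lipschitz:
  assumes m: "borel_prob m" and r: "r \<ge> 0" and F: "Im F * Im (poisson_H r m F) > 0" and F': "Im F' \<noteq> 0"
  shows "norm (poisson_H r m F - poisson_H r m F') \<le> norm (F - F') * (2 + norm (F - F') / \<bar>Im F'\<bar>)"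
proof -
  have F0: "Im F \<noteq> 0" using F by auto
  define c where "c = norm (F - F') / \<bar>Im F'\<bar>"
  have c: "c \<ge> 0" by (simp add: c_def)
  define I where "I = (\<integral>x. (complex_of_real x / (F - of_real x)) * (of_real x / (F' - of_real x)) \<partial>m)"
  have "norm I \<le> (\<integral>x. (1 + c) * (norm (complex_of_real x / (F - of_real x)))^2 \<partial>m)"
    unfolding I_def
  proof (rule Bochner_Integration.integral_norm_bound_integral)
    show "integrable m (\<lambda>x. (complex_of_real x / (F - of_real x)) * (of_real x / (F' - of_real x)))"
    proof (rule integrable_bounded_prob[OF m])
      show "norm ((complex_of_real x / (F - of_real x)) * (of_real x / (F' - of_real x))) \<le> (1 + norm F / \<bar>Im F\<bar>) * (1 + norm F' / \<bar>Im F'\<bar>)" for x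
        unfolding norm_mult by (intro mult_mono norm_real_resolvent_le F0 F') auto
    qed measurable
    show "integrable m (\<lambda>x. (1 + c) * (norm (complex_of_real x / (F - of_real x)))^2)"
      by (intro integrable_mult_right integrable_real_resolvent_square m F0)
    fix x
    let ?a = "complex_of_real x / (F - of_real x)"
    obtain q where q: "norm q \<le> c" "complex_of_real x / (F' - of_real x) = ?a * (1 + q)"
      using real_resolvent_change[OF F0 F', of x] unfolding c_def by blast
    have "norm (1 + q) \<le> 1 + c" using norm_triangle_ineq[of 1 q] q by simp
    then have "norm ?a * norm ?a * norm (1 + q) \<le> norm ?a * norm ?a * (1 + c)" by (intro mult_left_mono) auto
    then show "norm (?a * (complex_of_real x / (F' - of_real x))) \<le> (1 + c) * (norm ?a)^2"
      unfolding q(2) norm_mult power2_eq_square by (simp only: ac_simps)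
  qed
  then have "r * norm I \<le> (1 + c) * poisson_A r m F"
    using mult_left_mono[of "norm I" _ r] r by (simp add: poisson_A_def mult.left_commute)
  also have "\<dots> \<le> (1 + c) * 1"
    using poisson_A_less_1[OF m F] c by (intro mult_left_mono) auto
  finally have "norm (1 - of_real r * I) \<le> 2 + c"
    using norm_triangle_ineq4[of 1 "of_real r * I"] r by (simp add: norm_mult)
  then have "norm (F - F') * norm (1 - of_real r * I) \<le> norm (F - F') * (2 + c)" by (rule mult_left_mono) simp
  then show ?thesis unfolding poisson_H_diff[OF m F0 F'] I_def c_def norm_mult .
qed

text \<open>The errors of the two resolvents combine to (1 + c) (1 + d) - 1, and this factor is
  multiplied by r times the integral of |f g|, which is below 1 because both
  \<open>poisson_A\<close> are.\<close>

lemma joint_E_lipschitz: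
  assumes \<mu>: "borel_prob \<mu>" and r: "r \<ge> 0"
    and F: "Im F * Im (poisson_H r (marginal1 \<mu>) F) > 0" and F': "Im F' \<noteq> 0"
    and W: "Im W * Im (poisson_H r (marginal2 \<mu>) W) > 0" and W': "Im W' \<noteq> 0"
  shows "norm (joint_E r \<mu> F' W' - joint_E r \<mu> F W)
    \<le> (1 + norm (F - F') / \<bar>Im F'\<bar>) * (1 + norm (W - W') / \<bar>Im W'\<bar>) - 1"
proof -
  have F0: "Im F \<noteq> 0" and W0: "Im W \<noteq> 0" using F W by auto
  define c d where "c = norm (F - F') / \<bar>Im F'\<bar>" and "d = norm (W - W') / \<bar>Im W'\<bar>"
  have cd: "c \<ge> 0" "d \<ge> 0" by (simp_all add: c_def d_def)
  note [measurable] = measurable_coordinates[OF \<mu>]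
  let ?f = "\<lambda>F (p :: real \<times> real). complex_of_real (fst p) / (F - of_real (fst p))"
  let ?g = "\<lambda>W (p :: real \<times> real). complex_of_real (snd p) / (W - of_real (snd p))"
  have i: "integrable \<mu> (\<lambda>p. ?f F p * ?g W p)" if "Im F \<noteq> 0" "Im W \<noteq> 0" for F W
  proof (rule integrable_bounded_prob2[OF \<mu>])
    show "norm (?f F p * ?g W p) \<le> (1 + norm F / \<bar>Im F\<bar>) * (1 + norm W / \<bar>Im W\<bar>)" for p
      unfolding norm_mult by (intro mult_mono norm_real_resolvent_le that) auto
  qed measurable
  have sq: "integrable \<mu> (\<lambda>p. (norm (?f F p))^2)" "integrable \<mu> (\<lambda>p. (norm (?g W p))^2)"
  proof -
    show "integrable \<mu> (\<lambda>p. (norm (?f F p))^2)"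
    proof (rule integrable_bounded_prob2[OF \<mu>])
      show "norm ((norm (?f F p))^2) \<le> (1 + norm F / \<bar>Im F\<bar>)^2" for p
        using power_mono[OF norm_real_resolvent_le[OF F0, of "fst p"], of 2] by simp
    qed measurable
    show "integrable \<mu> (\<lambda>p. (norm (?g W p))^2)"
    proof (rule integrable_bounded_prob2[OF \<mu>])
      show "norm ((norm (?g W p))^2) \<le> (1 + norm W / \<bar>Im W\<bar>)^2" for p
        using power_mono[OF norm_real_resolvent_le[OF W0, of "snd p"], of 2] by simp
    qed measurable
  qed
  let ?K = "((1 + c) * (1 + d) - 1) / 2"
  have K: "?K \<ge> 0" using cd by (simp add: algebra_simps)
  have expand: "a * (1 + x) * (b * (1 + y)) - a * b = a * b * (x + y + x * y)" for a b x y :: complex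
    by (simp add: algebra_simps)
  have "norm (\<integral>p. ?f F' p * ?g W' p - ?f F p * ?g W p \<partial>\<mu>) \<le> (\<integral>p. ?K * ((norm (?f F p))^2 + (norm (?g W p))^2) \<partial>\<mu>)"
  proof (rule Bochner_Integration.integral_norm_bound_integral)
    show "integrable \<mu> (\<lambda>p. ?f F' p * ?g W' p - ?f F p * ?g W p)"
      by (intro Bochner_Integration.integrable_diff i F0 W0 F' W')
    show "integrable \<mu> (\<lambda>p. ?K * ((norm (?f F p))^2 + (norm (?g W p))^2))"
      by (intro integrable_mult_right Bochner_Integration.integrable_add sq)
    fix p
    obtain q where q: "norm q \<le> c" "?f F' p = ?f F p * (1 + q)"
      using real_resolvent_change[OF F0 F', of "fst p"] unfolding c_def by blast
    obtain q' where q': "norm q' \<le> d" "?g W' p = ?g W p * (1 + q')"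
      using real_resolvent_change[OF W0 W', of "snd p"] unfolding d_def by blast
    have "?f F' p * ?g W' p - ?f F p * ?g W p = ?f F p * ?g W p * (q + q' + q * q')"
      unfolding q(2) q'(2) by (rule expand)
    then have "norm (?f F' p * ?g W' p - ?f F p * ?g W p) = norm (?f F p) * norm (?g W p) * norm (q + q' + q * q')"
      by (simp only: norm_mult)
    also have "\<dots> \<le> (((norm (?f F p))^2 + (norm (?g W p))^2) / 2) * ((1 + c) * (1 + d) - 1)"
    proof (rule mult_mono)
      show "norm (?f F p) * norm (?g W p) \<le> ((norm (?f F p))^2 + (norm (?g W p))^2) / 2"
        using sum_squares_bound[of "norm (?f F p)" "norm (?g W p)"] by simp
      have "norm (q + q' + q * q') \<le> norm q + norm q' + norm q * norm q'"
        using norm_triangle_ineq[of "q + q'" "q * q'"] norm_triangle_ineq[of q q'] by (simp add: norm_mult)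
      also have "\<dots> \<le> c + d + c * d" using q q' cd by (intro add_mono mult_mono) auto
      finally show "norm (q + q' + q * q') \<le> (1 + c) * (1 + d) - 1" by (simp add: algebra_simps)
    qed auto
    finally show "norm (?f F' p * ?g W' p - ?f F p * ?g W p) \<le> ?K * ((norm (?f F p))^2 + (norm (?g W p))^2)"
      by (simp add: mult.commute)
  qed
  also have "\<dots> = ?K * ((\<integral>p. (norm (?f F p))^2 \<partial>\<mu>) + (\<integral>p. (norm (?g W p))^2 \<partial>\<mu>))"
    by (simp only: integral_mult_right_zero Bochner_Integration.integral_add[OF sq])
  finally have b: "norm (\<integral>p. ?f F' p * ?g W' p - ?f F p * ?g W p \<partial>\<mu>) \<le> ?K * ((\<integral>p. (norm (?f F p))^2 \<partial>\<mu>) + (\<integral>p. (norm (?g W p))^2 \<partial>\<mu>))" .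
  have "joint_E r \<mu> F' W' - joint_E r \<mu> F W = of_real r * (\<integral>p. ?f F' p * ?g W' p - ?f F p * ?g W p \<partial>\<mu>)"
    unfolding joint_E_def Bochner_Integration.integral_diff[OF i[OF F' W'] i[OF F0 W0]] by (simp add: right_diff_distrib)
  then have "norm (joint_E r \<mu> F' W' - joint_E r \<mu> F W) = r * norm (\<integral>p. ?f F' p * ?g W' p - ?f F p * ?g W p \<partial>\<mu>)"
    using r by (simp add: norm_mult)
  also have "\<dots> \<le> r * (?K * ((\<integral>p. (norm (?f F p))^2 \<partial>\<mu>) + (\<integral>p. (norm (?g W p))^2 \<partial>\<mu>)))"
    using b r by (rule mult_left_mono)
  also have "\<dots> = ?K * (poisson_A r (marginal1 \<mu>) F + poisson_A r (marginal2 \<mu>) W)"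
    unfolding poisson_A_marginal1[OF \<mu>] poisson_A_marginal2[OF \<mu>] by (simp add: algebra_simps)
  also have "\<dots> \<le> ?K * (1 + 1)"
    using K poisson_A_less_1[OF borel_prob_marginal(1)[OF \<mu>] F] poisson_A_less_1[OF borel_prob_marginal(2)[OF \<mu>] W]
    by (intro mult_left_mono) auto
  also have "\<dots> = (1 + c) * (1 + d) - 1" by (simp only: one_add_one) simp
  finally show ?thesis unfolding c_def d_def .
qed

section \<open>Truncation of jumps\<close>

definition truncate_jump :: "real \<Rightarrow> real \<times> real \<Rightarrow> real \<times> real" where
  "truncate_jump M p = (if \<bar>fst p\<bar> \<le> M \<and> \<bar>snd p\<bar> \<le> M then p else (0, 0))"

lemma truncate_jump_set: "{p :: real \<times> real. \<bar>fst p\<bar> \<le> M \<and> \<bar>snd p\<bar> \<le> M} \<in> sets borel"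
  by (intro borel_closed closed_Collect_conj closed_Collect_le continuous_intros)

lemma borel_measurable_truncate_jump: "truncate_jump M \<in> borel_measurable borel"
  unfolding truncate_jump_def
  by (intro measurable_If measurable_ident_sets refl measurable_const) (use truncate_jump_set in auto)

text \<open>Large jumps are sent to the origin, where f vanishes, so the truncated and the original
  integrand differ by at most B and only outside the square. The integrands of (H F - F) / (r F) and
  of E / r are of this kind.\<close>

lemma integral_truncate_jump:
  fixes f :: "real \<times> real \<Rightarrow> complex"
  assumes \<mu>: "borel_prob \<mu>" and f: "f \<in> borel_measurable borel" "f (0, 0) = 0" "\<And>p. norm (f p) \<le> B"
  shows "norm ((\<integral>p. f p \<partial>distr \<mu> borel (truncate_jump M)) - (\<integral>p. f p \<partial>\<mu>))
    \<le> B * measure \<mu> (- {p. \<bar>fst p\<bar> \<le> M \<and> \<bar>snd p\<bar> \<le> M})"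
proof -
  interpret prob_space \<mu> by (rule borel_probD(1)[OF \<mu>])
  define A where "A = - {p :: real \<times> real. \<bar>fst p\<bar> \<le> M \<and> \<bar>snd p\<bar> \<le> M}"
  have A: "A \<in> sets \<mu>" unfolding A_def borel_probD(3)[OF \<mu>] by (intro borel_comp truncate_jump_set)
  have T: "truncate_jump M \<in> borel_measurable \<mu>" by (simp add: measurable_borel_prob[OF \<mu>] borel_measurable_truncate_jump)
  have fT: "(\<lambda>p. f (truncate_jump M p)) \<in> borel_measurable borel"
    by (rule measurable_compose[OF borel_measurable_truncate_jump f(1)])
  have i: "integrable \<mu> (\<lambda>p. f (truncate_jump M p))" "integrable \<mu> f"
    by (rule integrable_bounded_prob[OF \<mu> fT f(3)] integrable_bounded_prob[OF \<mu> f(1,3)])+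
  have "(\<integral>p. f p \<partial>distr \<mu> borel (truncate_jump M)) - (\<integral>p. f p \<partial>\<mu>) = (\<integral>p. f (truncate_jump M p) - f p \<partial>\<mu>)"
    unfolding Bochner_Integration.integral_diff[OF i] by (simp add: integral_distr[OF T f(1)])
  also have "norm \<dots> \<le> (\<integral>p. B * indicator A p \<partial>\<mu>)"
  proof (rule Bochner_Integration.integral_norm_bound_integral)
    show "integrable \<mu> (\<lambda>p. f (truncate_jump M p) - f p)" using i by (rule Bochner_Integration.integrable_diff)
    show "integrable \<mu> (\<lambda>p. B * indicator A p)"
      using A by (intro integrable_mult_right integrable_real_indicator) (auto simp: emeasure_eq_measure)
    show "norm (f (truncate_jump M p) - f p) \<le> B * indicator A p" for p
      using f(2,3) by (auto simp: truncate_jump_def A_def)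
  qed
  also have "\<dots> = B * measure \<mu> A" using A by simp
  finally show ?thesis unfolding A_def .
qed

lemma measure_outside_square:
  assumes \<mu>: "borel_prob \<mu>" and \<epsilon>: "\<epsilon> > 0"
  shows "\<exists>M\<ge>0. measure \<mu> (- {p :: real \<times> real. \<bar>fst p\<bar> \<le> M \<and> \<bar>snd p\<bar> \<le> M}) < \<epsilon>"
proof -
  interpret prob_space \<mu> by (rule borel_probD(1)[OF \<mu>])
  define A where "A n = - {p :: real \<times> real. \<bar>fst p\<bar> \<le> real n \<and> \<bar>snd p\<bar> \<le> real n}" for n :: nat
  have A: "range A \<subseteq> sets \<mu>" unfolding A_def borel_probD(3)[OF \<mu>] by (auto intro!: borel_comp truncate_jump_set)
  have "(\<lambda>n. measure \<mu> (A n)) \<longlonglongrightarrow> measure \<mu> (\<Inter>n. A n)"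
    by (rule finite_Lim_measure_decseq[OF A]) (force simp: decseq_def A_def)
  moreover have "(\<Inter>n. A n) = {}"
  proof -
    have "p \<notin> A (nat \<lceil>max \<bar>fst p\<bar> \<bar>snd p\<bar>\<rceil>)" for p
      unfolding A_def using real_nat_ceiling_ge[of "max \<bar>fst p\<bar> \<bar>snd p\<bar>"]
      by (simp only: Compl_iff mem_Collect_eq not_not max.bounded_iff simp_thms)
    then show ?thesis by blast
  qed
  ultimately have "(\<lambda>n. measure \<mu> (A n)) \<longlonglongrightarrow> 0" by simp
  then have "\<forall>\<^sub>F n in sequentially. measure \<mu> (A n) < \<epsilon>" using \<epsilon> by (rule order_tendstoD)
  then obtain n where "measure \<mu> (A n) < \<epsilon>" by (auto simp: eventually_sequentially)
  then show ?thesis unfolding A_def by (intro exI[of _ "real n"]) auto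
qed

lemma poisson_H_eq_integral:
  assumes m: "borel_prob m" and F: "Im F \<noteq> 0"
  shows "poisson_H r m F = F + of_real r * F * (\<integral>x. of_real x / (F - of_real x) \<partial>m)"
proof -
  have i: "integrable m (\<lambda>x. F * (1 / (F - complex_of_real x)))" "integrable m (\<lambda>x. 1 :: complex)"
    using integrable_mult_right[OF integrable_resolvent[OF m F], of F] borel_probD(2)[OF m]
    by (auto simp: finite_measure.integrable_const)
  have "of_real x / (F - of_real x) = F * (1 / (F - complex_of_real x)) - 1" for x
    using sub_real_nonzero[OF F, of x] by (simp add: field_simps)
  then have "(\<integral>x. of_real x / (F - of_real x) \<partial>m) = (\<integral>x. F * (1 / (F - complex_of_real x)) - 1 \<partial>m)" by simp
  also have "\<dots> = F * cauchy_transform m F - 1"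
    unfolding Bochner_Integration.integral_diff[OF i] cauchy_transform_def integral_mult_right_zero
    using borel_probD(5)[OF m] by simp
  finally show ?thesis by (simp add: poisson_H_def)
qed

text \<open>For fixed F and W the integrands are bounded independently of the jumps. The truncation
  level is chosen after the rate, so that the rate times the mass outside the square is at most
  \<epsilon>.\<close>

lemma bounded_jumps_approximation:
  assumes \<mu>: "borel_prob \<mu>" and r: "r \<ge> 0" and \<epsilon>: "\<epsilon> > 0"
  obtains M \<mu>' where "bounded_jumps r M \<mu>'"
    "\<And>F. Im F \<noteq> 0 \<Longrightarrow> norm (poisson_H r (marginal1 \<mu>') F - poisson_H r (marginal1 \<mu>) F) \<le> norm F * (1 + norm F / \<bar>Im F\<bar>) * \<epsilon>"
    "\<And>F. Im F \<noteq> 0 \<Longrightarrow> norm (poisson_H r (marginal2 \<mu>') F - poisson_H r (marginal2 \<mu>) F) \<le> norm F * (1 + norm F / \<bar>Im F\<bar>) * \<epsilon>"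
    "\<And>F W. Im F \<noteq> 0 \<Longrightarrow> Im W \<noteq> 0 \<Longrightarrow>
      norm (joint_E r \<mu>' F W - joint_E r \<mu> F W) \<le> (1 + norm F / \<bar>Im F\<bar>) * (1 + norm W / \<bar>Im W\<bar>) * \<epsilon>"
proof -
  \<comment> \<open>Division by r + 1 instead of r also covers r = 0.\<close>
  have "\<epsilon> / (r + 1) > 0" using r \<epsilon> by simp
  from measure_outside_square[OF \<mu> this]
  obtain M where M: "M \<ge> 0" and tail: "measure \<mu> (- {p. \<bar>fst p\<bar> \<le> M \<and> \<bar>snd p\<bar> \<le> M}) < \<epsilon> / (r + 1)" (is "?t < _") by blast
  have rt: "r * ?t \<le> \<epsilon>"
  proof -
    have "r * ?t \<le> (r + 1) * ?t" using r by (intro mult_right_mono) auto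
    also have "\<dots> \<le> \<epsilon>" using tail r by (simp add: field_simps)
    finally show ?thesis .
  qed
  define \<mu>' where "\<mu>' = distr \<mu> borel (truncate_jump M)"
  have \<mu>': "borel_prob \<mu>'" unfolding \<mu>'_def by (rule borel_prob_distr[OF \<mu> borel_measurable_truncate_jump])
  have T: "truncate_jump M \<in> borel_measurable \<mu>" by (simp add: measurable_borel_prob[OF \<mu>] borel_measurable_truncate_jump)
  have d: "norm (of_real r * (\<integral>p. f p \<partial>\<mu>') - of_real r * (\<integral>p. f p \<partial>\<mu>)) \<le> B * \<epsilon>"
    if f: "f \<in> borel_measurable borel" "f (0, 0) = 0" "\<And>p. norm (f p) \<le> B" for f :: "real \<times> real \<Rightarrow> complex" and B
  proof -
    have B: "B \<ge> 0" using f(3)[of "(0, 0)"] norm_ge_zero order_trans by blast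
    have "norm (of_real r * (\<integral>p. f p \<partial>\<mu>') - of_real r * (\<integral>p. f p \<partial>\<mu>)) = r * norm ((\<integral>p. f p \<partial>\<mu>') - (\<integral>p. f p \<partial>\<mu>))"
      unfolding right_diff_distrib[symmetric] norm_mult using r by simp
    also have "\<dots> \<le> r * (B * ?t)" unfolding \<mu>'_def by (intro mult_left_mono integral_truncate_jump[OF \<mu> f] r)
    also have "\<dots> = B * (r * ?t)" by simp
    also have "\<dots> \<le> B * \<epsilon>" by (intro mult_left_mono rt B)
    finally show ?thesis .
  qed
  have mm: "(\<lambda>x. complex_of_real x / (F - of_real x)) \<in> borel_measurable borel" for F by measurable
  show ?thesis
  proof (rule that[of M \<mu>'])
    show "bounded_jumps r M \<mu>'"
    proof
      show "AE p in \<mu>'. \<bar>fst p\<bar> \<le> M" "AE p in \<mu>'. \<bar>snd p\<bar> \<le> M"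
        unfolding \<mu>'_def using M
        by (subst AE_distr_iff[OF T]; auto simp: truncate_jump_def intro!: borel_closed closed_Collect_le continuous_intros)+
    qed (use \<mu>' r M in auto)
    fix F assume F: "Im F \<noteq> 0"
    have "poisson_H r (marginal1 \<mu>') F - poisson_H r (marginal1 \<mu>) F
      = F * (of_real r * (\<integral>p. complex_of_real (fst p) / (F - of_real (fst p)) \<partial>\<mu>') - of_real r * (\<integral>p. complex_of_real (fst p) / (F - of_real (fst p)) \<partial>\<mu>))"
      unfolding poisson_H_eq_integral[OF borel_prob_marginal(1)[OF \<mu>'] F] poisson_H_eq_integral[OF borel_prob_marginal(1)[OF \<mu>] F]
        integral_marginal1[OF \<mu>' mm] integral_marginal1[OF \<mu> mm] by (simp add: algebra_simps)
    moreover have "norm (of_real r * (\<integral>p. complex_of_real (fst p) / (F - of_real (fst p)) \<partial>\<mu>') - of_real r * (\<integral>p. complex_of_real (fst p) / (F - of_real (fst p)) \<partial>\<mu>))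
        \<le> (1 + norm F / \<bar>Im F\<bar>) * \<epsilon>"
      by (intro d borel_measurable_real_resolvent norm_real_resolvent_le F) simp
    ultimately show "norm (poisson_H r (marginal1 \<mu>') F - poisson_H r (marginal1 \<mu>) F) \<le> norm F * (1 + norm F / \<bar>Im F\<bar>) * \<epsilon>"
      by (simp add: norm_mult mult.assoc mult_left_mono)
  next
    fix F assume F: "Im F \<noteq> 0"
    have "poisson_H r (marginal2 \<mu>') F - poisson_H r (marginal2 \<mu>) F
      = F * (of_real r * (\<integral>p. complex_of_real (snd p) / (F - of_real (snd p)) \<partial>\<mu>') - of_real r * (\<integral>p. complex_of_real (snd p) / (F - of_real (snd p)) \<partial>\<mu>))"
      unfolding poisson_H_eq_integral[OF borel_prob_marginal(2)[OF \<mu>'] F] poisson_H_eq_integral[OF borel_prob_marginal(2)[OF \<mu>] F]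
        integral_marginal2[OF \<mu>' mm] integral_marginal2[OF \<mu> mm] by (simp add: algebra_simps)
    moreover have "norm (of_real r * (\<integral>p. complex_of_real (snd p) / (F - of_real (snd p)) \<partial>\<mu>') - of_real r * (\<integral>p. complex_of_real (snd p) / (F - of_real (snd p)) \<partial>\<mu>))
        \<le> (1 + norm F / \<bar>Im F\<bar>) * \<epsilon>"
      by (intro d borel_measurable_real_resolvent norm_real_resolvent_le F) simp
    ultimately show "norm (poisson_H r (marginal2 \<mu>') F - poisson_H r (marginal2 \<mu>) F) \<le> norm F * (1 + norm F / \<bar>Im F\<bar>) * \<epsilon>"
      by (simp add: norm_mult mult.assoc mult_left_mono)
  next
    fix F W assume F: "Im F \<noteq> 0" and W: "Im W \<noteq> 0"
    show "norm (joint_E r \<mu>' F W - joint_E r \<mu> F W) \<le> (1 + norm F / \<bar>Im F\<bar>) * (1 + norm W / \<bar>Im W\<bar>) * \<epsilon>"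
      unfolding joint_E_def
    proof (rule d)
      show "norm (complex_of_real (fst p) / (F - of_real (fst p)) * (of_real (snd p) / (W - of_real (snd p))))
          \<le> (1 + norm F / \<bar>Im F\<bar>) * (1 + norm W / \<bar>Im W\<bar>)" for p
        unfolding norm_mult by (intro mult_mono norm_real_resolvent_le F W) auto
    qed (use borel_measurable_times[OF borel_measurable_real_resolvent] in simp_all)
  qed
qed

text \<open>The tail bound asks for a point near i y where the Cauchy transform is 1 / (i y), and
  H(i y) is such a point. Convergence of H at i y alone therefore bounds the tails of all late laws
  at level y.\<close>

lemma poisson_tail:
  assumes N: "\<And>n. borel_prob (N n)" and G: "\<And>n F. Im F * Im (poisson_H (r n) (m n) F) > 0 \<Longrightarrow> cauchy_transform (N n) (poisson_H (r n) (m n) F) = 1 / F"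
    and y: "y > 0" and lim: "(\<lambda>n. poisson_H (r n) (m n) (\<i> * of_real y)) \<longlonglongrightarrow> \<zeta>"
    and \<epsilon>: "\<epsilon> \<le> 1/2" "norm (\<zeta> - \<i> * of_real y) < \<epsilon> * y"
  shows "\<forall>\<^sub>F n in sequentially. measure (N n) {x. y \<le> \<bar>x\<bar>} \<le> 6 * \<epsilon>"
proof -
  have "(\<lambda>n. norm (poisson_H (r n) (m n) (\<i> * of_real y) - \<i> * of_real y)) \<longlonglongrightarrow> norm (\<zeta> - \<i> * of_real y)"
    by (intro tendsto_intros lim)
  then have "\<forall>\<^sub>F n in sequentially. norm (poisson_H (r n) (m n) (\<i> * of_real y) - \<i> * of_real y) < \<epsilon> * y"
    using \<epsilon>(2) by (rule order_tendstoD)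
  then show ?thesis
  proof eventually_elim
    case (elim n)
    let ?H = "poisson_H (r n) (m n) (\<i> * of_real y)"
    have "\<epsilon> * y \<le> 1/2 * y" using \<epsilon> y by (intro mult_right_mono) auto
    moreover have "Im (?H - \<i> * of_real y) = Im ?H - y" by simp
    ultimately have "Im ?H > 0" using elim abs_Im_le_cmod[of "?H - \<i> * of_real y"] y by linarith
    then have "Im (\<i> * of_real y) * Im ?H > 0" using y by simp
    from G[OF this] show ?case
      by (intro tail_bound_of_cauchy_transform[OF N y \<epsilon>(1)]) (use elim in auto)
  qed
qed

section \<open>Limit laws for converging data\<close>

lemma inverse_axis_seq: "\<beta> > 0 \<Longrightarrow> 1 / axis_seq \<beta> j = \<i> * of_real ((real j + 2) / \<beta>)"
proof -
  assume b: "\<beta> > 0"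
  have y: "(real j + 2) / \<beta> \<noteq> 0" using b by (simp add: add_nonneg_eq_0_iff)
  have inv: "1 / a = b" if "b * a = 1" for a b :: complex
    using that by (cases "a = 0") (auto simp: field_simps)
  have "(k * complex_of_real y) * (- k * of_real (1 / y)) = 1" if "k * k = -1" "y \<noteq> 0" for k :: complex and y
  proof -
    have "(k * complex_of_real y) * (- k * of_real (1 / y)) = - (k * k)" using that(2) by simp
    then show ?thesis unfolding that(1) by simp
  qed
  from inv[OF this[OF i_squared y]] show ?thesis by (simp add: axis_seq_def)
qed

text \<open>The assumptions concern H and E on one fixed Stolz domain; the jump distributions
  themselves are not assumed to converge. Both directions of the equivalence are instances, with
  rates n + 2 in one and k n / p in the other. Strict positivity in \<open>sign1\<close> and
  \<open>sign2\<close> carries the half plane condition from the limit back to late indices.\<close>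

locale poisson_limit =
  fixes r :: "nat \<Rightarrow> real" and \<mu> :: "nat \<Rightarrow> (real \<times> real) measure" and \<alpha> \<beta> :: real
    and R1 R2 :: "complex \<Rightarrow> complex" and E :: "complex \<Rightarrow> complex \<Rightarrow> complex"
  assumes ab: "\<alpha> > 0" "\<beta> > 0" and r: "\<And>n. r n \<ge> 0" and \<mu>: "\<And>n. borel_prob (\<mu> n)"
    and lim1: "\<And>z. z \<in> double_stolz \<alpha> \<beta> \<Longrightarrow> (\<lambda>n. poisson_H (r n) (marginal1 (\<mu> n)) (1 / z)) \<longlonglongrightarrow> 1 / z + R1 z"
    and lim2: "\<And>z. z \<in> double_stolz \<alpha> \<beta> \<Longrightarrow> (\<lambda>n. poisson_H (r n) (marginal2 (\<mu> n)) (1 / z)) \<longlonglongrightarrow> 1 / z + R2 z"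
    and limE: "\<And>z w. z \<in> double_stolz \<alpha> \<beta> \<Longrightarrow> w \<in> double_stolz \<alpha> \<beta> \<Longrightarrow> (\<lambda>n. joint_E (r n) (\<mu> n) (1 / z) (1 / w)) \<longlonglongrightarrow> E z w"
    and sign1: "\<And>z. z \<in> double_stolz \<alpha> \<beta> \<Longrightarrow> Im (1 / z + R1 z) * Im (1 / z) > 0"
    and sign2: "\<And>z. z \<in> double_stolz \<alpha> \<beta> \<Longrightarrow> Im (1 / z + R2 z) * Im (1 / z) > 0"
    and zero1: "((\<lambda>z. z * R1 z) \<longlongrightarrow> 0) (at 0 within double_stolz \<alpha> \<beta>)"
    and zero2: "((\<lambda>z. z * R2 z) \<longlongrightarrow> 0) (at 0 within double_stolz \<alpha> \<beta>)"
begin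

lemma sign_eventually:
  assumes "(\<lambda>n. H n) \<longlonglongrightarrow> \<zeta>" "Im \<zeta> * Im F > 0"
  shows "\<forall>\<^sub>F n in sequentially. Im F * Im (H n) > 0"
proof -
  have "(\<lambda>n. Im F * Im (H n)) \<longlonglongrightarrow> Im F * Im \<zeta>" by (intro tendsto_intros assms)
  then show ?thesis using assms(2) by (intro order_tendstoD) (auto simp: mult.commute)
qed

lemma tight:
  assumes N: "\<And>n. poisson_law (r n) (\<mu> n) (N n)" and \<delta>: "\<delta> > 0"
  shows "\<exists>Y. \<forall>\<^sub>F n in sequentially. measure (N n) {p. Y \<le> max \<bar>fst p\<bar> \<bar>snd p\<bar>} \<le> \<delta>"
proof -
  have Nb: "borel_prob (N n)" for n using N by (auto simp: poisson_law_def)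
  define \<epsilon> where "\<epsilon> = min (1/2) (\<delta> / 12)"
  have \<epsilon>: "0 < \<epsilon>" "\<epsilon> \<le> 1/2" "\<epsilon> \<le> \<delta> / 12" using \<delta> by (auto simp: \<epsilon>_def)
  have "\<forall>\<^sub>F j in sequentially. norm (axis_seq \<beta> j * R1 (axis_seq \<beta> j)) < \<epsilon>"
    using tendstoD[OF axis_seq_tendsto[OF zero1 ab] \<epsilon>(1)] by simp
  moreover have "\<forall>\<^sub>F j in sequentially. norm (axis_seq \<beta> j * R2 (axis_seq \<beta> j)) < \<epsilon>"
    using tendstoD[OF axis_seq_tendsto[OF zero2 ab] \<epsilon>(1)] by simp
  ultimately have "\<forall>\<^sub>F j in sequentially. norm (axis_seq \<beta> j * R1 (axis_seq \<beta> j)) < \<epsilon> \<and> norm (axis_seq \<beta> j * R2 (axis_seq \<beta> j)) < \<epsilon>"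
    by (rule eventually_conj)
  \<comment> \<open>At such an axis point z = 1 / (i y) the limit 1 / z + R z lies within \<epsilon>
    y of i y, which is the input of \<open>poisson_tail\<close>.\<close>
  then obtain j where j: "norm (axis_seq \<beta> j * R1 (axis_seq \<beta> j)) < \<epsilon>" "norm (axis_seq \<beta> j * R2 (axis_seq \<beta> j)) < \<epsilon>"
    by (auto simp: eventually_sequentially)
  define z where "z = axis_seq \<beta> j"
  define y where "y = (real j + 2) / \<beta>"
  have y: "y > 0" unfolding y_def using ab by (intro divide_pos_pos) auto
  have z: "z \<in> double_stolz \<alpha> \<beta>" unfolding z_def by (rule axis_seq_in[OF ab])
  have zy: "1 / z = \<i> * of_real y" unfolding z_def y_def by (rule inverse_axis_seq[OF ab(2)])
  have "norm (1 / z) = y" unfolding zy using y by (simp add: norm_mult)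
  then have y': "y * norm z = 1" using y by (auto simp: norm_divide field_simps)
  have ny: "norm a < \<epsilon> * y" if "norm (z * a) < \<epsilon>" for a
  proof -
    have "norm a = y * norm z * norm a" by (simp add: y')
    also have "\<dots> = norm (z * a) * y" by (simp add: norm_mult)
    also have "\<dots> < \<epsilon> * y" using that y by (rule mult_strict_right_mono)
    finally show ?thesis .
  qed
  have t1: "\<forall>\<^sub>F n in sequentially. measure (marginal1 (N n)) {x. y \<le> \<bar>x\<bar>} \<le> 6 * \<epsilon>"
  proof (rule poisson_tail[where r=r and m="\<lambda>n. marginal1 (\<mu> n)" and \<zeta>="1 / z + R1 z"])
    show "norm (1 / z + R1 z - \<i> * of_real y) < \<epsilon> * y" using ny[of "R1 z"] j by (simp add: z_def[symmetric] zy)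
    show "(\<lambda>n. poisson_H (r n) (marginal1 (\<mu> n)) (\<i> * of_real y)) \<longlonglongrightarrow> 1 / z + R1 z" using lim1[OF z] unfolding zy .
  qed (use N Nb borel_prob_marginal y \<epsilon> in \<open>auto simp: poisson_law_def\<close>)
  have t2: "\<forall>\<^sub>F n in sequentially. measure (marginal2 (N n)) {x. y \<le> \<bar>x\<bar>} \<le> 6 * \<epsilon>"
  proof (rule poisson_tail[where r=r and m="\<lambda>n. marginal2 (\<mu> n)" and \<zeta>="1 / z + R2 z"])
    show "norm (1 / z + R2 z - \<i> * of_real y) < \<epsilon> * y" using ny[of "R2 z"] j by (simp add: z_def[symmetric] zy)
    show "(\<lambda>n. poisson_H (r n) (marginal2 (\<mu> n)) (\<i> * of_real y)) \<longlonglongrightarrow> 1 / z + R2 z" using lim2[OF z] unfolding zy .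
  qed (use N Nb borel_prob_marginal y \<epsilon> in \<open>auto simp: poisson_law_def\<close>)
  show ?thesis
  proof (intro exI[of _ y])
    show "\<forall>\<^sub>F n in sequentially. measure (N n) {p. y \<le> max \<bar>fst p\<bar> \<bar>snd p\<bar>} \<le> \<delta>"
      using t1 t2
    proof eventually_elim
      case (elim n)
      then show ?case using measure_max_marginals_le[OF Nb, of n y] \<epsilon>(3) by linarith
    qed
  qed
qed

text \<open>The functional equations hold at the moving points H(1 / z) for late n. Equicontinuity
  of the transforms freezes these points at their limits 1 / z + R z, and weak convergence along a
  subsequence carries the equations to L.\<close>

lemma limit_law_of_poisson_laws:
  assumes N: "\<And>n. poisson_law (r n) (\<mu> n) (N n)"
  shows "\<exists>q L. strict_mono q \<and> borel_prob L \<and> weakly_converges (N \<circ> q) L \<and>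
    (\<forall>z\<in>double_stolz \<alpha> \<beta>. cauchy_transform (marginal1 L) (1 / z + R1 z) = z) \<and>
    (\<forall>z\<in>double_stolz \<alpha> \<beta>. cauchy_transform (marginal2 L) (1 / z + R2 z) = z) \<and>
    (\<forall>z\<in>double_stolz \<alpha> \<beta>. \<forall>w\<in>double_stolz \<alpha> \<beta>.
      cauchy_transform2 L (1 / z + R1 z) (1 / w + R2 w) * (1 / z * (1 / w) * (1 - E z w)) = 1)"
proof -
  have Nb: "borel_prob (N n)" for n using N by (auto simp: poisson_law_def)
  obtain q L where q: "strict_mono q" and L: "borel_prob L" and w: "weakly_converges (N \<circ> q) L"
    using borel_prob_weak_compactness[of N, OF Nb tight[of N, OF N]] by blast
  have w': "weakly_converges (\<lambda>n. N (q n)) L" using w by (simp add: comp_def)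
  have H1: "(\<lambda>n. poisson_H (r (q n)) (marginal1 (\<mu> (q n))) (1 / z)) \<longlonglongrightarrow> 1 / z + R1 z" if "z \<in> double_stolz \<alpha> \<beta>" for z
    using LIMSEQ_subseq_LIMSEQ[OF lim1[OF that] q] by (simp add: comp_def)
  have H2: "(\<lambda>n. poisson_H (r (q n)) (marginal2 (\<mu> (q n))) (1 / z)) \<longlonglongrightarrow> 1 / z + R2 z" if "z \<in> double_stolz \<alpha> \<beta>" for z
    using LIMSEQ_subseq_LIMSEQ[OF lim2[OF that] q] by (simp add: comp_def)
  have i1: "Im (1 / z + R1 z) \<noteq> 0" if "z \<in> double_stolz \<alpha> \<beta>" for z using sign1[OF that] by auto
  have i2: "Im (1 / z + R2 z) \<noteq> 0" if "z \<in> double_stolz \<alpha> \<beta>" for z using sign2[OF that] by auto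
  have c: "(\<lambda>n. f n (H n)) \<longlonglongrightarrow> l" if "(\<lambda>n. f n (H n) - f n h) \<longlonglongrightarrow> 0" "(\<lambda>n. f n h) \<longlonglongrightarrow> l"
    for f :: "nat \<Rightarrow> complex \<Rightarrow> complex" and H h l
    using tendsto_add[OF that] by simp
  have "cauchy_transform (marginal1 L) (1 / z + R1 z) = z" if z: "z \<in> double_stolz \<alpha> \<beta>" for z
  proof (rule LIMSEQ_unique)
    let ?H = "\<lambda>n. poisson_H (r (q n)) (marginal1 (\<mu> (q n))) (1 / z)"
    show "(\<lambda>n. cauchy_transform (marginal1 (N (q n))) (?H n)) \<longlonglongrightarrow> cauchy_transform (marginal1 L) (1 / z + R1 z)"
      by (rule c[where f="\<lambda>n. cauchy_transform (marginal1 (N (q n)))" and h="1 / z + R1 z", OF cauchy_transform_equicontinuous weakly_converges_cauchy_transform[OF weakly_converges_marginal1[OF w']]])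
         (use H1[OF z] i1[OF z] Nb L borel_prob_marginal in auto)
    show "(\<lambda>n. cauchy_transform (marginal1 (N (q n))) (?H n)) \<longlonglongrightarrow> z"
      by (rule tendsto_eventually)
         (use sign_eventually[OF H1[OF z] sign1[OF z]] N in \<open>auto elim!: eventually_mono simp: poisson_law_def\<close>)
  qed
  moreover have "cauchy_transform (marginal2 L) (1 / z + R2 z) = z" if z: "z \<in> double_stolz \<alpha> \<beta>" for z
  proof (rule LIMSEQ_unique)
    let ?H = "\<lambda>n. poisson_H (r (q n)) (marginal2 (\<mu> (q n))) (1 / z)"
    have "weakly_converges (\<lambda>n. marginal2 (N (q n))) (marginal2 L)"
      using weakly_converges_marginal1[OF weakly_converges_swap[OF w' Nb L] borel_prob_swap[OF Nb] borel_prob_swap[OF L]]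
      by (simp add: marginal1_swap Nb L)
    then show "(\<lambda>n. cauchy_transform (marginal2 (N (q n))) (?H n)) \<longlonglongrightarrow> cauchy_transform (marginal2 L) (1 / z + R2 z)"
      by (intro c[where f="\<lambda>n. cauchy_transform (marginal2 (N (q n)))" and h="1 / z + R2 z", OF cauchy_transform_equicontinuous weakly_converges_cauchy_transform])
         (use H2[OF z] i2[OF z] Nb L borel_prob_marginal in auto)
    show "(\<lambda>n. cauchy_transform (marginal2 (N (q n))) (?H n)) \<longlonglongrightarrow> z"
      by (rule tendsto_eventually)
         (use sign_eventually[OF H2[OF z] sign2[OF z]] N in \<open>auto elim!: eventually_mono simp: poisson_law_def\<close>)
  qed
  moreover have "cauchy_transform2 L (1 / z + R1 z) (1 / w + R2 w) * (1 / z * (1 / w) * (1 - E z w)) = 1"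
    if z: "z \<in> double_stolz \<alpha> \<beta>" and w: "w \<in> double_stolz \<alpha> \<beta>" for z w
  proof (rule LIMSEQ_unique)
    let ?H = "\<lambda>n. poisson_H (r (q n)) (marginal1 (\<mu> (q n))) (1 / z)" and ?K = "\<lambda>n. poisson_H (r (q n)) (marginal2 (\<mu> (q n))) (1 / w)"
    let ?g = "\<lambda>n. cauchy_transform2 (N (q n)) (?H n) (?K n) * (1 / z * (1 / w) * (1 - joint_E (r (q n)) (\<mu> (q n)) (1 / z) (1 / w)))"
    have "(\<lambda>n. joint_E (r (q n)) (\<mu> (q n)) (1 / z) (1 / w)) \<longlonglongrightarrow> E z w"
      using LIMSEQ_subseq_LIMSEQ[OF limE[OF z w] q] by (simp add: comp_def)
    moreover have "(\<lambda>n. cauchy_transform2 (N (q n)) (?H n) (?K n)) \<longlonglongrightarrow> cauchy_transform2 L (1 / z + R1 z) (1 / w + R2 w)"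
      using tendsto_add[OF cauchy_transform2_equicontinuous[OF Nb H1[OF z] H2[OF w] i1[OF z] i2[OF w], of q]
          weakly_converges_cauchy_transform2[OF w' Nb L i1[OF z] i2[OF w]]] by simp
    ultimately show "?g \<longlonglongrightarrow> cauchy_transform2 L (1 / z + R1 z) (1 / w + R2 w) * (1 / z * (1 / w) * (1 - E z w))"
      by (intro tendsto_intros)
    show "?g \<longlonglongrightarrow> 1"
    proof (rule tendsto_eventually)
      show "\<forall>\<^sub>F n in sequentially. ?g n = 1"
        using sign_eventually[OF H1[OF z] sign1[OF z]] sign_eventually[OF H2[OF w] sign2[OF w]]
      proof eventually_elim
        case (elim n)
        then show ?case using N[of "q n"] unfolding poisson_law_def by blast
      qed
    qed
  qed
  ultimately show ?thesis using q L w by blast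
qed

text \<open>Truncation with error 1 / (n + 1) changes neither the limit of H nor that of E and makes
  \<open>poisson_law_exists\<close> applicable. The compound Poisson laws obtained here therefore
  belong to the truncated jump distributions, with unchanged rates.\<close>

lemma limit_law:
  obtains \<mu>' N q L where "\<And>n. borel_prob (\<mu>' n)" "\<And>n. bifree_compound_poisson (r n) (\<mu>' n) (N n)"
    "strict_mono (q :: nat \<Rightarrow> nat)" "borel_prob L" "weakly_converges (N \<circ> q) L"
    "\<And>z. z \<in> double_stolz \<alpha> \<beta> \<Longrightarrow> cauchy_transform (marginal1 L) (1 / z + R1 z) = z"
    "\<And>z. z \<in> double_stolz \<alpha> \<beta> \<Longrightarrow> cauchy_transform (marginal2 L) (1 / z + R2 z) = z"
    "\<And>z w. z \<in> double_stolz \<alpha> \<beta> \<Longrightarrow> w \<in> double_stolz \<alpha> \<beta> \<Longrightarrow>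
      cauchy_transform2 L (1 / z + R1 z) (1 / w + R2 w) * (1 / z * (1 / w) * (1 - E z w)) = 1"
proof -
  have "\<exists>M \<mu>'. bounded_jumps (r n) M \<mu>' \<and>
    (\<forall>F. Im F \<noteq> 0 \<longrightarrow> norm (poisson_H (r n) (marginal1 \<mu>') F - poisson_H (r n) (marginal1 (\<mu> n)) F) \<le> norm F * (1 + norm F / \<bar>Im F\<bar>) * (1 / real (Suc n))) \<and>
    (\<forall>F. Im F \<noteq> 0 \<longrightarrow> norm (poisson_H (r n) (marginal2 \<mu>') F - poisson_H (r n) (marginal2 (\<mu> n)) F) \<le> norm F * (1 + norm F / \<bar>Im F\<bar>) * (1 / real (Suc n))) \<and>
    (\<forall>F W. Im F \<noteq> 0 \<longrightarrow> Im W \<noteq> 0 \<longrightarrow>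
      norm (joint_E (r n) \<mu>' F W - joint_E (r n) (\<mu> n) F W) \<le> (1 + norm F / \<bar>Im F\<bar>) * (1 + norm W / \<bar>Im W\<bar>) * (1 / real (Suc n)))" for n
    by (rule bounded_jumps_approximation[OF \<mu> r, of "1 / real (Suc n)" n n]) (simp, blast)
  then obtain M \<mu>' where b: "\<And>n. bounded_jumps (r n) (M n) (\<mu>' n)"
    and d1: "\<And>n F. Im F \<noteq> 0 \<Longrightarrow> norm (poisson_H (r n) (marginal1 (\<mu>' n)) F - poisson_H (r n) (marginal1 (\<mu> n)) F) \<le> norm F * (1 + norm F / \<bar>Im F\<bar>) * (1 / real (Suc n))"
    and d2: "\<And>n F. Im F \<noteq> 0 \<Longrightarrow> norm (poisson_H (r n) (marginal2 (\<mu>' n)) F - poisson_H (r n) (marginal2 (\<mu> n)) F) \<le> norm F * (1 + norm F / \<bar>Im F\<bar>) * (1 / real (Suc n))"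
    and dE: "\<And>n F W. Im F \<noteq> 0 \<Longrightarrow> Im W \<noteq> 0 \<Longrightarrow>
      norm (joint_E (r n) (\<mu>' n) F W - joint_E (r n) (\<mu> n) F W) \<le> (1 + norm F / \<bar>Im F\<bar>) * (1 + norm W / \<bar>Im W\<bar>) * (1 / real (Suc n))"
    by metis
  have \<mu>': "borel_prob (\<mu>' n)" for n using b by (simp add: bounded_jumps_def)
  have lim: "f \<longlonglongrightarrow> l" if "g \<longlonglongrightarrow> l" "\<And>n. norm (f n - g n) \<le> C * (1 / real (Suc n))" for f g :: "nat \<Rightarrow> complex" and l C
  proof -
    have "(\<lambda>n. C * (1 / real (Suc n))) \<longlonglongrightarrow> 0" by real_asymp
    then have "(\<lambda>n. f n - g n) \<longlonglongrightarrow> 0" by (rule Lim_null_comparison[rotated]) (use that(2) in auto)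
    from tendsto_add[OF this that(1)] show ?thesis by simp
  qed
  have nr: "Im (1 / z) \<noteq> 0" if "z \<in> double_stolz \<alpha> \<beta>" for z
    using Im_inverse_nonzero[OF double_stolz_nonreal[OF that]] .
  interpret T: poisson_limit r \<mu>' \<alpha> \<beta> R1 R2 E
  proof
    show "(\<lambda>n. poisson_H (r n) (marginal1 (\<mu>' n)) (1 / z)) \<longlonglongrightarrow> 1 / z + R1 z" if "z \<in> double_stolz \<alpha> \<beta>" for z
      by (rule lim[OF lim1[OF that] d1[OF nr[OF that]]])
    show "(\<lambda>n. poisson_H (r n) (marginal2 (\<mu>' n)) (1 / z)) \<longlonglongrightarrow> 1 / z + R2 z" if "z \<in> double_stolz \<alpha> \<beta>" for z
      by (rule lim[OF lim2[OF that] d2[OF nr[OF that]]])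
    show "(\<lambda>n. joint_E (r n) (\<mu>' n) (1 / z) (1 / w)) \<longlonglongrightarrow> E z w" if "z \<in> double_stolz \<alpha> \<beta>" "w \<in> double_stolz \<alpha> \<beta>" for z w
      by (rule lim[OF limE[OF that] dE[OF nr[OF that(1)] nr[OF that(2)]]])
  qed (use ab r \<mu>' sign1 sign2 zero1 zero2 in auto)
  obtain N where N: "\<And>n. poisson_law (r n) (\<mu>' n) (N n)"
    using bounded_jumps.poisson_law_exists[OF b] by metis
  have cp: "bifree_compound_poisson (r n) (\<mu>' n) (N n)" for n
    by (rule bifree_compound_poisson_of_poisson_law[OF b N])
  show ?thesis
    using T.limit_law_of_poisson_laws[of N, OF N] that[of \<mu>' N, OF \<mu>' cp] by blast
qed

end

section \<open>Infinitesimal arrays\<close>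

text \<open>Since 1 + y Im (1 / (i y - x)) = x^2 / (x^2 + y^2), the first factor on the right is the
  mean of an increasing function of |x|, and Markov's inequality applies at |x| = \<delta>.\<close>

lemma tail_le_cauchy_transform:
  assumes m: "borel_prob m" and y: "y > 0" and \<delta>: "\<delta> > 0"
  shows "measure m {x. \<delta> \<le> \<bar>x\<bar>} \<le> (1 + y * Im (cauchy_transform m (\<i> * of_real y))) * ((y^2 + \<delta>^2) / \<delta>^2)"
proof -
  interpret prob_space m by (rule borel_probD(1)[OF m])
  have im: "Im (\<i> * complex_of_real y) \<noteq> 0" using y by simp
  have e: "1 + y * Im (1 / (\<i> * complex_of_real y - of_real x)) = x^2 / (x^2 + y^2)" for x
  proof -
    have "x^2 + y^2 \<noteq> 0" using y by (simp add: sum_power2_eq_zero_iff)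
    then show ?thesis by (simp add: Im_divide cmod_power2 field_simps power2_eq_square)
  qed
  have i: "integrable m (\<lambda>x. 1 / (\<i> * complex_of_real y - of_real x))" by (rule integrable_resolvent[OF m im])
  have i': "integrable m (\<lambda>x. y * Im (1 / (\<i> * complex_of_real y - of_real x)))"
    by (intro integrable_mult_right integrable_Im i)
  have "Im (cauchy_transform m (\<i> * of_real y)) = (\<integral>x. Im (1 / (\<i> * complex_of_real y - of_real x)) \<partial>m)"
    unfolding cauchy_transform_def by (rule integral_Im[OF i, symmetric])
  then have s: "1 + y * Im (cauchy_transform m (\<i> * of_real y)) = (\<integral>x. x^2 / (x^2 + y^2) \<partial>m)"
    unfolding e[symmetric] by (subst Bochner_Integration.integral_add) (use i' in \<open>auto simp: prob_space\<close>)
  have si: "integrable m (\<lambda>x. x^2 / (x^2 + y^2))" unfolding e[symmetric] using i' by simp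
  have "measure m {x \<in> space m. \<delta>^2 / (\<delta>^2 + y^2) \<le> x^2 / (x^2 + y^2)} \<le> (\<integral>x. x^2 / (x^2 + y^2) \<partial>m) / (\<delta>^2 / (\<delta>^2 + y^2))"
  proof (rule integral_Markov_inequality_measure[where A="{}"])
    show "0 < \<delta>^2 / (\<delta>^2 + y^2)" using \<delta> by (intro divide_pos_pos add_pos_nonneg) auto
  qed (use si in auto)
  moreover have "measure m {x. \<delta> \<le> \<bar>x\<bar>} \<le> measure m {x \<in> space m. \<delta>^2 / (\<delta>^2 + y^2) \<le> x^2 / (x^2 + y^2)}"
  proof (rule finite_measure_mono)
    show "{x. \<delta> \<le> \<bar>x\<bar>} \<subseteq> {x \<in> space m. \<delta>^2 / (\<delta>^2 + y^2) \<le> x^2 / (x^2 + y^2)}"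
    proof
      fix x assume "x \<in> {x. \<delta> \<le> \<bar>x\<bar>}"
      then have "\<delta>^2 \<le> x^2" using \<delta> power_mono[of \<delta> "\<bar>x\<bar>" 2] by simp
      then have "\<delta>^2 * y^2 \<le> x^2 * y^2" by (rule mult_right_mono) simp
      moreover have "\<delta>^2 + y^2 > 0" "x^2 + y^2 > 0" using y by (auto intro: add_nonneg_pos)
      ultimately show "x \<in> {x \<in> space m. \<delta>^2 / (\<delta>^2 + y^2) \<le> x^2 / (x^2 + y^2)}"
        by (simp add: borel_probD(4)[OF m] field_simps)
    qed
    have "(\<lambda>x. x^2 / (x^2 + y^2)) \<in> borel_measurable m" using si by (rule borel_measurable_integrable)
    then show "{x \<in> space m. \<delta>^2 / (\<delta>^2 + y^2) \<le> x^2 / (x^2 + y^2)} \<in> sets m" by measurable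
  qed
  ultimately show ?thesis unfolding s using \<delta> by (simp add: mult.commute add.commute)
qed

text \<open>Vanishing marginal tails push the mass into every neighbourhood of the origin; inside it
  continuity of f is used and outside it the bound.\<close>

lemma integral_tendsto_at_origin:
  fixes f :: "real \<times> real \<Rightarrow> complex"
  assumes N: "\<And>n. borel_prob (N n)"
    and tail1: "\<And>\<delta>. \<delta> > 0 \<Longrightarrow> (\<lambda>n. measure (marginal1 (N n)) {x. \<delta> \<le> \<bar>x\<bar>}) \<longlonglongrightarrow> 0"
    and tail2: "\<And>\<delta>. \<delta> > 0 \<Longrightarrow> (\<lambda>n. measure (marginal2 (N n)) {x. \<delta> \<le> \<bar>x\<bar>}) \<longlonglongrightarrow> 0"
    and f: "continuous_on UNIV f" "\<And>p. norm (f p) \<le> B"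
  shows "(\<lambda>n. \<integral>p. f p \<partial>N n) \<longlonglongrightarrow> f (0, 0)"
proof (rule LIMSEQ_I)
  fix e :: real assume e: "e > 0"
  have B: "B \<ge> 0" using f(2)[of "(0, 0)"] norm_ge_zero order_trans by blast
  have "isCont f (0, 0)" using f(1) by (simp add: continuous_on_eq_continuous_at)
  then obtain d where d: "d > 0" "\<And>p. dist p (0, 0) < d \<Longrightarrow> dist (f p) (f (0, 0)) < e / 2"
    using e unfolding continuous_at_eps_delta by (meson half_gt_zero)
  define A where "A = {p :: real \<times> real. d / 2 \<le> max \<bar>fst p\<bar> \<bar>snd p\<bar>}"
  have A: "A \<in> sets borel" unfolding A_def
    by (intro borel_closed closed_Collect_le continuous_intros)
  have tail: "(\<lambda>n. measure (N n) A) \<longlonglongrightarrow> 0"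
  proof (rule tendsto_sandwich[OF _ _ tendsto_const])
    have "d / 2 > 0" using d by simp
    from tendsto_add[OF tail1[OF this] tail2[OF this]]
    show "(\<lambda>n. measure (marginal1 (N n)) {x. d / 2 \<le> \<bar>x\<bar>} + measure (marginal2 (N n)) {x. d / 2 \<le> \<bar>x\<bar>}) \<longlonglongrightarrow> 0" by simp
    show "\<forall>\<^sub>F n in sequentially. measure (N n) A \<le> measure (marginal1 (N n)) {x. d / 2 \<le> \<bar>x\<bar>} + measure (marginal2 (N n)) {x. d / 2 \<le> \<bar>x\<bar>}"
      unfolding A_def by (intro always_eventually allI measure_max_marginals_le N)
  qed simp
  have pt: "norm (f p - f (0, 0)) \<le> e / 2 + 2 * B * indicator A p" for p
  proof (cases "p \<in> A")
    case True
    have "norm (f p - f (0, 0)) \<le> B + B" using norm_triangle_ineq4[of "f p" "f (0, 0)"] f(2)[of p] f(2)[of "(0, 0)"] by linarith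
    then show ?thesis using True e by simp
  next
    case False
    then have "\<bar>fst p\<bar> < d / 2" "\<bar>snd p\<bar> < d / 2" by (auto simp: A_def)
    then have "norm p < d" using norm_Pair_le[of "fst p" "snd p"] by simp
    then show ?thesis using d(2)[of p] False by (simp add: dist_norm zero_prod_def[symmetric])
  qed
  have bound: "norm ((\<integral>p. f p \<partial>N n) - f (0, 0)) \<le> e / 2 + 2 * B * measure (N n) A" for n
  proof -
    interpret prob_space "N n" by (rule borel_probD(1)[OF N])
    have An: "A \<in> sets (N n)" by (simp add: borel_probD(3)[OF N] A)
    have i: "integrable (N n) f" by (rule integrable_bounded_prob[OF N borel_measurable_continuous_onI[OF f(1)] f(2)])
    have "(\<integral>p. f p \<partial>N n) - f (0, 0) = (\<integral>p. f p - f (0, 0) \<partial>N n)"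
      by (subst Bochner_Integration.integral_diff[OF i]) (auto simp: prob_space)
    also have "norm \<dots> \<le> (\<integral>p. e / 2 + 2 * B * indicator A p \<partial>N n)"
      by (rule Bochner_Integration.integral_norm_bound_integral)
         (use i An pt in \<open>auto simp: emeasure_eq_measure intro!: Bochner_Integration.integrable_diff Bochner_Integration.integrable_add integrable_mult_right integrable_real_indicator\<close>)
    also have "\<dots> = e / 2 + 2 * B * measure (N n) A"
      using An by (subst Bochner_Integration.integral_add)
         (auto simp: emeasure_eq_measure prob_space intro!: integrable_mult_right integrable_real_indicator)
    finally show ?thesis .
  qed
  have "(\<lambda>n. e / 2 + 2 * B * measure (N n) A) \<longlonglongrightarrow> e / 2 + 2 * B * 0"
    by (intro tendsto_intros tail)
  from order_tendstoD(2)[OF this, of e] e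
  have "\<forall>\<^sub>F n in sequentially. e / 2 + 2 * B * measure (N n) A < e" by simp
  then have "\<forall>\<^sub>F n in sequentially. norm ((\<integral>p. f p \<partial>N n) - f (0, 0)) < e"
    by eventually_elim (use bound le_less_trans in blast)
  then show "\<exists>no. \<forall>n\<ge>no. norm ((\<integral>p. f p \<partial>N n) - f (0, 0)) < e" by (simp add: eventually_sequentially)
qed

lemma integral_uniform_limit:
  fixes f :: "real \<times> real \<Rightarrow> complex"
  assumes N: "\<And>n. borel_prob (N n)" and lim: "(\<lambda>n. \<integral>p. f p \<partial>N n) \<longlonglongrightarrow> l"
    and f: "f \<in> borel_measurable borel" "\<And>p. norm (f p) \<le> B"
    and g: "uniform_limit UNIV g f sequentially" "\<And>n. g n \<in> borel_measurable borel"
  shows "(\<lambda>n. \<integral>p. g n p \<partial>N n) \<longlonglongrightarrow> l"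
proof -
  have "(\<lambda>n. (\<integral>p. g n p \<partial>N n) - (\<integral>p. f p \<partial>N n)) \<longlonglongrightarrow> 0"
    unfolding tendsto_iff
  proof (intro allI impI)
    fix e :: real assume "e > 0"
    then have e: "e / 2 > 0" "e / 2 < e" by auto
    from g(1) e(1) have "\<forall>\<^sub>F n in sequentially. \<forall>p\<in>UNIV. dist (g n p) (f p) < e / 2" unfolding uniform_limit_iff by blast
    then show "\<forall>\<^sub>F n in sequentially. dist ((\<integral>p. g n p \<partial>N n) - (\<integral>p. f p \<partial>N n)) 0 < e"
    proof eventually_elim
      case (elim n)
      have d: "norm (g n p - f p) \<le> e / 2" for p using bspec[OF elim UNIV_I, of p] unfolding dist_norm by (rule less_imp_le)
      have "norm (g n p) \<le> B + e / 2" for p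
        using norm_triangle_ineq[of "f p" "g n p - f p"] d[of p] f(2)[of p] by simp
      then have i: "integrable (N n) (g n)" by (rule integrable_bounded_prob[OF N g(2)])
      have "norm (\<integral>p. g n p - f p \<partial>N n) \<le> e / 2" by (rule norm_integral_prob_le[OF borel_probD(1)[OF N] d])
      then show ?case
        unfolding Bochner_Integration.integral_diff[OF i integrable_bounded_prob[OF N f]] using e by simp
    qed
  qed
  from tendsto_add[OF this lim] show ?thesis by simp
qed

lemma uniform_limit_resolvent:
  assumes \<zeta>: "\<zeta> \<longlonglongrightarrow> F" "\<And>n. Im (\<zeta> n) \<noteq> 0" and F: "Im F \<noteq> 0"
  shows "uniform_limit UNIV (\<lambda>n x. 1 / (\<zeta> n - complex_of_real (u x))) (\<lambda>x. 1 / (F - of_real (u x))) sequentially"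
  unfolding uniform_limit_iff
proof (intro allI impI)
  fix e :: real assume e: "e > 0"
  have "(\<lambda>n. norm (\<zeta> n - F) / (\<bar>Im (\<zeta> n)\<bar> * \<bar>Im F\<bar>)) \<longlonglongrightarrow> norm (F - F) / (\<bar>Im F\<bar> * \<bar>Im F\<bar>)"
    by (intro tendsto_intros \<zeta>) (use F in auto)
  then have "\<forall>\<^sub>F n in sequentially. norm (\<zeta> n - F) / (\<bar>Im (\<zeta> n)\<bar> * \<bar>Im F\<bar>) < e" using e by (intro order_tendstoD) auto
  then show "\<forall>\<^sub>F n in sequentially. \<forall>x\<in>UNIV. dist (1 / (\<zeta> n - complex_of_real (u x))) (1 / (F - of_real (u x))) < e"
    unfolding dist_norm by eventually_elim (use norm_resolvent_diff_le[OF \<zeta>(2) F] le_less_trans in blast)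
qed

lemma bounded_resolvent: "Im F \<noteq> 0 \<Longrightarrow> bounded (range (\<lambda>x. 1 / (F - complex_of_real (u x))))"
  unfolding bounded_iff using norm_resolvent_le by blast

text \<open>Resolvents at convergent nonreal points converge uniformly, so the moving integrands may
  be replaced by a fixed bounded continuous one, whose integrals tend to its value at the
  origin.\<close>

lemma resolvent_products:
  assumes N: "\<And>n. borel_prob (N n)"
    and tail: "\<And>\<delta>. \<delta> > 0 \<Longrightarrow> (\<lambda>n. measure (marginal1 (N n)) {x. \<delta> \<le> \<bar>x\<bar>}) \<longlonglongrightarrow> 0"
      "\<And>\<delta>. \<delta> > 0 \<Longrightarrow> (\<lambda>n. measure (marginal2 (N n)) {x. \<delta> \<le> \<bar>x\<bar>}) \<longlonglongrightarrow> 0"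
    and \<zeta>: "\<zeta> \<longlonglongrightarrow> F" "\<And>n. Im (\<zeta> n) \<noteq> 0" and F: "Im F \<noteq> 0"
    and \<omega>: "\<omega> \<longlonglongrightarrow> W" "\<And>n. Im (\<omega> n) \<noteq> 0" and W: "Im W \<noteq> 0"
  shows "(\<lambda>n. \<integral>p. (1 / (\<zeta> n - of_real (fst p))) * (1 / (F - of_real (fst p))) \<partial>N n) \<longlonglongrightarrow> (1 / F) * (1 / F)"
    "(\<lambda>n. \<integral>p. (1 / (\<zeta> n - of_real (fst p))) * (1 / (F - of_real (fst p))) * (1 / (\<omega> n - of_real (snd p))) \<partial>N n) \<longlonglongrightarrow> (1 / F) * (1 / F) * (1 / W)"
proof -
  note [measurable] = measurable_fst_real measurable_snd_real
  let ?a = "\<lambda>p :: real \<times> real. 1 / (F - complex_of_real (fst p))" and ?b = "\<lambda>p :: real \<times> real. 1 / (W - complex_of_real (snd p))"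
  have c: "continuous_on UNIV ?a" "continuous_on UNIV ?b"
    by (intro continuous_intros; use sub_real_nonzero F W in auto)+
  have bd: "bounded (range ?a)" "bounded (range ?b)" by (rule bounded_resolvent F W)+
  have bd2: "bounded (range (\<lambda>p. f p * g p))" if "bounded (range f)" "bounded (range g)" for f g :: "real \<times> real \<Rightarrow> complex"
  proof -
    obtain A B where AB: "\<And>p. norm (f p) \<le> A" "\<And>p. norm (g p) \<le> B" using \<open>bounded (range f)\<close> \<open>bounded (range g)\<close> unfolding bounded_iff by auto
    have "norm (f p) \<le> \<bar>A\<bar>" "norm (g p) \<le> \<bar>B\<bar>" for p
      by (rule order_trans[OF AB(1) abs_ge_self] order_trans[OF AB(2) abs_ge_self])+
    then have "norm (f p * g p) \<le> \<bar>A\<bar> * \<bar>B\<bar>" for p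
      unfolding norm_mult by (intro mult_mono) auto
    then show ?thesis unfolding bounded_iff by blast
  qed
  have u: "uniform_limit UNIV (\<lambda>n p. (1 / (\<zeta> n - of_real (fst p))) * ?a p) (\<lambda>p. ?a p * ?a p) sequentially"
    by (rule uniform_lim_mult[OF uniform_limit_resolvent[OF \<zeta> F] uniform_limit_const bd(1,1)])
  have key: "(\<lambda>n. \<integral>p. g n p \<partial>N n) \<longlonglongrightarrow> f (0, 0)"
    if f: "continuous_on UNIV f" "bounded (range f)" and g: "uniform_limit UNIV g f sequentially" "\<And>n. g n \<in> borel_measurable borel"
    for f :: "real \<times> real \<Rightarrow> complex" and g
  proof -
    obtain B where B: "\<And>p. norm (f p) \<le> B" using f(2) unfolding bounded_iff by auto
    show ?thesis
      by (rule integral_uniform_limit[OF N integral_tendsto_at_origin[OF N tail f(1) B] borel_measurable_continuous_onI[OF f(1)] B g])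
  qed
  have "(\<lambda>n. \<integral>p. (1 / (\<zeta> n - of_real (fst p))) * ?a p \<partial>N n) \<longlonglongrightarrow> ?a (0, 0) * ?a (0, 0)"
    by (rule key[OF _ bd2[OF bd(1,1)] u]) (intro continuous_intros c, measurable)
  then show "(\<lambda>n. \<integral>p. (1 / (\<zeta> n - of_real (fst p))) * ?a p \<partial>N n) \<longlonglongrightarrow> (1 / F) * (1 / F)" by simp
  have "(\<lambda>n. \<integral>p. (1 / (\<zeta> n - of_real (fst p))) * ?a p * (1 / (\<omega> n - of_real (snd p))) \<partial>N n) \<longlonglongrightarrow> ?a (0, 0) * ?a (0, 0) * ?b (0, 0)"
    by (rule key[OF _ bd2[OF bd2[OF bd(1,1)] bd(2)] uniform_lim_mult[OF u uniform_limit_resolvent[OF \<omega> W] bd2[OF bd(1,1)] bd(2)]])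
       (intro continuous_intros c, measurable)
  then show "(\<lambda>n. \<integral>p. (1 / (\<zeta> n - of_real (fst p))) * ?a p * (1 / (\<omega> n - of_real (snd p))) \<partial>N n) \<longlonglongrightarrow> (1 / F) * (1 / F) * (1 / W)"
    by simp
qed

text \<open>The resolvent identity extracts the factor \<zeta> - F exactly. In the array this factor
  is a multiple of 1 / (n + 2), so multiplication by n + 2 leaves an integral with a finite
  limit.\<close>

lemma cauchy_transform_increment:
  assumes \<mu>: "borel_prob \<mu>" and F: "Im F \<noteq> 0" and \<zeta>: "Im \<zeta> \<noteq> 0" and \<omega>: "Im \<omega> \<noteq> 0"
  shows "cauchy_transform (marginal1 \<mu>) F - cauchy_transform (marginal1 \<mu>) \<zeta>
      = (\<zeta> - F) * (\<integral>p. (1 / (\<zeta> - of_real (fst p))) * (1 / (F - of_real (fst p))) \<partial>\<mu>)"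
    "cauchy_transform2 \<mu> F \<omega> - cauchy_transform2 \<mu> \<zeta> \<omega>
      = (\<zeta> - F) * (\<integral>p. (1 / (\<zeta> - of_real (fst p))) * (1 / (F - of_real (fst p))) * (1 / (\<omega> - of_real (snd p))) \<partial>\<mu>)"
proof -
  have d: "1 / (F - complex_of_real x) - 1 / (\<zeta> - complex_of_real x) = (\<zeta> - F) * ((1 / (\<zeta> - of_real x)) * (1 / (F - of_real x)))" for x
    unfolding resolvent_diff[OF F \<zeta>] by (simp only: ac_simps)
  show "cauchy_transform (marginal1 \<mu>) F - cauchy_transform (marginal1 \<mu>) \<zeta>
      = (\<zeta> - F) * (\<integral>p. (1 / (\<zeta> - of_real (fst p))) * (1 / (F - of_real (fst p))) \<partial>\<mu>)"
    unfolding cauchy_transform_marginal1[OF \<mu>] Bochner_Integration.integral_diff[OF integrable_resolvent_coordinates(1)[OF \<mu> F] integrable_resolvent_coordinates(1)[OF \<mu> \<zeta>], symmetric] d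
    by (rule integral_mult_right_zero)
  have d2: "1 / (\<omega> - complex_of_real t) / (F - complex_of_real x) - 1 / (\<omega> - complex_of_real t) / (\<zeta> - complex_of_real x)
    = (\<zeta> - F) * ((1 / (\<zeta> - of_real x)) * (1 / (F - of_real x)) * (1 / (\<omega> - of_real t)))" for x t
  proof -
    have "c / a - c / b = (1 / a - 1 / b) * c" for a b c :: complex by (simp add: left_diff_distrib)
    from this[of "1 / (\<omega> - complex_of_real t)" "F - complex_of_real x" "\<zeta> - complex_of_real x"]
    show ?thesis unfolding d by (simp only: mult.assoc)
  qed
  show "cauchy_transform2 \<mu> F \<omega> - cauchy_transform2 \<mu> \<zeta> \<omega>
      = (\<zeta> - F) * (\<integral>p. (1 / (\<zeta> - of_real (fst p))) * (1 / (F - of_real (fst p))) * (1 / (\<omega> - of_real (snd p))) \<partial>\<mu>)"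
    unfolding cauchy_transform2_eq(1) Bochner_Integration.integral_diff[OF integrable_resolvent2[OF \<mu> F \<omega>] integrable_resolvent2[OF \<mu> \<zeta> \<omega>], symmetric] d2
    by (rule integral_mult_right_zero)
qed

text \<open>Assumption \<open>h\<close> says that the bi-free R-transform of \<open>N n\<close> is
  \<open>(z R1 z + w R2 w + E z w) / (n + 2)\<close>.\<close>

locale infinitesimal_array =
  fixes N :: "nat \<Rightarrow> (real \<times> real) measure" and \<alpha> \<beta> :: real and R1 R2 :: "complex \<Rightarrow> complex" and E :: "complex \<Rightarrow> complex \<Rightarrow> complex"
  assumes ab: "\<alpha> > 0" "\<beta> > 0" and N: "\<And>n. borel_prob (N n)"
    and R1: "\<And>n. free_R_transform_on (marginal1 (N n)) (double_stolz \<alpha> \<beta>) (\<lambda>z. R1 z / of_nat (n + 2))"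
    and R2: "\<And>n. free_R_transform_on (marginal2 (N n)) (double_stolz \<alpha> \<beta>) (\<lambda>z. R2 z / of_nat (n + 2))"
    and h: "\<And>n z w. z \<in> double_stolz \<alpha> \<beta> \<Longrightarrow> w \<in> double_stolz \<alpha> \<beta> \<Longrightarrow>
      bifree_h (N n) (\<lambda>z. R1 z / of_nat (n + 2)) (\<lambda>z. R2 z / of_nat (n + 2)) z w * (1 - E z w / of_nat (n + 2)) = 1"
begin

lemma swap: "infinitesimal_array (\<lambda>n. swap_law (N n)) \<alpha> \<beta> R2 R1 (\<lambda>z w. E w z)"
proof
  fix n z w assume "z \<in> double_stolz \<alpha> \<beta>" "w \<in> double_stolz \<alpha> \<beta>"
  from h[OF this(2,1), of n]
  show "bifree_h (swap_law (N n)) (\<lambda>z. R2 z / of_nat (n + 2)) (\<lambda>z. R1 z / of_nat (n + 2)) z w * (1 - E w z / of_nat (n + 2)) = 1"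
    unfolding bifree_h_swap[OF N] .
qed (use ab R1 R2 borel_prob_swap[OF N] in \<open>simp_all only: marginal1_swap[OF N] marginal2_swap[OF N]\<close>)

definition \<zeta> :: "complex \<Rightarrow> nat \<Rightarrow> complex" where
  "\<zeta> z n = 1 / z + R1 z / of_nat (n + 2)"

lemma \<zeta>_minus: "\<zeta> z n - 1 / z = R1 z / of_nat (n + 2)"
  by (simp add: \<zeta>_def)

lemma \<zeta>:
  assumes z: "z \<in> double_stolz \<alpha> \<beta>"
  shows "\<zeta> z \<longlonglongrightarrow> 1 / z" "Im (\<zeta> z n) \<noteq> 0" "cauchy_transform (marginal1 (N n)) (\<zeta> z n) = z"
proof -
  have "(\<lambda>n. complex_of_real (1 / real (n + 2))) \<longlonglongrightarrow> of_real 0" by (intro tendsto_of_real) real_asymp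
  from tendsto_add[OF tendsto_const[of "1 / z"] tendsto_mult_left[OF this, of "R1 z"]]
  show "\<zeta> z \<longlonglongrightarrow> 1 / z" unfolding \<zeta>_def by simp
  show "Im (\<zeta> z n) \<noteq> 0" "cauchy_transform (marginal1 (N n)) (\<zeta> z n) = z"
    using R1[of n] z unfolding \<zeta>_def free_R_transform_on_def by (auto simp: complex_is_Real_iff)
qed

text \<open>The single point i y with y = 2 / \<beta> suffices: there the transforms converge to 1 /
  (i y), and the factor 1 + y Im G in the tail estimate tends to 0.\<close>

lemma tail:
  assumes \<delta>: "\<delta> > 0"
  shows "(\<lambda>n. measure (marginal1 (N n)) {x. \<delta> \<le> \<bar>x\<bar>}) \<longlonglongrightarrow> 0"
proof -
  define z where "z = axis_seq \<beta> 0"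
  define y where "y = 2 / \<beta>"
  have y: "y > 0" unfolding y_def using ab by simp
  have z: "z \<in> double_stolz \<alpha> \<beta>" unfolding z_def by (rule axis_seq_in[OF ab])
  have zy: "1 / z = \<i> * of_real y" unfolding z_def y_def inverse_axis_seq[OF ab(2)] by simp
  have imz: "Im z = - 1 / y" unfolding z_def y_def axis_seq_def by simp
  have "(\<lambda>n. cauchy_transform (marginal1 (N n)) (\<zeta> z n) - cauchy_transform (marginal1 (N n)) (1 / z)) \<longlonglongrightarrow> 0"
    by (rule cauchy_transform_equicontinuous[OF borel_prob_marginal(1)[OF N] \<zeta>(1)[OF z] Im_inverse_nonzero[OF double_stolz_nonreal[OF z]]])
  from tendsto_diff[OF tendsto_const this, of z]
  have "(\<lambda>n. cauchy_transform (marginal1 (N n)) (\<i> * of_real y)) \<longlonglongrightarrow> z" unfolding zy \<zeta>(3)[OF z] by simp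
  then have "(\<lambda>n. (1 + y * Im (cauchy_transform (marginal1 (N n)) (\<i> * of_real y))) * ((y^2 + \<delta>^2) / \<delta>^2))
      \<longlonglongrightarrow> (1 + y * Im z) * ((y^2 + \<delta>^2) / \<delta>^2)" by (intro tendsto_intros)
  moreover have "1 + y * Im z = 0" unfolding imz using y by simp
  ultimately have lim: "(\<lambda>n. (1 + y * Im (cauchy_transform (marginal1 (N n)) (\<i> * of_real y))) * ((y^2 + \<delta>^2) / \<delta>^2)) \<longlonglongrightarrow> 0" by simp
  show ?thesis
    by (rule tendsto_sandwich[OF _ _ tendsto_const lim])
       (use tail_le_cauchy_transform[OF borel_prob_marginal(1)[OF N] y \<delta>] in auto)
qed

text \<open>Expanding around \<open>\<zeta> z n\<close>, where the transform equals z, leaves R1 z /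
  (n + 2) times an integral that tends to z^2; the factor 1 / z turns this into z R1 z.\<close>

lemma increment1:
  assumes z: "z \<in> double_stolz \<alpha> \<beta>"
  shows "(\<lambda>n. of_nat (n + 2) * (1 / z * cauchy_transform (marginal1 (N n)) (1 / z) - 1)) \<longlonglongrightarrow> z * R1 z"
proof -
  interpret S: infinitesimal_array "\<lambda>n. swap_law (N n)" \<alpha> \<beta> R2 R1 "\<lambda>z w. E w z" by (rule swap)
  have z0: "z \<noteq> 0" using double_stolz_nonreal[OF z] by auto
  have F: "Im (1 / z) \<noteq> 0" by (rule Im_inverse_nonzero[OF double_stolz_nonreal[OF z]])
  let ?I = "\<lambda>n. \<integral>p. (1 / (\<zeta> z n - of_real (fst p))) * (1 / (1 / z - of_real (fst p))) \<partial>N n"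
  have tail2: "(\<lambda>n. measure (marginal2 (N n)) {x. \<delta> \<le> \<bar>x\<bar>}) \<longlonglongrightarrow> 0" if "\<delta> > 0" for \<delta>
    using S.tail[OF that] by (simp add: marginal1_swap[OF N])
  have "?I \<longlonglongrightarrow> 1 / (1 / z) * (1 / (1 / z))"
    by (rule resolvent_products(1)[OF N tail tail2 \<zeta>(1,2)[OF z] F \<zeta>(1,2)[OF z] F])
  then have "(\<lambda>n. 1 / z * R1 z * ?I n) \<longlonglongrightarrow> 1 / z * R1 z * (1 / (1 / z) * (1 / (1 / z)))" by (intro tendsto_intros)
  moreover have "1 / z * R1 z * ?I n = of_nat (n + 2) * (1 / z * cauchy_transform (marginal1 (N n)) (1 / z) - 1)" for n
  proof -
    have k: "of_nat (n + 2) \<noteq> (0 :: complex)" by (simp only: of_nat_eq_0_iff)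
    have "a = b + c" if "a - b = c" for a b c :: complex using that by (simp add: algebra_simps)
    from this[OF cauchy_transform_increment(1)[OF N F \<zeta>(2)[OF z] F, of n n]]
    have G: "cauchy_transform (marginal1 (N n)) (1 / z) = z + R1 z / of_nat (n + 2) * ?I n"
      unfolding \<zeta>(3)[OF z] \<zeta>_minus by simp
    have "k * (1 / z * (z + R / k * I) - 1) = 1 / z * R * I" if "k \<noteq> 0" for R I k :: complex
      using z0 that by (simp add: distrib_left)
    from this[OF k] show ?thesis unfolding G by (rule sym)
  qed
  moreover have "1 / z * R1 z * (1 / (1 / z) * (1 / (1 / z))) = z * R1 z" using z0 by simp
  ultimately show ?thesis by (simp only:)
qed

text \<open>The joint counterpart of \<open>increment1\<close>. The second argument may move with n,
  because one of its two applications takes it at a fixed point and the other at the shifted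
  point.\<close>

lemma increment2:
  assumes z: "z \<in> double_stolz \<alpha> \<beta>" and w: "w \<in> double_stolz \<alpha> \<beta>" and \<omega>: "\<omega> \<longlonglongrightarrow> 1 / w" "\<And>n. Im (\<omega> n) \<noteq> 0"
  shows "(\<lambda>n. of_nat (n + 2) * (1 / z * (1 / w) * (cauchy_transform2 (N n) (1 / z) (\<omega> n) - cauchy_transform2 (N n) (\<zeta> z n) (\<omega> n)))) \<longlonglongrightarrow> z * R1 z"
proof -
  interpret S: infinitesimal_array "\<lambda>n. swap_law (N n)" \<alpha> \<beta> R2 R1 "\<lambda>z w. E w z" by (rule swap)
  have zw0: "z \<noteq> 0" "w \<noteq> 0" using double_stolz_nonreal[OF z] double_stolz_nonreal[OF w] by auto
  have F: "Im (1 / z) \<noteq> 0" by (rule Im_inverse_nonzero[OF double_stolz_nonreal[OF z]])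
  have W: "Im (1 / w) \<noteq> 0" by (rule Im_inverse_nonzero[OF double_stolz_nonreal[OF w]])
  let ?J = "\<lambda>n. \<integral>p. (1 / (\<zeta> z n - of_real (fst p))) * (1 / (1 / z - of_real (fst p))) * (1 / (\<omega> n - of_real (snd p))) \<partial>N n"
  have tail2: "(\<lambda>n. measure (marginal2 (N n)) {x. \<delta> \<le> \<bar>x\<bar>}) \<longlonglongrightarrow> 0" if "\<delta> > 0" for \<delta>
    using S.tail[OF that] by (simp add: marginal1_swap[OF N])
  have "?J \<longlonglongrightarrow> 1 / (1 / z) * (1 / (1 / z)) * (1 / (1 / w))"
    by (rule resolvent_products(2)[OF N tail tail2 \<zeta>(1,2)[OF z] F \<omega> W])
  then have "(\<lambda>n. 1 / z * (1 / w) * R1 z * ?J n) \<longlonglongrightarrow> 1 / z * (1 / w) * R1 z * (1 / (1 / z) * (1 / (1 / z)) * (1 / (1 / w)))"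
    by (intro tendsto_intros)
  moreover have "1 / z * (1 / w) * R1 z * ?J n = of_nat (n + 2) * (1 / z * (1 / w) * (cauchy_transform2 (N n) (1 / z) (\<omega> n) - cauchy_transform2 (N n) (\<zeta> z n) (\<omega> n)))" for n
  proof -
    have k: "of_nat (n + 2) \<noteq> (0 :: complex)" by (simp only: of_nat_eq_0_iff)
    have G: "cauchy_transform2 (N n) (1 / z) (\<omega> n) - cauchy_transform2 (N n) (\<zeta> z n) (\<omega> n) = R1 z / of_nat (n + 2) * ?J n"
      unfolding cauchy_transform_increment(2)[OF N F \<zeta>(2)[OF z] \<omega>(2)] \<zeta>_minus ..
    have "a * R * J = k * (a * (R / k * J))" if "k \<noteq> 0" for a R J k :: complex
      using that by simp
    from this[OF k] show ?thesis unfolding G .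
  qed
  ultimately show ?thesis using zw0 by (simp add: mult.commute)
qed

text \<open>In \<open>joint_E_eq\<close> the joint transform at (1 / z, 1 / w) is compared with its
  value at the shifted points, one variable at a time. These two increments cancel in the limit
  against the marginal ones. What remains is k (H - 1) with H = 1 / (1 - E / k), and this tends to
  E.\<close>

lemma joint_E_limit:
  assumes z: "z \<in> double_stolz \<alpha> \<beta>" and w: "w \<in> double_stolz \<alpha> \<beta>"
  shows "(\<lambda>n. joint_E (real (n + 2)) (N n) (1 / z) (1 / w)) \<longlonglongrightarrow> E z w"
proof -
  interpret S: infinitesimal_array "\<lambda>n. swap_law (N n)" \<alpha> \<beta> R2 R1 "\<lambda>z w. E w z" by (rule swap)
  have zw0: "z \<noteq> 0" "w \<noteq> 0" using double_stolz_nonreal[OF z] double_stolz_nonreal[OF w] by auto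
  have F: "Im (1 / z) \<noteq> 0" by (rule Im_inverse_nonzero[OF double_stolz_nonreal[OF z]])
  have W: "Im (1 / w) \<noteq> 0" by (rule Im_inverse_nonzero[OF double_stolz_nonreal[OF w]])
  define k :: "nat \<Rightarrow> complex" where "k n = of_nat (n + 2)" for n
  have k0: "k n \<noteq> 0" for n unfolding k_def by (simp only: of_nat_eq_0_iff)
  define H where "H n = 1 / z * (1 / w) * cauchy_transform2 (N n) (\<zeta> z n) (S.\<zeta> w n)" for n
  have H: "H n * (1 - E z w / k n) = 1" for n
    using h[OF z w, of n] by (simp only: H_def k_def bifree_h_def \<zeta>_def S.\<zeta>_def) simp
  define a1 where "a1 n = k n * (1 / z * cauchy_transform (marginal1 (N n)) (1 / z) - 1)" for n
  define a2 where "a2 n = k n * (1 / w * cauchy_transform (marginal2 (N n)) (1 / w) - 1)" for n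
  define b1 where "b1 n = k n * (1 / z * (1 / w) * (cauchy_transform2 (N n) (1 / z) (1 / w) - cauchy_transform2 (N n) (\<zeta> z n) (1 / w)))" for n
  define b2 where "b2 n = k n * (1 / w * (1 / z) * (cauchy_transform2 (N n) (\<zeta> z n) (1 / w) - cauchy_transform2 (N n) (\<zeta> z n) (S.\<zeta> w n)))" for n
  have a1: "a1 \<longlonglongrightarrow> z * R1 z" using increment1[OF z] unfolding a1_def k_def .
  have a2: "a2 \<longlonglongrightarrow> w * R2 w" using S.increment1[OF w] unfolding a2_def k_def marginal1_swap[OF N] .
  have b1: "b1 \<longlonglongrightarrow> z * R1 z" using increment2[OF z w tendsto_const W] unfolding b1_def k_def .
  have b2: "b2 \<longlonglongrightarrow> w * R2 w" using S.increment2[OF w z \<zeta>(1,2)[OF z]] unfolding b2_def k_def cauchy_transform2_swap[OF N] .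
  have "(\<lambda>n. complex_of_real (1 / real (n + 2))) \<longlonglongrightarrow> of_real 0" by (intro tendsto_of_real) real_asymp
  then have "(\<lambda>n. 1 / k n) \<longlonglongrightarrow> 0" by (simp add: k_def)
  from tendsto_mult_left[OF this, of "E z w"] have Ek: "(\<lambda>n. E z w / k n) \<longlonglongrightarrow> 0" by simp
  then have "(\<lambda>n. E z w / (1 - E z w / k n)) \<longlonglongrightarrow> E z w / (1 - 0)" by (intro tendsto_intros) auto
  then have c: "(\<lambda>n. E z w / (1 - E z w / k n)) \<longlonglongrightarrow> E z w" by simp
  have cH: "k n * (H n - 1) = E z w / (1 - E z w / k n)" for n
  proof -
    have "k * (H - 1) = e / (1 - e / k)" if "H * (1 - e / k) = 1" "k \<noteq> 0" for H e k :: complex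
    proof -
      have "1 - e / k \<noteq> 0" using that(1) by auto
      moreover have "(H - 1) * (1 - e / k) = e / k" unfolding left_diff_distrib that(1) by simp
      ultimately have "H - 1 = e / k / (1 - e / k)" by (rule eq_divide_imp)
      then show ?thesis using that(2) by simp
    qed
    from this[OF H k0] show ?thesis .
  qed
  have "joint_E (real (n + 2)) (N n) (1 / z) (1 / w) = b1 n + b2 n + k n * (H n - 1) - a1 n - a2 n" for n
  proof -
    have "of_real (real (n + 2)) = k n" by (simp add: k_def)
    then show ?thesis
      unfolding joint_E_eq[OF N F W] a1_def a2_def b1_def b2_def H_def by (simp only: algebra_simps)
  qed
  moreover have "(\<lambda>n. b1 n + b2 n + k n * (H n - 1) - a1 n - a2 n) \<longlonglongrightarrow> z * R1 z + w * R2 w + E z w - z * R1 z - w * R2 w"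
    unfolding cH by (intro tendsto_intros a1 a2 b1 b2 c)
  ultimately show ?thesis by simp
qed

lemma poisson_H_limit:
  assumes z: "z \<in> double_stolz \<alpha> \<beta>"
  shows "(\<lambda>n. poisson_H (real (n + 2)) (marginal1 (N n)) (1 / z)) \<longlonglongrightarrow> 1 / z + R1 z"
proof -
  have z0: "z \<noteq> 0" using double_stolz_nonreal[OF z] by auto
  have "poisson_H (real (n + 2)) (marginal1 (N n)) (1 / z) = 1 / z + 1 / z * (of_nat (n + 2) * (1 / z * cauchy_transform (marginal1 (N n)) (1 / z) - 1))" for n
    unfolding poisson_H_def of_real_of_nat_eq by (simp only: ac_simps)
  moreover have "(\<lambda>n. 1 / z + 1 / z * (of_nat (n + 2) * (1 / z * cauchy_transform (marginal1 (N n)) (1 / z) - 1))) \<longlonglongrightarrow> 1 / z + 1 / z * (z * R1 z)"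
    by (intro tendsto_intros increment1[OF z])
  ultimately show ?thesis using z0 by simp
qed

end

text \<open>The transforms of L and \<nu> agree on a product of open image sets, hence by
  continuation at all nonreal pairs. By \<open>cauchy_transform2_determines\<close> the two laws
  then give the same integrals to all test functions, so they are interchangeable as weak
  limits.\<close>

lemma weakly_converges_of_R_transform:
  assumes \<nu>: "borel_prob \<nu>" and L: "borel_prob L" and ab: "\<alpha> > 0" "\<beta> > 0"
    and R1: "free_R_transform_on (marginal1 \<nu>) (double_stolz \<alpha> \<beta>) R1"
    and R2: "free_R_transform_on (marginal2 \<nu>) (double_stolz \<alpha> \<beta>) R2"
    and eq: "\<And>z w. z \<in> double_stolz \<alpha> \<beta> \<Longrightarrow> w \<in> double_stolz \<alpha> \<beta> \<Longrightarrow>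
      cauchy_transform2 L (1 / z + R1 z) (1 / w + R2 w) = cauchy_transform2 \<nu> (1 / z + R1 z) (1 / w + R2 w)"
    and w: "weakly_converges N L"
  shows "weakly_converges N \<nu>"
proof -
  let ?D = "double_stolz \<alpha> \<beta>"
  have 1: "cauchy_transform2 L \<zeta> (1 / w + R2 w) = cauchy_transform2 \<nu> \<zeta> (1 / w + R2 w)" if \<zeta>: "Im \<zeta> \<noteq> 0" and w: "w \<in> ?D" for \<zeta> w
  proof (rule identity_half_planes[OF cauchy_transform2_holomorphic1[OF L] cauchy_transform2_holomorphic1[OF \<nu>] free_R_transform_image[OF borel_prob_marginal(1)[OF \<nu>] R1 ab] _ \<zeta>])
    show "Im (1 / w + R2 w) \<noteq> 0" "Im (1 / w + R2 w) \<noteq> 0" by (rule free_R_transform_sign(3)[OF borel_prob_marginal(2)[OF \<nu>] R2 w])+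
  qed (use eq w in auto)
  have 2: "cauchy_transform2 L \<zeta> \<omega> = cauchy_transform2 \<nu> \<zeta> \<omega>" if \<zeta>: "Im \<zeta> \<noteq> 0" and \<omega>: "Im \<omega> \<noteq> 0" for \<zeta> \<omega>
    by (rule identity_half_planes[OF cauchy_transform2_holomorphic2[OF L \<zeta>] cauchy_transform2_holomorphic2[OF \<nu> \<zeta>] free_R_transform_image[OF borel_prob_marginal(2)[OF \<nu>] R2 ab] _ \<omega>])
       (use 1[OF \<zeta>] in auto)
  show ?thesis
    unfolding weakly_converges_def
  proof (intro allI impI)
    fix f :: "real \<times> real \<Rightarrow> real" assume f: "continuous_on UNIV f" "bounded (range f)"
    obtain B where B: "\<And>p. norm (f p) \<le> B" using f(2) unfolding bounded_iff by auto
    have "(\<integral>p. f p \<partial>L) = (\<integral>p. f p \<partial>\<nu>)" by (rule cauchy_transform2_determines[OF L \<nu> 2 f(1) B])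
    then show "(\<lambda>n. \<integral>p. f p \<partial>N n) \<longlonglongrightarrow> (\<integral>p. f p \<partial>\<nu>)"
      using w[unfolded weakly_converges_def, rule_format, OF f] by simp
  qed
qed

text \<open>Divisibility speaks of the joint R-transform as a whole. The axis limits of
  \<open>bifree_R_limits\<close> separate it into the marginal parts and the bracket, so that each
  of them is divided by n + 2, as \<open>infinitesimal_array\<close> requires. The indices n + 2
  enumerate exactly the m \<ge> 2.\<close>

lemma bifreely_infinitely_divisible_imp_limit:
  fixes \<nu> :: "(real \<times> real) measure"
  assumes \<nu>: "borel_prob \<nu>" and id: "bifreely_infinitely_divisible \<nu>"
  obtains \<mu> k N where "\<And>n. borel_prob (\<mu> n)" "\<And>n. k n > 0" "\<not> bdd_above (range k)"
    "\<And>n. bifree_compound_poisson (real (k n)) (\<mu> n) (N n)" "weakly_converges N \<nu>"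
proof -
  obtain \<alpha> \<beta> R where ab: "\<alpha> > 0" "\<beta> > 0" and R: "bifree_R_transform_on \<nu> (double_stolz \<alpha> \<beta>) R"
    and m: "\<And>m::nat. m \<ge> 2 \<Longrightarrow> \<exists>\<mu> Q. borel_prob \<mu> \<and> bifree_R_transform_on \<mu> (double_stolz \<alpha> \<beta>) Q \<and>
      (\<forall>z\<in>double_stolz \<alpha> \<beta>. \<forall>w\<in>double_stolz \<alpha> \<beta>. R z w = of_nat m * Q z w)"
    using id unfolding bifreely_infinitely_divisible_def by blast
  define D where "D = double_stolz \<alpha> \<beta>"
  obtain R1 R2 where R1: "free_R_transform_on (marginal1 \<nu>) D R1" and R2: "free_R_transform_on (marginal2 \<nu>) D R2"
    and h: "\<And>z w. z \<in> D \<Longrightarrow> w \<in> D \<Longrightarrow> bifree_h \<nu> R1 R2 z w \<noteq> 0"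
    and Req: "\<And>z w. z \<in> D \<Longrightarrow> w \<in> D \<Longrightarrow> R z w = z * R1 z + w * R2 w + (1 - 1 / bifree_h \<nu> R1 R2 z w)"
    using R unfolding bifree_R_transform_on_def D_def by blast
  have "\<forall>n. \<exists>\<mu> Q. borel_prob \<mu> \<and> bifree_R_transform_on \<mu> D Q \<and> (\<forall>z\<in>D. \<forall>w\<in>D. R z w = of_nat (n + 2) * Q z w)"
    unfolding D_def by (intro allI m) simp
  from choice[OF this] obtain M where "\<forall>n. \<exists>Q. borel_prob (M n) \<and> bifree_R_transform_on (M n) D Q \<and> (\<forall>z\<in>D. \<forall>w\<in>D. R z w = of_nat (n + 2) * Q z w)" ..
  from choice[OF this] obtain Q where M: "\<And>n. borel_prob (M n)" and Q: "\<And>n. bifree_R_transform_on (M n) D (Q n)"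
    and RQ: "\<And>n z w. z \<in> D \<Longrightarrow> w \<in> D \<Longrightarrow> R z w = of_nat (n + 2) * Q n z w"
    by blast
  define E where "E z w = 1 - 1 / bifree_h \<nu> R1 R2 z w" for z w
  interpret A: infinitesimal_array M \<alpha> \<beta> R1 R2 E
  proof
    fix n
    define k :: complex where "k = of_nat (n + 2)"
    have k: "k \<noteq> 0" unfolding k_def by (simp only: of_nat_eq_0_iff)
    obtain Q1 Q2 where Q1: "free_R_transform_on (marginal1 (M n)) D Q1" and Q2: "free_R_transform_on (marginal2 (M n)) D Q2"
      and hQ: "\<And>z w. z \<in> D \<Longrightarrow> w \<in> D \<Longrightarrow> bifree_h (M n) Q1 Q2 z w \<noteq> 0"
      and Qeq: "\<And>z w. z \<in> D \<Longrightarrow> w \<in> D \<Longrightarrow> Q n z w = z * Q1 z + w * Q2 w + (1 - 1 / bifree_h (M n) Q1 Q2 z w)"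
      using Q[of n] unfolding bifree_R_transform_on_def by blast
    have QR: "Q n z w = R z w / k" if "z \<in> D" "w \<in> D" for z w
      using RQ[OF that, of n] k unfolding k_def[symmetric] by simp
    have e1: "Q1 z = R1 z / k" if z: "z \<in> D" for z
    proof -
      have "(\<lambda>j. R z (axis_seq \<beta> j) / k) \<longlonglongrightarrow> z * R1 z / k"
        by (intro tendsto_intros bifree_R_limits(1)[OF \<nu> ab R1[unfolded D_def] R2[unfolded D_def] Req[unfolded D_def] z[unfolded D_def]] k)
      moreover have "(\<lambda>j. Q n z (axis_seq \<beta> j)) \<longlonglongrightarrow> z * Q1 z"
        by (rule bifree_R_limits(1)[OF M ab Q1[unfolded D_def] Q2[unfolded D_def] Qeq[unfolded D_def] z[unfolded D_def]])
      moreover have "Q n z (axis_seq \<beta> j) = R z (axis_seq \<beta> j) / k" for j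
        by (rule QR[OF z]) (simp add: D_def axis_seq_in[OF ab])
      ultimately have "z * Q1 z = z * R1 z / k" by (simp add: LIMSEQ_unique)
      moreover have "z \<noteq> 0" using double_stolz_nonreal[OF z[unfolded D_def]] by auto
      ultimately show ?thesis by (simp only: times_divide_eq_right[symmetric] mult_cancel_left) simp
    qed
    have e2: "Q2 z = R2 z / k" if z: "z \<in> D" for z
    proof -
      have "(\<lambda>j. R (axis_seq \<beta> j) z / k) \<longlonglongrightarrow> z * R2 z / k"
        by (intro tendsto_intros bifree_R_limits(2)[OF \<nu> ab R1[unfolded D_def] R2[unfolded D_def] Req[unfolded D_def] z[unfolded D_def]] k)
      moreover have "(\<lambda>j. Q n (axis_seq \<beta> j) z) \<longlonglongrightarrow> z * Q2 z"
        by (rule bifree_R_limits(2)[OF M ab Q1[unfolded D_def] Q2[unfolded D_def] Qeq[unfolded D_def] z[unfolded D_def]])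
      moreover have "Q n (axis_seq \<beta> j) z = R (axis_seq \<beta> j) z / k" for j
        by (rule QR[OF _ z]) (simp add: D_def axis_seq_in[OF ab])
      ultimately have "z * Q2 z = z * R2 z / k" by (simp add: LIMSEQ_unique)
      moreover have "z \<noteq> 0" using double_stolz_nonreal[OF z[unfolded D_def]] by auto
      ultimately show ?thesis by (simp only: times_divide_eq_right[symmetric] mult_cancel_left) simp
    qed
    show "free_R_transform_on (marginal1 (M n)) (double_stolz \<alpha> \<beta>) (\<lambda>z. R1 z / of_nat (n + 2))"
      using free_R_transform_cong[OF Q1 e1] unfolding D_def k_def .
    show "free_R_transform_on (marginal2 (M n)) (double_stolz \<alpha> \<beta>) (\<lambda>z. R2 z / of_nat (n + 2))"
      using free_R_transform_cong[OF Q2 e2] unfolding D_def k_def .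
    fix z w assume "z \<in> double_stolz \<alpha> \<beta>" "w \<in> double_stolz \<alpha> \<beta>"
    then have zw: "z \<in> D" "w \<in> D" by (simp_all add: D_def)
    let ?g = "bifree_h (M n) (\<lambda>z. R1 z / k) (\<lambda>z. R2 z / k) z w"
    have g: "?g = bifree_h (M n) Q1 Q2 z w" by (simp add: bifree_h_def e1[OF zw(1)] e2[OF zw(2)])
    have x: "1 / g = 1 - e / k" if "(x + y + e) / k = x / k + y / k + (1 - 1 / g)" for x y e g :: complex
      using that by (simp add: add_divide_distrib algebra_simps)
    have "1 / ?g = 1 - E z w / k"
      by (rule x[of "z * R1 z" "w * R2 w"])
         (use Qeq[OF zw] in \<open>simp only: QR[OF zw] Req[OF zw] g E_def e1[OF zw(1)] e2[OF zw(2)] times_divide_eq_right\<close>)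
    moreover have "?g * (1 / ?g) = 1" using hQ[OF zw] by (simp add: g)
    ultimately show "bifree_h (M n) (\<lambda>z. R1 z / of_nat (n + 2)) (\<lambda>z. R2 z / of_nat (n + 2)) z w * (1 - E z w / of_nat (n + 2)) = 1"
      unfolding k_def[symmetric] by (simp only:)
  qed (use ab M in auto)
  interpret S: infinitesimal_array "\<lambda>n. swap_law (M n)" \<alpha> \<beta> R2 R1 "\<lambda>z w. E w z" by (rule A.swap)
  have n: "borel_prob (marginal1 \<nu>)" "borel_prob (marginal2 \<nu>)" by (rule borel_prob_marginal[OF \<nu>])+
  interpret P: poisson_limit "\<lambda>n. real (n + 2)" M \<alpha> \<beta> R1 R2 E
  proof
    show "(\<lambda>n. poisson_H (real (n + 2)) (marginal2 (M n)) (1 / z)) \<longlonglongrightarrow> 1 / z + R2 z" if "z \<in> double_stolz \<alpha> \<beta>" for z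
      using S.poisson_H_limit[OF that] unfolding marginal1_swap[OF M] .
    show "(\<lambda>n. poisson_H (real (n + 2)) (marginal1 (M n)) (1 / z)) \<longlonglongrightarrow> 1 / z + R1 z" if "z \<in> double_stolz \<alpha> \<beta>" for z
      by (rule A.poisson_H_limit[OF that])
    show "(\<lambda>n. joint_E (real (n + 2)) (M n) (1 / z) (1 / w)) \<longlonglongrightarrow> E z w" if "z \<in> double_stolz \<alpha> \<beta>" "w \<in> double_stolz \<alpha> \<beta>" for z w
      by (rule A.joint_E_limit[OF that])
    show "Im (1 / z + R1 z) * Im (1 / z) > 0" "Im (1 / z + R2 z) * Im (1 / z) > 0" if "z \<in> double_stolz \<alpha> \<beta>" for z
      by (rule free_R_transform_sign(2)[OF n(1) R1[unfolded D_def] that] free_R_transform_sign(2)[OF n(2) R2[unfolded D_def] that])+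
    show "((\<lambda>z. z * R1 z) \<longlongrightarrow> 0) (at 0 within double_stolz \<alpha> \<beta>)" "((\<lambda>z. z * R2 z) \<longlongrightarrow> 0) (at 0 within double_stolz \<alpha> \<beta>)"
      using R1 R2 unfolding D_def free_R_transform_on_def by blast+
  qed (use ab M in simp_all)
  obtain \<mu>' N q L where \<mu>': "\<And>n. borel_prob (\<mu>' n)" and cp: "\<And>n. bifree_compound_poisson (real (n + 2)) (\<mu>' n) (N n)"
    and q: "strict_mono (q :: nat \<Rightarrow> nat)" and L: "borel_prob L" and w: "weakly_converges (N \<circ> q) L"
    and "\<And>z. z \<in> double_stolz \<alpha> \<beta> \<Longrightarrow> cauchy_transform (marginal1 L) (1 / z + R1 z) = z"
    and "\<And>z. z \<in> double_stolz \<alpha> \<beta> \<Longrightarrow> cauchy_transform (marginal2 L) (1 / z + R2 z) = z"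
    and G: "\<And>z w. z \<in> double_stolz \<alpha> \<beta> \<Longrightarrow> w \<in> double_stolz \<alpha> \<beta> \<Longrightarrow>
      cauchy_transform2 L (1 / z + R1 z) (1 / w + R2 w) * (1 / z * (1 / w) * (1 - E z w)) = 1"
    using that by (rule P.limit_law)
  have "weakly_converges (N \<circ> q) \<nu>"
  proof (rule weakly_converges_of_R_transform[OF \<nu> L ab R1[unfolded D_def] R2[unfolded D_def] _ w])
    fix z w assume zw: "z \<in> double_stolz \<alpha> \<beta>" "w \<in> double_stolz \<alpha> \<beta>"
    have zw0: "z \<noteq> 0" "w \<noteq> 0" using double_stolz_nonreal[OF zw(1)] double_stolz_nonreal[OF zw(2)] by auto
    have h0: "bifree_h \<nu> R1 R2 z w \<noteq> 0" using h zw by (simp add: D_def)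
    have "g = G" if "g * (1 / z * (1 / w) * (1 - (1 - 1 / (G / (z * w))))) = 1" "G / (z * w) \<noteq> 0" for g G
      using that zw0 by simp
    from this[OF G[OF zw, unfolded E_def bifree_h_def] h0[unfolded bifree_h_def]]
    show "cauchy_transform2 L (1 / z + R1 z) (1 / w + R2 w) = cauchy_transform2 \<nu> (1 / z + R1 z) (1 / w + R2 w)" .
  qed
  \<comment> \<open>The rates are read along the subsequence q, and q n \<ge> n keeps them
    unbounded.\<close>
  moreover have "\<not> bdd_above (range (\<lambda>n. q n + 2))"
  proof
    assume "bdd_above (range (\<lambda>n. q n + 2))"
    then obtain B where "\<And>n. q n + 2 \<le> B" by (auto simp: bdd_above_def)
    from this[of B] show False using seq_suble[OF q, of B] by simp
  qed
  ultimately show ?thesis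
    using that[of "\<mu>' \<circ> q" "\<lambda>n. q n + 2" "N \<circ> q"] \<mu>' cp by simp
qed

section \<open>Limits are infinitely divisible\<close>

text \<open>Injectivity provides a holomorphic inverse of G on its image. By
  \<open>cauchy_transform_surj_sector\<close> this image contains a Stolz angle, and near 0 the
  inverse there is 1 / z up to a relative error \<epsilon>. As \<epsilon> is arbitrary, z R z tends
  to 0.\<close>

lemma free_R_transform_exists:
  assumes m: "borel_prob m" and inj: "inj_on (cauchy_transform m) (- \<real>)"
  shows "\<exists>\<beta>>0. \<exists>R. free_R_transform_on m (double_stolz 1 \<beta>) R"
proof -
  obtain g where hol: "g holomorphic_on cauchy_transform m ` (- \<real>)"
    and "\<And>\<zeta>. \<zeta> \<in> - \<real> \<Longrightarrow> deriv (cauchy_transform m) \<zeta> * deriv g (cauchy_transform m \<zeta>) = 1"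
    and g: "\<And>\<zeta>. \<zeta> \<in> - \<real> \<Longrightarrow> g (cauchy_transform m \<zeta>) = \<zeta>"
    using that by (rule holomorphic_has_inverse[OF cauchy_transform_holomorphic[OF m] open_nonreal inj])
  define R where "R z = g z - 1 / z" for z
  have near: "\<exists>Y>0. \<forall>\<gamma>. \<forall>z\<in>double_stolz 1 \<gamma>. Y \<le> norm (1 / z) \<longrightarrow>
      1 / z + R z \<in> - \<real> \<and> cauchy_transform m (1 / z + R z) = z \<and> z \<in> cauchy_transform m ` (- \<real>) \<and> norm (z * R z) \<le> \<epsilon>"
    if \<epsilon>: "0 < \<epsilon>" "\<epsilon> \<le> 1/8" for \<epsilon>
  proof -
    obtain Y where Y: "Y > 0" and ex: "\<And>F. Y \<le> norm F \<Longrightarrow> norm F \<le> 2 * \<bar>Im F\<bar> \<Longrightarrow>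
        \<exists>\<zeta>. norm (\<zeta> - F) \<le> \<epsilon> * norm F \<and> Im \<zeta> \<noteq> 0 \<and> cauchy_transform m \<zeta> = 1 / F"
      using cauchy_transform_surj_sector[OF m \<epsilon>] by blast
    have "1 / z + R z \<in> - \<real> \<and> cauchy_transform m (1 / z + R z) = z \<and> z \<in> cauchy_transform m ` (- \<real>) \<and> norm (z * R z) \<le> \<epsilon>"
      if z: "z \<in> double_stolz 1 \<gamma>" and zY: "Y \<le> norm (1 / z)" for z \<gamma>
    proof -
      have z0: "z \<noteq> 0" using double_stolz_nonreal[OF z] by auto
      have "norm (1 / z) \<le> 2 * \<bar>Im (1 / z)\<bar>" using abs_Im_inverse[OF z] by simp
      from ex[OF zY this] obtain \<zeta> where \<zeta>: "norm (\<zeta> - 1 / z) \<le> \<epsilon> * norm (1 / z)" "Im \<zeta> \<noteq> 0" "cauchy_transform m \<zeta> = z" by auto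
      have nr: "\<zeta> \<in> - \<real>" using \<zeta>(2) by (simp add: complex_is_Real_iff)
      have gz: "g z = \<zeta>" using g[OF nr] \<zeta>(3) by simp
      have "norm (z * R z) = norm z * norm (\<zeta> - 1 / z)" by (simp add: R_def gz norm_mult)
      also have "\<dots> \<le> norm z * (\<epsilon> * norm (1 / z))" using \<zeta>(1) by (rule mult_left_mono) simp
      also have "\<dots> = \<epsilon>" using z0 by (simp add: norm_divide)
      finally show ?thesis using nr \<zeta>(3) by (auto simp: R_def gz)
    qed
    then show ?thesis using Y by blast
  qed
  obtain Y where Y: "Y > 0" and near0: "\<And>\<gamma> z. z \<in> double_stolz 1 \<gamma> \<Longrightarrow> Y \<le> norm (1 / z) \<Longrightarrow>
      1 / z + R z \<in> - \<real> \<and> cauchy_transform m (1 / z + R z) = z \<and> z \<in> cauchy_transform m ` (- \<real>)"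
  proof -
    have "0 < (1/8 :: real)" "(1/8 :: real) \<le> 1/8" by simp_all
    from near[OF this] show ?thesis using that by blast
  qed
  \<comment> \<open>With aperture 1, |z| \<le> 2 |Im z| < 1 / Y, so |1 / z| exceeds the threshold
    Y.\<close>
  define D where "D = double_stolz 1 (1 / (2 * Y))"
  have D: "1 / z + R z \<in> - \<real> \<and> cauchy_transform m (1 / z + R z) = z \<and> z \<in> cauchy_transform m ` (- \<real>)" if z: "z \<in> D" for z
  proof (rule near0)
    show "z \<in> double_stolz 1 (1 / (2 * Y))" using z unfolding D_def .
    then have "norm z \<le> 2 * \<bar>Im z\<bar>" "\<bar>Im z\<bar> < 1 / (2 * Y)" "norm z > 0"
      using norm_double_stolz_le[of z 1] by (auto simp: double_stolz_iff)
    moreover from this have "Y * norm z \<le> Y * (2 * \<bar>Im z\<bar>)" "Y * (2 * \<bar>Im z\<bar>) \<le> 1"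
      using Y by (auto simp: field_simps)
    ultimately show "Y \<le> norm (1 / z)" by (simp add: norm_divide field_simps)
  qed
  have "free_R_transform_on m D R"
    unfolding free_R_transform_on_def
  proof (intro conjI ballI)
    have "D \<subseteq> cauchy_transform m ` (- \<real>)" using D by blast
    then show "R holomorphic_on D" unfolding R_def
      by (intro holomorphic_intros holomorphic_on_subset[OF hol]) (auto simp: D_def dest: double_stolz_nonreal)
    show "1 / z + R z \<notin> \<real>" "cauchy_transform m (1 / z + R z) = z" if "z \<in> D" for z using D[OF that] by simp_all
    show "((\<lambda>z. z * R z) \<longlongrightarrow> 0) (at 0 within D)"
      unfolding tendsto_iff
    proof (intro allI impI)
      fix e :: real assume e: "e > 0"
      then have "0 < min (e / 2) (1/8)" "min (e / 2) (1/8) \<le> 1/8" by auto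
      from near[OF this] obtain Y' where Y': "Y' > 0"
        and n: "\<And>z. z \<in> D \<Longrightarrow> Y' \<le> norm (1 / z) \<Longrightarrow> norm (z * R z) \<le> min (e / 2) (1/8)"
        unfolding D_def by blast
      show "\<forall>\<^sub>F z in at 0 within D. dist (z * R z) 0 < e"
        unfolding eventually_at
      proof (intro exI[of _ "1 / Y'"] conjI ballI impI)
        fix z assume z: "z \<in> D" "z \<noteq> 0 \<and> dist z 0 < 1 / Y'"
        then have "Y' \<le> norm (1 / z)" using Y' by (simp add: norm_divide field_simps)
        from n[OF z(1) this] show "dist (z * R z) 0 < e" using e by simp
      qed (use Y' in simp)
    qed
  qed
  then show ?thesis unfolding D_def using Y by (intro exI[of _ "1 / (2 * Y)"] conjI exI[of _ R]) auto
qed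

text \<open>For every n the n-th function H takes the value \<zeta> exactly at the reciprocal
  transform of \<open>P n\<close>. The bound of \<open>poisson_H_lipschitz\<close>, uniform in n,
  replaces this moving point by its limit although the functions H vary with n.\<close>

lemma poisson_H_converges:
  assumes m: "\<And>n. borel_prob (m n)" and r: "\<And>n. r n \<ge> 0" and P: "\<And>n. borel_prob (P n)" and L: "borel_prob L" and w: "weakly_converges P L"
    and H: "\<And>n. poisson_H (r n) (m n) (1 / cauchy_transform (P n) \<zeta>) = \<zeta>" and \<zeta>: "Im \<zeta> \<noteq> 0"
  shows "(\<lambda>n. 1 / cauchy_transform (P n) \<zeta>) \<longlonglongrightarrow> 1 / cauchy_transform L \<zeta>"
    "(\<lambda>n. poisson_H (r n) (m n) (1 / cauchy_transform L \<zeta>)) \<longlonglongrightarrow> \<zeta>"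
proof -
  define F where "F n = 1 / cauchy_transform (P n) \<zeta>" for n
  define F0 where "F0 = 1 / cauchy_transform L \<zeta>"
  have F0: "Im F0 \<noteq> 0" unfolding F0_def by (rule Im_inverse_nonzero[OF cauchy_transform_nonzero(1)[OF L \<zeta>]])
  show F: "(\<lambda>n. 1 / cauchy_transform (P n) \<zeta>) \<longlonglongrightarrow> 1 / cauchy_transform L \<zeta>"
    by (intro tendsto_intros weakly_converges_cauchy_transform[OF w P L \<zeta>] cauchy_transform_nonzero(2)[OF L \<zeta>])
  have HF: "poisson_H (r n) (m n) (F n) = \<zeta>" for n unfolding F_def by (rule H)
  have b: "norm (\<zeta> - poisson_H (r n) (m n) F0) \<le> norm (F n - F0) * (2 + norm (F n - F0) / \<bar>Im F0\<bar>)" for n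
  proof -
    have "Im (F n) * Im (poisson_H (r n) (m n) (F n)) > 0"
      unfolding HF unfolding F_def by (rule cauchy_transform_nonzero(3)[OF P \<zeta>])
    from poisson_H_lipschitz[OF m r this F0] show ?thesis unfolding HF .
  qed
  have "(\<lambda>n. norm (F n - F0)) \<longlonglongrightarrow> 0"
    unfolding F_def F0_def by (rule tendsto_norm_zero[OF LIM_zero[OF F]])
  then have "(\<lambda>n. norm (F n - F0) * (2 + norm (F n - F0) / \<bar>Im F0\<bar>)) \<longlonglongrightarrow> 0 * (2 + 0 / \<bar>Im F0\<bar>)"
    by (intro tendsto_mult tendsto_add tendsto_divide tendsto_const) (use F0 in simp_all)
  then have "(\<lambda>n. norm (F n - F0) * (2 + norm (F n - F0) / \<bar>Im F0\<bar>)) \<longlonglongrightarrow> 0" by simp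
  then have "(\<lambda>n. \<zeta> - poisson_H (r n) (m n) F0) \<longlonglongrightarrow> 0"
    by (rule Lim_null_comparison[rotated]) (intro always_eventually allI b)
  from tendsto_diff[OF tendsto_const this, of \<zeta>]
  show "(\<lambda>n. poisson_H (r n) (m n) (1 / cauchy_transform L \<zeta>)) \<longlonglongrightarrow> \<zeta>" unfolding F0_def by simp
qed

text \<open>The left inverses survive as a limit: by \<open>poisson_H_converges\<close> the point
  \<zeta> is recovered from the value of the limit transform at \<zeta> alone. This is what supplies
  the marginal R-transforms of the limit law.\<close>

lemma inj_cauchy_transform_of_limit:
  assumes "\<And>n. borel_prob (m n)" "\<And>n. r n \<ge> 0" "\<And>n. borel_prob (P n)" "borel_prob L" "weakly_converges P L"
    and H: "\<And>n \<zeta>. Im \<zeta> \<noteq> 0 \<Longrightarrow> poisson_H (r n) (m n) (1 / cauchy_transform (P n) \<zeta>) = \<zeta>"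
  shows "inj_on (cauchy_transform L) (- \<real>)"
proof (rule inj_onI)
  fix \<zeta> \<zeta>' :: complex assume "\<zeta> \<in> - \<real>" "\<zeta>' \<in> - \<real>" and eq: "cauchy_transform L \<zeta> = cauchy_transform L \<zeta>'"
  then have i: "Im \<zeta> \<noteq> 0" "Im \<zeta>' \<noteq> 0" by (auto simp: complex_is_Real_iff)
  from poisson_H_converges(2)[OF assms(1-5) H[OF i(2)] i(2)] poisson_H_converges(2)[OF assms(1-5) H[OF i(1)] i(1)]
  show "\<zeta> = \<zeta>'" unfolding eq by (intro LIMSEQ_unique)
qed

text \<open>E is bounded by 1, so |1 - E| \<le> 2, and the joint equation bounds |G F W| from below
  by 1/2 for every n, hence in the limit. The equation can then be solved for E, and
  \<open>joint_E_lipschitz\<close> moves the evaluation points to their limits.\<close>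

lemma joint_E_converges:
  assumes \<mu>: "\<And>n. borel_prob (\<mu> n)" and r: "\<And>n. r n \<ge> 0" and \<nu>: "borel_prob \<nu>" and w: "weakly_converges N \<nu>"
    and cp: "\<And>n. bifree_compound_poisson (r n) (\<mu> n) (N n)" and \<zeta>: "Im \<zeta> \<noteq> 0" and \<omega>: "Im \<omega> \<noteq> 0"
    and F1: "(\<lambda>n. 1 / cauchy_transform (marginal1 (N n)) \<zeta>) \<longlonglongrightarrow> F0" "Im F0 \<noteq> 0"
    and W1: "(\<lambda>n. 1 / cauchy_transform (marginal2 (N n)) \<omega>) \<longlonglongrightarrow> W0" "Im W0 \<noteq> 0"
  shows "cauchy_transform2 \<nu> \<zeta> \<omega> \<noteq> 0"
    "(\<lambda>n. joint_E (r n) (\<mu> n) F0 W0) \<longlonglongrightarrow> 1 - 1 / (cauchy_transform2 \<nu> \<zeta> \<omega> * (F0 * W0))"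
proof -
  have N: "borel_prob (N n)" for n using cp by (simp add: bifree_compound_poisson_def)
  define F W where "F n = 1 / cauchy_transform (marginal1 (N n)) \<zeta>" and "W n = 1 / cauchy_transform (marginal2 (N n)) \<omega>" for n
  define G E where "G n = cauchy_transform2 (N n) \<zeta> \<omega>" and "E n = joint_E (r n) (\<mu> n) (F n) (W n)" for n
  have F: "F \<longlonglongrightarrow> F0" and W: "W \<longlonglongrightarrow> W0" using F1 W1 unfolding F_def W_def by simp_all
  have G: "G \<longlonglongrightarrow> cauchy_transform2 \<nu> \<zeta> \<omega>" unfolding G_def by (rule weakly_converges_cauchy_transform2[OF w N \<nu> \<zeta> \<omega>])
  have m: "borel_prob (marginal1 (\<mu> n))" "borel_prob (marginal2 (\<mu> n))" "borel_prob (marginal1 (N n))" "borel_prob (marginal2 (N n))" for n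
    by (rule borel_prob_marginal \<mu> N)+
  have HF: "poisson_H (r n) (marginal1 (\<mu> n)) (F n) = \<zeta>" and HW: "poisson_H (r n) (marginal2 (\<mu> n)) (W n) = \<omega>"
    and GE: "G n * (F n * W n * (1 - E n)) = 1" for n
    unfolding F_def W_def G_def E_def
    by (rule bifree_compound_poisson_global[OF \<mu> cp] \<zeta> \<omega>)+
  have sF: "Im (F n) * Im (poisson_H (r n) (marginal1 (\<mu> n)) (F n)) > 0" and sW: "Im (W n) * Im (poisson_H (r n) (marginal2 (\<mu> n)) (W n)) > 0" for n
    unfolding HF HW unfolding F_def W_def by (rule cauchy_transform_nonzero(3)[OF m(3) \<zeta>] cauchy_transform_nonzero(3)[OF m(4) \<omega>])+
  have nE: "norm (1 - E n) \<le> 2" for n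
  proof -
    have "norm (E n) \<le> (poisson_A (r n) (marginal1 (\<mu> n)) (F n) + poisson_A (r n) (marginal2 (\<mu> n)) (W n)) / 2"
      unfolding E_def by (rule norm_joint_E_le[OF \<mu> r]) (use sF[of n] sW[of n] in auto)
    also have "\<dots> \<le> 1" using poisson_A_less_1[OF m(1) sF, of n] poisson_A_less_1[OF m(2) sW, of n] by simp
    finally show ?thesis using norm_triangle_ineq4[of 1 "E n"] by simp
  qed
  have "1 \<le> norm (G n) * (norm (F n) * norm (W n) * 2)" for n
  proof -
    have "1 = norm (G n * (F n * W n * (1 - E n)))" unfolding GE by simp
    also have "\<dots> = norm (G n) * (norm (F n) * norm (W n) * norm (1 - E n))" by (simp only: norm_mult)
    also have "\<dots> \<le> norm (G n) * (norm (F n) * norm (W n) * 2)" by (intro mult_left_mono nE) auto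
    finally show ?thesis .
  qed
  moreover have "(\<lambda>n. norm (G n) * (norm (F n) * norm (W n) * 2)) \<longlonglongrightarrow> norm (cauchy_transform2 \<nu> \<zeta> \<omega>) * (norm F0 * norm W0 * 2)"
    by (intro tendsto_mult tendsto_norm tendsto_const F W G)
  ultimately have "1 \<le> norm (cauchy_transform2 \<nu> \<zeta> \<omega>) * (norm F0 * norm W0 * 2)" by (intro LIMSEQ_le_const) auto
  then show G0: "cauchy_transform2 \<nu> \<zeta> \<omega> \<noteq> 0" by auto
  have FW0: "F0 \<noteq> 0" "W0 \<noteq> 0" using F1(2) W1(2) by auto
  have E: "E n = 1 - 1 / (G n * (F n * W n))" for n
  proof -
    have inv: "e = 1 - 1 / x" if "x * (1 - e) = 1" for x e :: complex
    proof -
      have "x \<noteq> 0" using that by auto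
      then have "1 - e = 1 / x" using that by (simp add: eq_divide_eq mult.commute)
      then show ?thesis by (simp add: algebra_simps)
    qed
    show ?thesis by (rule inv) (use GE[of n] in \<open>simp only: mult.assoc\<close>)
  qed
  have "(\<lambda>n. 1 - 1 / (G n * (F n * W n))) \<longlonglongrightarrow> 1 - 1 / (cauchy_transform2 \<nu> \<zeta> \<omega> * (F0 * W0))"
    by (intro tendsto_diff tendsto_mult tendsto_divide tendsto_const F W G) (use G0 FW0 in simp_all)
  then have El: "E \<longlonglongrightarrow> 1 - 1 / (cauchy_transform2 \<nu> \<zeta> \<omega> * (F0 * W0))"
    unfolding E[symmetric] .
  define b where "b n = (1 + norm (F n - F0) / \<bar>Im F0\<bar>) * (1 + norm (W n - W0) / \<bar>Im W0\<bar>) - 1" for n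
  have "b \<longlonglongrightarrow> (1 + 0 / \<bar>Im F0\<bar>) * (1 + 0 / \<bar>Im W0\<bar>) - 1"
    unfolding b_def
    by (intro tendsto_diff tendsto_mult tendsto_add tendsto_divide tendsto_const tendsto_norm_zero LIM_zero F W)
       (use F1(2) W1(2) in simp_all)
  then have b: "b \<longlonglongrightarrow> 0" by simp
  have jb: "norm (joint_E (r n) (\<mu> n) F0 W0 - E n) \<le> b n" for n
    unfolding E_def b_def by (rule joint_E_lipschitz[OF \<mu> r sF F1(2) sW W1(2)])
  have "(\<lambda>n. joint_E (r n) (\<mu> n) F0 W0 - E n) \<longlonglongrightarrow> 0"
    by (rule Lim_null_comparison[OF always_eventually[OF allI[OF jb]] b])
  from tendsto_add[OF this El]
  show "(\<lambda>n. joint_E (r n) (\<mu> n) F0 W0) \<longlonglongrightarrow> 1 - 1 / (cauchy_transform2 \<nu> \<zeta> \<omega> * (F0 * W0))" by simp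
qed

text \<open>H minus the identity is linear in the rate, as is E, so dividing the rate by c divides
  the limiting R-transform by c. The root of the limit is thus taken on the level of the
  rates.\<close>

lemma poisson_H_scale: "poisson_H (r / c) m F = F + (poisson_H r m F - F) / of_real c"
  by (simp add: poisson_H_def)

lemma joint_E_scale: "joint_E (r / c) \<mu> F W = joint_E r \<mu> F W / of_real c"
  by (simp add: joint_E_def)

lemma bifree_h_eqI:
  fixes G z w e :: complex
  assumes "G * (1 / z * (1 / w) * (1 - e)) = 1" "z \<noteq> 0" "w \<noteq> 0"
  shows "G / (z * w) \<noteq> 0" "1 - 1 / (G / (z * w)) = e"
proof -
  have x: "G / (z * w) * (1 - e) = 1" using assms(1) by simp
  then show ne: "G / (z * w) \<noteq> 0" by auto
  have "1 - e = 1 / (G / (z * w))" using x ne by (metis nonzero_mult_div_cancel_left)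
  then show "1 - 1 / (G / (z * w)) = e" unfolding eq_commute[of "1 - e"] by (simp only: diff_diff_eq2 add_diff_cancel_left')
qed

text \<open>The limits of H and E are established once, on a Stolz domain D that is fixed before p,
  as the definition of divisibility demands. For each p their p-th parts satisfy
  \<open>poisson_limit\<close> with the rates k n / p on the same D, and the limit law found there
  is the required root.\<close>

lemma limit_imp_bifreely_infinitely_divisible:
  assumes \<nu>: "borel_prob \<nu>" and \<mu>: "\<And>n. borel_prob (\<mu> n)"
    and cp: "\<And>n. bifree_compound_poisson (real (k n)) (\<mu> n) (N n)" and w: "weakly_converges N \<nu>"
  shows "bifreely_infinitely_divisible \<nu>"
proof -
  have N: "borel_prob (N n)" for n using cp by (simp add: bifree_compound_poisson_def)
  have r: "real (k n) \<ge> 0" for n by simp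
  have m: "borel_prob (marginal1 (\<mu> n))" "borel_prob (marginal2 (\<mu> n))" "borel_prob (marginal1 (N n))" "borel_prob (marginal2 (N n))"
    "borel_prob (marginal1 \<nu>)" "borel_prob (marginal2 \<nu>)" for n
    by (rule borel_prob_marginal \<mu> N \<nu>)+
  have w1: "weakly_converges (\<lambda>n. marginal1 (N n)) (marginal1 \<nu>)" by (rule weakly_converges_marginal1[OF w N \<nu>])
  have w2: "weakly_converges (\<lambda>n. marginal2 (N n)) (marginal2 \<nu>)"
    using weakly_converges_marginal1[OF weakly_converges_swap[OF w N \<nu>] borel_prob_swap[OF N] borel_prob_swap[OF \<nu>]]
    unfolding marginal1_swap[OF N] marginal1_swap[OF \<nu>] .
  note H1 = bifree_compound_poisson_global(1)[OF \<mu> cp] and H2 = bifree_compound_poisson_global(2)[OF \<mu> cp]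
  note P1 = poisson_H_converges[OF m(1) r m(3) m(5) w1 H1] and P2 = poisson_H_converges[OF m(2) r m(4) m(6) w2 H2]
  obtain \<beta>1 R1 where b1: "\<beta>1 > 0" and R1': "free_R_transform_on (marginal1 \<nu>) (double_stolz 1 \<beta>1) R1"
    using free_R_transform_exists[OF m(5) inj_cauchy_transform_of_limit[OF m(1) r m(3) m(5) w1 H1]] by blast
  obtain \<beta>2 R2 where b2: "\<beta>2 > 0" and R2': "free_R_transform_on (marginal2 \<nu>) (double_stolz 1 \<beta>2) R2"
    using free_R_transform_exists[OF m(6) inj_cauchy_transform_of_limit[OF m(2) r m(4) m(6) w2 H2]] by blast
  define \<beta> where "\<beta> = min \<beta>1 \<beta>2"
  define D where "D = double_stolz 1 \<beta>"
  have \<beta>: "\<beta> > 0" using b1 b2 by (simp add: \<beta>_def)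
  have R1: "free_R_transform_on (marginal1 \<nu>) D R1" unfolding D_def
    by (rule free_R_transform_on_subset[OF R1' double_stolz_mono]) (simp_all add: \<beta>_def)
  have R2: "free_R_transform_on (marginal2 \<nu>) D R2" unfolding D_def
    by (rule free_R_transform_on_subset[OF R2' double_stolz_mono]) (simp_all add: \<beta>_def)
  have nz: "z \<noteq> 0" if "z \<in> D" for z using double_stolz_nonreal[OF that[unfolded D_def]] by auto
  have i: "Im (1 / z) \<noteq> 0" if "z \<in> D" for z by (rule Im_inverse_nonzero[OF double_stolz_nonreal[OF that[unfolded D_def]]])
  note s1 = free_R_transform_sign[OF m(5) R1] and s2 = free_R_transform_sign[OF m(6) R2]
  have G1: "cauchy_transform (marginal1 \<nu>) (1 / z + R1 z) = z" and G2: "cauchy_transform (marginal2 \<nu>) (1 / z + R2 z) = z" if "z \<in> D" for z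
    using R1 R2 that unfolding free_R_transform_on_def by blast+
  have F1: "(\<lambda>n. 1 / cauchy_transform (marginal1 (N n)) (1 / z + R1 z)) \<longlonglongrightarrow> 1 / z"
    and L1: "(\<lambda>n. poisson_H (real (k n)) (marginal1 (\<mu> n)) (1 / z)) \<longlonglongrightarrow> 1 / z + R1 z" if z: "z \<in> D" for z
    using P1[OF s1(3)[OF z] s1(3)[OF z]] unfolding G1[OF z] .
  have F2: "(\<lambda>n. 1 / cauchy_transform (marginal2 (N n)) (1 / z + R2 z)) \<longlonglongrightarrow> 1 / z"
    and L2: "(\<lambda>n. poisson_H (real (k n)) (marginal2 (\<mu> n)) (1 / z)) \<longlonglongrightarrow> 1 / z + R2 z" if z: "z \<in> D" for z
    using P2[OF s2(3)[OF z] s2(3)[OF z]] unfolding G2[OF z] .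
  define E where "E z w = 1 - 1 / bifree_h \<nu> R1 R2 z w" for z w
  have h: "bifree_h \<nu> R1 R2 z w \<noteq> 0" and LE: "(\<lambda>n. joint_E (real (k n)) (\<mu> n) (1 / z) (1 / w)) \<longlonglongrightarrow> E z w"
    if z: "z \<in> D" and w': "w \<in> D" for z w
  proof -
    note J = joint_E_converges[OF \<mu> r \<nu> w cp s1(3)[OF z] s2(3)[OF w'] F1[OF z] i[OF z] F2[OF w'] i[OF w']]
    show "bifree_h \<nu> R1 R2 z w \<noteq> 0" unfolding bifree_h_def using J(1) nz[OF z] nz[OF w'] by simp
    have "1 / z * (1 / w) = 1 / (z * w)" by simp
    then show "(\<lambda>n. joint_E (real (k n)) (\<mu> n) (1 / z) (1 / w)) \<longlonglongrightarrow> E z w"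
      using J(2) unfolding E_def bifree_h_def by (simp only: times_divide_eq_right mult.right_neutral)
  qed
  define R where "R z w = z * R1 z + w * R2 w + E z w" for z w
  have "bifree_R_transform_on \<nu> D R"
    unfolding bifree_R_transform_on_def
    by (intro exI[of _ R1] exI[of _ R2] conjI ballI R1 R2 h) (simp_all add: R_def E_def)
  moreover have "\<exists>L Q. borel_prob L \<and> bifree_R_transform_on L D Q \<and> (\<forall>z\<in>D. \<forall>w\<in>D. R z w = of_nat p * Q z w)" if p: "p \<ge> 2" for p :: nat
  proof -
    define c where "c = real p"
    have c: "c > 0" "c \<ge> 1" using p by (simp_all add: c_def)
    have c0: "complex_of_real c \<noteq> 0" using c by simp
    \<comment> \<open>Im (a + x / c) is the convex combination of Im a and Im (a + x) with weights 1
      - 1 / c and 1 / c, and both have the sign of Im a.\<close>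
    have sgn: "Im (a + x / of_real c) * Im a > 0" if "Im (a + x) * Im a > 0" "Im a \<noteq> 0" for a x
    proof -
      have "Im (a + x / of_real c) * Im a = (1 - 1 / c) * (Im a * Im a) + 1 / c * (Im (a + x) * Im a)"
        using c by (simp add: field_simps)
      moreover have "(1 - 1 / c) * (Im a * Im a) \<ge> 0" by (rule mult_nonneg_nonneg) (use c in simp_all)
      moreover have "1 / c * (Im (a + x) * Im a) > 0" by (rule mult_pos_pos) (use c that in simp_all)
      ultimately show ?thesis by linarith
    qed
    have zero: "((\<lambda>z. z * (T z / of_real c)) \<longlongrightarrow> 0) (at 0 within D)" if "((\<lambda>z. z * T z) \<longlongrightarrow> 0) (at 0 within D)" for T
      using tendsto_divide[OF that tendsto_const c0] by simp
    have scale: "(\<lambda>n. poisson_H (real (k n) / c) (m n) F) \<longlonglongrightarrow> F + x / of_real c"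
      if "(\<lambda>n. poisson_H (real (k n)) (m n) F) \<longlonglongrightarrow> F + x" for m F x
    proof -
      have "(\<lambda>n. F + (poisson_H (real (k n)) (m n) F - F) / of_real c) \<longlonglongrightarrow> F + (F + x - F) / of_real c"
        by (intro tendsto_add tendsto_const tendsto_divide tendsto_diff that c0)
      then show ?thesis unfolding poisson_H_scale add_diff_cancel_left' .
    qed
    interpret P: poisson_limit "\<lambda>n. real (k n) / c" \<mu> 1 \<beta> "\<lambda>z. R1 z / of_real c" "\<lambda>z. R2 z / of_real c" "\<lambda>z w. E z w / of_real c"
    proof (unfold_locales, fold D_def)
      show "(\<lambda>n. joint_E (real (k n) / c) (\<mu> n) (1 / z) (1 / w)) \<longlonglongrightarrow> E z w / of_real c" if "z \<in> D" "w \<in> D" for z w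
        unfolding joint_E_scale by (intro tendsto_divide LE that tendsto_const c0)
      show "Im (1 / z + R1 z / of_real c) * Im (1 / z) > 0" if "z \<in> D" for z by (rule sgn[OF s1(2)[OF that] i[OF that]])
      show "Im (1 / z + R2 z / of_real c) * Im (1 / z) > 0" if "z \<in> D" for z by (rule sgn[OF s2(2)[OF that] i[OF that]])
      show "((\<lambda>z. z * (R1 z / of_real c)) \<longlongrightarrow> 0) (at 0 within D)" "((\<lambda>z. z * (R2 z / of_real c)) \<longlongrightarrow> 0) (at 0 within D)"
        using R1 R2 unfolding free_R_transform_on_def by (blast intro: zero)+
      show "(\<lambda>n. poisson_H (real (k n) / c) (marginal1 (\<mu> n)) (1 / z)) \<longlonglongrightarrow> 1 / z + R1 z / of_real c" if "z \<in> D" for z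
        by (rule scale[OF L1[OF that]])
      show "(\<lambda>n. poisson_H (real (k n) / c) (marginal2 (\<mu> n)) (1 / z)) \<longlonglongrightarrow> 1 / z + R2 z / of_real c" if "z \<in> D" for z
        by (rule scale[OF L2[OF that]])
    qed (use \<beta> \<mu> c in simp_all)
    obtain \<mu>' N' q L where "\<And>n. borel_prob (\<mu>' n)" "\<And>n. bifree_compound_poisson (real (k n) / c) (\<mu>' n) (N' n)"
      "strict_mono (q :: nat \<Rightarrow> nat)" and L: "borel_prob L" and "weakly_converges (N' \<circ> q) L"
      and GL1: "\<And>z. z \<in> double_stolz 1 \<beta> \<Longrightarrow> cauchy_transform (marginal1 L) (1 / z + R1 z / of_real c) = z"
      and GL2: "\<And>z. z \<in> double_stolz 1 \<beta> \<Longrightarrow> cauchy_transform (marginal2 L) (1 / z + R2 z / of_real c) = z"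
      and GL: "\<And>z w. z \<in> double_stolz 1 \<beta> \<Longrightarrow> w \<in> double_stolz 1 \<beta> \<Longrightarrow>
        cauchy_transform2 L (1 / z + R1 z / of_real c) (1 / w + R2 w / of_real c) * (1 / z * (1 / w) * (1 - E z w / of_real c)) = 1"
      using that by (rule P.limit_law)
    have RL1: "free_R_transform_on (marginal1 L) D (\<lambda>z. R1 z / of_real c)"
      unfolding free_R_transform_on_def
    proof (intro conjI ballI)
      show "(\<lambda>z. R1 z / of_real c) holomorphic_on D" using R1 c0 unfolding free_R_transform_on_def by (intro holomorphic_intros) auto
      show "((\<lambda>z. z * (R1 z / of_real c)) \<longlongrightarrow> 0) (at 0 within D)" using P.zero1 unfolding D_def .
      fix z assume z: "z \<in> D"
      show "1 / z + R1 z / of_real c \<notin> \<real>" using P.sign1[OF z[unfolded D_def]] by (metis complex_is_Real_iff less_irrefl mult_zero_left)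
      show "cauchy_transform (marginal1 L) (1 / z + R1 z / of_real c) = z" by (rule GL1[OF z[unfolded D_def]])
    qed
    have RL2: "free_R_transform_on (marginal2 L) D (\<lambda>z. R2 z / of_real c)"
      unfolding free_R_transform_on_def
    proof (intro conjI ballI)
      show "(\<lambda>z. R2 z / of_real c) holomorphic_on D" using R2 c0 unfolding free_R_transform_on_def by (intro holomorphic_intros) auto
      show "((\<lambda>z. z * (R2 z / of_real c)) \<longlongrightarrow> 0) (at 0 within D)" using P.zero2 unfolding D_def .
      fix z assume z: "z \<in> D"
      show "1 / z + R2 z / of_real c \<notin> \<real>" using P.sign2[OF z[unfolded D_def]] by (metis complex_is_Real_iff less_irrefl mult_zero_left)
      show "cauchy_transform (marginal2 L) (1 / z + R2 z / of_real c) = z" by (rule GL2[OF z[unfolded D_def]])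
    qed
    have "bifree_R_transform_on L D (\<lambda>z w. R z w / of_real c)"
      unfolding bifree_R_transform_on_def
    proof (intro exI conjI ballI)
      show "free_R_transform_on (marginal1 L) D (\<lambda>z. R1 z / of_real c)" by (rule RL1)
      show "free_R_transform_on (marginal2 L) D (\<lambda>z. R2 z / of_real c)" by (rule RL2)
      fix z w assume zw: "z \<in> D" "w \<in> D"
      note h = bifree_h_eqI[OF GL[OF zw[unfolded D_def]] nz[OF zw(1)] nz[OF zw(2)]]
      show "bifree_h L (\<lambda>z. R1 z / of_real c) (\<lambda>z. R2 z / of_real c) z w \<noteq> 0" unfolding bifree_h_def by (rule h(1))
      show "R z w / of_real c = z * (R1 z / of_real c) + w * (R2 w / of_real c) + (1 - 1 / bifree_h L (\<lambda>z. R1 z / of_real c) (\<lambda>z. R2 z / of_real c) z w)"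
        unfolding bifree_h_def h(2) R_def by (simp only: add_divide_distrib times_divide_eq_right)
    qed
    moreover have "R z w = of_nat p * (R z w / of_real c)" for z w using p by (simp add: c_def)
    ultimately show ?thesis using L by blast
  qed
  ultimately show ?thesis
    unfolding bifreely_infinitely_divisible_def using \<beta> unfolding D_def by (intro exI[of _ 1] conjI exI[of _ \<beta>] exI[of _ R]) auto
qed

theorem proposition3p11:
  fixes \<nu> :: "(real \<times> real) measure"
  assumes "borel_prob \<nu>"
  shows "bifreely_infinitely_divisible \<nu> \<longleftrightarrow>
    (\<exists>(\<mu> :: nat \<Rightarrow> (real \<times> real) measure) (k :: nat \<Rightarrow> nat) (N :: nat \<Rightarrow> (real \<times> real) measure).
       (\<forall>n. borel_prob (\<mu> n)) \<and> (\<forall>n. k n > 0) \<and> \<not> bdd_above (range k) \<and>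
       (\<forall>n. bifree_compound_poisson (real (k n)) (\<mu> n) (N n)) \<and>
       weakly_converges N \<nu>)" (is "_ \<longleftrightarrow> ?rhs")
proof
  assume "bifreely_infinitely_divisible \<nu>"
  from bifreely_infinitely_divisible_imp_limit[OF assms this] show ?rhs by metis
next
  assume ?rhs
  then show "bifreely_infinitely_divisible \<nu>"
  proof (elim exE conjE)
    fix \<mu> k N assume "\<forall>n. borel_prob (\<mu> n)" "\<forall>n. bifree_compound_poisson (real (k n)) (\<mu> n) (N n)" "weakly_converges N \<nu>"
    then show ?thesis by (intro limit_imp_bifreely_infinitely_divisible[OF assms]) blast+
  qed
qed

end
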